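(* Let $d=2$ and assume the standing setup with $a(x)$ a multiple of the identity for a.a. $x$ and $b\in\mathcal M$ a multiple of the identity (identified with scalars $a(x),b\ge\alpha$). Let $\mathcal H:=\{H\in\mathbb R^{2\times2}$ symmetric positive definite with $\det H=1\}$ and $\omega(H):=\{x\in\mathbb R^2:x^THx\le1\}$. Then for almost all $x_0\in\Omega$, \[ \operatorname{cl}\{\delta J(a;b,x_0,\omega(H)):H\in\mathcal H\}=-(b-a(x_0))\nabla y(x_0)\cdot\nabla p(x_0)+\frac12\frac{(b-a(x_0))^2}{b}\Big([-1,1]\cdot\|\nabla y(x_0)\|_2\|\nabla p(x_0)\|_2+\nabla y(x_0)\cdot\nabla p(x_0)\Big). \] In particular, \[ \inf_{H\in\mathcal H}\delta J(a;b,x_0,\omega(H))=-(b-a(x_0))\nabla y(x_0)\cdot\nabla p(x_0)+\frac12\frac{(b-a(x_0))^2}{b}\Big(\nabla y(x_0)\cdot\nabla p(x_0)-\|\nabla y(x_0)\|_2\|\nabla p(x_0)\|_2\Big). \]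
   Context: Standing setup: $\Omega\subset\mathbb R^d$ bounded domain, $\alpha>0$, $y_d,f\in L^2(\Omega)$; $\mathcal M:=\{A\in\mathbb R^{d\times d}:\xi^TA\xi\ge\alpha|\xi|^2\ \forall\xi\}$, $\mathcal A:=\{a\in L^\infty(\Omega;\mathbb R^{d\times d}):a(x)\in\mathcal M\text{ a.e.}\}$. Fix $a\in\mathcal A$; $y\in H^1_0(\Omega)$ solves $\int_\Omega a\nabla y\cdot\nabla v=\int_\Omega fv$, $p\in H^1_0(\Omega)$ solves $\int_\Omega a\nabla v\cdot\nabla p=\int_\Omega(y-y_d)v$, for all $v\in H^1_0(\Omega)$; $J(a):=\frac12\|y-y_d\|^2_{L^2(\Omega)}$. $a_r:=a+\chi_{x_0+r\omega}(b-a)$, $\delta J(a;b,x_0,\omega):=\lim_{r\searrow0}\frac{J(a_r)-J(a)}{r^d|\omega|}$. $c+[-1,1]\cdot t$ denotes $[c-t,c+t]$. *)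

theory Defs
  imports "HOL-Analysis.Analysis"
begin

type_synonym R2 = "real^2"

definition cgrad :: "(R2 \<Rightarrow> real) \<Rightarrow> R2 \<Rightarrow> R2" where
  "cgrad \<phi> x = (\<chi> i. frechet_derivative \<phi> (at x) (axis i 1))"

fun Ck :: "nat \<Rightarrow> (R2 \<Rightarrow> real) \<Rightarrow> bool" where
  "Ck 0 f \<longleftrightarrow> continuous_on UNIV f"
| "Ck (Suc k) f \<longleftrightarrow> continuous_on UNIV f \<and> (\<forall>x. f differentiable (at x)) \<and>
      (\<forall>i. Ck k (\<lambda>x. frechet_derivative f (at x) (axis i 1)))"

definition smooth_fun :: "(R2 \<Rightarrow> real) \<Rightarrow> bool" where
  "smooth_fun f \<longleftrightarrow> (\<forall>k. Ck k f)"

definition test_fun :: "R2 set \<Rightarrow> (R2 \<Rightarrow> real) \<Rightarrow> bool" where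
  "test_fun \<Omega> \<phi> \<longleftrightarrow> smooth_fun \<phi> \<and> compact (closure {x. \<phi> x \<noteq> 0})
      \<and> closure {x. \<phi> x \<noteq> 0} \<subseteq> \<Omega>"

definition L2_on :: "R2 set \<Rightarrow> (R2 \<Rightarrow> real) \<Rightarrow> bool" where
  "L2_on \<Omega> u \<longleftrightarrow> set_borel_measurable lebesgue \<Omega> u \<and>
      set_integrable lebesgue \<Omega> (\<lambda>x. (u x)\<^sup>2)"

definition L2v_on :: "R2 set \<Rightarrow> (R2 \<Rightarrow> R2) \<Rightarrow> bool" where
  "L2v_on \<Omega> g \<longleftrightarrow> set_borel_measurable lebesgue \<Omega> g \<and>
      set_integrable lebesgue \<Omega> (\<lambda>x. (norm (g x))\<^sup>2)"

definition weak_grad :: "R2 set \<Rightarrow> (R2 \<Rightarrow> real) \<Rightarrow> (R2 \<Rightarrow> R2) \<Rightarrow> bool" where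
  "weak_grad \<Omega> u g \<longleftrightarrow> (\<forall>\<phi>. test_fun \<Omega> \<phi> \<longrightarrow> (\<forall>i.
      (LINT x:\<Omega>|lebesgue. u x * cgrad \<phi> x $ i) = - (LINT x:\<Omega>|lebesgue. g x $ i * \<phi> x)))"

definition H10 :: "R2 set \<Rightarrow> (R2 \<Rightarrow> real) \<Rightarrow> bool" where
  "H10 \<Omega> u \<longleftrightarrow> L2_on \<Omega> u \<and> (\<exists>g. weak_grad \<Omega> u g \<and> L2v_on \<Omega> g \<and>
      (\<exists>\<phi>. (\<forall>n. test_fun \<Omega> (\<phi> n)) \<and>
        ((\<lambda>n. LINT x:\<Omega>|lebesgue. (u x - \<phi> n x)\<^sup>2 + (norm (g x - cgrad (\<phi> n) x))\<^sup>2)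
           \<longlonglongrightarrow> 0)))"

definition wgrad :: "R2 set \<Rightarrow> (R2 \<Rightarrow> real) \<Rightarrow> R2 \<Rightarrow> R2" where
  "wgrad \<Omega> u = (SOME g. weak_grad \<Omega> u g \<and> L2v_on \<Omega> g)"

text \<open>State equation (scalar coefficient a, i.e. matrix a(x) I).\<close>
definition state_sol :: "R2 set \<Rightarrow> (R2 \<Rightarrow> real) \<Rightarrow> (R2 \<Rightarrow> real) \<Rightarrow> (R2 \<Rightarrow> real) \<Rightarrow> bool" where
  "state_sol \<Omega> f a y \<longleftrightarrow> H10 \<Omega> y \<and> (\<forall>v. H10 \<Omega> v \<longrightarrow>
      (LINT x:\<Omega>|lebesgue. a x * (wgrad \<Omega> y x \<bullet> wgrad \<Omega> v x)) = (LINT x:\<Omega>|lebesgue. f x * v x))"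

definition adj_sol :: "R2 set \<Rightarrow> (R2 \<Rightarrow> real) \<Rightarrow> (R2 \<Rightarrow> real) \<Rightarrow> (R2 \<Rightarrow> real) \<Rightarrow> (R2 \<Rightarrow> real) \<Rightarrow> bool" where
  "adj_sol \<Omega> a y yd p \<longleftrightarrow> H10 \<Omega> p \<and> (\<forall>v. H10 \<Omega> v \<longrightarrow>
      (LINT x:\<Omega>|lebesgue. a x * (wgrad \<Omega> v x \<bullet> wgrad \<Omega> p x)) = (LINT x:\<Omega>|lebesgue. (y x - yd x) * v x))"

definition Jcost :: "R2 set \<Rightarrow> (R2 \<Rightarrow> real) \<Rightarrow> (R2 \<Rightarrow> real) \<Rightarrow> (R2 \<Rightarrow> real) \<Rightarrow> real" where
  "Jcost \<Omega> f yd a = (THE c. \<exists>y. state_sol \<Omega> f a y \<and>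
      c = 1/2 * (LINT x:\<Omega>|lebesgue. (y x - yd x)\<^sup>2))"

definition pert :: "(R2 \<Rightarrow> real) \<Rightarrow> real \<Rightarrow> R2 \<Rightarrow> R2 set \<Rightarrow> real \<Rightarrow> R2 \<Rightarrow> real" where
  "pert a b x0 \<omega> r = (\<lambda>x. if x \<in> (\<lambda>z. x0 + r *\<^sub>R z) ` \<omega> then b else a x)"

definition dJ_quot :: "R2 set \<Rightarrow> (R2 \<Rightarrow> real) \<Rightarrow> (R2 \<Rightarrow> real) \<Rightarrow> (R2 \<Rightarrow> real) \<Rightarrow> real \<Rightarrow> R2 \<Rightarrow> R2 set \<Rightarrow> real \<Rightarrow> real" where
  "dJ_quot \<Omega> f yd a b x0 \<omega> r =
     (Jcost \<Omega> f yd (pert a b x0 \<omega> r) - Jcost \<Omega> f yd a) / (r ^ 2 * measure lebesgue \<omega>)"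

definition dJ :: "R2 set \<Rightarrow> (R2 \<Rightarrow> real) \<Rightarrow> (R2 \<Rightarrow> real) \<Rightarrow> (R2 \<Rightarrow> real) \<Rightarrow> real \<Rightarrow> R2 \<Rightarrow> R2 set \<Rightarrow> real" where
  "dJ \<Omega> f yd a b x0 \<omega> = Lim (at_right 0) (dJ_quot \<Omega> f yd a b x0 \<omega>)"

definition Hset :: "(real^2^2) set" where
  "Hset = {H. transpose H = H \<and> (\<forall>\<xi>. \<xi> \<noteq> 0 \<longrightarrow> \<xi> \<bullet> (H *v \<xi>) > 0) \<and> det H = 1}"

definition ellipse :: "real^2^2 \<Rightarrow> R2 set" where
  "ellipse H = {x. x \<bullet> (H *v x) \<le> 1}"

end

(*
  Let h be the change of grad y caused by the inclusion B = x0 + r omega, and beta = b - a(x0).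
  The adjoint state turns the change of J into
    - int_B (b - a) grad y . grad p - int_B (b - a) h . grad p + O(|w|^2),  w the change of y.
  Energy estimates give |h| = O(r), and duality plus compactness improve this to |w| = o(r).
  The limit of the middle term is found without a limit profile of h: an ellipse has an explicit
  potential whose gradient k is constant on it (k = N c, N the depolarisation matrix), decays
  quadratically, and for which k - chi_omega c is divergence free. Choosing c with
  a(x0) c + beta N c = - beta grad p(x0) and testing the equation of h with the rescaled, truncated
  potential yields beta int_B h . grad p(x0) = int_B (b - a) grad y . N c + o(r^2) at Lebesgue points.
  For det H = 1 the resulting derivative depends on H only through its trace and its traceless part,
  which sweeps out the interval as the eccentricity tends to infinity.
*)
theory Submission
  imports Defs
begin

section \<open>Square integrable functions\<close>

text \<open>The coefficient is merely bounded and measurable, so neither gradient need be continuous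
  anywhere and \<open>h\<close> is controlled only in L2. Every error of the linear part therefore
  has to be arranged as a product of an O(r) and an o(r) factor. This shapes the freezing of the
  coefficient at \<open>x0\<close> on the whole domain: the o(r) factor is
  \<open>(a - a x0) * k\<close>, small near \<open>x0\<close> by the Lebesgue point property and
  small further out because \<open>k\<close> decays quadratically. The same decay makes the
  truncation of the potential cost only O(r^2). The Lebesgue point conditions concern
  \<open>a\<close>, \<open>b\<close> and the two gradients, never \<open>H\<close> or the sequence
  of radii, so one null set serves all ellipses. The explicit potential is only Lipschitz across the
  boundary of the ellipse, whereas the Sobolev space is a closure of smooth functions; integration
  by parts for Lipschitz functions and mollification bridge this gap.\<close>

definition sqint :: "'a measure \<Rightarrow> ('a \<Rightarrow> 'b::euclidean_space) \<Rightarrow> bool" where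
  "sqint M u \<longleftrightarrow> u \<in> borel_measurable M \<and> integrable M (\<lambda>x. (norm (u x))\<^sup>2)"

definition n2 :: "'a measure \<Rightarrow> ('a \<Rightarrow> 'b::euclidean_space) \<Rightarrow> real" where
  "n2 M u = sqrt (\<integral>x. (norm (u x))\<^sup>2 \<partial>M)"

lemma n2_nonneg [simp]: "n2 M u \<ge> 0"
  unfolding n2_def by simp

lemma n2_sq: "(n2 M u)\<^sup>2 = (\<integral>x. (norm (u x))\<^sup>2 \<partial>M)"
  unfolding n2_def by simp

lemma sqint_meas [measurable_dest]: "sqint M u \<Longrightarrow> u \<in> borel_measurable M"
  unfolding sqint_def by simp

lemma sqint_integrable: "sqint M u \<Longrightarrow> integrable M (\<lambda>x. (norm (u x))\<^sup>2)"
  unfolding sqint_def by simp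

lemma sqint_norm_mult:
  assumes "sqint M u" "sqint M v"
  shows "integrable M (\<lambda>x. norm (u x) * norm (v x))"
proof (rule Bochner_Integration.integrable_bound)
  show "integrable M (\<lambda>x. (norm (u x))\<^sup>2 + (norm (v x))\<^sup>2)"
    using assms by (simp add: sqint_integrable)
  note [measurable] = sqint_meas[OF assms(1)] sqint_meas[OF assms(2)]
  show "(\<lambda>x. norm (u x) * norm (v x)) \<in> borel_measurable M" by measurable
  have "a * b \<le> a\<^sup>2 + b\<^sup>2" for a b :: real
  proof -
    have "2 * (a * b) \<le> a\<^sup>2 + b\<^sup>2" "0 \<le> a\<^sup>2 + b\<^sup>2" using sum_squares_bound[of a b] by (auto simp: mult.assoc)
    then show ?thesis by linarith
  qed
  then show "AE x in M. norm (norm (u x) * norm (v x)) \<le> norm ((norm (u x))\<^sup>2 + (norm (v x))\<^sup>2)"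
    by (auto simp: abs_mult)
qed

lemma sqint_bound:
  fixes w :: "'a \<Rightarrow> 'b::euclidean_space" and u :: "'a \<Rightarrow> 'c::euclidean_space"
  assumes "sqint M u" "w \<in> borel_measurable M" "AE x in M. norm (w x) \<le> C * norm (u x)"
  shows "sqint M w"
  unfolding sqint_def
proof
  show "w \<in> borel_measurable M" by fact
  note [measurable] = assms(2)
  show "integrable M (\<lambda>x. (norm (w x))\<^sup>2)"
  proof (rule Bochner_Integration.integrable_bound)
    show "integrable M (\<lambda>x. C\<^sup>2 * (norm (u x))\<^sup>2)"
      using assms(1) by (simp add: sqint_integrable)
    show "AE x in M. norm ((norm (w x))\<^sup>2) \<le> norm (C\<^sup>2 * (norm (u x))\<^sup>2)"
      using assms(3)
    proof eventually_elim
      case (elim x)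
      then have "(norm (w x))\<^sup>2 \<le> (C * norm (u x))\<^sup>2" by (intro power_mono) auto
      then show ?case by (simp add: power_mult_distrib)
    qed
  qed measurable
qed

lemma sqint_scaleR: "sqint M u \<Longrightarrow> sqint M (\<lambda>x. c *\<^sub>R u x)"
  by (rule sqint_bound[where C="\<bar>c\<bar>"]) (auto dest: sqint_meas)

lemma sqint_cmult: "sqint M (u :: _ \<Rightarrow> real) \<Longrightarrow> sqint M (\<lambda>x. c * u x)"
  using sqint_scaleR[of M u c] by simp

lemma sqint_add: 
  assumes "sqint M u" "sqint M v" shows "sqint M (\<lambda>x. u x + v x)"
  unfolding sqint_def
proof
  note [measurable] = sqint_meas[OF assms(1)] sqint_meas[OF assms(2)]
  show "(\<lambda>x. u x + v x) \<in> borel_measurable M" by measurable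
  show "integrable M (\<lambda>x. (norm (u x + v x))\<^sup>2)"
  proof (rule Bochner_Integration.integrable_bound)
    show "integrable M (\<lambda>x. 2 * (norm (u x))\<^sup>2 + 2 * (norm (v x))\<^sup>2)"
      using assms by (simp add: sqint_integrable)
    have "(norm (u x + v x))\<^sup>2 \<le> 2 * (norm (u x))\<^sup>2 + 2 * (norm (v x))\<^sup>2" for x
    proof -
      have "(norm (u x + v x))\<^sup>2 \<le> (norm (u x) + norm (v x))\<^sup>2"
        by (intro power_mono norm_triangle_ineq) auto
      also have "\<dots> \<le> 2 * (norm (u x))\<^sup>2 + 2 * (norm (v x))\<^sup>2"
        using sum_squares_bound[of "norm (u x)" "norm (v x)"] by (simp add: power2_sum)
      finally show ?thesis .
    qed
    then show "AE x in M. norm ((norm (u x + v x))\<^sup>2) \<le> norm (2 * (norm (u x))\<^sup>2 + 2 * (norm (v x))\<^sup>2)"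
      by auto
  qed measurable
qed

lemma sqint_diff: "sqint M u \<Longrightarrow> sqint M v \<Longrightarrow> sqint M (\<lambda>x. u x - v x)"
  using sqint_add[of M u "\<lambda>x. (-1) *\<^sub>R v x"] sqint_scaleR[of M v "-1"] by simp

lemma sqint_inner:
  assumes "sqint M u" "sqint M v" shows "integrable M (\<lambda>x. u x \<bullet> v x)"
proof (rule Bochner_Integration.integrable_bound[OF sqint_norm_mult[OF assms]])
  note [measurable] = sqint_meas[OF assms(1)] sqint_meas[OF assms(2)]
  show "(\<lambda>x. u x \<bullet> v x) \<in> borel_measurable M" by measurable
qed (auto intro: Cauchy_Schwarz_ineq2)

lemma sqint_mult:
  fixes u v :: "_ \<Rightarrow> real"
  shows "sqint M u \<Longrightarrow> sqint M v \<Longrightarrow> integrable M (\<lambda>x. u x * v x)"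
  using sqint_inner[of M u v] by simp

lemma sqint_cong_AE:
  assumes "sqint M u" "w \<in> borel_measurable M" "AE x in M. w x = u x"
  shows "sqint M w"
  by (rule sqint_bound[OF assms(1,2), where C=1]) (use assms(3) in auto)

lemma n2_cong_AE:
  assumes "u \<in> borel_measurable M" "w \<in> borel_measurable M" "AE x in M. w x = u x"
  shows "n2 M w = n2 M u"
  unfolding n2_def
  by (rule arg_cong[where f=sqrt], rule integral_cong_AE) (use assms in auto)

lemma n2_mono:
  fixes w :: "'a \<Rightarrow> 'b::euclidean_space" and u :: "'a \<Rightarrow> 'c::euclidean_space"
  assumes "sqint M u" "w \<in> borel_measurable M" "AE x in M. norm (w x) \<le> C * norm (u x)" "C \<ge> 0"
  shows "n2 M w \<le> C * n2 M u"
proof -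
  have w: "sqint M w" by (rule sqint_bound[OF assms(1-3)])
  have "(\<integral>x. (norm (w x))\<^sup>2 \<partial>M) \<le> (\<integral>x. C\<^sup>2 * (norm (u x))\<^sup>2 \<partial>M)"
  proof (rule integral_mono_AE)
    show "AE x in M. (norm (w x))\<^sup>2 \<le> C\<^sup>2 * (norm (u x))\<^sup>2"
      using assms(3)
    proof eventually_elim
      case (elim x)
      then have "(norm (w x))\<^sup>2 \<le> (C * norm (u x))\<^sup>2" by (intro power_mono) auto
      then show ?case by (simp add: power_mult_distrib)
    qed
  qed (use w assms(1) in \<open>auto simp: sqint_integrable\<close>)
  also have "\<dots> = (C * n2 M u)\<^sup>2" by (simp add: power_mult_distrib n2_sq)
  finally have "sqrt (\<integral>x. (norm (w x))\<^sup>2 \<partial>M) \<le> sqrt ((C * n2 M u)\<^sup>2)"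
    by (rule real_sqrt_le_mono)
  then show ?thesis using \<open>C \<ge> 0\<close> by (simp add: n2_def[of M w])
qed

lemma n2_scaleR: "n2 M (\<lambda>x. c *\<^sub>R u x) = \<bar>c\<bar> * n2 M u"
  by (simp add: n2_def power_mult_distrib real_sqrt_mult)

lemma n2_cmult: "n2 M (\<lambda>x. c * u x :: real) = \<bar>c\<bar> * n2 M u"
  using n2_scaleR[of M c u] by simp

lemma n2_minus: "n2 M (\<lambda>x. v x - u x) = n2 M (\<lambda>x. u x - v x)"
  by (simp add: n2_def norm_minus_commute)

text \<open>Evaluate at the vertex \<open>t = -b/c\<close>; for \<open>c = 0\<close> the expression
  is affine in \<open>t\<close> and stays nonnegative only if \<open>b = 0\<close>. It serves
  Cauchy-Schwarz and, later, shows that near-minimisers of the energy nearly satisfy the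
  Euler-Lagrange equation.\<close>

lemma discriminant_le:
  fixes a b c :: real
  assumes "\<And>t. a + 2 * t * b + t\<^sup>2 * c \<ge> 0" "a \<ge> 0" "c \<ge> 0"
  shows "b\<^sup>2 \<le> a * c"
proof (cases "c = 0")
  case True
  have "b = 0"
  proof (rule ccontr)
    assume b: "b \<noteq> 0"
    have "a + 2 * (-(a+1)/(2*b)) * b \<ge> 0" using assms(1)[of "-(a+1)/(2*b)"] True by simp
    then show False using b by (simp add: field_simps)
  qed
  then show ?thesis using True by simp
next
  case False
  then have c: "c > 0" using assms(3) by simp
  have "a + 2 * (-b/c) * b + (-b/c)\<^sup>2 * c \<ge> 0" using assms(1) by blast
  then have "a - b\<^sup>2/c \<ge> 0" using c by (simp add: field_simps power2_eq_square)
  then show ?thesis using c by (simp add: field_simps)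
qed

lemma L2_cauchy_schwarz:
  assumes "sqint M u" "sqint M v"
  shows "(\<integral>x. norm (u x) * norm (v x) \<partial>M) \<le> n2 M u * n2 M v"
proof -
  let ?I = "\<integral>x. norm (u x) * norm (v x) \<partial>M"
  have "?I\<^sup>2 \<le> (n2 M u)\<^sup>2 * (n2 M v)\<^sup>2"
  proof (rule discriminant_le)
    fix t :: real
    have "0 \<le> (\<integral>x. (norm (u x) + t * norm (v x))\<^sup>2 \<partial>M)" by simp
    also have "\<dots> = (\<integral>x. (norm (u x))\<^sup>2 + (2 * t * (norm (u x) * norm (v x)) + t\<^sup>2 * (norm (v x))\<^sup>2) \<partial>M)"
      by (intro Bochner_Integration.integral_cong) (auto simp: power2_eq_square algebra_simps)
    also have "\<dots> = (n2 M u)\<^sup>2 + 2 * t * ?I + t\<^sup>2 * (n2 M v)\<^sup>2"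
      using sqint_norm_mult[OF assms] assms by (simp add: sqint_integrable n2_sq)
    finally show "0 \<le> (n2 M u)\<^sup>2 + 2 * t * ?I + t\<^sup>2 * (n2 M v)\<^sup>2" .
  qed auto
  then have "?I\<^sup>2 \<le> (n2 M u * n2 M v)\<^sup>2" by (simp add: power_mult_distrib)
  then show ?thesis by (rule power2_le_imp_le) simp
qed

lemma L2_inner_bound:
  assumes "sqint M u" "sqint M v"
  shows "\<bar>\<integral>x. u x \<bullet> v x \<partial>M\<bar> \<le> n2 M u * n2 M v"
proof -
  have "\<bar>\<integral>x. u x \<bullet> v x \<partial>M\<bar> \<le> (\<integral>x. \<bar>u x \<bullet> v x\<bar> \<partial>M)" by (rule integral_abs_bound)
  also have "\<dots> \<le> (\<integral>x. norm (u x) * norm (v x) \<partial>M)"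
    by (rule integral_mono[OF integrable_abs[OF sqint_inner[OF assms]] sqint_norm_mult[OF assms] Cauchy_Schwarz_ineq2])
  also have "\<dots> \<le> n2 M u * n2 M v" by (rule L2_cauchy_schwarz[OF assms])
  finally show ?thesis .
qed

lemma L2_mult_bound:
  fixes u v :: "_ \<Rightarrow> real"
  assumes "sqint M u" "sqint M v"
  shows "\<bar>\<integral>x. u x * v x \<partial>M\<bar> \<le> n2 M u * n2 M v"
  using L2_inner_bound[OF assms] by simp

lemma L2_weighted_bound:
  assumes u: "sqint M u" and v: "sqint M v" and a: "a \<in> borel_measurable M" 
    and aC: "AE x in M. \<bar>a x\<bar> \<le> C" and C: "C \<ge> 0"
  shows "integrable M (\<lambda>x. a x * (u x \<bullet> v x))" "\<bar>\<integral>x. a x * (u x \<bullet> v x) \<partial>M\<bar> \<le> C * n2 M u * n2 M v"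
proof -
  note [measurable] = a sqint_meas[OF u] sqint_meas[OF v]
  have m: "(\<lambda>x. a x *\<^sub>R u x) \<in> borel_measurable M" by measurable
  have b: "AE x in M. norm (a x *\<^sub>R u x) \<le> C * norm (u x)"
    using aC by eventually_elim (auto intro: mult_right_mono)
  have s: "sqint M (\<lambda>x. a x *\<^sub>R u x)" by (rule sqint_bound[OF u m b])
  show "integrable M (\<lambda>x. a x * (u x \<bullet> v x))" using sqint_inner[OF s v] by simp
  have "\<bar>\<integral>x. a x * (u x \<bullet> v x) \<partial>M\<bar> \<le> n2 M (\<lambda>x. a x *\<^sub>R u x) * n2 M v"
    using L2_inner_bound[OF s v] by simp
  also have "\<dots> \<le> (C * n2 M u) * n2 M v"
    by (intro mult_right_mono n2_mono[OF u m b C]) auto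
  finally show "\<bar>\<integral>x. a x * (u x \<bullet> v x) \<partial>M\<bar> \<le> C * n2 M u * n2 M v" by simp
qed

lemma n2_triangle:
  assumes "sqint M u" "sqint M v"
  shows "n2 M (\<lambda>x. u x + v x) \<le> n2 M u + n2 M v"
proof -
  have "(n2 M (\<lambda>x. u x + v x))\<^sup>2 = (\<integral>x. (norm (u x))\<^sup>2 + (2 * (u x \<bullet> v x) + (norm (v x))\<^sup>2) \<partial>M)"
    unfolding n2_sq
    by (intro Bochner_Integration.integral_cong) (auto simp: power2_norm_eq_inner inner_commute algebra_simps inner_add_left inner_add_right)
  also have "\<dots> = (n2 M u)\<^sup>2 + 2 * (\<integral>x. u x \<bullet> v x \<partial>M) + (n2 M v)\<^sup>2"
    using sqint_inner[OF assms] assms by (simp add: sqint_integrable n2_sq)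
  also have "\<dots> \<le> (n2 M u + n2 M v)\<^sup>2"
    using L2_inner_bound[OF assms] by (simp add: power2_sum)
  finally show ?thesis by (rule power2_le_imp_le) simp
qed

lemma n2_le_add_diff:
  assumes "sqint M u" "sqint M v"
  shows "n2 M u \<le> n2 M v + n2 M (\<lambda>x. u x - v x)"
  using n2_triangle[OF assms(2) sqint_diff[OF assms]] by simp

lemma tendsto_n2:
  assumes "\<And>n. sqint M (s n)" "sqint M u" "(\<lambda>n. n2 M (\<lambda>x. u x - s n x)) \<longlonglongrightarrow> 0"
  shows "(\<lambda>n. n2 M (s n)) \<longlonglongrightarrow> n2 M u"
proof -
  have le: "norm (n2 M (s n) - n2 M u) \<le> n2 M (\<lambda>x. u x - s n x)" for n
  proof -
  have "n2 M (s n) \<le> n2 M u + n2 M (\<lambda>x. s n x - u x)"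
    by (rule n2_le_add_diff[OF assms(1) assms(2)])
  moreover have "n2 M u \<le> n2 M (s n) + n2 M (\<lambda>x. u x - s n x)"
    by (rule n2_le_add_diff[OF assms(2) assms(1)])
  moreover have "n2 M (\<lambda>x. s n x - u x) = n2 M (\<lambda>x. u x - s n x)" by (rule n2_minus)
  ultimately show "norm (n2 M (s n) - n2 M u) \<le> n2 M (\<lambda>x. u x - s n x)"
    by (simp add: abs_le_iff)
  qed
  have "(\<lambda>n. n2 M (s n) - n2 M u) \<longlonglongrightarrow> 0"
    by (rule Lim_null_comparison[OF eventuallyI assms(3)]) (rule le)
  then show ?thesis by (rule LIM_zero_cancel)
qed

text \<open>The tool behind all density arguments: weighted bilinear forms pass to the limit along
  test functions that approximate an element of the Sobolev space.\<close>

lemma tendsto_L2_weighted: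
  assumes s: "\<And>n. sqint M (s n)" and u: "sqint M u" and su: "(\<lambda>n. n2 M (\<lambda>x. u x - s n x)) \<longlonglongrightarrow> 0"
    and v: "sqint M v" and a: "a \<in> borel_measurable M" 
    and aC: "AE x in M. \<bar>a x\<bar> \<le> C" and C: "C \<ge> 0"
  shows "(\<lambda>n. \<integral>x. a x * (s n x \<bullet> v x) \<partial>M) \<longlonglongrightarrow> (\<integral>x. a x * (u x \<bullet> v x) \<partial>M)"
proof -
  have 0: "(\<lambda>n. C * n2 M (\<lambda>x. u x - s n x) * n2 M v) \<longlonglongrightarrow> 0"
    by (auto intro!: tendsto_mult_left_zero tendsto_mult_right_zero su)
  have le: "norm ((\<integral>x. a x * (s n x \<bullet> v x) \<partial>M) - (\<integral>x. a x * (u x \<bullet> v x) \<partial>M))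
      \<le> C * n2 M (\<lambda>x. u x - s n x) * n2 M v" for n
  proof -
    note i = L2_weighted_bound[OF _ v a aC C]
    have "(\<integral>x. a x * (s n x \<bullet> v x) \<partial>M) - (\<integral>x. a x * (u x \<bullet> v x) \<partial>M) =
      (\<integral>x. a x * (s n x \<bullet> v x) - a x * (u x \<bullet> v x) \<partial>M)"
      by (rule Bochner_Integration.integral_diff[symmetric, OF i(1)[OF s] i(1)[OF u]])
    also have "\<dots> = (\<integral>x. a x * ((s n x - u x) \<bullet> v x) \<partial>M)"
      by (simp only: inner_diff_left right_diff_distrib)
    finally have "norm ((\<integral>x. a x * (s n x \<bullet> v x) \<partial>M) - (\<integral>x. a x * (u x \<bullet> v x) \<partial>M))
      \<le> C * n2 M (\<lambda>x. s n x - u x) * n2 M v"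
      using i(2)[OF sqint_diff[OF s u], of n] by (simp only: real_norm_def)
    moreover have "n2 M (\<lambda>x. s n x - u x) = n2 M (\<lambda>x. u x - s n x)" by (rule n2_minus)
    ultimately show "norm ((\<integral>x. a x * (s n x \<bullet> v x) \<partial>M) - (\<integral>x. a x * (u x \<bullet> v x) \<partial>M))
      \<le> C * n2 M (\<lambda>x. u x - s n x) * n2 M v"
      by simp
  qed
  have "(\<lambda>n. (\<integral>x. a x * (s n x \<bullet> v x) \<partial>M) - (\<integral>x. a x * (u x \<bullet> v x) \<partial>M)) \<longlonglongrightarrow> 0"
    by (rule Lim_null_comparison[OF eventuallyI 0]) (rule le)
  then show ?thesis by (rule LIM_zero_cancel)
qed

lemma sqint_const_finite: "finite_measure M \<Longrightarrow> sqint M (\<lambda>x. c)"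
  unfolding sqint_def by (simp add: finite_measure.integrable_const)

lemma sqint_bounded_finite:
  assumes "finite_measure M" "u \<in> borel_measurable M" "AE x in M. norm (u x) \<le> C"
  shows "sqint M u"
  by (rule sqint_bound[OF sqint_const_finite[OF assms(1), of "1::real"] assms(2), where C=C])
     (use assms in auto)

lemma sqint_imp_integrable:
  assumes "finite_measure M" "sqint M u"
  shows "integrable M u" "(\<integral>x. norm (u x) \<partial>M) \<le> n2 M u * sqrt (measure M (space M))"
proof -
  have c: "sqint M (\<lambda>x. 1::real)" by (rule sqint_const_finite[OF assms(1)])
  have "integrable M (\<lambda>x. norm (u x))" using sqint_norm_mult[OF assms(2) c] by simp
  then show "integrable M u" using sqint_meas[OF assms(2)] by (simp add: integrable_norm_iff)
  show "(\<integral>x. norm (u x) \<partial>M) \<le> n2 M u * sqrt (measure M (space M))"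
    using L2_cauchy_schwarz[OF assms(2) c] by (simp add: n2_def)
qed

text \<open>On a finite measure space a Cauchy sequence in L2 is Cauchy in L1, which yields a
  subsequence converging almost everywhere; Fatou's lemma then controls the L2 distance of its limit
  to every late term.\<close>

lemma L2_complete:
  fixes s :: "nat \<Rightarrow> 'a \<Rightarrow> 'b::euclidean_space"
  assumes fin: "finite_measure M" and s: "\<And>n. sqint M (s n)"
    and cau: "\<And>e. e > 0 \<Longrightarrow> \<exists>N. \<forall>i\<ge>N. \<forall>j\<ge>N. n2 M (\<lambda>x. s i x - s j x) < e"
  obtains u where "sqint M u" "(\<lambda>n. n2 M (\<lambda>x. u x - s n x)) \<longlonglongrightarrow> 0"
proof -
  let ?m = "sqrt (measure M (space M)) + 1"
  have m: "?m > 0" by (simp add: add_nonneg_pos)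
  note [measurable] = sqint_meas[OF s]
  have "\<exists>N. \<forall>i\<ge>N. \<forall>j\<ge>N. (LINT x|M. norm (s i x - s j x)) < e" if e: "e > 0" for e :: real
  proof -
    obtain N where N: "\<And>i j. i \<ge> N \<Longrightarrow> j \<ge> N \<Longrightarrow> n2 M (\<lambda>x. s i x - s j x) < e / ?m"
      using cau[OF divide_pos_pos[OF e m]] by blast
    have "(LINT x|M. norm (s i x - s j x)) < e" if "i \<ge> N" "j \<ge> N" for i j
    proof -
      have "(LINT x|M. norm (s i x - s j x)) \<le> n2 M (\<lambda>x. s i x - s j x) * sqrt (measure M (space M))"
        by (rule sqint_imp_integrable[OF fin sqint_diff[OF s s]])
      also have "\<dots> \<le> n2 M (\<lambda>x. s i x - s j x) * ?m" by (intro mult_left_mono) auto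
      also have "\<dots> < e" using N[OF that] m by (simp add: pos_less_divide_eq)
      finally show ?thesis .
    qed
    then show ?thesis by blast
  qed
  then obtain r where r: "strict_mono r" "AE x in M. Cauchy (\<lambda>i. s (r i) x)"
    using cauchy_L1_AE_cauchy_subseq[of M s] sqint_imp_integrable(1)[OF fin s] by metis
  define u where "u x = lim (\<lambda>i. s (r i) x)" for x
  have u_m [measurable]: "u \<in> borel_measurable M" unfolding u_def by measurable
  have conv: "AE x in M. (\<lambda>i. s (r i) x) \<longlonglongrightarrow> u x"
    using r(2) by eventually_elim (simp add: u_def Cauchy_convergent_iff convergent_LIMSEQ_iff)
  \<comment> \<open>Fatou is applied to the subsequence against a fixed late term
    \<open>s n\<close>; the one estimate gives both the square integrability of the difference and
    the rate.\<close>
  have key: "sqint M (\<lambda>x. u x - s n x) \<and> n2 M (\<lambda>x. u x - s n x) \<le> e" 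
    if N: "\<forall>i\<ge>N. \<forall>j\<ge>N. n2 M (\<lambda>x. s i x - s j x) < e" and n: "n \<ge> N" for e n N
  proof -
    have e: "e > 0" using N n2_nonneg by (meson le_less_trans order_refl)
    have le: "(\<integral>\<^sup>+x. ennreal ((norm (s (r i) x - s n x))\<^sup>2) \<partial>M) \<le> ennreal (e\<^sup>2)" if "i \<ge> N" for i
    proof -
      have "r i \<ge> N" using that seq_suble[OF r(1), of i] by simp
      then have "n2 M (\<lambda>x. s (r i) x - s n x) \<le> e" using N n by (simp add: less_imp_le)
      then have "(n2 M (\<lambda>x. s (r i) x - s n x))\<^sup>2 \<le> e\<^sup>2" by (intro power_mono) auto
      then have "(\<integral>x. (norm (s (r i) x - s n x))\<^sup>2 \<partial>M) \<le> e\<^sup>2" by (simp add: n2_sq)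
      then show ?thesis
        using sqint_integrable[OF sqint_diff[OF s s]] by (subst nn_integral_eq_integral) (auto intro: ennreal_leI)
    qed
    have "(\<integral>\<^sup>+x. ennreal ((norm (u x - s n x))\<^sup>2) \<partial>M) =
      (\<integral>\<^sup>+x. liminf (\<lambda>i. ennreal ((norm (s (r i) x - s n x))\<^sup>2)) \<partial>M)"
    proof (rule nn_integral_cong_AE)
      show "AE x in M. ennreal ((norm (u x - s n x))\<^sup>2) = liminf (\<lambda>i. ennreal ((norm (s (r i) x - s n x))\<^sup>2))"
        using conv
      proof eventually_elim
        case (elim x)
        have "(\<lambda>i. ennreal ((norm (s (r i) x - s n x))\<^sup>2)) \<longlonglongrightarrow> ennreal ((norm (u x - s n x))\<^sup>2)"
          by (intro tendsto_intros elim tendsto_ennrealI)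
        then show ?case by (rule lim_imp_Liminf[OF sequentially_bot, symmetric])
      qed
    qed
    also have "\<dots> \<le> liminf (\<lambda>i. \<integral>\<^sup>+x. ennreal ((norm (s (r i) x - s n x))\<^sup>2) \<partial>M)"
      by (rule nn_integral_liminf) measurable
    also have "\<dots> \<le> ennreal (e\<^sup>2)"
      by (rule Liminf_le) (auto simp: eventually_sequentially intro!: exI[of _ N] le)
    finally have fin2: "(\<integral>\<^sup>+x. ennreal ((norm (u x - s n x))\<^sup>2) \<partial>M) \<le> ennreal (e\<^sup>2)" .
    have int: "integrable M (\<lambda>x. (norm (u x - s n x))\<^sup>2)"
    proof (rule integrableI_bounded)
      show "(\<integral>\<^sup>+x. ennreal (norm ((norm (u x - s n x))\<^sup>2)) \<partial>M) < \<infinity>"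
        using le_less_trans[OF fin2 ennreal_less_top] by simp
    qed measurable
    have "(\<integral>x. (norm (u x - s n x))\<^sup>2 \<partial>M) \<le> e\<^sup>2"
      using fin2 unfolding nn_integral_eq_integral[OF int AE_I2[OF zero_le_power2]]
      by (simp add: ennreal_le_iff)
    then have "(n2 M (\<lambda>x. u x - s n x))\<^sup>2 \<le> e\<^sup>2" by (simp add: n2_sq)
    then have "n2 M (\<lambda>x. u x - s n x) \<le> e" by (rule power2_le_imp_le[OF _ less_imp_le[OF e]])
    then show ?thesis using int unfolding sqint_def by simp
  qed
  obtain N1 where N1: "\<forall>i\<ge>N1. \<forall>j\<ge>N1. n2 M (\<lambda>x. s i x - s j x) < 1" using cau[OF zero_less_one] by blast
  have "sqint M (\<lambda>x. u x - s N1 x)" using key[OF N1] by auto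
  from sqint_add[OF this s[of N1]] have u: "sqint M u" by simp
  have "(\<lambda>n. n2 M (\<lambda>x. u x - s n x)) \<longlonglongrightarrow> 0"
  proof (rule LIMSEQ_I)
    fix e :: real assume "e > 0"
    then obtain N where N: "\<forall>i\<ge>N. \<forall>j\<ge>N. n2 M (\<lambda>x. s i x - s j x) < e/2" using cau[OF half_gt_zero] by blast
    have "n2 M (\<lambda>x. u x - s n x) < e" if "n \<ge> N" for n
      using key[OF N that] \<open>e > 0\<close> by linarith
    then show "\<exists>no. \<forall>n\<ge>no. norm (n2 M (\<lambda>x. u x - s n x) - 0) < e"
      by auto
  qed
  with u show ?thesis by (rule that)
qed

section \<open>Smooth test functions\<close>

lemma Ck_cont: "Ck k f \<Longrightarrow> continuous_on UNIV f"
  by (cases k) auto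

lemma Ck_SucD: "Ck (Suc k) f \<Longrightarrow> Ck k f"
  by (induction k arbitrary: f) auto

lemma Ck_SucI:
  assumes "\<And>x. (f has_derivative D x) (at x)" "\<And>i. Ck k (\<lambda>x. D x (axis i 1))"
  shows "Ck (Suc k) f"
proof -
  have "frechet_derivative f (at x) = D x" for x
    by (rule frechet_derivative_at[OF assms(1), symmetric])
  moreover have "continuous_on UNIV f"
    by (intro continuous_at_imp_continuous_on ballI has_derivative_continuous[OF assms(1)])
  moreover have "f differentiable at x" for x using assms(1) by (auto simp: differentiable_def)
  ultimately show ?thesis using assms(2) by simp
qed

lemma Ck_has_derivative: "Ck (Suc k) f \<Longrightarrow> (f has_derivative frechet_derivative f (at x)) (at x)"
  by (simp add: frechet_derivative_works)

lemma Ck_const: "Ck k (\<lambda>x. c)"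
proof (induction k arbitrary: c)
  case (Suc k)
  show ?case by (rule Ck_SucI[where D="\<lambda>x h. 0"]) (auto intro!: Suc)
qed auto

lemma Ck_add: "Ck k f \<Longrightarrow> Ck k g \<Longrightarrow> Ck k (\<lambda>x. f x + g x)"
proof (induction k arbitrary: f g)
  case 0 then show ?case by (auto intro: continuous_on_add)
next
  case (Suc k)
  show ?case
  proof (rule Ck_SucI)
    show "((\<lambda>x. f x + g x) has_derivative (\<lambda>h. frechet_derivative f (at x) h + frechet_derivative g (at x) h)) (at x)" for x
      by (intro has_derivative_add Ck_has_derivative[OF Suc.prems(1)] Ck_has_derivative[OF Suc.prems(2)])
    show "Ck k (\<lambda>x. frechet_derivative f (at x) (axis i 1) + frechet_derivative g (at x) (axis i 1))" for i
      using Suc by simp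
  qed
qed

lemma Ck_mult: "Ck k f \<Longrightarrow> Ck k g \<Longrightarrow> Ck k (\<lambda>x. f x * g x)"
proof (induction k arbitrary: f g)
  case 0 then show ?case by (auto intro: continuous_on_mult)
next
  case (Suc k)
  show ?case
  proof (rule Ck_SucI)
    show "((\<lambda>x. f x * g x) has_derivative (\<lambda>h. f x * frechet_derivative g (at x) h + frechet_derivative f (at x) h * g x)) (at x)" for x
      by (intro has_derivative_mult Ck_has_derivative[OF Suc.prems(1)] Ck_has_derivative[OF Suc.prems(2)])
    show "Ck k (\<lambda>x. f x * frechet_derivative g (at x) (axis i 1) + frechet_derivative f (at x) (axis i 1) * g x)" for i
      using Suc.prems Ck_SucD[OF Suc.prems(1)] Ck_SucD[OF Suc.prems(2)] by (intro Ck_add Suc.IH) auto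
  qed
qed

text \<open>\<open>E\<close> is a chain in which each function is the derivative of its predecessor.
  Differentiation shifts the index \<open>n\<close> and produces a constant factor, so the induction
  on \<open>k\<close> leaves \<open>n\<close> free.\<close>

lemma Ck_coordinate:
  assumes E: "\<And>n t. (E n has_real_derivative E (Suc n) t) (at t)"
  shows "Ck k (\<lambda>x. E n (c + s * x $ j))"
proof (induction k arbitrary: n)
  case 0
  have "continuous_on UNIV (E n)"
    by (intro continuous_at_imp_continuous_on ballI DERIV_isCont[OF E])
  then have "continuous_on UNIV (\<lambda>x::R2. E n (c + s * x $ j))"
    by (rule continuous_on_compose2) (auto intro!: continuous_intros)
  then show ?case by simp
next
  case (Suc k)
  show ?case
  proof (rule Ck_SucI)
    show "((\<lambda>x::R2. E n (c + s * x $ j)) has_derivative (\<lambda>h. E (Suc n) (c + s * x $ j) * (s * h $ j))) (at x)" for x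
    proof -
      have "((\<lambda>x::R2. x $ j) has_derivative (\<lambda>h. h $ j)) (at x)"
        by (intro bounded_linear_imp_has_derivative bounded_linear_vec_nth)
      then have "((\<lambda>x::R2. c + s * x $ j) has_derivative (\<lambda>h. s * h $ j)) (at x)"
        by (auto intro!: derivative_eq_intros)
      from has_derivative_compose[OF this, of "E n" "\<lambda>t. E (Suc n) (c + s * x $ j) * t"]
      show ?thesis using E[of n "c + s * x $ j"] by (simp add: has_field_derivative_def)
    qed
    show "Ck k (\<lambda>x. E (Suc n) (c + s * x $ j) * (s * axis i 1 $ j))" for i
      by (intro Ck_mult Ck_const Suc)
  qed
qed

text \<open>The derivative of \<open>P(1/t) * exp(-1/t)\<close> is
  \<open>(1/t)^2 * (P - P')(1/t) * exp(-1/t)\<close>, which dictates the recursion.\<close>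

fun bump_poly :: "nat \<Rightarrow> real poly" where
  "bump_poly 0 = 1"
| "bump_poly (Suc n) = [:0,0,1:] * (bump_poly n - pderiv (bump_poly n))"

definition flat_exp :: "nat \<Rightarrow> real \<Rightarrow> real" where
  "flat_exp n t = (if t > 0 then poly (bump_poly n) (1/t) * exp (-1/t) else 0)"

lemma poly_exp_decay: "((\<lambda>u. poly q u * exp (- u)) \<longlongrightarrow> 0) (at_top :: real filter)"
proof -
  have "((\<lambda>u::real. \<Sum>i\<le>degree q. coeff q i * (u ^ i / exp u)) \<longlongrightarrow> (\<Sum>i\<le>degree q. coeff q i * 0)) at_top"
    by (intro tendsto_intros tendsto_power_div_exp_0)
  moreover have "poly q u * exp (- u) = (\<Sum>i\<le>degree q. coeff q i * (u ^ i / exp u))" for u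
    by (simp add: poly_altdef sum_distrib_right exp_minus divide_inverse mult.assoc)
  ultimately show ?thesis by simp
qed

text \<open>Only \<open>t = 0\<close> needs an argument: from the right the difference quotient is
  again a polynomial in \<open>1/h\<close> times \<open>exp(-1/h)\<close> and is beaten by the
  exponential; from the left it vanishes.\<close>

lemma flat_exp_has_derivative: "(flat_exp n has_real_derivative flat_exp (Suc n) t) (at t)"
proof -
  consider "t > 0" | "t < 0" | "t = 0" by linarith
  then show ?thesis
  proof cases
    case 1
    have "((\<lambda>t. poly (bump_poly n) (1/t) * exp (-1/t)) has_real_derivative flat_exp (Suc n) t) (at t)"
      using 1 by (auto intro!: derivative_eq_intros poly_DERIV[THEN DERIV_chain2] simp: flat_exp_def field_simps power2_eq_square)
    moreover have "eventually (\<lambda>u. poly (bump_poly n) (1/u) * exp (-1/u) = flat_exp n u) (nhds t)"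
      using eventually_nhds_in_open[of "{0<..}" t] 1 by (auto simp: flat_exp_def elim!: eventually_mono)
    ultimately show ?thesis by (subst (asm) DERIV_cong_ev[OF refl _ refl])
  next
    case 2
    have "((\<lambda>t. 0) has_real_derivative flat_exp (Suc n) t) (at t)"
      using 2 by (simp add: flat_exp_def)
    moreover have "eventually (\<lambda>u. 0 = flat_exp n u) (nhds t)"
      using eventually_nhds_in_open[of "{..<0}" t] 2 by (auto simp: flat_exp_def elim!: eventually_mono)
    ultimately show ?thesis by (subst (asm) DERIV_cong_ev[OF refl _ refl])
  next
    case 3
    have r: "((\<lambda>h. flat_exp n h / h) \<longlongrightarrow> 0) (at_right 0)"
    proof (rule Lim_transform_eventually)
      have "((\<lambda>h. poly ([:0,1:] * bump_poly n) (inverse h) * exp (- inverse h)) \<longlongrightarrow> 0) (at_right 0)"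
        by (rule filterlim_compose[OF poly_exp_decay filterlim_inverse_at_top_right])
      then show "((\<lambda>h. poly ([:0,1:] * bump_poly n) (inverse h) * exp (- inverse h)) \<longlongrightarrow> 0) (at_right 0)" .
      show "\<forall>\<^sub>F h in at_right 0. poly ([:0,1:] * bump_poly n) (inverse h) * exp (- inverse h) = flat_exp n h / h"
        using eventually_at_right_less[of 0]
        by eventually_elim (auto simp: flat_exp_def field_simps)
    qed
    have l: "((\<lambda>h. flat_exp n h / h) \<longlongrightarrow> 0) (at_left 0)"
    proof (rule Lim_transform_eventually[OF tendsto_const])
      show "\<forall>\<^sub>F h in at_left 0. 0 = flat_exp n h / h"
        by (auto simp: flat_exp_def eventually_at_filter)
    qed
    show ?thesis
      using filterlim_split_at[OF l r] 3 by (simp add: DERIV_def flat_exp_def)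
  qed
qed

lemma flat_exp_nonneg: "flat_exp 0 t \<ge> 0" and flat_exp_pos: "t > 0 \<Longrightarrow> flat_exp 0 t > 0"
  and flat_exp_zero: "t \<le> 0 \<Longrightarrow> flat_exp n t = 0" and flat_exp_le1: "flat_exp 0 t \<le> 1"
  by (auto simp: flat_exp_def)

lemma smooth_add: "smooth_fun f \<Longrightarrow> smooth_fun g \<Longrightarrow> smooth_fun (\<lambda>x. f x + g x)"
  and smooth_mult: "smooth_fun f \<Longrightarrow> smooth_fun g \<Longrightarrow> smooth_fun (\<lambda>x. f x * g x)"
  and smooth_const: "smooth_fun (\<lambda>x. c)"
  unfolding smooth_fun_def by (auto intro: Ck_add Ck_mult Ck_const)

lemma smooth_flat_exp: "smooth_fun (\<lambda>x. flat_exp n (c + s * x $ j))"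
  unfolding smooth_fun_def using Ck_coordinate[of flat_exp] flat_exp_has_derivative by blast

lemma smooth_has_derivative:
  assumes "smooth_fun f"
  shows "(f has_derivative (\<lambda>h. cgrad f x \<bullet> h)) (at x)"
proof -
  have d: "(f has_derivative frechet_derivative f (at x)) (at x)"
    using assms unfolding smooth_fun_def by (metis Ck_has_derivative)
  then interpret bounded_linear "frechet_derivative f (at x)" by (rule has_derivative_bounded_linear)
  have "frechet_derivative f (at x) h = cgrad f x \<bullet> h" for h
  proof -
    have "h = (\<Sum>i\<in>UNIV. (h $ i) *\<^sub>R axis i 1)" 
      using basis_expansion[of h] by (simp add: scalar_mult_eq_scaleR)
    then have "frechet_derivative f (at x) h = frechet_derivative f (at x) (\<Sum>i\<in>UNIV. (h $ i) *\<^sub>R axis i 1)" by simp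
    also have "\<dots> = (\<Sum>i\<in>UNIV. h $ i * frechet_derivative f (at x) (axis i 1))" by (simp add: sum scaleR)
    also have "\<dots> = cgrad f x \<bullet> h" by (simp add: cgrad_def inner_vec_def mult.commute)
    finally show ?thesis .
  qed
  then show ?thesis using d by (metis has_derivative_eq_rhs ext)
qed

lemma cgrad_unique:
  assumes "(f has_derivative (\<lambda>h. g \<bullet> h)) (at x)" shows "cgrad f x = g"
  unfolding cgrad_def frechet_derivative_at[OF assms, symmetric] by (simp add: vec_eq_iff inner_axis)

lemma smooth_pd:
  assumes "smooth_fun f" shows "smooth_fun (\<lambda>x. cgrad f x $ i)"
  unfolding smooth_fun_def
proof
  fix k
  have "Ck (Suc k) f" using assms unfolding smooth_fun_def by blast
  then show "Ck k (\<lambda>x. cgrad f x $ i)" by (simp add: cgrad_def)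
qed

lemma smooth_continuous: "smooth_fun f \<Longrightarrow> continuous_on UNIV f"
  unfolding smooth_fun_def by (auto intro: Ck_cont)

lemma smooth_cgrad_continuous: "smooth_fun f \<Longrightarrow> continuous_on UNIV (cgrad f)"
  using continuous_on_vec_lambda[of UNIV "\<lambda>i x. cgrad f x $ i"] smooth_continuous[OF smooth_pd, of f] by simp

lemma test_fun_grad:
  assumes "test_fun \<Omega> f"
  shows "(f has_derivative (\<lambda>h. cgrad f x \<bullet> h)) (at x)" "continuous_on UNIV f" "continuous_on UNIV (cgrad f)"
  using assms by (auto simp: test_fun_def smooth_has_derivative smooth_continuous smooth_cgrad_continuous)

lemma test_fun_vanish:
  assumes "test_fun \<Omega> f" "x \<notin> closure {x. f x \<noteq> 0}"
  shows "f x = 0" "cgrad f x = 0"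
proof -
  note cs = closure_subset[of "{x. f x \<noteq> 0}"]
  show "f x = 0" using assms(2) cs by auto
  have "(f has_derivative (\<lambda>h. 0 \<bullet> h)) (at x)"
  proof (rule has_derivative_transform_within_open)
    show "((\<lambda>x. 0) has_derivative (\<lambda>h. 0 \<bullet> h)) (at x)" by simp
    show "open (- closure {x. f x \<noteq> 0})" by (rule open_Compl) simp
    show "x \<in> - closure {x. f x \<noteq> 0}" using assms(2) by simp
    show "0 = f y" if "y \<in> - closure {x. f x \<noteq> 0}" for y using that cs by auto
  qed
  then show "cgrad f x = 0" by (rule cgrad_unique)
qed

lemma test_fun_vanish_outside:
  assumes "test_fun \<Omega> f" "x \<notin> \<Omega>" shows "f x = 0" "cgrad f x = 0"
proof -
  have "x \<notin> closure {x. f x \<noteq> 0}" using assms unfolding test_fun_def by blast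
  then show "f x = 0" "cgrad f x = 0" by (rule test_fun_vanish[OF assms(1)])+
qed

lemma bounded_subset_cball_origin:
  assumes "bounded (S :: 'a::real_normed_vector set)"
  shows "\<exists>R>0. S \<subseteq> cball 0 R"
proof -
  obtain R where "\<forall>x\<in>S. norm x \<le> R" using assms unfolding bounded_iff by auto
  then show ?thesis by (intro exI[of _ "max R 1"]) (auto simp: le_max_iff_disj)
qed

lemma test_fun_bounded_support:
  assumes "test_fun \<Omega> f"
  obtains R where "R > 0" "\<And>x. x \<notin> cball 0 R \<Longrightarrow> f x = 0" "\<And>x. x \<notin> cball 0 R \<Longrightarrow> cgrad f x = 0"
proof -
  have "bounded (closure {x. f x \<noteq> 0})" using assms by (auto simp: test_fun_def compact_imp_bounded)
  then obtain R where R: "R > 0" "closure {x. f x \<noteq> 0} \<subseteq> cball 0 R"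
    by (metis bounded_subset_cball_origin)
  have n: "x \<notin> closure {x. f x \<noteq> 0}" if "x \<notin> cball 0 R" for x using that R(2) by auto
  show ?thesis by (rule that[OF R(1) test_fun_vanish(1)[OF assms n] test_fun_vanish(2)[OF assms n]])
qed

lemma test_fun_bounded:
  assumes "test_fun \<Omega> f"
  obtains C where "C \<ge> 0" "\<And>x. \<bar>f x\<bar> \<le> C" "\<And>x. norm (cgrad f x) \<le> C"
proof -
  obtain R where R: "R > 0" "\<And>x. x \<notin> cball 0 R \<Longrightarrow> f x = 0" "\<And>x. x \<notin> cball 0 R \<Longrightarrow> cgrad f x = 0"
    using test_fun_bounded_support[OF assms] by blast
  have "bounded (f ` cball 0 R)" "bounded (cgrad f ` cball 0 R)"
    using test_fun_grad[OF assms] by (auto intro!: compact_imp_bounded compact_continuous_image elim: continuous_on_subset)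
  then obtain C1 C2 where C: "\<And>x. x \<in> cball 0 R \<Longrightarrow> norm (f x) \<le> C1" "\<And>x. x \<in> cball 0 R \<Longrightarrow> norm (cgrad f x) \<le> C2"
    unfolding bounded_iff by blast
  show ?thesis
  proof (rule that[of "max 0 (max C1 C2)"])
    fix x
    show "\<bar>f x\<bar> \<le> max 0 (max C1 C2)" using C(1)[of x] R(2)[of x] by (cases "x \<in> cball 0 R") auto
    show "norm (cgrad f x) \<le> max 0 (max C1 C2)" using C(2)[of x] R(3)[of x] by (cases "x \<in> cball 0 R") auto
  qed simp
qed

lemma test_fun_lincomb:
  assumes "test_fun \<Omega> f" "test_fun \<Omega> g"
  shows "test_fun \<Omega> (\<lambda>x. s * f x + t * g x)"
  unfolding test_fun_def
proof (intro conjI)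
  show "smooth_fun (\<lambda>x. s * f x + t * g x)"
    using assms by (auto simp: test_fun_def intro!: smooth_add smooth_mult smooth_const)
  have sub: "closure {x. s * f x + t * g x \<noteq> 0} \<subseteq> closure {x. f x \<noteq> 0} \<union> closure {x. g x \<noteq> 0}"
  proof -
    have "{x. s * f x + t * g x \<noteq> 0} \<subseteq> {x. f x \<noteq> 0} \<union> {x. g x \<noteq> 0}" by auto
    then have "closure {x. s * f x + t * g x \<noteq> 0} \<subseteq> closure ({x. f x \<noteq> 0} \<union> {x. g x \<noteq> 0})" by (rule closure_mono)
    then show ?thesis by simp
  qed
  then show "closure {x. s * f x + t * g x \<noteq> 0} \<subseteq> \<Omega>" using assms by (auto simp: test_fun_def)
  have "compact (closure {x. f x \<noteq> 0} \<union> closure {x. g x \<noteq> 0})" using assms by (auto simp: test_fun_def)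
  then show "compact (closure {x. s * f x + t * g x \<noteq> 0})"
    unfolding compact_eq_bounded_closed using bounded_subset[OF _ sub] by blast
qed

lemma cgrad_lincomb:
  assumes "test_fun \<Omega> f" "test_fun \<Omega> g"
  shows "cgrad (\<lambda>x. s * f x + t * g x) x = s *\<^sub>R cgrad f x + t *\<^sub>R cgrad g x"
  by (rule cgrad_unique)
     (auto intro!: derivative_eq_intros test_fun_grad(1)[OF assms(1)] test_fun_grad(1)[OF assms(2)] simp: inner_add_left)

text \<open>The steepness \<open>m\<close> has two uses: as \<open>m\<close> grows the bump tends to
  the indicator of the open box, which gives the fundamental lemma, and for \<open>m = 1\<close> the
  bump is normalised to a mollifier.\<close>

definition box_bump :: "real \<Rightarrow> R2 \<Rightarrow> R2 \<Rightarrow> R2 \<Rightarrow> real" where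
  "box_bump m l u x = flat_exp 0 (m * (x $ 1 - l $ 1)) * flat_exp 0 (m * (u $ 1 - x $ 1))
     * (flat_exp 0 (m * (x $ 2 - l $ 2)) * flat_exp 0 (m * (u $ 2 - x $ 2)))"

lemma smooth_box_bump: "smooth_fun (box_bump m l u)"
proof -
  have "smooth_fun (\<lambda>x. flat_exp 0 ((- m * l $ 1) + m * x $ 1) * flat_exp 0 (m * u $ 1 + (- m) * x $ 1)
     * (flat_exp 0 ((- m * l $ 2) + m * x $ 2) * flat_exp 0 (m * u $ 2 + (- m) * x $ 2)))"
    by (intro smooth_mult smooth_flat_exp)
  then show ?thesis by (simp add: box_bump_def[abs_def] algebra_simps)
qed

lemma box_bump_nonneg: "box_bump m l u x \<ge> 0" and box_bump_le1: "box_bump m l u x \<le> 1"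
  by (auto simp: box_bump_def flat_exp_nonneg flat_exp_le1 mult_le_one)

lemma box_bump_zero:
  assumes "m > 0" "x \<notin> box l u" shows "box_bump m l u x = 0"
proof -
  have "\<exists>i\<in>{1,2}. x $ i \<le> l $ i \<or> u $ i \<le> x $ i"
    using assms(2) unfolding mem_box_cart forall_2 by (auto simp: not_less)
  then show ?thesis
    using assms(1) by (auto simp: box_bump_def flat_exp_zero mult_le_0_iff)
qed

lemma box_bump_pos:
  assumes "m > 0" "x \<in> box l u" shows "box_bump m l u x > 0"
  using assms by (auto simp: box_bump_def mem_box_cart intro!: mult_pos_pos flat_exp_pos)

lemma box_bump_tendsto:
  "(\<lambda>n. box_bump (real (Suc n)) l u x) \<longlonglongrightarrow> indicat_real (box l u) x"
proof (cases "x \<in> box l u")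
  case False
  then show ?thesis by (simp add: box_bump_zero)
next
  case True
  have *: "(\<lambda>n. flat_exp 0 (real (Suc n) * d)) \<longlonglongrightarrow> 1" if "d > 0" for d
  proof -
    have "(\<lambda>n. exp (- (inverse (real (Suc n)) * (1/d)))) \<longlonglongrightarrow> exp (- (0 * (1/d)))"
      by (intro tendsto_intros LIMSEQ_inverse_real_of_nat)
    moreover have "exp (- (inverse (real (Suc n)) * (1/d))) = flat_exp 0 (real (Suc n) * d)" for n
      unfolding flat_exp_def using that by (simp add: zero_less_mult_iff divide_inverse)
    ultimately show ?thesis by simp
  qed
  have "(\<lambda>n. box_bump (real (Suc n)) l u x) \<longlonglongrightarrow> 1 * 1 * (1 * 1)"
    unfolding box_bump_def using True by (intro tendsto_mult *) (auto simp: mem_box_cart)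
  then show ?thesis using True by simp
qed

lemma test_fun_box_bump:
  assumes "m > 0" "cbox l u \<subseteq> \<Omega>" shows "test_fun \<Omega> (box_bump m l u)"
  unfolding test_fun_def
proof (intro conjI smooth_box_bump)
  have "{x. box_bump m l u x \<noteq> 0} \<subseteq> cbox l u"
    using box_bump_zero[OF assms(1)] box_subset_cbox[of l u] by blast
  then have sub: "closure {x. box_bump m l u x \<noteq> 0} \<subseteq> cbox l u" by (rule closure_minimal[OF _ closed_cbox])
  then show "closure {x. box_bump m l u x \<noteq> 0} \<subseteq> \<Omega>" using assms(2) by blast
  show "compact (closure {x. box_bump m l u x \<noteq> 0})"
    unfolding compact_eq_bounded_closed using bounded_subset[OF bounded_cbox sub] by simp
qed

section \<open>Translation invariance and integration by parts for Lipschitz functions\<close>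

lemma lborel_integral_translate:
  fixes f :: "'a::euclidean_space \<Rightarrow> 'b::{banach, second_countable_topology}"
  assumes "f \<in> borel_measurable borel"
  shows "(\<integral>x. f (c + x) \<partial>lborel) = (\<integral>x. f x \<partial>lborel)"
proof -
  have "(\<integral>x. f x \<partial>(distr lborel borel ((+) c))) = (\<integral>x. f (c + x) \<partial>lborel)"
    by (rule integral_distr) (use assms in auto)
  then show ?thesis by (simp add: lborel_distr_plus)
qed

lemma lborel_integrable_translate:
  fixes f :: "'a::euclidean_space \<Rightarrow> 'b::{banach, second_countable_topology}"
  assumes "integrable lborel f"
  shows "integrable lborel (\<lambda>x. f (c + x))"
proof -
  have "integrable (distr lborel borel ((+) c)) f" using assms by (simp add: lborel_distr_plus)
  then show ?thesis by (subst (asm) integrable_distr_eq) (use assms in auto)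
qed

lemma integrable_compact_support:
  fixes f :: "'a::euclidean_space \<Rightarrow> 'b::euclidean_space"
  assumes "continuous_on UNIV f" "\<And>x. x \<notin> cball 0 R \<Longrightarrow> f x = 0"
  shows "integrable lborel f"
proof -
  have "integrable lborel (\<lambda>x. indicator (cball 0 R) x *\<^sub>R f x)"
    by (rule borel_integrable_compact) (use assms(1) in \<open>auto elim: continuous_on_subset\<close>)
  moreover have "(\<lambda>x. indicator (cball 0 R) x *\<^sub>R f x) = f"
    using assms(2) by (auto simp: indicator_def fun_eq_iff)
  ultimately show ?thesis by simp
qed

lemma borel_measurable_continuous_UNIV: "continuous_on UNIV f \<Longrightarrow> f \<in> borel_measurable borel"
  by (rule borel_measurable_continuous_onI)

lemma directional_difference_quotient:
  fixes u :: "'a::real_normed_vector \<Rightarrow> real"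
  assumes "(u has_derivative D) (at x)"
  shows "(\<lambda>n. (u (x + inverse (real (Suc n)) *\<^sub>R h) - u x) * real (Suc n)) \<longlonglongrightarrow> D h"
proof -
  have lin: "bounded_linear D" by (rule has_derivative_bounded_linear[OF assms])
  have l: "((\<lambda>t::real. x + t *\<^sub>R h) has_derivative (\<lambda>t. t *\<^sub>R h)) (at 0)"
    by (auto intro!: derivative_eq_intros)
  have "((\<lambda>t::real. u (x + t *\<^sub>R h)) has_derivative (\<lambda>t. D (t *\<^sub>R h))) (at 0)"
    by (rule has_derivative_compose[OF l]) (use assms in simp)
  then have "((\<lambda>t::real. u (x + t *\<^sub>R h)) has_real_derivative D h) (at 0)"
    by (rule has_derivative_imp_has_field_derivative) (simp add: linear_scale[OF bounded_linear.linear[OF lin]])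
  then have "((\<lambda>t. (u (x + t *\<^sub>R h) - u x) / t) \<longlongrightarrow> D h) (at 0)"
    by (simp add: DERIV_def)
  moreover have "filterlim (\<lambda>n. inverse (real (Suc n))) (at 0) sequentially"
    unfolding filterlim_at using LIMSEQ_inverse_real_of_nat by (auto intro!: eventuallyI)
  ultimately have "(\<lambda>n. (u (x + inverse (real (Suc n)) *\<^sub>R h) - u x) / inverse (real (Suc n))) \<longlonglongrightarrow> D h"
    by (rule filterlim_compose)
  then show ?thesis by (simp add: divide_inverse)
qed

lemma lipschitz_continuous:
  fixes u :: "'a::real_normed_vector \<Rightarrow> 'b::real_normed_vector"
  assumes "\<And>x y. norm (u x - u y) \<le> L * norm (x - y)" shows "continuous_on UNIV u"
proof -
  have "norm (u x - u y) \<le> \<bar>L\<bar> * norm (x - y)" for x y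
    by (rule order_trans[OF assms]) (intro mult_right_mono, auto)
  then have "(\<bar>L\<bar>)-lipschitz_on UNIV u" by (intro lipschitz_onI) (auto simp: dist_norm)
  then show ?thesis by (rule lipschitz_on_continuous_on)
qed

text \<open>The difference quotients have integral zero by translation invariance and converge
  dominatedly, so no Fubini argument is needed.\<close>

lemma lipschitz_integral_derivative_zero:
  fixes u :: "'a::euclidean_space \<Rightarrow> real"
  assumes lip: "\<And>x y. norm (u x - u y) \<le> L * norm (x - y)"
    and supp: "\<And>x. x \<notin> cball 0 R \<Longrightarrow> u x = 0"
    and der: "AE x in lborel. (u has_derivative D x) (at x)"
    and meas: "(\<lambda>x. D x h) \<in> borel_measurable borel"
  shows "integrable lborel (\<lambda>x. D x h)" "(\<integral>x. D x h \<partial>lborel) = 0"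
proof -
  have cont: "continuous_on UNIV u" by (rule lipschitz_continuous[OF lip])
  note u_m [measurable] = borel_measurable_continuous_UNIV[OF cont]
  note meas [measurable]
  have int: "integrable lborel u" by (rule integrable_compact_support[OF cont supp])
  define q where "q n x = (u (x + inverse (real (Suc n)) *\<^sub>R h) - u x) * real (Suc n)" for n x
  define w where "w x = \<bar>L\<bar> * norm h * indicator (cball 0 (R + norm h)) x" for x :: 'a
  have q_m: "q n \<in> borel_measurable lborel" for n unfolding q_def by measurable
  have w_i: "integrable lborel w"
    unfolding w_def by (intro integrable_mult_right integrable_real_indicator) (use emeasure_bounded_finite[OF bounded_cball] in auto)
  have lim: "AE x in lborel. (\<lambda>n. q n x) \<longlonglongrightarrow> D x h"
    using der unfolding q_def by eventually_elim (rule directional_difference_quotient)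
  have bd: "norm (q n x) \<le> w x" for n x
  proof (cases "x \<in> cball 0 (R + norm h)")
    case True
    have "norm (u (x + inverse (real (Suc n)) *\<^sub>R h) - u x) \<le> \<bar>L\<bar> * norm (inverse (real (Suc n)) *\<^sub>R h)"
      by (rule order_trans[OF lip]) (auto intro: mult_right_mono)
    then have "norm (u (x + inverse (real (Suc n)) *\<^sub>R h) - u x) * real (Suc n) \<le> (\<bar>L\<bar> * norm (inverse (real (Suc n)) *\<^sub>R h)) * real (Suc n)"
      by (rule mult_right_mono) simp
    also have "(\<bar>L\<bar> * norm (inverse (real (Suc n)) *\<^sub>R h)) * real (Suc n) = \<bar>L\<bar> * norm h"
      by (simp del: of_nat_Suc)
    finally show ?thesis using True by (simp add: q_def w_def abs_mult del: of_nat_Suc)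
  next
    case False
    then have x: "norm x > R + norm h" by simp
    have "norm (inverse (real (Suc n)) *\<^sub>R h) \<le> 1 * norm h"
      unfolding norm_scaleR by (intro mult_right_mono) (auto simp: inverse_le_1_iff)
    then have "norm (x + inverse (real (Suc n)) *\<^sub>R h) > R"
      using x norm_triangle_ineq2[of x "- (inverse (real (Suc n)) *\<^sub>R h)"] by simp
    then have "u (x + inverse (real (Suc n)) *\<^sub>R h) = 0" by (intro supp) simp
    moreover have "u x = 0" by (rule supp) (use x norm_ge_zero[of h] in \<open>simp add: not_le, linarith\<close>)
    ultimately show ?thesis by (simp add: q_def w_def)
  qed
  have "(\<integral>x. q n x \<partial>lborel) = 0" for n
  proof -
    let ?c = "inverse (real (Suc n)) *\<^sub>R h"
    have "(\<integral>x. q n x \<partial>lborel) = ((\<integral>x. u (?c + x) \<partial>lborel) - (\<integral>x. u x \<partial>lborel)) * real (Suc n)"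
      unfolding q_def using int lborel_integrable_translate[OF int, of ?c] by (simp add: add.commute del: of_nat_Suc)
    then show ?thesis using lborel_integral_translate[OF u_m, of ?c] by simp
  qed
  moreover have "(\<lambda>n. \<integral>x. q n x \<partial>lborel) \<longlonglongrightarrow> (\<integral>x. D x h \<partial>lborel)"
    by (rule integral_dominated_convergence[OF _ q_m w_i lim]) (use bd in auto)
  ultimately show "(\<integral>x. D x h \<partial>lborel) = 0" by (simp add: LIMSEQ_const_iff)
  show "integrable lborel (\<lambda>x. D x h)"
    by (rule integrable_dominated_convergence[OF _ q_m w_i lim]) (use bd in auto)
qed

lemma test_fun_lipschitz:
  assumes "test_fun \<Omega> f" "\<And>x. norm (cgrad f x) \<le> C"
  shows "norm (f x - f y) \<le> C * norm (x - y)"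
proof (rule differentiable_bound[where S=UNIV and f'="\<lambda>x h. cgrad f x \<bullet> h"])
  show "(f has_derivative (\<lambda>h. cgrad f x \<bullet> h)) (at x within UNIV)" for x
    using test_fun_grad(1)[OF assms(1)] by simp
  show "onorm (\<lambda>h. cgrad f x \<bullet> h) \<le> C" for x
  proof (rule onorm_bound)
    show "0 \<le> C" using assms(2)[of x] norm_ge_zero[of "cgrad f x"] by linarith
    fix h show "norm (cgrad f x \<bullet> h) \<le> C * norm h"
      using Cauchy_Schwarz_ineq2[of "cgrad f x" h] mult_right_mono[OF assms(2)[of x] norm_ge_zero[of h]] by simp
  qed
qed auto

lemma test_fun_pd: 
  assumes "test_fun \<Omega> f" shows "test_fun \<Omega> (\<lambda>x. cgrad f x $ i)"
proof -
  let ?S = "closure {x. f x \<noteq> 0}"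
  have "{x. cgrad f x $ i \<noteq> 0} \<subseteq> ?S"
  proof
    fix x assume x: "x \<in> {x. cgrad f x $ i \<noteq> 0}"
    show "x \<in> ?S"
    proof (rule ccontr)
      assume "x \<notin> ?S"
      then have "cgrad f x = 0" by (rule test_fun_vanish(2)[OF assms])
      then show False using x by simp
    qed
  qed
  then have sub: "closure {x. cgrad f x $ i \<noteq> 0} \<subseteq> ?S" by (rule closure_minimal) simp
  have S: "compact ?S" "?S \<subseteq> \<Omega>" using assms by (auto simp: test_fun_def)
  show ?thesis unfolding test_fun_def
  proof (intro conjI)
    show "smooth_fun (\<lambda>x. cgrad f x $ i)" using assms by (simp add: test_fun_def smooth_pd)
    show "compact (closure {x. cgrad f x $ i \<noteq> 0})"
      unfolding compact_eq_bounded_closed using bounded_subset[OF compact_imp_bounded[OF S(1)] sub] by simp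
    show "closure {x. cgrad f x $ i \<noteq> 0} \<subseteq> \<Omega>" using sub S(2) by (rule subset_trans)
  qed
qed

text \<open>The product \<open>v * \<phi>\<close> is Lipschitz with compact support, so the integral
  of its directional derivative vanishes, and the product rule splits that integral.\<close>

lemma lipschitz_ibp:
  assumes lip: "\<And>x y. norm (v x - v y) \<le> L * norm (x - y)"
    and M: "\<And>x. \<bar>v x\<bar> \<le> M"
    and der: "AE x in lborel. (v has_derivative (\<lambda>h. g x \<bullet> h)) (at x)"
    and g: "g \<in> borel_measurable borel" and phi: "test_fun \<Omega> \<phi>"
  shows "integrable lborel (\<lambda>x. v x * (cgrad \<phi> x \<bullet> h))" "integrable lborel (\<lambda>x. \<phi> x * (g x \<bullet> h))"
    "(\<integral>x. v x * (cgrad \<phi> x \<bullet> h) \<partial>lborel) = - (\<integral>x. \<phi> x * (g x \<bullet> h) \<partial>lborel)"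
proof -
  have vc: "continuous_on UNIV v" by (rule lipschitz_continuous[OF lip])
  note pc = test_fun_grad[OF phi]
  obtain R where R: "R > 0" "\<And>x. x \<notin> cball 0 R \<Longrightarrow> \<phi> x = 0" "\<And>x. x \<notin> cball 0 R \<Longrightarrow> cgrad \<phi> x = 0"
    using test_fun_bounded_support[OF phi] by metis
  obtain C where C: "C \<ge> 0" "\<And>x. \<bar>\<phi> x\<bar> \<le> C" "\<And>x. norm (cgrad \<phi> x) \<le> C"
    using test_fun_bounded[OF phi] by metis
  have M0: "M \<ge> 0" using M[of 0] abs_ge_zero[of "v 0"] by linarith
  show i1: "integrable lborel (\<lambda>x. v x * (cgrad \<phi> x \<bullet> h))"
    by (rule integrable_compact_support[where R=R]) (use R(3) in \<open>auto intro!: continuous_intros vc pc\<close>)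
  note [measurable] = g borel_measurable_continuous_UNIV[OF vc] borel_measurable_continuous_UNIV[OF pc(2)]
    borel_measurable_continuous_UNIV[OF pc(3)]
  have lipp: "norm (v x * \<phi> x - v y * \<phi> y) \<le> (M * C + C * \<bar>L\<bar>) * norm (x - y)" for x y
  proof -
    have "v x * \<phi> x - v y * \<phi> y = v x * (\<phi> x - \<phi> y) + \<phi> y * (v x - v y)" by (simp add: algebra_simps)
    then have "norm (v x * \<phi> x - v y * \<phi> y) \<le> \<bar>v x\<bar> * norm (\<phi> x - \<phi> y) + \<bar>\<phi> y\<bar> * norm (v x - v y)"
      by (metis abs_mult norm_triangle_ineq real_norm_def)
    also have "\<dots> \<le> M * (C * norm (x - y)) + C * (\<bar>L\<bar> * norm (x - y))"
    proof (intro add_mono mult_mono M C(2) test_fun_lipschitz[OF phi C(3)])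
      show "norm (v x - v y) \<le> \<bar>L\<bar> * norm (x - y)"
        by (rule order_trans[OF lip]) (auto intro: mult_right_mono)
    qed (use M0 C(1) in auto)
    finally show ?thesis by (simp add: algebra_simps)
  qed
  have z: "v x * \<phi> x = 0" if "x \<notin> cball 0 R" for x using R(2)[OF that] by simp
  have d: "AE x in lborel. ((\<lambda>x. v x * \<phi> x) has_derivative (\<lambda>h. v x * (cgrad \<phi> x \<bullet> h) + (g x \<bullet> h) * \<phi> x)) (at x)"
    using der by eventually_elim (rule has_derivative_mult[OF _ pc(1)])
  have m: "(\<lambda>x. v x * (cgrad \<phi> x \<bullet> h) + (g x \<bullet> h) * \<phi> x) \<in> borel_measurable borel" by measurable
  note F = lipschitz_integral_derivative_zero[OF lipp z d m]
  have "integrable lborel (\<lambda>x. (v x * (cgrad \<phi> x \<bullet> h) + (g x \<bullet> h) * \<phi> x) - v x * (cgrad \<phi> x \<bullet> h))"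
    by (rule Bochner_Integration.integrable_diff[OF F(1) i1])
  then show i2: "integrable lborel (\<lambda>x. \<phi> x * (g x \<bullet> h))" by (simp add: mult.commute)
  have "(\<integral>x. v x * (cgrad \<phi> x \<bullet> h) + \<phi> x * (g x \<bullet> h) \<partial>lborel) = 0"
    using F(2) by (simp add: mult.commute)
  then show "(\<integral>x. v x * (cgrad \<phi> x \<bullet> h) \<partial>lborel) = - (\<integral>x. \<phi> x * (g x \<bullet> h) \<partial>lborel)"
    using Bochner_Integration.integral_add[OF i1 i2] by linarith
qed

text \<open>The shift by \<open>h\<close> telescopes into \<open>n + 1\<close> equal short shifts,
  all with the same square integral by translation invariance. Cauchy-Schwarz for sums bounds the
  long shift by \<open>(n + 1)^2\<close> times a short one, and this converges to the integral of
  the squared directional derivative.\<close>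

lemma translation_estimate:
  assumes phi: "test_fun \<Omega> \<phi>"
  shows "integrable lborel (\<lambda>x. (\<phi> (x + h) - \<phi> x)\<^sup>2)" "integrable lborel (\<lambda>x. (norm (cgrad \<phi> x))\<^sup>2)"
    "(\<integral>x. (\<phi> (x + h) - \<phi> x)\<^sup>2 \<partial>lborel) \<le> (norm h)\<^sup>2 * (\<integral>x. (norm (cgrad \<phi> x))\<^sup>2 \<partial>lborel)"
proof -
  note pc = test_fun_grad[OF phi]
  obtain R where R: "R > 0" "\<And>x. x \<notin> cball 0 R \<Longrightarrow> \<phi> x = 0" "\<And>x. x \<notin> cball 0 R \<Longrightarrow> cgrad \<phi> x = 0"
    using test_fun_bounded_support[OF phi] by metis
  obtain C where C: "C \<ge> 0" "\<And>x. \<bar>\<phi> x\<bar> \<le> C" "\<And>x. norm (cgrad \<phi> x) \<le> C"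
    using test_fun_bounded[OF phi] by metis
  note [measurable] = borel_measurable_continuous_UNIV[OF pc(2)] borel_measurable_continuous_UNIV[OF pc(3)]
  have pc2: "continuous_on UNIV (\<lambda>x. \<phi> (x + k))" for k
    by (rule continuous_on_compose2[OF pc(2)]) (auto intro!: continuous_intros)
  have far: "\<phi> (x + k) = 0" "\<phi> x = 0" if "x \<notin> cball 0 (R + norm k)" for x k
  proof -
    have x: "norm x > R + norm k" using that by simp
    then have "norm (x + k) > R" using norm_triangle_ineq2[of x "-k"] by simp
    then show "\<phi> (x + k) = 0" by (intro R) simp
    show "\<phi> x = 0" by (rule R) (use x norm_ge_zero[of k] in \<open>simp add: not_le, linarith\<close>)
  qed
  have i: "integrable lborel (\<lambda>x. (\<phi> (x + k) - \<phi> x)\<^sup>2)" for k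
    by (rule integrable_compact_support[where R="R + norm k"]) (use far in \<open>auto intro!: continuous_intros pc pc2\<close>)
  show "integrable lborel (\<lambda>x. (\<phi> (x + h) - \<phi> x)\<^sup>2)" by (rule i)
  show ig: "integrable lborel (\<lambda>x. (norm (cgrad \<phi> x))\<^sup>2)"
    by (rule integrable_compact_support[where R=R]) (use R(3) in \<open>auto intro!: continuous_intros pc\<close>)
  let ?I = "\<lambda>k. \<integral>x. (\<phi> (x + k) - \<phi> x)\<^sup>2 \<partial>lborel"
  define t where "t n = inverse (real (Suc n))" for n
  have step: "?I h \<le> (real (Suc n))\<^sup>2 * ?I (t n *\<^sub>R h)" for n
  proof -
    let ?d = "\<lambda>j x. \<phi> (x + (real (Suc j) * t n) *\<^sub>R h) - \<phi> (x + (real j * t n) *\<^sub>R h)"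
    have sq: "?d j x = \<phi> (((real j * t n) *\<^sub>R h + x) + t n *\<^sub>R h) - \<phi> ((real j * t n) *\<^sub>R h + x)" for j x
      by (simp add: algebra_simps)
    have id: "integrable lborel (\<lambda>x. (?d j x)\<^sup>2)" for j
      unfolding sq by (rule lborel_integrable_translate[OF i[of "t n *\<^sub>R h"]])
    have ed: "(\<integral>x. (?d j x)\<^sup>2 \<partial>lborel) = ?I (t n *\<^sub>R h)" for j
      unfolding sq by (rule lborel_integral_translate) measurable
    have tel: "\<phi> (x + h) - \<phi> x = (\<Sum>j<Suc n. ?d j x)" for x
    proof -
      have "(\<Sum>j<Suc n. ?d j x) = \<phi> (x + (real (Suc n) * t n) *\<^sub>R h) - \<phi> (x + (real 0 * t n) *\<^sub>R h)"
        by (rule sum_lessThan_telescope)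
      also have "real (Suc n) * t n = 1" by (simp add: t_def del: of_nat_Suc)
      finally show ?thesis by simp
    qed
    have "(\<phi> (x + h) - \<phi> x)\<^sup>2 \<le> real (Suc n) * (\<Sum>j<Suc n. (?d j x)\<^sup>2)" for x
      using sum_squared_le_sum_of_squares[of "\<lambda>j. ?d j x" "{..<Suc n}"] unfolding tel by (simp add: mult.commute)
    then have "?I h \<le> (\<integral>x. real (Suc n) * (\<Sum>j<Suc n. (?d j x)\<^sup>2) \<partial>lborel)"
      by (intro integral_mono i integrable_mult_right Bochner_Integration.integrable_sum id)
    also have "\<dots> = real (Suc n) * (\<Sum>j<Suc n. \<integral>x. (?d j x)\<^sup>2 \<partial>lborel)"
      by (simp only: integral_mult_right_zero Bochner_Integration.integral_sum[OF id])
    also have "\<dots> = (real (Suc n))\<^sup>2 * ?I (t n *\<^sub>R h)" 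
      unfolding ed by (simp add: power2_eq_square del: of_nat_Suc)
    finally show ?thesis .
  qed
  define q where "q n x = ((\<phi> (x + t n *\<^sub>R h) - \<phi> x) * real (Suc n))\<^sup>2" for n x
  define w where "w x = (C * norm h)\<^sup>2 * indicator (cball 0 (R + norm h)) x" for x :: R2
  have q_m: "q n \<in> borel_measurable lborel" for n unfolding q_def by measurable
  have w_i: "integrable lborel w"
    unfolding w_def by (intro integrable_mult_right integrable_real_indicator) (use emeasure_bounded_finite[OF bounded_cball] in auto)
  have lim: "(\<lambda>n. q n x) \<longlonglongrightarrow> (cgrad \<phi> x \<bullet> h)\<^sup>2" for x
    unfolding q_def t_def by (intro tendsto_power directional_difference_quotient[OF pc(1)])
  have tn: "norm (t n *\<^sub>R h) \<le> norm h" for n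
  proof -
    have "norm (t n *\<^sub>R h) \<le> 1 * norm h"
      unfolding norm_scaleR t_def by (intro mult_right_mono) (auto simp: inverse_le_1_iff)
    then show ?thesis by simp
  qed
  have bd: "norm (q n x) \<le> w x" for n x
  proof (cases "x \<in> cball 0 (R + norm h)")
    case True
    have "norm (\<phi> (x + t n *\<^sub>R h) - \<phi> x) \<le> C * norm (t n *\<^sub>R h)"
      using test_fun_lipschitz[OF phi C(3), of "x + t n *\<^sub>R h" x] by simp
    then have "norm (\<phi> (x + t n *\<^sub>R h) - \<phi> x) * real (Suc n) \<le> (C * norm (t n *\<^sub>R h)) * real (Suc n)"
      by (rule mult_right_mono) simp
    also have "\<dots> = C * norm h" by (simp add: t_def del: of_nat_Suc)
    finally have "(norm (\<phi> (x + t n *\<^sub>R h) - \<phi> x) * real (Suc n))\<^sup>2 \<le> (C * norm h)\<^sup>2"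
      by (rule power_mono) simp
    then show ?thesis using True by (simp add: q_def w_def power_mult_distrib del: of_nat_Suc)
  next
    case False
    then have "x \<notin> cball 0 (R + norm (t n *\<^sub>R h))" using tn[of n] by (simp add: not_le)
    from far[OF this] show ?thesis by (simp add: q_def w_def)
  qed
  have "(\<lambda>n. \<integral>x. q n x \<partial>lborel) \<longlonglongrightarrow> (\<integral>x. (cgrad \<phi> x \<bullet> h)\<^sup>2 \<partial>lborel)"
    by (rule integral_dominated_convergence[OF _ q_m w_i]) (use bd lim in auto)
  moreover have "?I h \<le> (\<integral>x. q n x \<partial>lborel)" for n
  proof -
    have "(\<integral>x. q n x \<partial>lborel) = (real (Suc n))\<^sup>2 * ?I (t n *\<^sub>R h)"
      unfolding q_def power_mult_distrib by (simp add: mult.commute)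
    then show ?thesis using step[of n] by simp
  qed
  ultimately have "?I h \<le> (\<integral>x. (cgrad \<phi> x \<bullet> h)\<^sup>2 \<partial>lborel)"
    by (intro LIMSEQ_le_const) auto
  also have "\<dots> \<le> (\<integral>x. (norm h)\<^sup>2 * (norm (cgrad \<phi> x))\<^sup>2 \<partial>lborel)"
  proof (rule integral_mono)
    show "integrable lborel (\<lambda>x. (cgrad \<phi> x \<bullet> h)\<^sup>2)"
      by (rule integrable_compact_support[where R=R]) (use R(3) in \<open>auto intro!: continuous_intros pc\<close>)
    show "integrable lborel (\<lambda>x. (norm h)\<^sup>2 * (norm (cgrad \<phi> x))\<^sup>2)" using ig by simp
    fix x
    have "\<bar>cgrad \<phi> x \<bullet> h\<bar>\<^sup>2 \<le> (norm (cgrad \<phi> x) * norm h)\<^sup>2"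
      by (intro power_mono Cauchy_Schwarz_ineq2) simp
    then show "(cgrad \<phi> x \<bullet> h)\<^sup>2 \<le> (norm h)\<^sup>2 * (norm (cgrad \<phi> x))\<^sup>2"
      by (simp add: power_mult_distrib mult.commute)
  qed
  finally show "?I h \<le> (norm h)\<^sup>2 * (\<integral>x. (norm (cgrad \<phi> x))\<^sup>2 \<partial>lborel)" by simp
qed

section \<open>Lebesgue points and mollification\<close>

text \<open>Absolute deviations are averaged, so the property passes to any subset that fills a
  fixed fraction of the cubes, such as a shrinking ellipse. The power of \<open>h\<close> stands for
  the volume of the cube up to a constant factor.\<close>

definition lebesgue_point :: "('a::euclidean_space \<Rightarrow> real) \<Rightarrow> 'a \<Rightarrow> bool" where
  "lebesgue_point f y \<longleftrightarrow> (\<forall>e>0. \<exists>d>0. \<forall>h. 0 < h \<and> h < d \<longrightarrow>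
     (LINT t:cbox (y - h *\<^sub>R One) (y + h *\<^sub>R One)|lebesgue. \<bar>f t - f y\<bar>) \<le> e * h ^ DIM('a))"

text \<open>The library's differentiation theorem concerns boxes having \<^term>\<open>x\<close> as lower corner;
  the box centred at \<^term>\<open>x\<close> is covered by the reflected corner boxes.\<close>

lemma AE_lebesgue_point:
  fixes f :: "'a::euclidean_space \<Rightarrow> real"
  assumes f: "integrable lebesgue f"
  shows "AE y in lebesgue. lebesgue_point f y"
proof -
  \<comment> \<open>All sign patterns: the reflection \<open>T c\<close> maps the orthant at
    \<open>y\<close> with signs \<open>c\<close> to the one in which \<open>T c y\<close> is the
    lower corner.\<close>
  define C where "C = (Basis :: 'a set) \<rightarrow>\<^sub>E {1, -1::real}"
  have finC: "finite C" unfolding C_def by (intro finite_PiE) auto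
  define T where "T c t = (\<Sum>j\<in>Basis. (c j * (t \<bullet> j)) *\<^sub>R j)" for c and t :: 'a
  have T_inner: "T c t \<bullet> j = c j * (t \<bullet> j)" if "j \<in> Basis" for c t j
    unfolding T_def using that by (simp add: inner_sum_left inner_Basis if_distrib sum.delta cong: if_cong)
  have c1: "c j = 1 \<or> c j = -1" if "c \<in> C" "j \<in> Basis" for c j using that unfolding C_def by (auto dest: PiE_mem)
  have T_T: "T c (T c t) = t" if "c \<in> C" for c t
  proof (rule euclidean_eqI)
    fix b :: 'a assume b: "b \<in> Basis"
    show "T c (T c t) \<bullet> b = t \<bullet> b" unfolding T_inner[OF b] using c1[OF that b] by auto
  qed
  have distr: "distr lebesgue lebesgue (T c) = (lebesgue :: 'a measure)" and T_m: "T c \<in> lebesgue \<rightarrow>\<^sub>M lebesgue" if "c \<in> C" for c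
  proof -
    have nz: "c j \<noteq> 0" if "j \<in> Basis" for j using c1[OF \<open>c \<in> C\<close> that] by auto
    have p: "(\<Prod>j\<in>(Basis::'a set). \<bar>c j\<bar>) = 1" 
    proof (intro prod.neutral ballI)
      fix j :: 'a assume "j \<in> Basis"
      from c1[OF \<open>c \<in> C\<close> this] show "\<bar>c j\<bar> = 1" by auto
    qed
    have "lebesgue = density (distr lebesgue lebesgue (\<lambda>x. 0 + T c x)) (\<lambda>_. (\<Prod>j\<in>Basis. \<bar>c j\<bar>))"
      unfolding T_def by (rule lebesgue_affine_euclidean[of c "0::'a", OF nz])
    then show "distr lebesgue lebesgue (T c) = (lebesgue :: 'a measure)" unfolding p by (simp add: density_1)
    show "T c \<in> lebesgue \<rightarrow>\<^sub>M lebesgue"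
      using lebesgue_affine_measurable[of c "0::'a", OF nz] by (simp add: T_def[abs_def])
  qed
  \<comment> \<open>Comparing with a constant \<open>q\<close> instead of \<open>f y\<close> makes
    the integrand independent of the point; only rational \<open>q\<close> are used, so the
    exceptional sets have a null union.\<close>
  define F where "F c q t = \<bar>f (T c t) - q\<bar>" for c q t
  have fT: "integrable lebesgue (\<lambda>t. f (T c t))" if "c \<in> C" for c
  proof -
    have "integrable (distr lebesgue lebesgue (T c)) f" using f distr[OF that] by simp
    then show ?thesis by (subst (asm) integrable_distr_eq) (use T_m[OF that] f in auto)
  qed
  have si: "set_integrable lebesgue (cbox l u) (\<lambda>t. \<bar>g t - q\<bar>)" if "integrable lebesgue g" for l u q and g :: "'a \<Rightarrow> real"
  proof (intro set_integrable_abs set_integral_diff)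
    show "set_integrable lebesgue (cbox l u) g"
      unfolding set_integrable_def by (rule integrable_mult_indicator[OF _ that]) simp
    show "set_integrable lebesgue (cbox l u) (\<lambda>t. q)"
      using lmeasurable_cbox[of l u] by (simp add: set_integrable_def lmeasurable_iff_integrable)
  qed
  have "\<exists>N. negligible N \<and> (\<forall>x e. x \<notin> N \<longrightarrow> 0 < e \<longrightarrow> (\<exists>d>0. \<forall>h. 0 < h \<and> h < d \<longrightarrow>
     norm (integral (cbox x (x + h *\<^sub>R One)) (F c q) /\<^sub>R h ^ DIM('a) - F c q x) < e))" if "c \<in> C" for c q
  proof -
    have "F c q integrable_on cbox a b" for a b
      using si[OF fT[OF that]] unfolding F_def[abs_def] by (rule set_lebesgue_integral_eq_integral(1))
    from integrable_ccontinuous_explicit[of "F c q", OF this] show ?thesis by metis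
  qed
  then obtain N where N: "\<And>c q. c \<in> C \<Longrightarrow> negligible (N c q)"
    "\<And>c q x e. c \<in> C \<Longrightarrow> x \<notin> N c q \<Longrightarrow> 0 < e \<Longrightarrow> \<exists>d>0. \<forall>h. 0 < h \<and> h < d \<longrightarrow>
     norm (integral (cbox x (x + h *\<^sub>R One)) (F c q) /\<^sub>R h ^ DIM('a) - F c q x) < e"
    by metis
  have "AE y in lebesgue. T c y \<notin> N c q" if "c \<in> C" for c q
  proof -
    have "N c q \<in> null_sets lebesgue" using N(1)[OF that] by (simp add: negligible_iff_null_sets)
    then have "AE y in distr lebesgue lebesgue (T c). y \<notin> N c q" unfolding distr[OF that] by (rule AE_not_in)
    then show ?thesis by (rule AE_distrD[OF T_m[OF that]])
  qed
  then have "AE y in lebesgue. \<forall>q\<in>\<rat>. \<forall>c\<in>C. T c y \<notin> N c q"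
    using finC by (simp add: AE_ball_countable countable_rat countable_finite)
  then show ?thesis
  proof eventually_elim
    case (elim y)
    show "lebesgue_point f y" unfolding lebesgue_point_def
    proof (intro allI impI)
      fix e :: real assume e: "e > 0"
      \<comment> \<open>Each of the \<open>card C\<close> corner boxes contributes at most
        \<open>2 * (e / K)\<close> times \<open>h ^ DIM('a)\<close>, and replacing \<open>q\<close>
        by \<open>f y\<close> costs \<open>e / K\<close> times the volume of the centred box, which
        is \<open>2 ^ DIM('a)\<close> times \<open>h ^ DIM('a)\<close>.\<close>
      define K where "K = 2 * real (card C) + 2 ^ DIM('a)"
      have K: "K > 0" unfolding K_def by (simp add: add_nonneg_pos)
      have "e / K > 0" using e K by simp
      obtain q where q: "q \<in> \<rat>" "\<bar>f y - q\<bar> < e / K"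
      proof -
        obtain q where "q \<in> \<rat>" "f y < q" "q < f y + e / K" using Rats_dense_in_real[of "f y" "f y + e/K"] \<open>e / K > 0\<close> by auto
        then show ?thesis by (intro that[of q]) auto
      qed
      have "\<forall>c\<in>C. \<exists>d>0. \<forall>h. 0 < h \<and> h < d \<longrightarrow>
        norm (integral (cbox (T c y) (T c y + h *\<^sub>R One)) (F c q) /\<^sub>R h ^ DIM('a) - F c q (T c y)) < e / K"
        using N(2) elim q(1) \<open>e / K > 0\<close> by blast
      then obtain d where d: "\<And>c. c \<in> C \<Longrightarrow> d c > 0" "\<And>c h. c \<in> C \<Longrightarrow> 0 < h \<Longrightarrow> h < d c \<Longrightarrow>
        norm (integral (cbox (T c y) (T c y + h *\<^sub>R One)) (F c q) /\<^sub>R h ^ DIM('a) - F c q (T c y)) < e / K"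
        by metis
      define D where "D = Min (insert 1 (d ` C))"
      have D: "D > 0" "\<And>c. c \<in> C \<Longrightarrow> D \<le> d c" unfolding D_def using finC d(1) by auto
      show "\<exists>d>0. \<forall>h. 0 < h \<and> h < d \<longrightarrow>
         (LINT t:cbox (y - h *\<^sub>R One) (y + h *\<^sub>R One)|lebesgue. \<bar>f t - f y\<bar>) \<le> e * h ^ DIM('a)"
      proof (intro exI[of _ D] conjI D(1) allI impI)
        fix h assume h: "0 < h \<and> h < D"
        let ?n = "h ^ DIM('a)"
        have n: "?n > 0" using h by simp
        let ?Q = "cbox (y - h *\<^sub>R One) (y + h *\<^sub>R One)"
        let ?B = "\<lambda>c. cbox (T c y) (T c y + h *\<^sub>R One)"
        have B_sets: "?B c \<in> sets lebesgue" for c by simp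
        have ind_int: "integrable lebesgue (\<lambda>t. indicator (?B c) (T c t) * \<bar>f t - q\<bar>)"
          and quad: "(\<integral>t. indicator (?B c) (T c t) * \<bar>f t - q\<bar> \<partial>lebesgue) \<le> (2 * (e / K)) * ?n" if c: "c \<in> C" for c
        proof -
          have iB: "integrable lebesgue (\<lambda>t. indicator (?B c) t *\<^sub>R F c q t)"
            using si[OF fT[OF c], of "T c y" "T c y + h *\<^sub>R One" q] unfolding F_def set_integrable_def by simp
          have iB': "integrable (distr lebesgue lebesgue (T c)) (\<lambda>t. indicator (?B c) t *\<^sub>R F c q t)"
            using iB distr[OF c] by simp
          have m: "(\<lambda>t. indicator (?B c) t *\<^sub>R F c q t) \<in> borel_measurable lebesgue" using iB by auto
          have eq: "indicator (?B c) (T c t) *\<^sub>R F c q (T c t) = indicator (?B c) (T c t) * \<bar>f t - q\<bar>" for t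
            by (simp add: F_def T_T[OF c])
          show "integrable lebesgue (\<lambda>t. indicator (?B c) (T c t) * \<bar>f t - q\<bar>)"
            using iB' unfolding integrable_distr_eq[OF T_m[OF c] m] eq .
          have "(\<integral>t. indicator (?B c) (T c t) * \<bar>f t - q\<bar> \<partial>lebesgue)
             = (\<integral>t. indicator (?B c) t *\<^sub>R F c q t \<partial>(distr lebesgue lebesgue (T c)))"
            unfolding integral_distr[OF T_m[OF c] m] eq by simp
          also have "\<dots> = (LINT t:?B c|lebesgue. F c q t)" unfolding distr[OF c] set_lebesgue_integral_def by simp
          also have "\<dots> = integral (?B c) (F c q)"
            by (rule set_lebesgue_integral_eq_integral(2)) (use iB in \<open>simp add: set_integrable_def\<close>)
          also have "\<dots> \<le> (2 * (e / K)) * ?n"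
          proof -
            have "h < d c" using h D(2)[OF c] by linarith
            then have "norm (integral (?B c) (F c q) /\<^sub>R ?n - F c q (T c y)) < e / K" using d(2)[OF c] h by blast
            moreover have "F c q (T c y) < e / K" using q(2) by (simp add: F_def T_T[OF c])
            ultimately have "integral (?B c) (F c q) / ?n \<le> 2 * (e / K)" by (simp add: divide_inverse mult.commute)
            then show ?thesis using n by (simp add: pos_divide_le_eq)
          qed
          finally show "(\<integral>t. indicator (?B c) (T c t) * \<bar>f t - q\<bar> \<partial>lebesgue) \<le> (2 * (e / K)) * ?n" .
        qed
        have cover: "indicator ?Q t * \<bar>f t - q\<bar> \<le> (\<Sum>c\<in>C. indicator (?B c) (T c t) * \<bar>f t - q\<bar>)" for t
        proof (cases "t \<in> ?Q")
          case True
          \<comment> \<open>The signs of the orthant in which \<open>t\<close> lies as seen from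
            \<open>y\<close>.\<close>
          define c where "c = (\<lambda>j\<in>Basis. if t \<bullet> j \<ge> y \<bullet> j then 1 else -1 :: real)"
          have c: "c \<in> C" unfolding C_def c_def by auto
          have "T c t \<in> ?B c"
            unfolding mem_box
          proof (intro ballI)
            fix i :: 'a assume i: "i \<in> Basis"
            have "y \<bullet> i - h \<le> t \<bullet> i \<and> t \<bullet> i \<le> y \<bullet> i + h"
              using True i by (auto simp: mem_box inner_simps)
            then show "T c y \<bullet> i \<le> T c t \<bullet> i \<and> T c t \<bullet> i \<le> (T c y + h *\<^sub>R One) \<bullet> i"
              using i by (auto simp: inner_add_left T_inner c_def)
          qed
          then have "\<bar>f t - q\<bar> = indicator (?B c) (T c t) * \<bar>f t - q\<bar>" by simp
          also have "\<dots> \<le> (\<Sum>c\<in>C. indicator (?B c) (T c t) * \<bar>f t - q\<bar>)"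
            by (rule member_le_sum[OF c _ finC]) simp
          finally show ?thesis using True by simp
        qed (simp add: sum_nonneg)
        have s1: "set_integrable lebesgue ?Q (\<lambda>t. \<bar>f t - q\<bar>)" by (rule si[OF f])
        have s2: "set_integrable lebesgue ?Q (\<lambda>t. \<bar>q - f y\<bar>)"
          using lmeasurable_cbox[of "y - h *\<^sub>R One" "y + h *\<^sub>R One"] by (simp add: set_integrable_def lmeasurable_iff_integrable)
        have "(LINT t:?Q|lebesgue. \<bar>f t - q\<bar>) \<le> (\<integral>t. (\<Sum>c\<in>C. indicator (?B c) (T c t) * \<bar>f t - q\<bar>) \<partial>lebesgue)"
          unfolding set_lebesgue_integral_def
          by (rule integral_mono) (use cover s1 ind_int in \<open>auto simp: set_integrable_def\<close>)
        also have "\<dots> = (\<Sum>c\<in>C. \<integral>t. indicator (?B c) (T c t) * \<bar>f t - q\<bar> \<partial>lebesgue)"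
          by (rule Bochner_Integration.integral_sum[OF ind_int])
        also have "\<dots> \<le> (\<Sum>c\<in>C. (2 * (e / K)) * ?n)" by (rule sum_mono[OF quad])
        finally have 1: "(LINT t:?Q|lebesgue. \<bar>f t - q\<bar>) \<le> real (card C) * ((2 * (e / K)) * ?n)" by simp
        have mQ: "measure lebesgue ?Q = (2 * h) ^ DIM('a)"
          using h by (subst measure_completion) (auto simp: measure_lborel_cbox_eq inner_simps)
        have 2: "(LINT t:?Q|lebesgue. \<bar>q - f y\<bar>) \<le> (2 * h) ^ DIM('a) * (e / K)"
        proof -
          have "(2 * h) ^ DIM('a) * \<bar>q - f y\<bar> \<le> (2 * h) ^ DIM('a) * (e / K)"
            using q(2) h by (intro mult_left_mono) (auto simp: abs_minus_commute)
          then show ?thesis using mQ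
            by (simp add: set_lebesgue_integral_def)
        qed
        have "(LINT t:?Q|lebesgue. \<bar>f t - f y\<bar>) \<le> (LINT t:?Q|lebesgue. \<bar>f t - q\<bar> + \<bar>q - f y\<bar>)"
          by (rule set_integral_mono[OF si[OF f] set_integral_add(1)[OF s1 s2]]) auto
        also have "\<dots> = (LINT t:?Q|lebesgue. \<bar>f t - q\<bar>) + (LINT t:?Q|lebesgue. \<bar>q - f y\<bar>)"
          by (rule set_integral_add(2)[OF s1 s2])
        also have "\<dots> \<le> real (card C) * ((2 * (e / K)) * ?n) + (2 * h) ^ DIM('a) * (e / K)" using 1 2 by linarith
        also have "\<dots> = K * (e / K) * ?n"
        proof -
          have "real (card C) * ((2 * s) * ?n) + (2 * h) ^ DIM('a) * s = K * s * ?n" for s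
            unfolding K_def by (simp add: algebra_simps power_mult_distrib)
          then show ?thesis .
        qed
        also have "\<dots> = e * ?n" using K by simp
        finally show "(LINT t:?Q|lebesgue. \<bar>f t - f y\<bar>) \<le> e * ?n" .
      qed
    qed
  qed
qed

section \<open>Convolution and mollification\<close>

lemma norm_lebesgue_integral_le:
  fixes f :: "'a \<Rightarrow> 'b::{banach, second_countable_topology}"
  assumes "integrable M f" "integrable M g" "\<And>x. norm (f x) \<le> g x"
  shows "norm (\<integral>x. f x \<partial>M) \<le> (\<integral>x. g x \<partial>M)"
  using assms by (intro order_trans[OF integral_norm_bound integral_mono]) auto

lemma test_fun_grad_lipschitz:
  assumes "test_fun \<Omega> f"
  obtains C where "C \<ge> 0" "\<And>x y. norm (cgrad f x - cgrad f y) \<le> C * norm (x - y)"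
proof -
  have "\<exists>C. C \<ge> 0 \<and> (\<forall>x y. norm (cgrad f x $ i - cgrad f y $ i) \<le> C * norm (x - y))" for i
  proof -
    obtain C where C: "C \<ge> 0" "\<And>x. norm (cgrad (\<lambda>x. cgrad f x $ i) x) \<le> C"
      using test_fun_bounded[OF test_fun_pd[OF assms, of i]] by metis
    show ?thesis using C(1) test_fun_lipschitz[OF test_fun_pd[OF assms] C(2)] by blast
  qed
  then obtain C where C: "\<And>i. C i \<ge> 0" "\<And>i x y. norm (cgrad f x $ i - cgrad f y $ i) \<le> C i * norm (x - y)"
    by metis
  show ?thesis
  proof (rule that[of "\<Sum>i\<in>UNIV. C i"])
    show "0 \<le> (\<Sum>i\<in>UNIV. C i)" by (intro sum_nonneg C)
    fix x y
    have "norm (cgrad f x - cgrad f y) \<le> (\<Sum>i\<in>UNIV. \<bar>(cgrad f x - cgrad f y) $ i\<bar>)" by (rule norm_le_l1_cart)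
    also have "\<dots> \<le> (\<Sum>i\<in>UNIV. C i * norm (x - y))" by (intro sum_mono) (use C(2) in auto)
    finally show "norm (cgrad f x - cgrad f y) \<le> (\<Sum>i\<in>UNIV. C i) * norm (x - y)" by (simp add: sum_distrib_right)
  qed
qed

lemma test_fun_taylor:
  assumes phi: "test_fun \<Omega> f" and C: "\<And>x y. norm (cgrad f x - cgrad f y) \<le> C * norm (x - y)" "C \<ge> 0"
  shows "norm (f y - f x - cgrad f x \<bullet> (y - x)) \<le> C * (norm (y - x))\<^sup>2"
proof -
  have "norm (f y - f x - cgrad f x \<bullet> (y - x)) \<le> norm (y - x) * (C * norm (y - x))"
  proof (rule differentiable_bound_linearization[where S="cball x (norm (y - x))" and f'="\<lambda>x h. cgrad f x \<bullet> h"])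
    fix t :: real assume t: "t \<in> {0..1}"
    then show "x + t *\<^sub>R (y - x) \<in> cball x (norm (y - x))"
      by (auto simp: dist_norm intro!: mult_left_le_one_le)
  next
    fix z show "(f has_derivative (\<lambda>h. cgrad f z \<bullet> h)) (at z within cball x (norm (y - x)))"
      by (rule has_derivative_at_withinI[OF test_fun_grad(1)[OF phi]])
  next
    fix z assume z: "z \<in> cball x (norm (y - x))"
    have "onorm (\<lambda>h. cgrad f z \<bullet> h - cgrad f x \<bullet> h) \<le> C * norm (y - x)"
    proof (rule onorm_bound)
      fix h
      have "norm (cgrad f z \<bullet> h - cgrad f x \<bullet> h) \<le> norm (cgrad f z - cgrad f x) * norm h"
        unfolding inner_diff_left[symmetric] real_norm_def by (rule Cauchy_Schwarz_ineq2)
      also have "\<dots> \<le> (C * norm (z - x)) * norm h" by (intro mult_right_mono C) auto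
      also have "\<dots> \<le> (C * norm (y - x)) * norm h" 
        using z C(2) by (intro mult_right_mono mult_left_mono) (auto simp: dist_norm norm_minus_commute)
      finally show "norm (cgrad f z \<bullet> h - cgrad f x \<bullet> h) \<le> C * norm (y - x) * norm h" .
    qed (use C in simp)
    then show "onorm ((\<lambda>h. cgrad f z \<bullet> h) - (\<lambda>h. cgrad f x \<bullet> h)) \<le> C * norm (y - x)" by (simp add: fun_diff_def)
  qed auto
  then show ?thesis by (simp add: power2_eq_square mult_ac)
qed

text \<open>The first-order Taylor remainder of \<open>\<rho>\<close> is quadratic uniformly in the
  base point, so integrated against \<open>v\<close> it stays quadratic and the convolution is
  differentiated directly.\<close>

lemma conv_has_derivative:
  assumes vc: "continuous_on UNIV v" and v0: "\<And>x. x \<notin> cball 0 R \<Longrightarrow> v x = (0::real)"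
    and rho: "test_fun \<Omega> \<rho>"
  shows "((\<lambda>x. \<integral>t. v t * \<rho> (x - t) \<partial>lborel) has_derivative
     (\<lambda>h. (\<integral>t. v t *\<^sub>R cgrad \<rho> (x - t) \<partial>lborel) \<bullet> h)) (at x)"
    "integrable lborel (\<lambda>t. v t *\<^sub>R cgrad \<rho> (x - t))"
proof -
  note rc = test_fun_grad[OF rho]
  obtain C where C: "C \<ge> 0" "\<And>x y. norm (cgrad \<rho> x - cgrad \<rho> y) \<le> C * norm (x - y)"
    using test_fun_grad_lipschitz[OF rho] by metis
  have rc2: "continuous_on UNIV (\<lambda>t. \<rho> (x - t))" "continuous_on UNIV (\<lambda>t. cgrad \<rho> (x - t))" for x
    by (rule continuous_on_compose2[OF rc(2)] continuous_on_compose2[OF rc(3)]; auto intro!: continuous_intros)+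
  have i1: "integrable lborel (\<lambda>t. v t * \<rho> (x - t))" for x
    by (rule integrable_compact_support[where R=R]) (use v0 in \<open>auto intro!: continuous_intros vc rc2\<close>)
  show i2: "integrable lborel (\<lambda>t. v t *\<^sub>R cgrad \<rho> (x - t))" for x
    by (rule integrable_compact_support[where R=R]) (use v0 in \<open>auto intro!: continuous_intros vc rc2\<close>)
  have iv: "integrable lborel (\<lambda>t. norm (v t))"
    using integrable_compact_support[OF vc v0] by simp
  let ?F = "\<lambda>x. \<integral>t. v t * \<rho> (x - t) \<partial>lborel" and ?G = "\<lambda>x. \<integral>t. v t *\<^sub>R cgrad \<rho> (x - t) \<partial>lborel"
  let ?V = "\<integral>t. norm (v t) \<partial>lborel"
  have est: "norm (?F y - ?F x - ?G x \<bullet> (y - x)) \<le> (?V * C) * (norm (y - x))\<^sup>2" for y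
  proof -
    have i3: "integrable lborel (\<lambda>t. (v t *\<^sub>R cgrad \<rho> (x - t)) \<bullet> (y - x))"
      by (rule integrable_inner_left) (rule i2)
    have eq: "?G x \<bullet> (y - x) = (\<integral>t. (v t *\<^sub>R cgrad \<rho> (x - t)) \<bullet> (y - x) \<partial>lborel)"
      by (rule integral_inner_left[symmetric]) (rule i2)
    have "?F y - ?F x - ?G x \<bullet> (y - x) =
      (\<integral>t. v t * \<rho> (y - t) - v t * \<rho> (x - t) - (v t *\<^sub>R cgrad \<rho> (x - t)) \<bullet> (y - x) \<partial>lborel)"
      unfolding eq using i1 i3 by simp
    also have "norm \<dots> \<le> (\<integral>t. norm (v t) * (C * (norm (y - x))\<^sup>2) \<partial>lborel)"
    proof (rule norm_lebesgue_integral_le)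
      show "integrable lborel (\<lambda>t. v t * \<rho> (y - t) - v t * \<rho> (x - t) - (v t *\<^sub>R cgrad \<rho> (x - t)) \<bullet> (y - x))"
        using i1 i3 by simp
      show "integrable lborel (\<lambda>t. norm (v t) * (C * (norm (y - x))\<^sup>2))" using iv by simp
      fix t
      have "v t * \<rho> (y - t) - v t * \<rho> (x - t) - (v t *\<^sub>R cgrad \<rho> (x - t)) \<bullet> (y - x)
        = v t * (\<rho> (y - t) - \<rho> (x - t) - cgrad \<rho> (x - t) \<bullet> ((y - t) - (x - t)))" by (simp add: algebra_simps)
      then show "norm (v t * \<rho> (y - t) - v t * \<rho> (x - t) - (v t *\<^sub>R cgrad \<rho> (x - t)) \<bullet> (y - x)) \<le> norm (v t) * (C * (norm (y - x))\<^sup>2)"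
        using test_fun_taylor[OF rho C(2,1), of "y - t" "x - t"] by (simp add: abs_mult mult_left_mono)
    qed
    also have "\<dots> = (?V * C) * (norm (y - x))\<^sup>2" by simp
    finally show ?thesis .
  qed
  show "(?F has_derivative (\<lambda>h. ?G x \<bullet> h)) (at x)"
  proof (rule has_derivativeI_sandwich[of 1])
    show "bounded_linear (\<lambda>h. ?G x \<bullet> h)" by (rule bounded_linear_inner_right)
    show "((\<lambda>y. (?V * C) * norm (y - x)) \<longlongrightarrow> 0) (at x)"
      by (auto intro!: tendsto_eq_intros)
    fix y assume "y \<noteq> x"
    then have "norm (y - x) > 0" by simp
    then show "norm (?F y - ?F x - ?G x \<bullet> (y - x)) / norm (y - x) \<le> (?V * C) * norm (y - x)"
      using est[of y] by (simp add: pos_divide_le_eq power2_eq_square mult.assoc)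
  qed auto
qed

text \<open>All derivatives fall on the kernel, whose partial derivatives are again test functions;
  hence the induction on \<open>k\<close> with the kernel arbitrary.\<close>

lemma smooth_conv:
  assumes vc: "continuous_on UNIV v" and v0: "\<And>x. x \<notin> cball 0 R \<Longrightarrow> v x = (0::real)"
    and rho: "test_fun \<Omega> \<rho>"
  shows "smooth_fun (\<lambda>x. \<integral>t. v t * \<rho> (x - t) \<partial>lborel)"
proof -
  have "Ck k (\<lambda>x. \<integral>t. v t * \<rho> (x - t) \<partial>lborel)" if "test_fun \<Omega> \<rho>" for k \<rho>
    using that
  proof (induction k arbitrary: \<rho>)
    case 0
    note d = conv_has_derivative(1)[OF vc v0 0]
    have "continuous_on UNIV (\<lambda>x. \<integral>t. v t * \<rho> (x - t) \<partial>lborel)"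
      by (intro continuous_at_imp_continuous_on ballI has_derivative_continuous[OF d])
    then show ?case by simp
  next
    case (Suc k)
    show ?case
    proof (rule Ck_SucI[OF conv_has_derivative(1)[OF vc v0 Suc.prems]])
      fix i
      have "(\<integral>t. v t *\<^sub>R cgrad \<rho> (x - t) \<partial>lborel) \<bullet> axis i 1 = (\<integral>t. v t * (cgrad \<rho> (x - t) $ i) \<partial>lborel)" for x
        by (subst integral_inner_left[symmetric]) (auto intro: conv_has_derivative(2)[OF vc v0 Suc.prems] simp: inner_axis)
      then show "Ck k (\<lambda>x. (\<integral>t. v t *\<^sub>R cgrad \<rho> (x - t) \<partial>lborel) \<bullet> axis i 1)"
        using Suc.IH[OF test_fun_pd[OF Suc.prems, of i]] by simp
    qed
  qed
  then show ?thesis using rho unfolding smooth_fun_def by blast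
qed

definition mol :: "real \<Rightarrow> R2 \<Rightarrow> real" where
  "mol \<epsilon> z = box_bump 1 (vec (-\<epsilon>)) (vec \<epsilon>) z / (\<integral>z. box_bump 1 (vec (-\<epsilon>)) (vec \<epsilon>) z \<partial>lborel)"

lemma test_fun_UNIV_box_bump: "test_fun UNIV (box_bump 1 l u)"
  by (rule test_fun_box_bump) auto

lemma integrable_box_bump: "integrable lborel (box_bump 1 l u)"
proof -
  obtain R where R: "R > 0" "\<And>x. x \<notin> cball 0 R \<Longrightarrow> box_bump 1 l u x = 0"
    using test_fun_bounded_support[OF test_fun_UNIV_box_bump] by metis
  show ?thesis by (rule integrable_compact_support[OF test_fun_grad(2)[OF test_fun_UNIV_box_bump] R(2)])
qed

lemma box_bump_integral_pos:
  assumes "\<epsilon> > 0" shows "(\<integral>z. box_bump 1 (vec (-\<epsilon>)) (vec \<epsilon>) z \<partial>lborel) > 0"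
proof (rule ccontr)
  let ?b = "box_bump 1 (vec (-\<epsilon>)) (vec \<epsilon>)"
  let ?B = "box (vec (-\<epsilon>)) (vec \<epsilon> :: R2)"
  assume "\<not> ?thesis"
  moreover have "(\<integral>z. ?b z \<partial>lborel) \<ge> 0" by (simp add: box_bump_nonneg)
  ultimately have "(\<integral>z. ?b z \<partial>lborel) = 0" by linarith
  then have "AE z in lborel. ?b z = 0"
    by (subst (asm) integral_nonneg_eq_0_iff_AE[OF integrable_box_bump]) (auto simp: box_bump_nonneg)
  then have "AE z in lborel. z \<notin> ?B"
  proof eventually_elim
    case (elim z) then show ?case using box_bump_pos[of 1 z "vec (-\<epsilon>)" "vec \<epsilon>"] by force
  qed
  then have "?B \<in> null_sets lborel" by (subst AE_iff_null_sets) auto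
  then have "negligible ?B" by (simp add: negligible_iff_null_sets null_sets_completionI)
  then have "?B = {}" by (simp only: negligible_interval)
  moreover have "0 \<in> ?B" using assms by (simp add: mem_box_cart)
  ultimately show False by blast
qed

lemma mol_nonneg: "\<epsilon> > 0 \<Longrightarrow> mol \<epsilon> z \<ge> 0"
  using box_bump_integral_pos[of \<epsilon>] by (simp add: mol_def box_bump_nonneg)

lemma mol_even: "mol \<epsilon> (x - t) = mol \<epsilon> (t - x)"
  by (simp add: mol_def box_bump_def algebra_simps)

lemma mol_support:
  assumes "\<epsilon> > 0" "mol \<epsilon> z \<noteq> 0" shows "norm z < 2 * \<epsilon>"
proof -
  have "z \<in> box (vec (-\<epsilon>)) (vec \<epsilon>)"
    using box_bump_zero[of 1 z "vec (-\<epsilon>)" "vec \<epsilon>"] assms(2) by (auto simp: mol_def)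
  then have "\<bar>z $ 1\<bar> < \<epsilon>" "\<bar>z $ 2\<bar> < \<epsilon>" by (auto simp: mem_box_cart forall_2)
  then show ?thesis using norm_le_l1_cart[of z] by (simp add: sum_2)
qed

lemma test_fun_mol: "test_fun UNIV (mol \<epsilon>)"
  using test_fun_lincomb[OF test_fun_UNIV_box_bump test_fun_UNIV_box_bump, 
     of "1 / (\<integral>z. box_bump 1 (vec (-\<epsilon>)) (vec \<epsilon>) z \<partial>lborel)" "vec (-\<epsilon>)" "vec \<epsilon>" 0]
  by (simp add: mol_def[abs_def])

lemma test_fun_mol_reflect: "test_fun UNIV (\<lambda>t. mol \<epsilon> (x - t))"
proof -
  have "box_bump 1 (vec (-\<epsilon>)) (vec \<epsilon>) (x - t) = box_bump 1 (x - vec \<epsilon>) (x + vec \<epsilon>) t" for t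
    by (simp add: box_bump_def algebra_simps)
  then show ?thesis
    using test_fun_lincomb[OF test_fun_UNIV_box_bump test_fun_UNIV_box_bump, 
     of "1 / (\<integral>z. box_bump 1 (vec (-\<epsilon>)) (vec \<epsilon>) z \<partial>lborel)" "x - vec \<epsilon>" "x + vec \<epsilon>" 0]
    by (simp add: mol_def[abs_def])
qed

lemma mol_integral:
  assumes "\<epsilon> > 0"
  shows "integrable lborel (\<lambda>t. mol \<epsilon> (x - t))" "(\<integral>t. mol \<epsilon> (x - t) \<partial>lborel) = 1"
proof -
  have i: "integrable lborel (mol \<epsilon>)" unfolding mol_def[abs_def] by (intro integrable_divide integrable_box_bump)
  have e: "mol \<epsilon> (x - t) = mol \<epsilon> (- x + t)" for t by (subst mol_even) simp
  show "integrable lborel (\<lambda>t. mol \<epsilon> (x - t))" unfolding e by (rule lborel_integrable_translate[OF i])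
  have "(\<integral>t. mol \<epsilon> (x - t) \<partial>lborel) = (\<integral>t. mol \<epsilon> t \<partial>lborel)"
    unfolding e using i by (intro lborel_integral_translate) auto
  also have "\<dots> = 1" using box_bump_integral_pos[OF assms] by (simp add: mol_def)
  finally show "(\<integral>t. mol \<epsilon> (x - t) \<partial>lborel) = 1" .
qed

lemma mol_average_le:
  assumes e: "\<epsilon> > 0" and k: "k \<in> borel_measurable borel" and b: "\<And>t. norm (x - t) < 2 * \<epsilon> \<Longrightarrow> \<bar>k t\<bar> \<le> B"
  shows "integrable lborel (\<lambda>t. mol \<epsilon> (x - t) * k t)" "\<bar>\<integral>t. mol \<epsilon> (x - t) * k t \<partial>lborel\<bar> \<le> B"
proof -
  note i = mol_integral[OF e, of x]
  have iB: "integrable lborel (\<lambda>t. mol \<epsilon> (x - t) * B)" using i(1) by simp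
  have bd: "norm (mol \<epsilon> (x - t) * k t) \<le> mol \<epsilon> (x - t) * B" for t
  proof (cases "mol \<epsilon> (x - t) = 0")
    case False
    from b[OF mol_support[OF e this]] show ?thesis using mol_nonneg[OF e] by (simp add: abs_mult mult_left_mono)
  qed simp
  have [measurable]: "(\<lambda>t. mol \<epsilon> (x - t)) \<in> borel_measurable borel" using i(1) by auto
  note k[measurable]
  show i2: "integrable lborel (\<lambda>t. mol \<epsilon> (x - t) * k t)"
  proof (rule Bochner_Integration.integrable_bound[OF iB])
    show "AE t in lborel. norm (mol \<epsilon> (x - t) * k t) \<le> norm (mol \<epsilon> (x - t) * B)"
      using order_trans[OF bd abs_ge_self] by auto
  qed measurable
  have "norm (\<integral>t. mol \<epsilon> (x - t) * k t \<partial>lborel) \<le> (\<integral>t. mol \<epsilon> (x - t) * B \<partial>lborel)"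
    by (rule norm_lebesgue_integral_le[OF i2 iB bd])
  then show "\<bar>\<integral>t. mol \<epsilon> (x - t) * k t \<partial>lborel\<bar> \<le> B" using i(2) by simp
qed

lemma norm_le_if_inner_le:
  fixes v :: "'a::real_inner"
  assumes "\<And>h. \<bar>v \<bullet> h\<bar> \<le> B * norm h" "B \<ge> 0" shows "norm v \<le> B"
proof (cases "v = 0")
  case True then show ?thesis using assms(2) by simp
next
  case False
  have "norm v * norm v \<le> B * norm v" using assms(1)[of v] by (simp add: dot_square_norm power2_eq_square)
  then show ?thesis using False by simp
qed

text \<open>This admits Lipschitz functions as limits of test functions. The gradients of the
  mollified functions are averages of \<open>g\<close>, whence the uniform bound and the convergence
  at continuity points of \<open>g\<close>; the margin \<open>e0\<close> keeps the enlarged supports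
  inside the domain.\<close>

lemma mollification:
  assumes lip: "\<And>x y. norm (v x - v y) \<le> L * norm (x - y)"
    and M: "\<And>x. \<bar>v x\<bar> \<le> M"
    and der: "AE x in lborel. (v has_derivative (\<lambda>h. g x \<bullet> h)) (at x)"
    and g: "g \<in> borel_measurable borel" and B: "\<And>x. norm (g x) \<le> B"
    and v0: "\<And>x. x \<notin> cball x0 d \<Longrightarrow> v x = 0" and e0: "e0 > 0" "cball x0 (d + e0) \<subseteq> \<Omega>"
  obtains \<phi> where "\<And>n. test_fun \<Omega> (\<phi> n)" "\<And>n x. norm (cgrad (\<phi> n) x) \<le> B"
     "\<And>x. isCont g x \<Longrightarrow> (\<lambda>n. cgrad (\<phi> n) x) \<longlonglongrightarrow> g x"
proof -
  have vc: "continuous_on UNIV v" by (rule lipschitz_continuous[OF lip])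
  have v00: "v x = 0" if "x \<notin> cball 0 (norm x0 + d)" for x
  proof (rule v0, rule notI)
    assume "x \<in> cball x0 d"
    then have "norm x \<le> norm x0 + d" using norm_triangle_ineq2[of x x0] by (simp add: dist_norm norm_minus_commute)
    then show False using that by simp
  qed
  have B0: "B \<ge> 0" using B[of 0] norm_ge_zero[of "g 0"] by linarith
  \<comment> \<open>The kernel reaches up to \<open>2 * \<epsilon>\<close> in the Euclidean norm,
    which is bounded by the sum of the two coordinates; the spread thus stays within
    \<open>e0\<close>.\<close>
  define \<epsilon> where "\<epsilon> n = e0 / 2 * inverse (real (Suc n))" for n
  have e: "\<epsilon> n > 0" "2 * \<epsilon> n \<le> e0" for n
  proof -
    show "\<epsilon> n > 0" using e0(1) by (simp add: \<epsilon>_def del: of_nat_Suc)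
    have "e0 * inverse (real (Suc n)) \<le> e0 * 1" using e0(1) by (intro mult_left_mono) (auto simp: inverse_le_1_iff)
    then show "2 * \<epsilon> n \<le> e0" by (simp add: \<epsilon>_def)
  qed
  have e_lim: "\<epsilon> \<longlonglongrightarrow> 0"
    using tendsto_mult_left[OF LIMSEQ_inverse_real_of_nat, of "e0/2"] by (simp add: \<epsilon>_def[abs_def])
  define \<phi> where "\<phi> n x = (\<integral>t. v t * mol (\<epsilon> n) (x - t) \<partial>lborel)" for n x
  have t: "test_fun \<Omega> (\<phi> n)" for n
  proof -
    have "\<phi> n x = 0" if "x \<notin> cball x0 (d + e0)" for x
    proof -
      have "v t * mol (\<epsilon> n) (x - t) = 0" for t
      proof (rule ccontr)
        assume "\<not> ?thesis"
        then have "v t \<noteq> 0" "mol (\<epsilon> n) (x - t) \<noteq> 0" by auto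
        then have "t \<in> cball x0 d" "norm (x - t) < 2 * \<epsilon> n" using v0 mol_support[OF e(1)] by blast+
        then have "dist x0 x \<le> d + e0" using dist_triangle[of x0 x t] e(2)[of n] by (simp add: dist_norm norm_minus_commute)
        then show False using that by simp
      qed
      then show ?thesis unfolding \<phi>_def by (simp only: Bochner_Integration.integral_zero)
    qed
    then have "{x. \<phi> n x \<noteq> 0} \<subseteq> cball x0 (d + e0)" by blast
    then have sub: "closure {x. \<phi> n x \<noteq> 0} \<subseteq> cball x0 (d + e0)" by (rule closure_minimal[OF _ closed_cball])
    show ?thesis unfolding test_fun_def
    proof (intro conjI)
      show "smooth_fun (\<phi> n)" unfolding \<phi>_def[abs_def] by (rule smooth_conv[OF vc v00 test_fun_mol])
      show "compact (closure {x. \<phi> n x \<noteq> 0})"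
        unfolding compact_eq_bounded_closed using bounded_subset[OF bounded_cball sub] by simp
      show "closure {x. \<phi> n x \<noteq> 0} \<subseteq> \<Omega>" using sub e0(2) by (rule subset_trans)
    qed
  qed
  \<comment> \<open>Integration by parts in \<open>t\<close> moves the derivative from the kernel to
    \<open>v\<close>; the reflection \<open>x - t\<close> in the kernel supplies the compensating
    sign.\<close>
  have grad: "cgrad (\<phi> n) x \<bullet> h = (\<integral>t. mol (\<epsilon> n) (x - t) * (g t \<bullet> h) \<partial>lborel)" for n x h
  proof -
    note d = conv_has_derivative[OF vc v00 test_fun_mol[of "\<epsilon> n"], where x=x]
    have c: "cgrad (\<lambda>t. mol (\<epsilon> n) (x - t)) t = - cgrad (mol (\<epsilon> n)) (x - t)" for t
    proof (rule cgrad_unique)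
      have "((\<lambda>t. x - t) has_derivative (\<lambda>h. - h)) (at t)" by (auto intro!: derivative_eq_intros)
      from has_derivative_compose[OF this test_fun_grad(1)[OF test_fun_mol]]
      show "((\<lambda>t. mol (\<epsilon> n) (x - t)) has_derivative (\<lambda>h. - cgrad (mol (\<epsilon> n)) (x - t) \<bullet> h)) (at t)" by simp
    qed
    have "cgrad (\<phi> n) x \<bullet> h = (\<integral>t. v t *\<^sub>R cgrad (mol (\<epsilon> n)) (x - t) \<partial>lborel) \<bullet> h"
      unfolding \<phi>_def[abs_def] by (rule arg_cong[where f="\<lambda>z. z \<bullet> h"], rule cgrad_unique, rule d(1))
    also have "\<dots> = (\<integral>t. (v t *\<^sub>R cgrad (mol (\<epsilon> n)) (x - t)) \<bullet> h \<partial>lborel)"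
      by (rule integral_inner_left[symmetric]) (rule d(2))
    also have "\<dots> = - (\<integral>t. v t * (cgrad (\<lambda>t. mol (\<epsilon> n) (x - t)) t \<bullet> h) \<partial>lborel)"
      unfolding c by simp
    also have "\<dots> = (\<integral>t. mol (\<epsilon> n) (x - t) * (g t \<bullet> h) \<partial>lborel)"
      using lipschitz_ibp(3)[OF lip M der g test_fun_mol_reflect[of "\<epsilon> n" x], of h] by simp
    finally show ?thesis .
  qed
  note g [measurable]
  have bd: "norm (cgrad (\<phi> n) x) \<le> B" for n x
  proof (rule norm_le_if_inner_le)
    fix h
    show "\<bar>cgrad (\<phi> n) x \<bullet> h\<bar> \<le> B * norm h"
      unfolding grad
    proof (rule mol_average_le(2)[OF e(1)])
      show "\<bar>g t \<bullet> h\<bar> \<le> B * norm h" for t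
        by (rule order_trans[OF Cauchy_Schwarz_ineq2]) (intro mult_right_mono B, simp)
    qed measurable
  qed (rule B0)
  have lim: "(\<lambda>n. cgrad (\<phi> n) x) \<longlonglongrightarrow> g x" if gc: "isCont g x" for x
  proof (rule LIMSEQ_I)
    fix r :: real assume r: "r > 0"
    obtain s where s: "s > 0" "\<And>t. dist t x < s \<Longrightarrow> dist (g t) (g x) < r/2"
      using gc half_gt_zero[OF r] unfolding continuous_at_eps_delta by blast
    from LIMSEQ_D[OF e_lim, of "s/2"] s(1) obtain n0 where n0: "\<And>n. n \<ge> n0 \<Longrightarrow> norm (\<epsilon> n - 0) < s/2" by auto
    have "norm (cgrad (\<phi> n) x - g x) \<le> r/2" if n: "n \<ge> n0" for n
    proof (rule norm_le_if_inner_le)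
      fix h
      have gi: "integrable lborel (\<lambda>t. mol (\<epsilon> n) (x - t) * (g t \<bullet> h))"
      proof (rule mol_average_le(1)[OF e(1)])
        show "\<bar>g t \<bullet> h\<bar> \<le> B * norm h" for t
          by (rule order_trans[OF Cauchy_Schwarz_ineq2]) (intro mult_right_mono B, simp)
      qed measurable
      have "(cgrad (\<phi> n) x - g x) \<bullet> h = (\<integral>t. mol (\<epsilon> n) (x - t) * (g t \<bullet> h) \<partial>lborel) - (\<integral>t. mol (\<epsilon> n) (x - t) * (g x \<bullet> h) \<partial>lborel)"
        by (simp add: inner_diff_left grad mol_integral(2)[OF e(1)])
      also have "\<dots> = (\<integral>t. mol (\<epsilon> n) (x - t) * ((g t - g x) \<bullet> h) \<partial>lborel)"
        using gi mol_integral(1)[OF e(1), of n x] by (simp add: inner_diff_left right_diff_distrib)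
      also have "\<bar>\<dots>\<bar> \<le> r/2 * norm h"
      proof (rule mol_average_le(2)[OF e(1)])
        fix t assume "norm (x - t) < 2 * \<epsilon> n"
        then have "dist t x < s" using n0[OF n] by (simp add: dist_norm norm_minus_commute abs_less_iff)
        then have "norm (g t - g x) \<le> r/2" using s(2)[of t] by (simp add: dist_norm)
        then show "\<bar>(g t - g x) \<bullet> h\<bar> \<le> r/2 * norm h"
          by (intro order_trans[OF Cauchy_Schwarz_ineq2] mult_right_mono) auto
      qed measurable
      finally show "\<bar>(cgrad (\<phi> n) x - g x) \<bullet> h\<bar> \<le> r/2 * norm h" .
    qed (use r in simp)
    moreover have "r/2 < r" using r by simp
    ultimately show "\<exists>no. \<forall>n\<ge>no. norm (cgrad (\<phi> n) x - g x) < r"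
      by (intro exI[of _ n0] allI impI) (rule le_less_trans)
  qed
  show ?thesis by (rule that[OF t bd lim])
qed

lemma LIMSEQ_null_le:
  fixes s q :: "nat \<Rightarrow> real"
  assumes "\<And>n. \<bar>s n\<bar> \<le> q n" "q \<longlonglongrightarrow> 0" shows "s \<longlonglongrightarrow> 0"
proof (rule Lim_null_comparison)
  show "\<forall>\<^sub>F n in sequentially. norm (s n) \<le> q n" using assms(1) by simp
qed fact

section \<open>Weak solutions on a bounded domain\<close>

locale bounded_open =
  fixes \<Omega> :: "R2 set"
  assumes open_Omega: "open \<Omega>" and bounded_Omega: "bounded \<Omega>"
begin

abbreviation M :: "R2 measure" where "M \<equiv> lebesgue_on \<Omega>"

lemma Omega_sets [simp]: "\<Omega> \<in> sets lebesgue" "\<Omega> \<in> sets borel" "\<Omega> \<inter> space lebesgue \<in> sets lebesgue"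
  using open_Omega by auto

lemma Omega_lmeasurable: "\<Omega> \<in> lmeasurable"
  by (rule bounded_set_imp_lmeasurable[OF bounded_Omega Omega_sets(1)])

lemma finite_M: "finite_measure M"
  by (rule finite_measure_lebesgue_on[OF Omega_lmeasurable])

lemma AE_M: "(AE x in M. P x) \<longleftrightarrow> (AE x in lebesgue. x \<in> \<Omega> \<longrightarrow> P x)"
  by (rule AE_restrict_space_iff) simp

lemma set_integral_M:
  fixes f :: "R2 \<Rightarrow> 'b::{banach, second_countable_topology}"
  shows "(LINT x:\<Omega>|lebesgue. f x) = (\<integral>x. f x \<partial>M)"
  unfolding set_lebesgue_integral_def integral_restrict_space[OF Omega_sets(3)] ..

lemma set_integrable_M:
  fixes f :: "R2 \<Rightarrow> 'b::{banach, second_countable_topology}"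
  shows "set_integrable lebesgue \<Omega> f \<longleftrightarrow> integrable M f"
  unfolding set_integrable_def integrable_restrict_space[OF Omega_sets(3)] ..

lemma set_measurable_M:
  fixes f :: "R2 \<Rightarrow> 'b::{banach, second_countable_topology}"
  shows "set_borel_measurable lebesgue \<Omega> f \<longleftrightarrow> f \<in> borel_measurable M"
  unfolding set_borel_measurable_def borel_measurable_restrict_space_iff[OF Omega_sets(3)] ..

lemma L2_on_iff: "L2_on \<Omega> u \<longleftrightarrow> sqint M u"
  by (simp add: L2_on_def sqint_def set_integrable_M set_measurable_M)

lemma L2v_on_iff: "L2v_on \<Omega> g \<longleftrightarrow> sqint M g"
  by (simp add: L2v_on_def sqint_def set_integrable_M set_measurable_M)

lemma borel_imp_M: "f \<in> borel_measurable borel \<Longrightarrow> f \<in> borel_measurable M"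
  by (intro measurable_restrict_space1 measurable_completion) simp

lemma integral_M_lborel:
  fixes f :: "R2 \<Rightarrow> 'b::{banach, second_countable_topology}"
  assumes "f \<in> borel_measurable borel" "\<And>x. x \<notin> \<Omega> \<Longrightarrow> f x = 0"
  shows "(\<integral>x. f x \<partial>M) = (\<integral>x. f x \<partial>lborel)"
proof -
  have "(\<integral>x. f x \<partial>M) = (\<integral>x. indicator \<Omega> x *\<^sub>R f x \<partial>lebesgue)"
    by (rule integral_restrict_space[OF Omega_sets(3)])
  also have "(\<lambda>x. indicator \<Omega> x *\<^sub>R f x) = f" using assms(2) by (auto simp: indicator_def fun_eq_iff)
  also have "(\<integral>x. f x \<partial>lebesgue) = (\<integral>x. f x \<partial>lborel)" by (rule integral_completion) (use assms(1) in simp)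
  finally show ?thesis .
qed

lemma test_meas:
  assumes "test_fun A f" shows "f \<in> borel_measurable M" "cgrad f \<in> borel_measurable M"
  by (intro borel_imp_M borel_measurable_continuous_UNIV test_fun_grad[OF assms])+

lemma test_sqint:
  assumes "test_fun A f" shows "sqint M f" "sqint M (cgrad f)"
proof -
  obtain C where C: "C \<ge> 0" "\<And>x. \<bar>f x\<bar> \<le> C" "\<And>x. norm (cgrad f x) \<le> C" using test_fun_bounded[OF assms] by metis
  show "sqint M f" "sqint M (cgrad f)"
    by (rule sqint_bounded_finite[OF finite_M, where C=C]; use test_meas[OF assms] C in auto)+
qed

lemma test_ibp:
  assumes "test_fun \<Omega> f" "test_fun \<Omega> \<psi>"
  shows "(\<integral>x. f x * cgrad \<psi> x $ i \<partial>M) = - (\<integral>x. cgrad f x $ i * \<psi> x \<partial>M)"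
proof -
  obtain C where C: "C \<ge> 0" "\<And>x. \<bar>f x\<bar> \<le> C" "\<And>x. norm (cgrad f x) \<le> C" using test_fun_bounded[OF assms(1)] by metis
  note gf = test_fun_grad[OF assms(1)] and gp = test_fun_grad[OF assms(2)]
  note m [measurable] = gf(2,3)[THEN borel_measurable_continuous_UNIV] gp(2,3)[THEN borel_measurable_continuous_UNIV]
  have "(\<integral>x. f x * (cgrad \<psi> x \<bullet> axis i 1) \<partial>lborel) = - (\<integral>x. \<psi> x * (cgrad f x \<bullet> axis i 1) \<partial>lborel)"
    by (rule lipschitz_ibp(3)[OF test_fun_lipschitz[OF assms(1) C(3)] C(2) _ m(2) assms(2)]) (use gf(1) in auto)
  also have "(\<integral>x. f x * (cgrad \<psi> x \<bullet> axis i 1) \<partial>lborel) = (\<integral>x. f x * (cgrad \<psi> x \<bullet> axis i 1) \<partial>M)"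
    by (rule integral_M_lborel[symmetric]) (use test_fun_vanish_outside[OF assms(1)] in auto)
  also have "(\<integral>x. \<psi> x * (cgrad f x \<bullet> axis i 1) \<partial>lborel) = (\<integral>x. \<psi> x * (cgrad f x \<bullet> axis i 1) \<partial>M)"
    by (rule integral_M_lborel[symmetric]) (use test_fun_vanish_outside[OF assms(1)] in auto)
  finally show ?thesis by (simp add: inner_axis mult.commute)
qed

text \<open>Carrying the gradient as a second component avoids \<open>wgrad\<close>, which a
  \<open>SOME\<close> fixes only up to null sets. The two L2 limits are kept apart, in place of the
  single integral in \<open>H10\<close>, so that each can be fed into an estimate on its
  own.\<close>

definition H1pair :: "(R2 \<Rightarrow> real) \<Rightarrow> (R2 \<Rightarrow> R2) \<Rightarrow> bool" where
  "H1pair u g \<longleftrightarrow> sqint M u \<and> sqint M g \<and> (\<exists>\<phi>. (\<forall>n. test_fun \<Omega> (\<phi> n)) \<and>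
     (\<lambda>n. n2 M (\<lambda>x. u x - \<phi> n x)) \<longlonglongrightarrow> 0 \<and> (\<lambda>n. n2 M (\<lambda>x. g x - cgrad (\<phi> n) x)) \<longlonglongrightarrow> 0)"

lemma H1pair_sqint: "H1pair u g \<Longrightarrow> sqint M u" "H1pair u g \<Longrightarrow> sqint M g"
  unfolding H1pair_def by auto

lemma H1pair_approx:
  assumes "H1pair u g"
  shows "\<exists>\<phi>. (\<forall>n. test_fun \<Omega> (\<phi> n)) \<and> (\<lambda>n. n2 M (\<lambda>x. u x - \<phi> n x)) \<longlonglongrightarrow> 0 \<and>
    (\<lambda>n. n2 M (\<lambda>x. g x - cgrad (\<phi> n) x)) \<longlonglongrightarrow> 0"
  using assms unfolding H1pair_def by auto

lemma H1pair_test: assumes "test_fun \<Omega> f" shows "H1pair f (cgrad f)"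
  unfolding H1pair_def
  by (intro conjI test_sqint[OF assms] exI[of _ "\<lambda>n. f"]) (use assms in \<open>auto simp: n2_def\<close>)

lemma H1pair_weak_grad:
  assumes "H1pair u g" shows "weak_grad \<Omega> u g"
  unfolding weak_grad_def set_integral_M
proof (intro allI impI)
  fix \<psi> i assume psi: "test_fun \<Omega> \<psi>"
  obtain \<phi> where phi: "\<And>n. test_fun \<Omega> (\<phi> n)" "(\<lambda>n. n2 M (\<lambda>x. u x - \<phi> n x)) \<longlonglongrightarrow> 0"
    "(\<lambda>n. n2 M (\<lambda>x. g x - cgrad (\<phi> n) x)) \<longlonglongrightarrow> 0" using H1pair_approx[OF assms] by blast
  have c: "sqint M (\<lambda>x. cgrad \<psi> x $ i)" by (rule test_sqint(1)[OF test_fun_pd[OF psi]])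
  have v: "sqint M (\<lambda>x. \<psi> x *\<^sub>R axis i (1::real) :: R2)"
    by (rule sqint_bound[OF test_sqint(1)[OF psi], where C=1]) (use test_meas[OF psi] in auto)
  have "(\<lambda>n. \<integral>x. 1 * (\<phi> n x \<bullet> cgrad \<psi> x $ i) \<partial>M) \<longlonglongrightarrow> (\<integral>x. 1 * (u x \<bullet> cgrad \<psi> x $ i) \<partial>M)"
    by (rule tendsto_L2_weighted[OF test_sqint(1)[OF phi(1)] H1pair_sqint(1)[OF assms] phi(2) c, where C=1]) auto
  then have 1: "(\<lambda>n. \<integral>x. \<phi> n x * cgrad \<psi> x $ i \<partial>M) \<longlonglongrightarrow> (\<integral>x. u x * cgrad \<psi> x $ i \<partial>M)" by simp
  have "(\<lambda>n. \<integral>x. 1 * (cgrad (\<phi> n) x \<bullet> (\<psi> x *\<^sub>R axis i 1)) \<partial>M) \<longlonglongrightarrow> (\<integral>x. 1 * (g x \<bullet> (\<psi> x *\<^sub>R axis i 1)) \<partial>M)"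
    by (rule tendsto_L2_weighted[OF test_sqint(2)[OF phi(1)] H1pair_sqint(2)[OF assms] phi(3) v, where C=1]) auto
  then have "(\<lambda>n. - (\<integral>x. cgrad (\<phi> n) x $ i * \<psi> x \<partial>M)) \<longlonglongrightarrow> - (\<integral>x. g x $ i * \<psi> x \<partial>M)"
    by (intro tendsto_minus) (simp add: inner_axis mult.commute)
  with 1 show "(\<integral>x. u x * cgrad \<psi> x $ i \<partial>M) = - (\<integral>x. g x $ i * \<psi> x \<partial>M)"
    unfolding test_ibp[OF phi(1) psi] by (rule LIMSEQ_unique)
qed

text \<open>Bumps steepening to the indicator of a box show that \<open>f\<close> has integral zero
  over open boxes whose closed box lies in the domain; at a Lebesgue point the averages over
  shrinking centred squares recover the value of \<open>f\<close>.\<close>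

lemma fundamental_lemma:
  fixes f :: "R2 \<Rightarrow> real"
  assumes f: "integrable M f" and z: "\<And>\<phi>. test_fun \<Omega> \<phi> \<Longrightarrow> (\<integral>x. f x * \<phi> x \<partial>M) = 0"
  shows "AE x in M. f x = 0"
proof -
  define f0 where "f0 x = indicator \<Omega> x *\<^sub>R f x" for x
  have f0: "integrable lebesgue f0" unfolding f0_def using f unfolding integrable_restrict_space[OF Omega_sets(3)] .
  have box0: "(\<integral>x. indicator (box l u) x * f x \<partial>M) = 0" if lu: "cbox l u \<subseteq> \<Omega>" for l u
  proof -
    note t = test_fun_box_bump[OF _ lu]
    have "(\<lambda>n. \<integral>x. f x * box_bump (real (Suc n)) l u x \<partial>M) \<longlonglongrightarrow> (\<integral>x. indicator (box l u) x * f x \<partial>M)"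
    proof (rule integral_dominated_convergence)
      show "integrable M (\<lambda>x. norm (f x))" using f by simp
      have [measurable]: "f \<in> borel_measurable M" using f by auto
      have [measurable]: "box_bump (real (Suc n)) l u \<in> borel_measurable M" for n
        by (rule test_meas(1)[OF t]) simp
      have [measurable]: "indicat_real (box l u) \<in> borel_measurable M" by (rule borel_imp_M) simp
      show "(\<lambda>x. indicator (box l u) x * f x) \<in> borel_measurable M" by measurable
      show "(\<lambda>x. f x * box_bump (real (Suc n)) l u x) \<in> borel_measurable M" for n by measurable
      show "AE x in M. (\<lambda>n. f x * box_bump (real (Suc n)) l u x) \<longlonglongrightarrow> indicator (box l u) x * f x"
        by (rule AE_I2) (subst mult.commute, intro tendsto_mult box_bump_tendsto tendsto_const)
      show "AE x in M. norm (f x * box_bump (real (Suc n)) l u x) \<le> norm (f x)" for n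
        by (rule AE_I2) (auto simp: abs_mult box_bump_nonneg box_bump_le1 mult_left_le)
    qed
    moreover have "(\<integral>x. f x * box_bump (real (Suc n)) l u x \<partial>M) = 0" for n by (rule z[OF t]) simp
    ultimately show ?thesis by (simp add: LIMSEQ_const_iff)
  qed
  have "AE y in lebesgue. y \<in> \<Omega> \<longrightarrow> f y = 0"
    using AE_lebesgue_point[OF f0]
  proof eventually_elim
    case (elim y)
    show ?case
    proof
      assume y: "y \<in> \<Omega>"
      obtain r where r: "r > 0" "ball y r \<subseteq> \<Omega>" using open_Omega y by (meson openE)
      have "\<bar>f y\<bar> \<le> 0 + e" if e: "e > 0" for e
      proof -
        obtain d where d: "d > 0" "\<And>h. 0 < h \<Longrightarrow> h < d \<Longrightarrow>
           (LINT t:cbox (y - h *\<^sub>R One) (y + h *\<^sub>R One)|lebesgue. \<bar>f0 t - f0 y\<bar>) \<le> e * h ^ DIM(R2)"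
          using elim e unfolding lebesgue_point_def by blast
        \<comment> \<open>Halving gives \<open>h < d\<close> strictly; \<open>2 * h < r\<close> puts
          the square into the ball, since the norm is at most the sum of two coordinates.\<close>
        define h where "h = min d (r/2) / 2"
        have h: "0 < h" "h < d" "2 * h < r" using d(1) r(1) unfolding h_def by auto
        let ?l = "y - h *\<^sub>R One" and ?u = "y + h *\<^sub>R One"
        have sub: "cbox ?l ?u \<subseteq> \<Omega>"
        proof (rule subset_trans[OF _ r(2)], rule subsetI)
          fix t assume t: "t \<in> cbox ?l ?u"
          have "norm (y - t) \<le> (\<Sum>b\<in>Basis. \<bar>(y - t) \<bullet> b\<bar>)" by (rule norm_le_l1)
          also have "\<dots> \<le> (\<Sum>b\<in>(Basis::R2 set). h)"
          proof (rule sum_mono)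
            fix b :: R2 assume b: "b \<in> Basis"
            have "(y - h *\<^sub>R One) \<bullet> b \<le> t \<bullet> b \<and> t \<bullet> b \<le> (y + h *\<^sub>R One) \<bullet> b" using t b by (auto simp: mem_box)
            then show "\<bar>(y - t) \<bullet> b\<bar> \<le> h" using b by (auto simp: inner_simps)
          qed
          also have "\<dots> = 2 * h" by simp
          finally show "t \<in> ball y r" using h(3) by (simp add: dist_norm)
        qed
        have q: "measure lebesgue (cbox ?l ?u) = (2 * h)\<^sup>2"
        proof -
          have b: "(?u - ?l) \<bullet> b = 2 * h" "?l \<bullet> b \<le> ?u \<bullet> b" if "b \<in> Basis" for b
            unfolding inner_diff_left inner_add_left inner_scaleR_left using that h(1) by simp_all
          have "measure lebesgue (cbox ?l ?u) = (\<Prod>b\<in>Basis. (?u - ?l) \<bullet> b)"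
            using b(2) by (subst measure_completion) (auto simp: measure_lborel_cbox_eq)
          also have "\<dots> = (\<Prod>b\<in>(Basis :: R2 set). 2 * h)" by (rule prod.cong[OF refl b(1)])
          finally show ?thesis by simp
        qed
        have si: "set_integrable lebesgue (cbox ?l ?u) f0"
          unfolding set_integrable_def by (rule integrable_mult_indicator[OF _ f0]) simp
        have sc: "set_integrable lebesgue (cbox ?l ?u) (\<lambda>t. f0 y)"
          using lmeasurable_cbox[of ?l ?u] by (simp add: set_integrable_def lmeasurable_iff_integrable)
        have "(LINT t:cbox ?l ?u|lebesgue. f0 t) = (\<integral>t. indicator (box ?l ?u) t * f0 t \<partial>lebesgue)"
          unfolding set_lebesgue_integral_def
        proof (rule integral_cong_AE)
          show "(\<lambda>x. indicat_real (cbox ?l ?u) x *\<^sub>R f0 x) \<in> borel_measurable lebesgue" using si by (auto simp: set_integrable_def)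
          show "(\<lambda>x. indicat_real (box ?l ?u) x * f0 x) \<in> borel_measurable lebesgue"
            using f0 by (intro borel_measurable_times borel_measurable_indicator) auto
          have "cbox ?l ?u - box ?l ?u \<in> null_sets lebesgue"
            using negligible_frontier_interval[of ?l ?u] by (simp add: negligible_iff_null_sets)
          from AE_not_in[OF this] show "AE x in lebesgue. indicat_real (cbox ?l ?u) x *\<^sub>R f0 x = indicat_real (box ?l ?u) x * f0 x"
          proof eventually_elim
            case (elim x)
            then show ?case using box_subset_cbox[of ?l ?u] by (auto simp: indicator_def)
          qed
        qed
        also have "\<dots> = (\<integral>x. indicator (box ?l ?u) x * f x \<partial>M)"
          unfolding integral_restrict_space[OF Omega_sets(3)] by (simp add: f0_def mult.left_commute)
        also have "\<dots> = 0" by (rule box0[OF sub])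
        finally have eq: "(2 * h)\<^sup>2 * f0 y = - (LINT t:cbox ?l ?u|lebesgue. f0 t - f0 y)"
          using set_integral_diff(2)[OF si sc] q by (simp add: set_lebesgue_integral_def)
        have "(2 * h)\<^sup>2 * \<bar>f0 y\<bar> = \<bar>(2 * h)\<^sup>2 * f0 y\<bar>" unfolding abs_mult abs_power2 ..
        also have "\<dots> = \<bar>LINT t:cbox ?l ?u|lebesgue. f0 t - f0 y\<bar>" unfolding eq abs_minus_cancel ..
        also have "\<dots> \<le> (LINT t:cbox ?l ?u|lebesgue. \<bar>f0 t - f0 y\<bar>)"
          unfolding set_lebesgue_integral_def
          by (rule order_trans[OF integral_abs_bound]) (simp add: abs_mult)
        also have "\<dots> \<le> e * h\<^sup>2" using d(2)[OF h(1,2)] by simp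
        finally have "4 * \<bar>f0 y\<bar> \<le> e" using h(1) by (simp add: power2_eq_square)
        then show ?thesis using y e by (simp add: f0_def)
      qed
      then have "\<bar>f y\<bar> \<le> 0" by (rule field_le_epsilon)
      then show "f y = 0" by simp
    qed
  qed
  then show ?thesis by (simp add: AE_M)
qed

lemma weak_grad_unique:
  assumes "weak_grad \<Omega> u g" "weak_grad \<Omega> u g'" "sqint M g" "sqint M g'"
  shows "AE x in M. g x = g' x"
proof -
  have i: "sqint M (\<lambda>x. g x $ i)" if "sqint M g" for i and g :: "R2 \<Rightarrow> R2"
  proof (rule sqint_bound[OF that, where C=1])
    have "(\<lambda>x. g x \<bullet> axis i 1) \<in> borel_measurable M"
      using sqint_meas[OF that] by (intro borel_measurable_inner) auto
    then show "(\<lambda>x. g x $ i) \<in> borel_measurable M" by (simp add: inner_axis)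
    show "AE x in M. norm (g x $ i) \<le> 1 * norm (g x)"
      by (rule AE_I2) (simp add: component_le_norm_cart)
  qed
  have "AE x in M. g x $ i - g' x $ i = 0" for i
  proof (rule fundamental_lemma)
    have s: "sqint M (\<lambda>x. g x $ i - g' x $ i)" by (intro sqint_diff i assms)
    show "integrable M (\<lambda>x. g x $ i - g' x $ i)" by (rule sqint_imp_integrable(1)[OF finite_M s])
    fix \<phi> assume phi: "test_fun \<Omega> \<phi>"
    have "(\<integral>x. u x * cgrad \<phi> x $ i \<partial>M) = - (\<integral>x. g x $ i * \<phi> x \<partial>M)"
      using assms(1) phi unfolding weak_grad_def set_integral_M by blast
    moreover have "(\<integral>x. u x * cgrad \<phi> x $ i \<partial>M) = - (\<integral>x. g' x $ i * \<phi> x \<partial>M)"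
      using assms(2) phi unfolding weak_grad_def set_integral_M by blast
    ultimately have "(\<integral>x. g x $ i * \<phi> x \<partial>M) = (\<integral>x. g' x $ i * \<phi> x \<partial>M)" by linarith
    then show "(\<integral>x. (g x $ i - g' x $ i) * \<phi> x \<partial>M) = 0"
      using sqint_mult[OF i[OF assms(3)] test_sqint(1)[OF phi]] sqint_mult[OF i[OF assms(4)] test_sqint(1)[OF phi]]
      by (simp add: left_diff_distrib)
  qed
  then have "AE x in M. \<forall>i\<in>UNIV. g x $ i - g' x $ i = 0" by (subst AE_finite_all) auto
  then show ?thesis by eventually_elim (simp add: vec_eq_iff)
qed

lemma H1pair_cong:
  assumes "H1pair u g" "g' \<in> borel_measurable M" "AE x in M. g' x = g x"
  shows "H1pair u g'"
proof -
  obtain \<phi> where phi: "\<And>n. test_fun \<Omega> (\<phi> n)" "(\<lambda>n. n2 M (\<lambda>x. u x - \<phi> n x)) \<longlonglongrightarrow> 0"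
    "(\<lambda>n. n2 M (\<lambda>x. g x - cgrad (\<phi> n) x)) \<longlonglongrightarrow> 0" using H1pair_approx[OF assms(1)] by blast
  have [measurable]: "g \<in> borel_measurable M" "g' \<in> borel_measurable M" "cgrad (\<phi> n) \<in> borel_measurable M" for n
    using assms sqint_meas[OF H1pair_sqint(2)[OF assms(1)]] test_meas[OF phi(1)] by auto
  have "n2 M (\<lambda>x. g' x - cgrad (\<phi> n) x) = n2 M (\<lambda>x. g x - cgrad (\<phi> n) x)" for n
    by (rule n2_cong_AE) (use assms(3) in auto)
  then show ?thesis unfolding H1pair_def
    using phi sqint_cong_AE[OF H1pair_sqint(2)[OF assms(1)] assms(2,3)] H1pair_sqint(1)[OF assms(1)]
    by (intro conjI exI[of _ \<phi>]) auto
qed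

text \<open>The gradient in \<open>H10\<close> and the one picked by \<open>wgrad\<close> may be
  different functions; both are weak gradients, hence equal almost everywhere, and the approximation
  transfers.\<close>

lemma H10_imp_H1pair: assumes "H10 \<Omega> u" shows "H1pair u (wgrad \<Omega> u)"
proof -
  obtain g \<phi> where g: "sqint M u" "weak_grad \<Omega> u g" "sqint M g" "\<And>n. test_fun \<Omega> (\<phi> n)"
    "(\<lambda>n. \<integral>x. (u x - \<phi> n x)\<^sup>2 + (norm (g x - cgrad (\<phi> n) x))\<^sup>2 \<partial>M) \<longlonglongrightarrow> 0"
    using assms unfolding H10_def L2_on_iff L2v_on_iff set_integral_M by blast
  have s: "sqint M (\<lambda>x. u x - \<phi> n x)" "sqint M (\<lambda>x. g x - cgrad (\<phi> n) x)" for n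
    by (intro sqint_diff g test_sqint[OF g(4)])+
  have eq: "(\<integral>x. (u x - \<phi> n x)\<^sup>2 + (norm (g x - cgrad (\<phi> n) x))\<^sup>2 \<partial>M) = (n2 M (\<lambda>x. u x - \<phi> n x))\<^sup>2 + (n2 M (\<lambda>x. g x - cgrad (\<phi> n) x))\<^sup>2" for n
    unfolding n2_sq using sqint_integrable[OF s(1)] sqint_integrable[OF s(2)] by simp
  have sq0: "s \<longlonglongrightarrow> 0" if "\<And>n. (s n)\<^sup>2 \<le> q n" "q \<longlonglongrightarrow> 0" for s q :: "nat \<Rightarrow> real"
  proof -
    have "(\<lambda>n. sqrt (q n)) \<longlonglongrightarrow> sqrt 0" by (rule tendsto_real_sqrt[OF that(2)])
    then have q0: "(\<lambda>n. sqrt (q n)) \<longlonglongrightarrow> 0" by simp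
    have "\<bar>s n\<bar> \<le> sqrt (q n)" for n using real_sqrt_le_mono[OF that(1)[of n]] by simp
    then show ?thesis using q0 by (rule LIMSEQ_null_le)
  qed
  have l: "(\<lambda>n. n2 M (\<lambda>x. u x - \<phi> n x)) \<longlonglongrightarrow> 0" "(\<lambda>n. n2 M (\<lambda>x. g x - cgrad (\<phi> n) x)) \<longlonglongrightarrow> 0"
    by (rule sq0[OF _ g(5)]; simp add: eq)+
  then have p: "H1pair u g" unfolding H1pair_def using g by blast
  have w: "weak_grad \<Omega> u (wgrad \<Omega> u) \<and> L2v_on \<Omega> (wgrad \<Omega> u)"
    unfolding wgrad_def by (rule someI[of _ g]) (use g in \<open>simp add: L2v_on_iff\<close>)
  then have w': "sqint M (wgrad \<Omega> u)" by (simp add: L2v_on_iff)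
  show ?thesis
    by (rule H1pair_cong[OF p sqint_meas[OF w'] weak_grad_unique[OF _ g(2) w' g(3)]]) (use w in simp)
qed

lemma H1pair_imp_H10: 
  assumes "H1pair u g" shows "H10 \<Omega> u" "AE x in M. wgrad \<Omega> u x = g x"
proof -
  obtain \<phi> where phi: "\<And>n. test_fun \<Omega> (\<phi> n)" "(\<lambda>n. n2 M (\<lambda>x. u x - \<phi> n x)) \<longlonglongrightarrow> 0"
    "(\<lambda>n. n2 M (\<lambda>x. g x - cgrad (\<phi> n) x)) \<longlonglongrightarrow> 0" using H1pair_approx[OF assms(1)] by blast
  note sq = H1pair_sqint[OF assms]
  have s: "sqint M (\<lambda>x. u x - \<phi> n x)" "sqint M (\<lambda>x. g x - cgrad (\<phi> n) x)" for n
    by (intro sqint_diff sq test_sqint[OF phi(1)])+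
  have eq: "(\<integral>x. (u x - \<phi> n x)\<^sup>2 + (norm (g x - cgrad (\<phi> n) x))\<^sup>2 \<partial>M) = (n2 M (\<lambda>x. u x - \<phi> n x))\<^sup>2 + (n2 M (\<lambda>x. g x - cgrad (\<phi> n) x))\<^sup>2" for n
    unfolding n2_sq using sqint_integrable[OF s(1)] sqint_integrable[OF s(2)] by simp
  have "(\<lambda>n. (n2 M (\<lambda>x. u x - \<phi> n x))\<^sup>2 + (n2 M (\<lambda>x. g x - cgrad (\<phi> n) x))\<^sup>2) \<longlonglongrightarrow> 0\<^sup>2 + 0\<^sup>2"
    by (intro tendsto_intros phi)
  then have "(\<lambda>n. \<integral>x. (u x - \<phi> n x)\<^sup>2 + (norm (g x - cgrad (\<phi> n) x))\<^sup>2 \<partial>M) \<longlonglongrightarrow> 0" by (simp add: eq)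
  then show H: "H10 \<Omega> u"
    unfolding H10_def L2_on_iff L2v_on_iff set_integral_M using sq H1pair_weak_grad[OF assms] phi(1) by blast
  note p = H10_imp_H1pair[OF H]
  show "AE x in M. wgrad \<Omega> u x = g x"
    by (rule weak_grad_unique[OF H1pair_weak_grad[OF p] H1pair_weak_grad[OF assms] H1pair_sqint(2)[OF p] sq(2)])
qed

lemma H1pair_lincomb:
  assumes "H1pair u g" "H1pair v k"
  shows "H1pair (\<lambda>x. s * u x + t * v x) (\<lambda>x. s *\<^sub>R g x + t *\<^sub>R k x)"
proof -
  obtain \<phi> where phi: "\<And>n. test_fun \<Omega> (\<phi> n)" "(\<lambda>n. n2 M (\<lambda>x. u x - \<phi> n x)) \<longlonglongrightarrow> 0"
    "(\<lambda>n. n2 M (\<lambda>x. g x - cgrad (\<phi> n) x)) \<longlonglongrightarrow> 0" using H1pair_approx[OF assms(1)] by blast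
  obtain \<psi> where psi: "\<And>n. test_fun \<Omega> (\<psi> n)" "(\<lambda>n. n2 M (\<lambda>x. v x - \<psi> n x)) \<longlonglongrightarrow> 0"
    "(\<lambda>n. n2 M (\<lambda>x. k x - cgrad (\<psi> n) x)) \<longlonglongrightarrow> 0" using H1pair_approx[OF assms(2)] by blast
  note sq = H1pair_sqint[OF assms(1)] H1pair_sqint[OF assms(2)]
  have gen: "(\<lambda>n. n2 M (\<lambda>x. (s *\<^sub>R a x + t *\<^sub>R b x) - (s *\<^sub>R a' n x + t *\<^sub>R b' n x))) \<longlonglongrightarrow> 0"
    if "\<And>n. sqint M (\<lambda>x. a x - a' n x)" "\<And>n. sqint M (\<lambda>x. b x - b' n x)"
     "(\<lambda>n. n2 M (\<lambda>x. a x - a' n x)) \<longlonglongrightarrow> 0" "(\<lambda>n. n2 M (\<lambda>x. b x - b' n x)) \<longlonglongrightarrow> 0"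
    for a b :: "R2 \<Rightarrow> 'b::euclidean_space" and a' b' :: "nat \<Rightarrow> R2 \<Rightarrow> 'b"
  proof -
    have l: "(\<lambda>n. \<bar>s\<bar> * n2 M (\<lambda>x. a x - a' n x) + \<bar>t\<bar> * n2 M (\<lambda>x. b x - b' n x)) \<longlonglongrightarrow> 0"
      using tendsto_add[OF tendsto_mult_left[OF that(3), of "\<bar>s\<bar>"] tendsto_mult_left[OF that(4), of "\<bar>t\<bar>"]] by simp
    have "n2 M (\<lambda>x. (s *\<^sub>R a x + t *\<^sub>R b x) - (s *\<^sub>R a' n x + t *\<^sub>R b' n x)) \<le> \<bar>s\<bar> * n2 M (\<lambda>x. a x - a' n x) + \<bar>t\<bar> * n2 M (\<lambda>x. b x - b' n x)" for n
    proof -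
      have "n2 M (\<lambda>x. (s *\<^sub>R a x + t *\<^sub>R b x) - (s *\<^sub>R a' n x + t *\<^sub>R b' n x)) = n2 M (\<lambda>x. s *\<^sub>R (a x - a' n x) + t *\<^sub>R (b x - b' n x))"
        by (simp add: algebra_simps)
      also have "\<dots> \<le> n2 M (\<lambda>x. s *\<^sub>R (a x - a' n x)) + n2 M (\<lambda>x. t *\<^sub>R (b x - b' n x))"
        by (intro n2_triangle sqint_scaleR that)
      finally show ?thesis unfolding n2_scaleR .
    qed
    then have "\<bar>n2 M (\<lambda>x. (s *\<^sub>R a x + t *\<^sub>R b x) - (s *\<^sub>R a' n x + t *\<^sub>R b' n x))\<bar> \<le> \<bar>s\<bar> * n2 M (\<lambda>x. a x - a' n x) + \<bar>t\<bar> * n2 M (\<lambda>x. b x - b' n x)" for n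
      by simp
    then show ?thesis using l by (rule LIMSEQ_null_le)
  qed
  show ?thesis unfolding H1pair_def
  proof (intro conjI exI[of _ "\<lambda>n x. s * \<phi> n x + t * \<psi> n x"] allI)
    show "sqint M (\<lambda>x. s * u x + t * v x)" by (intro sqint_add sqint_cmult sq)
    show "sqint M (\<lambda>x. s *\<^sub>R g x + t *\<^sub>R k x)" by (intro sqint_add sqint_scaleR sq)
    show "test_fun \<Omega> (\<lambda>x. s * \<phi> n x + t * \<psi> n x)" for n by (rule test_fun_lincomb[OF phi(1) psi(1)])
    show "(\<lambda>n. n2 M (\<lambda>x. s * u x + t * v x - (s * \<phi> n x + t * \<psi> n x))) \<longlonglongrightarrow> 0"
      using gen[OF sqint_diff[OF sq(1) test_sqint(1)[OF phi(1)]] sqint_diff[OF sq(3) test_sqint(1)[OF psi(1)]] phi(2) psi(2)] by simp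
    show "(\<lambda>n. n2 M (\<lambda>x. s *\<^sub>R g x + t *\<^sub>R k x - cgrad (\<lambda>x. s * \<phi> n x + t * \<psi> n x) x)) \<longlonglongrightarrow> 0"
      unfolding cgrad_lincomb[OF phi(1) psi(1)]
      by (rule gen[OF sqint_diff[OF sq(2) test_sqint(2)[OF phi(1)]] sqint_diff[OF sq(4) test_sqint(2)[OF psi(1)]] phi(3) psi(3)])
  qed
qed

end

section \<open>The Poincare inequality\<close>

context bounded_open
begin

lemma n2_M_lborel:
  fixes f :: "R2 \<Rightarrow> 'b::euclidean_space"
  assumes "f \<in> borel_measurable borel" "\<And>x. x \<notin> \<Omega> \<Longrightarrow> f x = 0"
  shows "(n2 M f)\<^sup>2 = (\<integral>x. (norm (f x))\<^sup>2 \<partial>lborel)"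
  unfolding n2_sq by (rule integral_M_lborel) (use assms in auto)

lemma test_borel:
  assumes "test_fun A f" shows "f \<in> borel_measurable borel" "cgrad f \<in> borel_measurable borel"
  by (intro borel_measurable_continuous_UNIV test_fun_grad[OF assms])+

lemma translation_estimate_n2:
  assumes "test_fun \<Omega> \<phi>"
  shows "(\<integral>x. (\<phi> (x + h) - \<phi> x)\<^sup>2 \<partial>lborel) \<le> (norm h)\<^sup>2 * (n2 M (cgrad \<phi>))\<^sup>2"
proof -
  have "(n2 M (cgrad \<phi>))\<^sup>2 = (\<integral>x. (norm (cgrad \<phi> x))\<^sup>2 \<partial>lborel)"
    by (rule n2_M_lborel[OF test_borel(2)[OF assms]]) (rule test_fun_vanish_outside(2)[OF assms])
  then show ?thesis using translation_estimate(3)[OF assms, of h] by simp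
qed

text \<open>Translating by more than the diameter of the domain moves the support off itself.\<close>

lemma poincare_test:
  obtains P where "P > 0" "\<And>\<phi>. test_fun \<Omega> \<phi> \<Longrightarrow> n2 M \<phi> \<le> P * n2 M (cgrad \<phi>)"
proof -
  obtain R where R: "R > 0" "\<Omega> \<subseteq> cball 0 R" using bounded_subset_cball_origin[OF bounded_Omega] by blast
  define h :: R2 where "h = (3 * R) *\<^sub>R axis 1 1"
  have h: "norm h = 3 * R" using R(1) by (simp add: h_def norm_axis_1)
  have "n2 M \<phi> \<le> 3 * R * n2 M (cgrad \<phi>)" if t: "test_fun \<Omega> \<phi>" for \<phi>
  proof -
    note m [measurable] = test_borel[OF t]
    have le: "(\<phi> x)\<^sup>2 \<le> (\<phi> (x + h) - \<phi> x)\<^sup>2" for x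
    proof (cases "x \<in> \<Omega>")
      case True
      have "norm x \<le> R" using True R(2) by auto
      moreover have "norm h \<le> norm (x + h) + norm x" using norm_triangle_ineq4[of "x + h" x] by simp
      ultimately have "norm (x + h) > R" using h R(1) by linarith
      then have "x + h \<notin> \<Omega>" using R(2) by auto
      then show ?thesis using test_fun_vanish_outside(1)[OF t] by simp
    qed (simp add: test_fun_vanish_outside(1)[OF t])
    have i: "integrable lborel (\<lambda>x. (\<phi> x)\<^sup>2)"
      by (rule Bochner_Integration.integrable_bound[OF translation_estimate(1)[OF t, of h]]) (use le in auto)
    have "(n2 M \<phi>)\<^sup>2 = (\<integral>x. (norm (\<phi> x))\<^sup>2 \<partial>lborel)"
      by (rule n2_M_lborel[OF m(1)]) (rule test_fun_vanish_outside(1)[OF t])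
    also have "\<dots> \<le> (\<integral>x. (\<phi> (x + h) - \<phi> x)\<^sup>2 \<partial>lborel)"
      by (rule integral_mono) (use i translation_estimate(1)[OF t] le in auto)
    also have "\<dots> \<le> (3 * R)\<^sup>2 * (n2 M (cgrad \<phi>))\<^sup>2" using translation_estimate_n2[OF t, of h] h by simp
    finally have "(n2 M \<phi>)\<^sup>2 \<le> (3 * R * n2 M (cgrad \<phi>))\<^sup>2" by (simp add: power_mult_distrib)
    then show ?thesis by (rule power2_le_imp_le) (use R in simp)
  qed
  then show ?thesis using that[of "3 * R"] R(1) by simp
qed

definition poincare_const :: real where
  "poincare_const = (SOME P. P > 0 \<and> (\<forall>\<phi>. test_fun \<Omega> \<phi> \<longrightarrow> n2 M \<phi> \<le> P * n2 M (cgrad \<phi>)))"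

lemma poincare_const: "poincare_const > 0" "test_fun \<Omega> \<phi> \<Longrightarrow> n2 M \<phi> \<le> poincare_const * n2 M (cgrad \<phi>)"
proof -
  have "\<exists>P. P > 0 \<and> (\<forall>\<phi>. test_fun \<Omega> \<phi> \<longrightarrow> n2 M \<phi> \<le> P * n2 M (cgrad \<phi>))" by (rule poincare_test) blast
  from someI_ex[OF this] show "poincare_const > 0" "test_fun \<Omega> \<phi> \<Longrightarrow> n2 M \<phi> \<le> poincare_const * n2 M (cgrad \<phi>)"
    unfolding poincare_const_def by blast+
qed

lemma poincare: assumes "H1pair u g" shows "n2 M u \<le> poincare_const * n2 M g"
proof -
  obtain \<phi> where phi: "\<And>n. test_fun \<Omega> (\<phi> n)" "(\<lambda>n. n2 M (\<lambda>x. u x - \<phi> n x)) \<longlonglongrightarrow> 0"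
    "(\<lambda>n. n2 M (\<lambda>x. g x - cgrad (\<phi> n) x)) \<longlonglongrightarrow> 0" using H1pair_approx[OF assms] by blast
  have "(\<lambda>n. n2 M (\<phi> n)) \<longlonglongrightarrow> n2 M u" by (rule tendsto_n2[OF test_sqint(1)[OF phi(1)] H1pair_sqint(1)[OF assms] phi(2)])
  moreover have "(\<lambda>n. n2 M (cgrad (\<phi> n))) \<longlonglongrightarrow> n2 M g" by (rule tendsto_n2[OF test_sqint(2)[OF phi(1)] H1pair_sqint(2)[OF assms] phi(3)])
  then have "(\<lambda>n. poincare_const * n2 M (cgrad (\<phi> n))) \<longlonglongrightarrow> poincare_const * n2 M g" by (rule tendsto_mult_left)
  ultimately show ?thesis by (rule LIMSEQ_le) (use poincare_const(2)[OF phi(1)] in blast)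
qed

section \<open>Existence and uniqueness of weak solutions\<close>

definition admissible :: "real \<Rightarrow> real \<Rightarrow> (R2 \<Rightarrow> real) \<Rightarrow> bool" where
  "admissible \<alpha> K a \<longleftrightarrow> 0 < \<alpha> \<and> 0 \<le> K \<and> a \<in> borel_measurable M \<and> (AE x in M. \<alpha> \<le> a x \<and> \<bar>a x\<bar> \<le> K)"

definition weak_sol :: "(R2 \<Rightarrow> real) \<Rightarrow> (R2 \<Rightarrow> real) \<Rightarrow> (R2 \<Rightarrow> real) \<Rightarrow> (R2 \<Rightarrow> R2) \<Rightarrow> bool" where
  "weak_sol a f u g \<longleftrightarrow> H1pair u g \<and> (\<forall>v k. H1pair v k \<longrightarrow> (\<integral>x. a x * (g x \<bullet> k x) \<partial>M) = (\<integral>x. f x * v x \<partial>M))"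

lemma admissible_bound:
  assumes "admissible \<alpha> K a"
  shows "a \<in> borel_measurable M" "AE x in M. \<bar>a x\<bar> \<le> K" "0 \<le> K" "0 < \<alpha>" "AE x in M. \<alpha> \<le> a x"
  using assms unfolding admissible_def by auto

lemma coercive:
  assumes a: "admissible \<alpha> K a" and g: "sqint M g"
  shows "\<alpha> * (n2 M g)\<^sup>2 \<le> (\<integral>x. a x * (g x \<bullet> g x) \<partial>M)"
proof -
  have "\<alpha> * (n2 M g)\<^sup>2 = (\<integral>x. \<alpha> * (norm (g x))\<^sup>2 \<partial>M)" by (simp add: n2_sq)
  also have "\<dots> \<le> (\<integral>x. a x * (g x \<bullet> g x) \<partial>M)"
  proof (rule integral_mono_AE)
    show "integrable M (\<lambda>x. \<alpha> * (norm (g x))\<^sup>2)" using sqint_integrable[OF g] by simp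
    show "integrable M (\<lambda>x. a x * (g x \<bullet> g x))" by (rule L2_weighted_bound(1)[OF g g admissible_bound(1,2,3)[OF a]])
    show "AE x in M. \<alpha> * (norm (g x))\<^sup>2 \<le> a x * (g x \<bullet> g x)"
      using admissible_bound(5)[OF a]
      by eventually_elim (auto simp: power2_norm_eq_inner intro: mult_right_mono)
  qed
  finally show ?thesis .
qed

lemma test_fun_zero: "test_fun \<Omega> (\<lambda>x. 0)"
  by (simp add: test_fun_def smooth_const)

lemma sol_test_imp_weak_sol:
  assumes a: "admissible \<alpha> K a" and f: "sqint M f" and u: "H1pair u g"
    and t: "\<And>\<psi>. test_fun \<Omega> \<psi> \<Longrightarrow> (\<integral>x. a x * (g x \<bullet> cgrad \<psi> x) \<partial>M) = (\<integral>x. f x * \<psi> x \<partial>M)"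
  shows "weak_sol a f u g"
  unfolding weak_sol_def
proof (intro conjI u allI impI)
  fix v k assume v: "H1pair v k"
  obtain \<phi> where phi: "\<And>n. test_fun \<Omega> (\<phi> n)" "(\<lambda>n. n2 M (\<lambda>x. v x - \<phi> n x)) \<longlonglongrightarrow> 0"
    "(\<lambda>n. n2 M (\<lambda>x. k x - cgrad (\<phi> n) x)) \<longlonglongrightarrow> 0" using H1pair_approx[OF v] by blast
  have 1: "(\<lambda>n. \<integral>x. a x * (cgrad (\<phi> n) x \<bullet> g x) \<partial>M) \<longlonglongrightarrow> (\<integral>x. a x * (k x \<bullet> g x) \<partial>M)"
    by (rule tendsto_L2_weighted[OF test_sqint(2)[OF phi(1)] H1pair_sqint(2)[OF v] phi(3) H1pair_sqint(2)[OF u] admissible_bound(1,2,3)[OF a]])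
  have "(\<lambda>n. \<integral>x. 1 * (\<phi> n x \<bullet> f x) \<partial>M) \<longlonglongrightarrow> (\<integral>x. 1 * (v x \<bullet> f x) \<partial>M)"
    by (rule tendsto_L2_weighted[OF test_sqint(1)[OF phi(1)] H1pair_sqint(1)[OF v] phi(2) f, where C=1]) auto
  then have 2: "(\<lambda>n. \<integral>x. f x * \<phi> n x \<partial>M) \<longlonglongrightarrow> (\<integral>x. f x * v x \<partial>M)" by (simp add: mult.commute)
  have "(\<integral>x. a x * (cgrad (\<phi> n) x \<bullet> g x) \<partial>M) = (\<integral>x. f x * \<phi> n x \<partial>M)" for n
    using t[OF phi(1)] by (simp add: inner_commute)
  with 1 have "(\<lambda>n. \<integral>x. f x * \<phi> n x \<partial>M) \<longlonglongrightarrow> (\<integral>x. a x * (k x \<bullet> g x) \<partial>M)" by simp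
  from LIMSEQ_unique[OF this 2] show "(\<integral>x. a x * (g x \<bullet> k x) \<partial>M) = (\<integral>x. f x * v x \<partial>M)" by (simp add: inner_commute)
qed

text \<open>Existence by minimising the energy over test functions: by the parallelogram identity a
  minimising sequence is Cauchy in the energy norm.\<close>

lemma weak_sol_exists:
  assumes a: "admissible \<alpha> K a" and f: "sqint M f"
  obtains u g where "weak_sol a f u g"
proof -
  note ab = admissible_bound[OF a]
  define B where "B \<phi> \<psi> = (\<integral>x. a x * (cgrad \<phi> x \<bullet> cgrad \<psi> x) \<partial>M)" for \<phi> \<psi>
  define l where "l \<phi> = (\<integral>x. f x * \<phi> x \<partial>M)" for \<phi>
  define E where "E \<phi> = B \<phi> \<phi> / 2 - l \<phi>" for \<phi>
  have iB: "integrable M (\<lambda>x. a x * (cgrad \<phi> x \<bullet> cgrad \<psi> x))" if "test_fun \<Omega> \<phi>" "test_fun \<Omega> \<psi>" for \<phi> \<psi>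
    by (rule L2_weighted_bound(1)[OF test_sqint(2)[OF that(1)] test_sqint(2)[OF that(2)] ab(1-3)])
  have il: "integrable M (\<lambda>x. f x * \<phi> x)" if "test_fun \<Omega> \<phi>" for \<phi> by (rule sqint_mult[OF f test_sqint(1)[OF that]])
  have quad: "B (\<lambda>x. s * \<phi> x + t * \<psi> x) (\<lambda>x. s * \<phi> x + t * \<psi> x) = s\<^sup>2 * B \<phi> \<phi> + 2 * s * t * B \<phi> \<psi> + t\<^sup>2 * B \<psi> \<psi>"
    "l (\<lambda>x. s * \<phi> x + t * \<psi> x) = s * l \<phi> + t * l \<psi>"
    if p: "test_fun \<Omega> \<phi>" "test_fun \<Omega> \<psi>" for s t \<phi> \<psi>
  proof -
    have "B (\<lambda>x. s * \<phi> x + t * \<psi> x) (\<lambda>x. s * \<phi> x + t * \<psi> x)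
      = (\<integral>x. s\<^sup>2 * (a x * (cgrad \<phi> x \<bullet> cgrad \<phi> x)) + (2 * s * t * (a x * (cgrad \<phi> x \<bullet> cgrad \<psi> x)) + t\<^sup>2 * (a x * (cgrad \<psi> x \<bullet> cgrad \<psi> x))) \<partial>M)"
      unfolding B_def cgrad_lincomb[OF p]
      by (intro Bochner_Integration.integral_cong) (auto simp: inner_simps power2_eq_square algebra_simps inner_commute[of "cgrad \<psi> _" "cgrad \<phi> _"])
    then show "B (\<lambda>x. s * \<phi> x + t * \<psi> x) (\<lambda>x. s * \<phi> x + t * \<psi> x) = s\<^sup>2 * B \<phi> \<phi> + 2 * s * t * B \<phi> \<psi> + t\<^sup>2 * B \<psi> \<psi>"
      using iB[OF p(1,1)] iB[OF p] iB[OF p(2,2)] by (simp add: B_def)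
    have "l (\<lambda>x. s * \<phi> x + t * \<psi> x) = (\<integral>x. s * (f x * \<phi> x) + t * (f x * \<psi> x) \<partial>M)"
      unfolding l_def by (intro Bochner_Integration.integral_cong) (auto simp: algebra_simps)
    then show "l (\<lambda>x. s * \<phi> x + t * \<psi> x) = s * l \<phi> + t * l \<psi>" using il[OF p(1)] il[OF p(2)] by (simp add: l_def)
  qed
  define S where "S = {E \<phi> | \<phi>. test_fun \<Omega> \<phi>}"
  define m where "m = Inf S"
  let ?c = "n2 M f * poincare_const"
  \<comment> \<open>Cauchy-Schwarz and Poincare bound the linear part by \<open>?c\<close> times the
    gradient norm; completing the square against the coercive part produces the constant.\<close>
  have lower: "E \<phi> \<ge> - (?c\<^sup>2) / (2 * \<alpha>)" if p: "test_fun \<Omega> \<phi>" for \<phi>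
  proof -
    let ?n = "n2 M (cgrad \<phi>)"
    have "l \<phi> \<le> n2 M f * n2 M \<phi>" unfolding l_def using L2_mult_bound[OF f test_sqint(1)[OF p]] by linarith
    also have "\<dots> \<le> n2 M f * (poincare_const * ?n)" by (intro mult_left_mono poincare_const(2)[OF p]) simp
    finally have "l \<phi> \<le> ?c * ?n" by simp
    moreover have "\<alpha> * ?n\<^sup>2 \<le> B \<phi> \<phi>" unfolding B_def by (rule coercive[OF a test_sqint(2)[OF p]])
    ultimately have "E \<phi> \<ge> \<alpha> * ?n\<^sup>2 / 2 - ?c * ?n" unfolding E_def by linarith
    moreover have "\<alpha> * ?n\<^sup>2 / 2 - ?c * ?n + ?c\<^sup>2 / (2 * \<alpha>) = (\<alpha> * ?n - ?c)\<^sup>2 / (2 * \<alpha>)"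
      using ab(4) by (simp add: power2_eq_square field_simps)
    moreover have "(\<alpha> * ?n - ?c)\<^sup>2 / (2 * \<alpha>) \<ge> 0" using ab(4) by simp
    ultimately show ?thesis by linarith
  qed
  have bdd: "bdd_below S" unfolding S_def by (rule bdd_belowI[of _ "- (?c\<^sup>2) / (2 * \<alpha>)"]) (use lower in auto)
  have ne: "S \<noteq> {}" unfolding S_def using test_fun_zero by auto
  have m_le: "m \<le> E \<phi>" if "test_fun \<Omega> \<phi>" for \<phi>
    unfolding m_def by (rule cInf_lower[OF _ bdd]) (use that in \<open>auto simp: S_def\<close>)
  define \<epsilon> where "\<epsilon> n = inverse (real (Suc n))" for n
  have e0: "\<epsilon> n > 0" for n by (simp add: \<epsilon>_def)
  have e_lim: "\<epsilon> \<longlonglongrightarrow> 0" unfolding \<epsilon>_def by (rule LIMSEQ_inverse_real_of_nat)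
  have "\<exists>\<phi>. test_fun \<Omega> \<phi> \<and> E \<phi> < m + \<epsilon> n" for n
  proof -
    have "Inf S < m + \<epsilon> n" using e0[of n] by (simp add: m_def)
    from cInf_lessD[OF ne this] show ?thesis unfolding S_def by blast
  qed
  then obtain \<phi> where phi: "\<And>n. test_fun \<Omega> (\<phi> n)" "\<And>n. E (\<phi> n) < m + \<epsilon> n" by metis
  \<comment> \<open>The form at the difference is eight times the gap between the mean energy and
    the energy of the midpoint, and the midpoint cannot fall below the infimum
    \<open>m\<close>.\<close>
  have par: "\<alpha> * (n2 M (\<lambda>x. cgrad (\<phi> i) x - cgrad (\<phi> j) x))\<^sup>2 \<le> 4 * (\<epsilon> i + \<epsilon> j)" for i j
  proof -
    let ?p = "\<lambda>x. (1/2) * \<phi> i x + (1/2) * \<phi> j x" and ?d = "\<lambda>x. 1 * \<phi> i x + (-1) * \<phi> j x"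
    have tp: "test_fun \<Omega> ?p" and td: "test_fun \<Omega> ?d" by (rule test_fun_lincomb[OF phi(1) phi(1)])+
    have "\<alpha> * (n2 M (cgrad ?d))\<^sup>2 \<le> B ?d ?d" unfolding B_def by (rule coercive[OF a test_sqint(2)[OF td]])
    also have "\<dots> = 8 * (E (\<phi> i) / 2 + E (\<phi> j) / 2 - E ?p)"
      unfolding E_def quad[OF phi(1) phi(1)] by (simp add: power2_eq_square field_simps)
    also have "\<dots> \<le> 8 * ((m + \<epsilon> i) / 2 + (m + \<epsilon> j) / 2 - m)"
    proof -
      have "8 * (X / 2 + Y / 2 - Z) \<le> 8 * ((m + \<epsilon> i) / 2 + (m + \<epsilon> j) / 2 - m)"
        if "X < m + \<epsilon> i" "Y < m + \<epsilon> j" "m \<le> Z" for X Y Z using that by (simp add: field_simps)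
      from this[OF phi(2) phi(2) m_le[OF tp]] show ?thesis .
    qed
    also have "\<dots> = 4 * (\<epsilon> i + \<epsilon> j)" by (simp add: field_simps)
    finally have "\<alpha> * (n2 M (cgrad ?d))\<^sup>2 \<le> 4 * (\<epsilon> i + \<epsilon> j)" .
    moreover have "cgrad ?d = (\<lambda>x. cgrad (\<phi> i) x - cgrad (\<phi> j) x)"
      using cgrad_lincomb[OF phi(1)[of i] phi(1)[of j], of 1 "-1"] by (simp add: fun_eq_iff)
    ultimately show ?thesis by simp
  qed
  have cau: "\<exists>N. \<forall>i\<ge>N. \<forall>j\<ge>N. n2 M (\<lambda>x. cgrad (\<phi> i) x - cgrad (\<phi> j) x) < r" if r: "r > 0" for r
  proof -
    have "\<alpha> * r\<^sup>2 / 8 > 0" using r ab(4) by simp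
    from order_tendstoD(2)[OF e_lim this] obtain N where N: "\<And>n. n \<ge> N \<Longrightarrow> \<epsilon> n < \<alpha> * r\<^sup>2 / 8"
      unfolding eventually_sequentially by blast
    have "n2 M (\<lambda>x. cgrad (\<phi> i) x - cgrad (\<phi> j) x) < r" if "i \<ge> N" "j \<ge> N" for i j
    proof -
      have "\<alpha> * (n2 M (\<lambda>x. cgrad (\<phi> i) x - cgrad (\<phi> j) x))\<^sup>2 < \<alpha> * r\<^sup>2" 
      proof -
        have "8 * \<epsilon> i < \<alpha> * r\<^sup>2" "8 * \<epsilon> j < \<alpha> * r\<^sup>2" using N[OF that(1)] N[OF that(2)] by simp_all
        then show ?thesis using par[of i j, unfolded distrib_left] by linarith
      qed
      then have "(n2 M (\<lambda>x. cgrad (\<phi> i) x - cgrad (\<phi> j) x))\<^sup>2 < r\<^sup>2" using ab(4) by simp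
      then show ?thesis by (rule power2_less_imp_less) (use r in simp)
    qed
    then show ?thesis by blast
  qed
  obtain g where g: "sqint M g" "(\<lambda>n. n2 M (\<lambda>x. g x - cgrad (\<phi> n) x)) \<longlonglongrightarrow> 0"
    by (rule L2_complete[OF finite_M test_sqint(2)[OF phi(1)] cau])
  have cau': "\<exists>N. \<forall>i\<ge>N. \<forall>j\<ge>N. n2 M (\<lambda>x. \<phi> i x - \<phi> j x) < r" if r: "r > 0" for r
  proof -
    have "r / poincare_const > 0" using r poincare_const(1) by simp
    from cau[OF this] obtain N where N: "\<forall>i\<ge>N. \<forall>j\<ge>N. n2 M (\<lambda>x. cgrad (\<phi> i) x - cgrad (\<phi> j) x) < r / poincare_const" by blast
    have "n2 M (\<lambda>x. \<phi> i x - \<phi> j x) < r" if ij: "i \<ge> N" "j \<ge> N" for i j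
    proof -
      have "n2 M (\<lambda>x. 1 * \<phi> i x + (-1) * \<phi> j x) \<le> poincare_const * n2 M (cgrad (\<lambda>x. 1 * \<phi> i x + (-1) * \<phi> j x))"
        by (rule poincare_const(2)[OF test_fun_lincomb[OF phi(1) phi(1)]])
      also have "cgrad (\<lambda>x. 1 * \<phi> i x + (-1) * \<phi> j x) = (\<lambda>x. cgrad (\<phi> i) x - cgrad (\<phi> j) x)"
        using cgrad_lincomb[OF phi(1)[of i] phi(1)[of j], of 1 "-1"] by (simp add: fun_eq_iff)
      also have "poincare_const * n2 M (\<lambda>x. cgrad (\<phi> i) x - cgrad (\<phi> j) x) < r"
        using N ij poincare_const(1) by (simp add: pos_less_divide_eq mult.commute)
      finally show ?thesis by simp
    qed
    then show ?thesis by blast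
  qed
  obtain u where u: "sqint M u" "(\<lambda>n. n2 M (\<lambda>x. u x - \<phi> n x)) \<longlonglongrightarrow> 0"
    by (rule L2_complete[OF finite_M test_sqint(1)[OF phi(1)] cau'])
  have ug: "H1pair u g" unfolding H1pair_def using u g phi(1) by blast
  have "weak_sol a f u g"
  proof (rule sol_test_imp_weak_sol[OF a f ug])
    fix \<psi> assume psi: "test_fun \<Omega> \<psi>"
    have B0: "B \<psi> \<psi> \<ge> 0" 
      using coercive[OF a test_sqint(2)[OF psi]] ab(4) unfolding B_def by (meson mult_nonneg_nonneg less_imp_le order_trans zero_le_power2)
    \<comment> \<open>Along the line through \<open>\<phi> n\<close> in direction
      \<open>\<psi>\<close> the energy is a quadratic that stays above \<open>m\<close>; its
      discriminant bounds the defect in the weak equation by the energy gap.\<close>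
    have sq: "(B (\<phi> n) \<psi> - l \<psi>)\<^sup>2 \<le> 2 * \<epsilon> n * B \<psi> \<psi>" for n
    proof -
      have "((B (\<phi> n) \<psi> - l \<psi>) / 2)\<^sup>2 \<le> (E (\<phi> n) - m) * (B \<psi> \<psi> / 2)"
      proof (rule discriminant_le)
        fix t :: real
        have "m \<le> E (\<lambda>x. 1 * \<phi> n x + t * \<psi> x)" by (rule m_le[OF test_fun_lincomb[OF phi(1) psi]])
        also have "\<dots> = E (\<phi> n) + t * (B (\<phi> n) \<psi> - l \<psi>) + t\<^sup>2 * (B \<psi> \<psi> / 2)"
          unfolding E_def quad[OF phi(1) psi] by (simp add: field_simps)
        finally show "0 \<le> (E (\<phi> n) - m) + 2 * t * ((B (\<phi> n) \<psi> - l \<psi>) / 2) + t\<^sup>2 * (B \<psi> \<psi> / 2)" by simp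
      qed (use m_le[OF phi(1)] B0 in auto)
      also have "\<dots> \<le> \<epsilon> n * (B \<psi> \<psi> / 2)" using phi(2)[of n] B0 by (intro mult_right_mono) auto
      finally show ?thesis by (simp add: power_divide)
    qed
    have "(\<lambda>n. sqrt (2 * \<epsilon> n * B \<psi> \<psi>)) \<longlonglongrightarrow> sqrt (2 * 0 * B \<psi> \<psi>)" by (intro tendsto_intros e_lim)
    then have s0: "(\<lambda>n. sqrt (2 * \<epsilon> n * B \<psi> \<psi>)) \<longlonglongrightarrow> 0" by simp
    have "\<bar>B (\<phi> n) \<psi> - l \<psi>\<bar> \<le> sqrt (2 * \<epsilon> n * B \<psi> \<psi>)" for n using real_sqrt_le_mono[OF sq[of n]] by simp
    then have "(\<lambda>n. B (\<phi> n) \<psi> - l \<psi>) \<longlonglongrightarrow> 0" using s0 by (rule LIMSEQ_null_le)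
    then have "(\<lambda>n. B (\<phi> n) \<psi>) \<longlonglongrightarrow> l \<psi>" by (rule LIM_zero_cancel)
    moreover have "(\<lambda>n. B (\<phi> n) \<psi>) \<longlonglongrightarrow> (\<integral>x. a x * (g x \<bullet> cgrad \<psi> x) \<partial>M)"
      unfolding B_def by (rule tendsto_L2_weighted[OF test_sqint(2)[OF phi(1)] g test_sqint(2)[OF psi] ab(1-3)])
    ultimately have "l \<psi> = (\<integral>x. a x * (g x \<bullet> cgrad \<psi> x) \<partial>M)" by (rule LIMSEQ_unique)
    then show "(\<integral>x. a x * (g x \<bullet> cgrad \<psi> x) \<partial>M) = (\<integral>x. f x * \<psi> x \<partial>M)" by (simp add: l_def)
  qed
  then show ?thesis by (rule that)
qed

lemma weak_sol_H1pair: "weak_sol a f u g \<Longrightarrow> H1pair u g" by (simp add: weak_sol_def)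

lemma weak_sol_eq: "weak_sol a f u g \<Longrightarrow> H1pair v k \<Longrightarrow> (\<integral>x. a x * (g x \<bullet> k x) \<partial>M) = (\<integral>x. f x * v x \<partial>M)"
  by (simp add: weak_sol_def)

lemma weak_sol_unique:
  assumes a: "admissible \<alpha> K a" and 1: "weak_sol a f u g" and 2: "weak_sol a f v k" and f: "sqint M f"
  shows "AE x in M. u x = v x"
proof -
  note h1 = weak_sol_H1pair[OF 1] and h2 = weak_sol_H1pair[OF 2]
  let ?w = "\<lambda>x. 1 * u x + (-1) * v x" and ?h = "\<lambda>x. 1 *\<^sub>R g x + (-1) *\<^sub>R k x"
  have h: "H1pair ?w ?h" by (rule H1pair_lincomb[OF h1 h2])
  note sh = H1pair_sqint(2)[OF h]
  have i: "integrable M (\<lambda>x. a x * (g x \<bullet> ?h x))" "integrable M (\<lambda>x. a x * (k x \<bullet> ?h x))"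
    by (rule L2_weighted_bound(1)[OF H1pair_sqint(2)[OF h1] sh admissible_bound(1-3)[OF a]]
      L2_weighted_bound(1)[OF H1pair_sqint(2)[OF h2] sh admissible_bound(1-3)[OF a]])+
  have "(\<integral>x. a x * (?h x \<bullet> ?h x) \<partial>M) = (\<integral>x. a x * (g x \<bullet> ?h x) - a x * (k x \<bullet> ?h x) \<partial>M)"
    by (intro Bochner_Integration.integral_cong) (auto simp: inner_diff_left right_diff_distrib)
  also have "\<dots> = 0" using Bochner_Integration.integral_diff[OF i] weak_sol_eq[OF 1 h] weak_sol_eq[OF 2 h] by simp
  finally have "\<alpha> * (n2 M ?h)\<^sup>2 \<le> 0" using coercive[OF a sh] by simp
  then have "n2 M ?h = 0" using admissible_bound(4)[OF a] by (simp add: mult_le_0_iff)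
  then have "n2 M ?w \<le> 0" using poincare[OF h] by simp
  then have "n2 M ?w = 0" using n2_nonneg[of M ?w] by linarith
  then have "(\<integral>x. (norm (?w x))\<^sup>2 \<partial>M) = 0" unfolding n2_sq[symmetric] by simp
  then have "AE x in M. (norm (?w x))\<^sup>2 = 0"
    by (subst (asm) integral_nonneg_eq_0_iff_AE[OF sqint_integrable[OF H1pair_sqint(1)[OF h]]]) auto
  then show ?thesis by eventually_elim simp
qed

section \<open>Link to the solution and cost notions of the statement\<close>

lemma state_sol_iff:
  "state_sol \<Omega> f a y \<longleftrightarrow> weak_sol a f y (wgrad \<Omega> y)" if a: "a \<in> borel_measurable M"
proof -
  have eq: "(\<integral>x. a x * (wgrad \<Omega> y x \<bullet> wgrad \<Omega> v x) \<partial>M) = (\<integral>x. a x * (wgrad \<Omega> y x \<bullet> k x) \<partial>M)"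
    if y: "H1pair y (wgrad \<Omega> y)" and v: "H1pair v k" for v k
  proof (rule integral_cong_AE)
    have [measurable]: "wgrad \<Omega> y \<in> borel_measurable M" "k \<in> borel_measurable M" "wgrad \<Omega> v \<in> borel_measurable M"
      using y v H10_imp_H1pair[OF H1pair_imp_H10(1)[OF v]] by (auto dest!: H1pair_sqint(2) sqint_meas)
    note a [measurable]
    show "(\<lambda>x. a x * (wgrad \<Omega> y x \<bullet> wgrad \<Omega> v x)) \<in> borel_measurable M" "(\<lambda>x. a x * (wgrad \<Omega> y x \<bullet> k x)) \<in> borel_measurable M" by measurable
    show "AE x in M. a x * (wgrad \<Omega> y x \<bullet> wgrad \<Omega> v x) = a x * (wgrad \<Omega> y x \<bullet> k x)"
      using H1pair_imp_H10(2)[OF v] by eventually_elim simp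
  qed
  show ?thesis
  proof
    assume s: "state_sol \<Omega> f a y"
    then have y: "H1pair y (wgrad \<Omega> y)" by (simp add: state_sol_def H10_imp_H1pair)
    show "weak_sol a f y (wgrad \<Omega> y)" unfolding weak_sol_def
    proof (intro conjI y allI impI)
      fix v k assume v: "H1pair v k"
      have "(\<integral>x. a x * (wgrad \<Omega> y x \<bullet> wgrad \<Omega> v x) \<partial>M) = (\<integral>x. f x * v x \<partial>M)"
        using s H1pair_imp_H10(1)[OF v] unfolding state_sol_def set_integral_M by blast
      then show "(\<integral>x. a x * (wgrad \<Omega> y x \<bullet> k x) \<partial>M) = (\<integral>x. f x * v x \<partial>M)" unfolding eq[OF y v] .
    qed
  next
    assume s: "weak_sol a f y (wgrad \<Omega> y)"
    then have y: "H1pair y (wgrad \<Omega> y)" by (simp add: weak_sol_def)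
    show "state_sol \<Omega> f a y" unfolding state_sol_def set_integral_M
    proof (intro conjI H1pair_imp_H10(1)[OF y] allI impI)
      fix v assume "H10 \<Omega> v"
      then have "H1pair v (wgrad \<Omega> v)" by (rule H10_imp_H1pair)
      with s show "(\<integral>x. a x * (wgrad \<Omega> y x \<bullet> wgrad \<Omega> v x) \<partial>M) = (\<integral>x. f x * v x \<partial>M)"
        unfolding weak_sol_def by blast
    qed
  qed
qed

lemma weak_sol_cong:
  assumes "weak_sol a f u g" "g' \<in> borel_measurable M" "AE x in M. g' x = g x" "a \<in> borel_measurable M"
  shows "weak_sol a f u g'"
  unfolding weak_sol_def
proof (intro conjI allI impI)
  show "H1pair u g'" by (rule H1pair_cong[OF weak_sol_H1pair[OF assms(1)] assms(2,3)])
  fix v k assume v: "H1pair v k"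
  have [measurable]: "g \<in> borel_measurable M" "k \<in> borel_measurable M" "g' \<in> borel_measurable M" "a \<in> borel_measurable M"
    using assms(2,4) v weak_sol_H1pair[OF assms(1)] by (auto dest!: H1pair_sqint(2) sqint_meas)
  have "(\<integral>x. a x * (g' x \<bullet> k x) \<partial>M) = (\<integral>x. a x * (g x \<bullet> k x) \<partial>M)"
    by (rule integral_cong_AE) (use assms(3) in auto)
  then show "(\<integral>x. a x * (g' x \<bullet> k x) \<partial>M) = (\<integral>x. f x * v x \<partial>M)" using weak_sol_eq[OF assms(1) v] by simp
qed

lemma weak_sol_imp_state_sol:
  assumes "weak_sol a f u g" "a \<in> borel_measurable M" shows "state_sol \<Omega> f a u"
proof -
  note h = weak_sol_H1pair[OF assms(1)]
  have "wgrad \<Omega> u \<in> borel_measurable M"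
    by (rule sqint_meas[OF H1pair_sqint(2)[OF H10_imp_H1pair[OF H1pair_imp_H10(1)[OF h]]]])
  then show ?thesis
    unfolding state_sol_iff[OF assms(2)] by (rule weak_sol_cong[OF assms(1) _ H1pair_imp_H10(2)[OF h] assms(2)])
qed

lemma adj_sol_imp_weak_sol:
  assumes "adj_sol \<Omega> a y yd p" "a \<in> borel_measurable M"
  shows "weak_sol a (\<lambda>x. y x - yd x) p (wgrad \<Omega> p)"
proof -
  have "state_sol \<Omega> (\<lambda>x. y x - yd x) a p"
    using assms(1) unfolding state_sol_def adj_sol_def by (simp add: inner_commute)
  then show ?thesis using state_sol_iff[OF assms(2)] by blast
qed

text \<open>The \<open>THE\<close> in \<open>Jcost\<close> is well-defined because two weak
  solutions for the same coefficient agree almost everywhere and so have the same cost.\<close>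

lemma Jcost_eq:
  assumes a: "admissible \<alpha> K a" and f: "sqint M f" and yd: "sqint M yd" and y: "weak_sol a f y g"
  shows "Jcost \<Omega> f yd a = 1/2 * (\<integral>x. (y x - yd x)\<^sup>2 \<partial>M)"
  unfolding Jcost_def set_integral_M
proof (rule the_equality)
  show "\<exists>y'. state_sol \<Omega> f a y' \<and> 1/2 * (\<integral>x. (y x - yd x)\<^sup>2 \<partial>M) = 1/2 * (\<integral>x. (y' x - yd x)\<^sup>2 \<partial>M)"
    using weak_sol_imp_state_sol[OF y admissible_bound(1)[OF a]] by blast
  fix c assume "\<exists>y. state_sol \<Omega> f a y \<and> c = 1/2 * (\<integral>x. (y x - yd x)\<^sup>2 \<partial>M)"
  then obtain z where z: "state_sol \<Omega> f a z" "c = 1/2 * (\<integral>x. (z x - yd x)\<^sup>2 \<partial>M)" by blast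
  have zs: "weak_sol a f z (wgrad \<Omega> z)" using z(1) state_sol_iff[OF admissible_bound(1)[OF a]] by blast
  have [measurable]: "z \<in> borel_measurable M" "y \<in> borel_measurable M" "yd \<in> borel_measurable M"
    using H1pair_sqint(1)[OF weak_sol_H1pair[OF zs]] H1pair_sqint(1)[OF weak_sol_H1pair[OF y]] yd by (auto dest!: sqint_meas)
  have "(\<integral>x. (z x - yd x)\<^sup>2 \<partial>M) = (\<integral>x. (y x - yd x)\<^sup>2 \<partial>M)"
    by (rule integral_cong_AE) (use weak_sol_unique[OF a zs y f] in auto)
  then show "c = 1/2 * (\<integral>x. (y x - yd x)\<^sup>2 \<partial>M)" using z(2) by simp
qed

end

section \<open>The potential of an ellipse\<close>

text \<open>The potential of a uniformly charged ellipse. In complex notation with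
  \<open>\<kappa> = (h22 - h11) - 2 i h12\<close> and \<open>\<tau> = tr H\<close> the conjugate field outside the ellipse is the small
  root \<open>X\<close> of \<open>\<kappa> X^2 - 2 z X + 1 = 0\<close> (inverse Joukowski map); inside it is real-linear.\<close>

locale ellipse_field =
  fixes \<kappa> :: complex and \<tau> :: real
  assumes kappa: "(cmod \<kappa>)\<^sup>2 = \<tau>\<^sup>2 - 4" and tau: "\<tau> \<ge> 2"
begin

definition Q :: "complex \<Rightarrow> real" where
  "Q z = (\<tau> * (cmod z)\<^sup>2 - Re (\<kappa> * (cnj z)\<^sup>2)) / 2"

text \<open>The equation says \<open>z = (1 / X + \<kappa> * X) / 2\<close>. For semi-axes
  \<open>s1\<close>, \<open>s2\<close> with \<open>s1 * s2 = 1\<close> one has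
  \<open>\<tau> + 2 = (s1 + s2)^2\<close>, and this map sends the circle of radius
  \<open>1 / (s1 + s2)\<close> onto the ellipse and the punctured disc inside the circle onto the
  exterior. The bound on \<open>X\<close> therefore selects the exterior branch.\<close>

definition small_root :: "complex \<Rightarrow> complex \<Rightarrow> bool" where
  "small_root z X \<longleftrightarrow> \<kappa> * X\<^sup>2 - 2 * z * X + 1 = 0 \<and> (cmod X)\<^sup>2 * (\<tau> + 2) \<le> 1"

text \<open>In terms of the semi-axes this is the modulus of \<open>(s1 - s2) / (s1 + s2)\<close>.
  It bounds \<open>cmod (\<kappa> * X * Y)\<close> for small roots and, being below 1, keeps the
  denominators \<open>\<kappa> * X * Y - 1\<close> away from zero.\<close>

definition \<theta> :: real where "\<theta> = cmod \<kappa> / (\<tau> + 2)"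

lemma kappa_less: "cmod \<kappa> < \<tau>"
  by (rule power2_less_imp_less) (use kappa tau in auto)

lemma theta: "0 \<le> \<theta>" "\<theta> < 1"
  using kappa_less tau by (auto simp: \<theta>_def)

text \<open>Multiplying by powers of \<open>X\<close> and inserting
  \<open>2 * z * X = 1 + \<kappa> * X^2\<close> eliminates \<open>z\<close>. The factorisation
  reduces the position of \<open>z\<close> relative to the ellipse to the sign of
  \<open>1 - (\<tau> + 2) * R\<close>, once the other factors are known to be positive.\<close>

lemma root_identity:
  assumes X: "\<kappa> * X\<^sup>2 - 2 * z * X + 1 = 0"
  defines "R \<equiv> (cmod X)\<^sup>2" and "S \<equiv> Re (\<kappa> * X\<^sup>2)"
  shows "8 * (Q z - 1) * R\<^sup>2 = (\<tau> * R - S) * ((1 - (\<tau> + 2) * R) * (1 - (\<tau> - 2) * R))"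
proof -
  have e: "2 * z * X = 1 + \<kappa> * X\<^sup>2" using X by (simp add: algebra_simps)
  have "4 * (cmod z)\<^sup>2 * R = (cmod (2 * z * X))\<^sup>2" unfolding R_def by (simp add: norm_mult power_mult_distrib)
  also have "\<dots> = (cmod (1 + \<kappa> * X\<^sup>2))\<^sup>2" unfolding e ..
  also have "\<dots> = 1 + 2 * S + (cmod (\<kappa> * X\<^sup>2))\<^sup>2" unfolding S_def cmod_power2 by (simp add: power2_eq_square algebra_simps)
  also have "(cmod (\<kappa> * X\<^sup>2))\<^sup>2 = (\<tau>\<^sup>2 - 4) * R\<^sup>2" unfolding R_def norm_mult norm_power power_mult_distrib kappa by simp
  finally have z2: "4 * (cmod z)\<^sup>2 * R = 1 + 2 * S + (\<tau>\<^sup>2 - 4) * R\<^sup>2" .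
  have XX: "X * cnj X = of_real R" unfolding R_def by (rule complex_norm_square[symmetric])
  have KK: "\<kappa> * cnj \<kappa> = of_real (\<tau>\<^sup>2 - 4)" unfolding kappa[symmetric] by (rule complex_norm_square[symmetric])
  have ce: "2 * cnj z * cnj X = 1 + cnj \<kappa> * (cnj X)\<^sup>2" using arg_cong[OF e, of cnj] by simp
  have "4 * (\<kappa> * (cnj z)\<^sup>2) * (X * cnj X)\<^sup>2 = \<kappa> * X\<^sup>2 * (2 * cnj z * cnj X)\<^sup>2" by (simp add: power2_eq_square algebra_simps)
  also have "\<dots> = \<kappa> * X\<^sup>2 + 2 * (\<kappa> * cnj \<kappa>) * (X * cnj X)\<^sup>2 + (\<kappa> * cnj \<kappa>) * (X * cnj X)\<^sup>2 * cnj (\<kappa> * X\<^sup>2)"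
    unfolding ce by (simp add: power2_eq_square algebra_simps)
  finally have "4 * (\<kappa> * (cnj z)\<^sup>2) * of_real (R\<^sup>2) = \<kappa> * X\<^sup>2 + of_real (2 * (\<tau>\<^sup>2 - 4) * R\<^sup>2) + of_real ((\<tau>\<^sup>2 - 4) * R\<^sup>2) * cnj (\<kappa> * X\<^sup>2)"
    unfolding XX KK by simp
  from arg_cong[OF this, of Re] have r: "4 * Re (\<kappa> * (cnj z)\<^sup>2) * R\<^sup>2 = S + 2 * (\<tau>\<^sup>2 - 4) * R\<^sup>2 + (\<tau>\<^sup>2 - 4) * R\<^sup>2 * S"
    unfolding S_def by (simp add: Re_power2 Im_power2)
  have "8 * Q z * R\<^sup>2 = \<tau> * R * (4 * (cmod z)\<^sup>2 * R) - 4 * Re (\<kappa> * (cnj z)\<^sup>2) * R\<^sup>2"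
  proof -
    have "2 * Q z = \<tau> * (cmod z)\<^sup>2 - Re (\<kappa> * (cnj z)\<^sup>2)" by (simp add: Q_def)
    moreover have "4 * (\<tau> * C - T) * R\<^sup>2 = \<tau> * R * (4 * C * R) - 4 * T * R\<^sup>2" for C T
      by (simp add: power2_eq_square algebra_simps)
    moreover have "8 * Q z * R\<^sup>2 = 4 * (2 * Q z) * R\<^sup>2" by simp
    ultimately show ?thesis by metis
  qed
  then have "8 * Q z * R\<^sup>2 = \<tau> * R * (1 + 2 * S + (\<tau>\<^sup>2 - 4) * R\<^sup>2) - (S + 2 * (\<tau>\<^sup>2 - 4) * R\<^sup>2 + (\<tau>\<^sup>2 - 4) * R\<^sup>2 * S)"
    unfolding z2 r .
  then show ?thesis by (simp add: power2_eq_square algebra_simps)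
qed

text \<open>The factor with \<open>S\<close> is positive because
  \<open>cmod \<kappa> < \<tau>\<close>, and \<open>1 - (\<tau> - 2) * (cmod X)^2\<close> is
  positive because \<open>X\<close> is the smaller root. Only the remaining factor can carry the
  sign of \<open>Q z - 1\<close>.\<close>

lemma root_signs:
  assumes X: "\<kappa> * X\<^sup>2 - 2 * z * X + 1 = 0" and R: "(cmod X)\<^sup>2 * cmod \<kappa> \<le> 1"
  shows "Q z \<ge> 1 \<Longrightarrow> (cmod X)\<^sup>2 * (\<tau> + 2) \<le> 1" "Q z = 1 \<Longrightarrow> (cmod X)\<^sup>2 * (\<tau> + 2) = 1"
proof -
  let ?R = "(cmod X)\<^sup>2" and ?S = "Re (\<kappa> * X\<^sup>2)"
  have X0: "X \<noteq> 0" using X by auto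
  then have R0: "?R > 0" by simp
  have "?S \<le> cmod \<kappa> * ?R" using complex_Re_le_cmod[of "\<kappa> * X\<^sup>2"] by (simp add: norm_mult norm_power)
  also have "\<dots> < \<tau> * ?R" using kappa_less R0 by simp
  finally have p1: "\<tau> * ?R - ?S > 0" by simp
  have p2: "1 - (\<tau> - 2) * ?R > 0"
  proof (cases "\<tau> = 2")
    case False
    then have "(\<tau> - 2)\<^sup>2 < (cmod \<kappa>)\<^sup>2" unfolding kappa using tau by (simp add: power2_eq_square algebra_simps)
    then have "\<tau> - 2 < cmod \<kappa>" by (rule power2_less_imp_less) simp
    then have "(\<tau> - 2) * ?R < cmod \<kappa> * ?R" using R0 by simp
    then show ?thesis using R by (simp add: mult.commute)
  qed simp
  note id = root_identity[OF X]
  show "?R * (\<tau> + 2) \<le> 1" if q: "Q z \<ge> 1"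
  proof (rule ccontr)
    assume "\<not> ?thesis"
    then have "1 - (\<tau> + 2) * ?R < 0" by (simp add: mult.commute)
    then have "(\<tau> * ?R - ?S) * ((1 - (\<tau> + 2) * ?R) * (1 - (\<tau> - 2) * ?R)) < 0"
      using p1 p2 by (intro mult_pos_neg mult_neg_pos)
    moreover have "8 * (Q z - 1) * ?R\<^sup>2 \<ge> 0" using q by simp
    ultimately show False using id by linarith
  qed
  show "?R * (\<tau> + 2) = 1" if q: "Q z = 1"
  proof -
    have "(\<tau> * ?R - ?S) * ((1 - (\<tau> + 2) * ?R) * (1 - (\<tau> - 2) * ?R)) = 0" using id q by simp
    then show ?thesis using p1 p2 by (simp add: mult.commute)
  qed
qed

text \<open>The two roots have product \<open>1 / \<kappa>\<close>, so one of them satisfies the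
  weak bound with \<open>cmod \<kappa>\<close>; outside the ellipse this improves to the bound with
  \<open>\<tau> + 2\<close>. For the disc, \<open>\<kappa> = 0\<close>, the equation is
  linear.\<close>

lemma small_root_exists:
  assumes q: "Q z \<ge> 1" shows "\<exists>X. small_root z X"
proof -
  have "\<exists>X. \<kappa> * X\<^sup>2 - 2 * z * X + 1 = 0 \<and> (cmod X)\<^sup>2 * cmod \<kappa> \<le> 1"
  proof (cases "\<kappa> = 0")
    case True
    have "z \<noteq> 0" using q by (auto simp: Q_def)
    then show ?thesis using True by (intro exI[of _ "1 / (2 * z)"]) auto
  next
    case False
    define s where "s = csqrt (z\<^sup>2 - \<kappa>)"
    have s: "s\<^sup>2 = z\<^sup>2 - \<kappa>" by (simp add: s_def)
    define X Y where "X = (z + s) / \<kappa>" and "Y = (z - s) / \<kappa>"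
    have kX: "\<kappa> * X = z + s" and kY: "\<kappa> * Y = z - s" using False by (auto simp: X_def Y_def)
    have "\<kappa> * (\<kappa> * X\<^sup>2 - 2 * z * X + 1) = (\<kappa> * X)\<^sup>2 - 2 * z * (\<kappa> * X) + \<kappa>" by (simp add: power2_eq_square algebra_simps)
    also have "\<dots> = s\<^sup>2 - z\<^sup>2 + \<kappa>" unfolding kX by (simp add: power2_eq_square algebra_simps)
    finally have eX: "\<kappa> * X\<^sup>2 - 2 * z * X + 1 = 0" using False s by simp
    have "\<kappa> * (\<kappa> * Y\<^sup>2 - 2 * z * Y + 1) = (\<kappa> * Y)\<^sup>2 - 2 * z * (\<kappa> * Y) + \<kappa>" by (simp add: power2_eq_square algebra_simps)
    also have "\<dots> = s\<^sup>2 - z\<^sup>2 + \<kappa>" unfolding kY by (simp add: power2_eq_square algebra_simps)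
    finally have eY: "\<kappa> * Y\<^sup>2 - 2 * z * Y + 1 = 0" using False s by simp
    have "\<kappa> * (\<kappa> * (X * Y)) = (\<kappa> * X) * (\<kappa> * Y)" by simp
    also have "\<dots> = z\<^sup>2 - s\<^sup>2" unfolding kX kY by (simp add: power2_eq_square algebra_simps)
    also have "\<dots> = \<kappa>" using s by simp
    finally have "\<kappa> * (X * Y) = 1" using False by simp
    then have n: "cmod \<kappa> * (cmod X * cmod Y) = 1" by (metis norm_mult norm_one)
    show ?thesis
    proof (cases "cmod X \<le> cmod Y")
      case True
      have "(cmod X)\<^sup>2 * cmod \<kappa> \<le> (cmod X * cmod Y) * cmod \<kappa>"
        unfolding power2_eq_square by (intro mult_right_mono mult_left_mono True) auto
      then show ?thesis using eX n by (intro exI[of _ X]) (simp add: mult.commute)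
    next
      case False
      have "(cmod Y)\<^sup>2 * cmod \<kappa> \<le> (cmod X * cmod Y) * cmod \<kappa>"
        unfolding power2_eq_square using False by (intro mult_right_mono) auto
      then show ?thesis using eY n by (intro exI[of _ Y]) (simp add: mult.commute)
    qed
  qed
  then show ?thesis unfolding small_root_def using root_signs(1)[OF _ _ q] by blast
qed

lemma small_root_theta:
  assumes "small_root z X" "small_root w Y" shows "cmod (\<kappa> * X * Y) \<le> \<theta>"
proof -
  have "cmod X \<le> sqrt (1 / (\<tau> + 2))" "cmod Y \<le> sqrt (1 / (\<tau> + 2))"
    using assms tau by (auto simp: small_root_def pos_le_divide_eq intro!: real_le_rsqrt)
  then have "cmod X * cmod Y \<le> sqrt (1 / (\<tau> + 2)) * sqrt (1 / (\<tau> + 2))" using tau by (intro mult_mono) auto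
  also have "\<dots> = 1 / (\<tau> + 2)" using tau by simp
  finally have "cmod \<kappa> * (cmod X * cmod Y) \<le> cmod \<kappa> * (1 / (\<tau> + 2))" by (rule mult_left_mono) simp
  then show ?thesis by (simp add: norm_mult \<theta>_def mult.assoc)
qed

text \<open>Subtracting the two equations crosswise gives an exact difference quotient. It yields
  both the Lipschitz estimate and the complex derivative, so no branch of the square root has to be
  chosen continuously or differentiated.\<close>

lemma small_root_diff:
  assumes "small_root z X" "small_root w Y"
  shows "(X - Y) * (\<kappa> * X * Y - 1) = 2 * (z - w) * (X * Y)"
proof -
  have "2 * z * X = 1 + \<kappa> * X\<^sup>2" "2 * w * Y = 1 + \<kappa> * Y\<^sup>2" using assms by (auto simp: small_root_def algebra_simps)
  then have "2 * z * X * Y - 2 * w * Y * X = (1 + \<kappa> * X\<^sup>2) * Y - (1 + \<kappa> * Y\<^sup>2) * X" by simp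
  then show ?thesis by (simp add: power2_eq_square algebra_simps)
qed

lemma denom_bound:
  assumes "small_root z X" "small_root w Y" shows "1 - \<theta> \<le> cmod (\<kappa> * X * Y - 1)"
  using small_root_theta[OF assms] norm_triangle_ineq2[of 1 "\<kappa> * X * Y"] by (simp add: norm_minus_commute)

lemma small_root_lipschitz:
  assumes "small_root z X" "small_root w Y"
  shows "cmod (X - Y) \<le> 2 / (1 - \<theta>) * cmod (z - w)"
proof -
  have "cmod X \<le> 1" "cmod Y \<le> 1"
  proof -
    have "(cmod A)\<^sup>2 \<le> 1\<^sup>2" if "small_root v A" for v A
    proof -
      have "(cmod A)\<^sup>2 * 1 \<le> (cmod A)\<^sup>2 * (\<tau> + 2)" using tau by (intro mult_left_mono) auto
      then show ?thesis using that by (simp add: small_root_def)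
    qed
    then show "cmod X \<le> 1" "cmod Y \<le> 1" using assms by (metis power2_le_imp_le zero_le_one)+
  qed
  then have xy: "cmod X * cmod Y \<le> 1" by (simp add: mult_le_one)
  have "cmod (X - Y) * (1 - \<theta>) \<le> cmod (X - Y) * cmod (\<kappa> * X * Y - 1)" by (intro mult_left_mono denom_bound[OF assms]) simp
  also have "\<dots> = cmod (2 * (z - w) * (X * Y))" unfolding small_root_diff[OF assms, symmetric] by (simp add: norm_mult)
  also have "\<dots> = 2 * cmod (z - w) * (cmod X * cmod Y)" by (simp only: norm_mult norm_numeral)
  also have "\<dots> \<le> 2 * cmod (z - w)" using xy by (simp add: mult_left_le)
  finally show ?thesis using theta by (simp add: field_simps)
qed

text \<open>The coefficient 1/2 of \<open>cnj z\<close> is the uniform unit charge density; the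
  coefficient of \<open>z\<close> is forced by matching the small root on the boundary.\<close>

definition h_in :: "complex \<Rightarrow> complex" where
  "h_in z = cnj z / 2 - cnj \<kappa> * z / (2 * of_real (\<tau> + 2))"

definition field :: "complex \<Rightarrow> complex" where
  "field z = (if Q z \<le> 1 then h_in z else (SOME X. small_root z X))"

lemma field_inside: "Q z \<le> 1 \<Longrightarrow> field z = h_in z" by (simp add: field_def)

text \<open>On the ellipse \<open>X * cnj X * (\<tau> + 2) = 1\<close>. Replacing the constant term
  of the quadratic by this product allows division by \<open>X\<close>; what remains is a
  real-linear equation in \<open>X\<close> and \<open>cnj X\<close>, solved together with its
  conjugate.\<close>

lemma h_in_boundary:
  assumes q: "Q z = 1" and X: "small_root z X" shows "X = h_in z"
proof -
  have t: "of_real (\<tau> + 2) \<noteq> (0 :: complex)" using tau by (metis add_nonneg_pos of_real_eq_0_iff zero_less_numeral order_less_irrefl order_trans zero_le_numeral)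
  have e: "\<kappa> * X\<^sup>2 - 2 * z * X + 1 = 0" and b: "(cmod X)\<^sup>2 * (\<tau> + 2) \<le> 1" using X by (auto simp: small_root_def)
  have "(cmod X)\<^sup>2 * cmod \<kappa> \<le> (cmod X)\<^sup>2 * (\<tau> + 2)" using kappa_less by (intro mult_left_mono) auto
  then have "(cmod X)\<^sup>2 * (\<tau> + 2) = 1" using root_signs(2)[OF e _ q] b by linarith
  then have one: "X * cnj X * of_real (\<tau> + 2) = 1" unfolding complex_norm_square[symmetric] of_real_mult[symmetric] by simp
  have X0: "X \<noteq> 0" using e by auto
  have "2 * z * X = X * cnj X * of_real (\<tau> + 2) + \<kappa> * X\<^sup>2" unfolding one using e by (simp add: algebra_simps)
  then have "X * (2 * z) = X * (cnj X * of_real (\<tau> + 2) + \<kappa> * X)" by (simp add: power2_eq_square algebra_simps)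
  then have z: "2 * z = cnj X * of_real (\<tau> + 2) + \<kappa> * X" using X0 by simp
  have cz: "2 * cnj z = X * of_real (\<tau> + 2) + cnj \<kappa> * cnj X" using arg_cong[OF z, of cnj] by simp
  have KK: "\<kappa> * cnj \<kappa> = of_real (\<tau>\<^sup>2 - 4)" unfolding kappa[symmetric] by (rule complex_norm_square[symmetric])
  have "4 * of_real (\<tau> + 2) * h_in z = (2 * cnj z) * of_real (\<tau> + 2) - cnj \<kappa> * (2 * z)"
  proof -
    have "4 * T * (a / 2 - b * c / (2 * T)) = (2 * a) * T - b * (2 * c)" if "T \<noteq> 0" for T a b c :: complex
      using that by (simp add: field_simps)
    from this[OF t] show ?thesis unfolding h_in_def .
  qed
  also have "\<dots> = X * (of_real (\<tau> + 2) * of_real (\<tau> + 2)) - (\<kappa> * cnj \<kappa>) * X" unfolding cz z by (simp add: algebra_simps)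
  also have "\<dots> = X * of_real ((\<tau> + 2) * (\<tau> + 2) - (\<tau>\<^sup>2 - 4))" unfolding KK by (simp add: algebra_simps)
  also have "(\<tau> + 2) * (\<tau> + 2) - (\<tau>\<^sup>2 - 4) = 4 * (\<tau> + 2)" by (simp add: power2_eq_square algebra_simps)
  finally have "(4 * of_real (\<tau> + 2)) * h_in z = (4 * of_real (\<tau> + 2)) * X" by (simp add: mult.commute)
  moreover have "(4 * of_real (\<tau> + 2) :: complex) \<noteq> 0" using t by (simp only: mult_eq_0_iff) simp
  ultimately show ?thesis by (metis mult_left_cancel)
qed

lemma field_small_root: assumes "Q z \<ge> 1" shows "small_root z (field z)"
proof (cases "Q z \<le> 1")
  case True
  then have q: "Q z = 1" using assms by simp
  obtain X where X: "small_root z X" using small_root_exists[OF assms] by blast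
  show ?thesis using h_in_boundary[OF q X] X field_inside[OF True] by simp
next
  case False
  then show ?thesis using someI_ex[OF small_root_exists[OF assms]] by (simp add: field_def)
qed

lemma h_in_diff: "h_in z - h_in w = h_in (z - w)"
  by (simp add: h_in_def algebra_simps diff_divide_distrib)

lemma h_in_bound: "cmod (h_in z) \<le> cmod z"
proof -
  have "cmod (h_in z) \<le> cmod z / 2 + cmod \<kappa> * cmod z / (2 * (\<tau> + 2))"
  proof -
    have "cmod (of_real (\<tau> + 2)) = \<tau> + 2" unfolding norm_of_real using tau by simp
    then show ?thesis unfolding h_in_def
      by (intro order_trans[OF norm_triangle_ineq4]) (simp add: norm_mult norm_divide del: of_real_add)
  qed
  also have "cmod \<kappa> * cmod z / (2 * (\<tau> + 2)) = \<theta> * cmod z / 2" by (simp add: \<theta>_def)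
  also have "cmod z / 2 + \<theta> * cmod z / 2 \<le> cmod z"
    using mult_right_mono[OF less_imp_le[OF theta(2)] norm_ge_zero[of z]] by simp
  finally show ?thesis .
qed

lemma Q_continuous: "continuous_on UNIV Q"
  unfolding Q_def[abs_def] by (intro continuous_intros) auto

definition lip :: real where "lip = 1 + 2 / (1 - \<theta>)"

text \<open>A segment from inside to outside meets a point with \<open>Q = 1\<close>, where
  \<open>field\<close> is described both by \<open>h_in\<close> and as a small root. Splitting there
  combines the two estimates; \<open>lip\<close> is the sum of their constants.\<close>

lemma field_lipschitz: "cmod (field z - field w) \<le> lip * cmod (z - w)"
proof -
  have l0: "2 / (1 - \<theta>) \<ge> 0" using theta by simp
  have inn: "cmod (field z - field w) \<le> lip * cmod (z - w)" if "Q z \<le> 1" "Q w \<le> 1" for z w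
    using h_in_bound[of "z - w"] mult_nonneg_nonneg[OF l0 norm_ge_zero[of "z - w"]]
    unfolding field_inside[OF that(1)] field_inside[OF that(2)] h_in_diff lip_def distrib_right by linarith
  have out: "cmod (field z - field w) \<le> lip * cmod (z - w)" if "Q z \<ge> 1" "Q w \<ge> 1" for z w
    using small_root_lipschitz[OF field_small_root[OF that(1)] field_small_root[OF that(2)]] norm_ge_zero[of "z - w"]
    unfolding lip_def distrib_right by linarith
  have mix: "cmod (field z - field w) \<le> lip * cmod (z - w)" if q: "Q z \<le> 1" "Q w \<ge> 1" for z w
  proof -
    have c: "continuous_on {0..1} (\<lambda>t. Q (z + of_real t * (w - z)))"
      by (rule continuous_on_compose2[OF Q_continuous]) (auto intro!: continuous_intros)
    obtain t where t: "0 \<le> t" "t \<le> 1" "Q (z + of_real t * (w - z)) = 1"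
      using IVT'[of "\<lambda>t. Q (z + of_real t * (w - z))" 0 1 1] q c by auto
    let ?u = "z + of_real t * (w - z)"
    have d: "cmod (z - ?u) = t * cmod (z - w)" "cmod (?u - w) = (1 - t) * cmod (z - w)"
    proof -
      have e: "z - ?u = of_real t * (z - w)" "?u - w = of_real (1 - t) * (z - w)" by (auto simp: algebra_simps)
      then show "cmod (z - ?u) = t * cmod (z - w)" "cmod (?u - w) = (1 - t) * cmod (z - w)"
        unfolding e norm_mult norm_of_real using t by simp_all
    qed
    have "cmod (field z - field w) \<le> cmod (field z - field ?u) + cmod (field ?u - field w)"
      using norm_triangle_ineq[of "field z - field ?u" "field ?u - field w"] by simp
    also have "\<dots> \<le> lip * cmod (z - ?u) + lip * cmod (?u - w)"
      by (intro add_mono inn out) (use q t in auto)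
    also have "\<dots> = lip * cmod (z - w)" unfolding d by (simp add: algebra_simps)
    finally show ?thesis .
  qed
  show ?thesis
  proof (cases "Q z \<le> 1")
    case True then show ?thesis using inn mix by (cases "Q w \<le> 1") auto
  next
    case False
    then show ?thesis using out[of z w] mix[of w z] by (cases "Q w \<le> 1") (auto simp: norm_minus_commute)
  qed
qed

lemma field_continuous: "continuous_on UNIV field"
  by (rule lipschitz_continuous[OF field_lipschitz])

text \<open>Implicit differentiation of \<open>\<kappa> * X^2 - 2 * z * X + 1 = 0\<close>, with
  \<open>z\<close> eliminated by the same equation.\<close>

definition dfield :: "complex \<Rightarrow> complex" where
  "dfield z = 2 * (field z)\<^sup>2 / (\<kappa> * (field z)\<^sup>2 - 1)"

lemma outside_denom: assumes "Q z \<ge> 1" shows "1 - \<theta> \<le> cmod (\<kappa> * (field z)\<^sup>2 - 1)"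
  using denom_bound[OF field_small_root[OF assms] field_small_root[OF assms]] by (simp add: power2_eq_square mult.assoc)

lemma field_decay: assumes "Q z \<ge> 1" shows "cmod (field z) * cmod z \<le> 1"
proof -
  note r = field_small_root[OF assms]
  have "2 * z * field z = 1 + \<kappa> * (field z)\<^sup>2" using r by (simp add: small_root_def algebra_simps)
  then have "cmod (2 * z * field z) = cmod (1 + \<kappa> * (field z)\<^sup>2)" by simp
  also have "\<dots> \<le> 1 + \<theta>" using norm_triangle_ineq[of 1 "\<kappa> * (field z)\<^sup>2"] small_root_theta[OF r r]
    by (simp add: power2_eq_square mult.assoc)
  finally have "2 * (cmod (field z) * cmod z) \<le> 1 + \<theta>" by (simp add: norm_mult mult_ac)
  then show ?thesis using theta(2) by linarith
qed

text \<open>The derivative is of the order of the square of \<open>field\<close>, and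
  \<open>field\<close> itself decays like \<open>1 / cmod z\<close>.\<close>

lemma dfield_bound:
  assumes "Q z \<ge> 1"
  shows "cmod (dfield z) \<le> 2 / (1 - \<theta>)" "cmod (dfield z) * (cmod z)\<^sup>2 \<le> 2 / (1 - \<theta>)"
proof -
  have t: "1 - \<theta> > 0" using theta by simp
  have b: "cmod (dfield z) \<le> 2 * (cmod (field z))\<^sup>2 / (1 - \<theta>)"
    unfolding dfield_def norm_divide norm_mult norm_power
    using outside_denom[OF assms] t by (simp add: frac_le norm_mult norm_power)
  have "(cmod (field z))\<^sup>2 * 1 \<le> (cmod (field z))\<^sup>2 * (\<tau> + 2)" using tau by (intro mult_left_mono) auto
  then have "(cmod (field z))\<^sup>2 \<le> 1" using field_small_root[OF assms] by (simp add: small_root_def)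
  then have "2 * (cmod (field z))\<^sup>2 / (1 - \<theta>) \<le> 2 / (1 - \<theta>)" using t by (simp add: divide_right_mono)
  then show "cmod (dfield z) \<le> 2 / (1 - \<theta>)" using b by linarith
  have "(cmod (field z) * cmod z)\<^sup>2 \<le> 1\<^sup>2" by (rule power_mono[OF field_decay[OF assms]]) simp
  then have "(cmod (field z))\<^sup>2 * (cmod z)\<^sup>2 \<le> 1" by (simp add: power_mult_distrib)
  then have "2 * ((cmod (field z))\<^sup>2 * (cmod z)\<^sup>2) / (1 - \<theta>) \<le> 2 / (1 - \<theta>)" using t by (simp add: divide_right_mono)
  moreover have "cmod (dfield z) * (cmod z)\<^sup>2 \<le> 2 * (cmod (field z))\<^sup>2 / (1 - \<theta>) * (cmod z)\<^sup>2" by (rule mult_right_mono[OF b]) simp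
  ultimately show "cmod (dfield z) * (cmod z)\<^sup>2 \<le> 2 / (1 - \<theta>)" by (simp add: mult.assoc)
qed

lemma open_outside: "open {z. Q z > 1}" and open_inside: "open {z. Q z < 1}"
  using Q_continuous by (auto intro!: open_Collect_less continuous_on_const)

lemma field_deriv_outside:
  assumes q: "Q z > 1" shows "(field has_field_derivative dfield z) (at z)"
  unfolding has_field_derivative_iff
proof (rule Lim_transform_eventually)
  have fc: "(field \<longlongrightarrow> field z) (at z)"
    using field_continuous continuous_on_eq_continuous_at[of UNIV field] by (simp add: isCont_def)
  have "\<kappa> * field z * field z - 1 \<noteq> 0"
  proof
    assume "\<kappa> * field z * field z - 1 = 0"
    then show False using outside_denom[of z] q theta(2) by (simp add: power2_eq_square mult.assoc)
  qed
  then have "((\<lambda>w. 2 * (field w * field z) / (\<kappa> * field w * field z - 1)) \<longlongrightarrow> 2 * (field z * field z) / (\<kappa> * field z * field z - 1)) (at z)"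
    by (intro tendsto_intros fc)
  then show "((\<lambda>w. 2 * (field w * field z) / (\<kappa> * field w * field z - 1)) \<longlongrightarrow> dfield z) (at z)"
    by (simp add: dfield_def power2_eq_square mult.assoc)
  have "\<forall>\<^sub>F w in at z. w \<in> {z. Q z > 1}"
    using eventually_nhds_in_open[OF open_outside, of z] q by (simp add: eventually_at_filter eventually_mono)
  moreover have "\<forall>\<^sub>F w in at z. w \<noteq> z" by (simp add: eventually_at_filter)
  ultimately show "\<forall>\<^sub>F w in at z. 2 * (field w * field z) / (\<kappa> * field w * field z - 1) = (field w - field z) / (w - z)"
  proof eventually_elim
    case (elim w)
    have r: "small_root w (field w)" "small_root z (field z)" using elim q by (auto intro: field_small_root)
    have "\<kappa> * field w * field z - 1 \<noteq> 0" using denom_bound[OF r] theta(2) by auto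
    then show ?case using small_root_diff[OF r] elim(2) by (simp add: frac_eq_eq mult_ac)
  qed
qed

lemma field_deriv_inside:
  assumes q: "Q z < 1" shows "(field has_derivative h_in) (at z)"
proof (rule has_derivative_transform_within_open[OF _ open_inside])
  have "bounded_linear h_in"
  proof (rule bounded_linear_intro[where K=1])
    show "h_in (x + y) = h_in x + h_in y" for x y by (simp add: h_in_def algebra_simps add_divide_distrib)
    show "h_in (r *\<^sub>R x) = r *\<^sub>R h_in x" for r x by (simp add: h_in_def scaleR_conv_of_real algebra_simps)
    show "norm (h_in x) \<le> norm x * 1" for x using h_in_bound by simp
  qed
  then show "(h_in has_derivative h_in) (at z)" by (rule bounded_linear_imp_has_derivative)
qed (use q field_inside in auto)

end

section \<open>Box averages and Rellich compactness\<close>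

context bounded_open
begin

definition square :: "real \<Rightarrow> R2 \<Rightarrow> R2 set" where
  "square s x = cbox (x - vec s) (x + vec s)"

lemma mem_square: "t \<in> square s x \<longleftrightarrow> \<bar>t $ 1 - x $ 1\<bar> \<le> s \<and> \<bar>t $ 2 - x $ 2\<bar> \<le> s"
  by (auto simp: square_def mem_box_cart forall_2 abs_le_iff)

lemma square_translate: "x + z \<in> square s x \<longleftrightarrow> z \<in> square s 0"
  by (simp add: mem_square)

lemma square_sets [measurable, simp]: "square s x \<in> sets borel" by (simp add: square_def)

lemma emeasure_square_finite: "emeasure lborel (square s x) < \<infinity>"
  unfolding square_def by (rule emeasure_bounded_finite[OF bounded_cbox])

lemma measure_square:
  assumes "s > 0" shows "measure lborel (square s x) = 4 * s\<^sup>2"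
proof -
  have b: "((x + vec s) - (x - vec s)) \<bullet> b = 2 * s" "(x - vec s) \<bullet> b \<le> (x + vec s) \<bullet> b" if bB: "b \<in> Basis" for b :: R2
  proof -
    obtain i where i: "b = axis i 1" using bB by (auto simp: Basis_vec_def)
    show "((x + vec s) - (x - vec s)) \<bullet> b = 2 * s" "(x - vec s) \<bullet> b \<le> (x + vec s) \<bullet> b"
      unfolding i inner_axis using assms by auto
  qed
  have "measure lborel (square s x) = (\<Prod>b\<in>Basis. ((x + vec s) - (x - vec s)) \<bullet> b)"
    unfolding square_def using b(2) by (simp add: measure_lborel_cbox_eq)
  also have "\<dots> = (\<Prod>b\<in>(Basis :: R2 set). 2 * s)" by (rule prod.cong[OF refl b(1)])
  finally show ?thesis by (simp add: power2_eq_square)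
qed

definition box_avg :: "real \<Rightarrow> (R2 \<Rightarrow> real) \<Rightarrow> R2 \<Rightarrow> real" where
  "box_avg s \<phi> x = (\<integral>t. indicator (square s x) t * \<phi> t \<partial>lborel) / (4 * s\<^sup>2)"

lemma square_pair_measurable [measurable]:
  "(\<lambda>(x, t). indicat_real (square s x) t) \<in> borel_measurable (lborel \<Otimes>\<^sub>M lborel)"
proof -
  have c: "closed {p :: R2 \<times> R2. \<bar>snd p $ 1 - fst p $ 1\<bar> \<le> s \<and> \<bar>snd p $ 2 - fst p $ 2\<bar> \<le> s}"
    by (intro closed_Collect_conj closed_Collect_le continuous_intros)
  have e: "(\<lambda>(x, t). indicat_real (square s x) t) = indicator {p. \<bar>snd p $ 1 - fst p $ 1\<bar> \<le> s \<and> \<bar>snd p $ 2 - fst p $ 2\<bar> \<le> s}"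
    by (auto simp: fun_eq_iff indicator_def mem_square)
  have "indicat_real {p :: R2 \<times> R2. \<bar>snd p $ 1 - fst p $ 1\<bar> \<le> s \<and> \<bar>snd p $ 2 - fst p $ 2\<bar> \<le> s} \<in> borel_measurable borel"
    using c by (intro borel_measurable_indicator) auto
  then show ?thesis unfolding e borel_prod[symmetric] by (simp add: measurable_cong_sets[OF sets_pair_measure_cong[OF sets_lborel sets_lborel] refl])
qed

lemma box_avg_measurable:
  assumes [measurable]: "\<phi> \<in> borel_measurable borel"
  shows "box_avg s \<phi> \<in> borel_measurable borel"
proof -
  have "(\<lambda>(x, t). indicat_real (square s x) t * \<phi> t) = (\<lambda>p. (\<lambda>(x, t). indicat_real (square s x) t) p * \<phi> (snd p))"
    by (auto simp: fun_eq_iff)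
  also have "\<dots> \<in> borel_measurable (lborel \<Otimes>\<^sub>M lborel)" by measurable
  finally have "(\<lambda>x. \<integral>t. indicat_real (square s x) t * \<phi> t \<partial>lborel) \<in> borel_measurable lborel"
    by (rule lborel.borel_measurable_lebesgue_integral)
  then have [measurable]: "(\<lambda>x. \<integral>t. indicat_real (square s x) t * \<phi> t \<partial>lborel) \<in> borel_measurable borel" by simp
  show ?thesis unfolding box_avg_def[abs_def] by measurable
qed

text \<open>The average deviates from the value by a mean of increments, and the square of a mean is
  at most the mean of the squares, by Cauchy-Schwarz against the indicator of the square.\<close>

lemma box_avg_pointwise:
  assumes t: "test_fun \<Omega> \<phi>" and s: "s > 0"
  shows "(\<phi> x - box_avg s \<phi> x)\<^sup>2 \<le> (\<integral>z. indicator (square s 0) z * (\<phi> (x + z) - \<phi> x)\<^sup>2 \<partial>lborel) / (4 * s\<^sup>2)"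
proof -
  obtain C where C: "C \<ge> 0" "\<And>x. \<bar>\<phi> x\<bar> \<le> C" using test_fun_bounded[OF t] by metis
  note [measurable] = test_borel[OF t]
  let ?I = "indicat_real (square s 0)"
  have I2: "sqint lborel ?I" unfolding sqint_def
  proof
    have "(\<lambda>x. (norm (?I x))\<^sup>2) = ?I" by (auto simp: indicator_def)
    then show "integrable lborel (\<lambda>x. (norm (?I x))\<^sup>2)"
      using emeasure_square_finite[of s 0] by (simp add: integrable_real_indicator)
  qed measurable
  have D2: "sqint lborel (\<lambda>z. ?I z * (\<phi> (x + z) - \<phi> x))"
  proof (rule sqint_bound[OF I2, where C="2 * C"])
    have "norm (?I z * (\<phi> (x + z) - \<phi> x)) \<le> 2 * C * norm (?I z)" for z
      using C(2)[of x] C(2)[of "x + z"] by (auto simp: indicator_def)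
    then show "AE z in lborel. norm (?I z * (\<phi> (x + z) - \<phi> x)) \<le> 2 * C * norm (?I z)" by simp
  qed measurable
  have P: "integrable lborel (\<lambda>z. ?I z * \<phi> (x + z))"
  proof (rule Bochner_Integration.integrable_bound)
    show "integrable lborel (\<lambda>z. ?I z * C)" using emeasure_square_finite[of s 0] by (simp add: integrable_real_indicator)
    show "AE z in lborel. norm (?I z * \<phi> (x + z)) \<le> norm (?I z * C)" using C by (auto simp: indicator_def)
  qed measurable
  have Q: "integrable lborel (\<lambda>z. ?I z * \<phi> x)" using emeasure_square_finite[of s 0] by (simp add: integrable_real_indicator)
  have m: "(\<integral>z. ?I z \<partial>lborel) = 4 * s\<^sup>2" using measure_square[OF s, of 0] by simp
  have "(\<integral>t. indicator (square s x) t * \<phi> t \<partial>lborel) = (\<integral>z. indicator (square s x) (x + z) * \<phi> (x + z) \<partial>lborel)"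
    by (rule lborel_integral_translate[symmetric]) measurable
  also have "\<dots> = (\<integral>z. ?I z * \<phi> (x + z) \<partial>lborel)"
    by (simp add: indicator_def square_translate)
  finally have e: "(\<integral>t. indicator (square s x) t * \<phi> t \<partial>lborel) = (\<integral>z. ?I z * \<phi> (x + z) \<partial>lborel)" .
  have "(\<integral>z. ?I z * (?I z * (\<phi> (x + z) - \<phi> x)) \<partial>lborel) = (\<integral>z. ?I z * \<phi> (x + z) - ?I z * \<phi> x \<partial>lborel)"
    by (intro Bochner_Integration.integral_cong) (auto simp: indicator_def)
  also have "\<dots> = (\<integral>z. ?I z * \<phi> (x + z) \<partial>lborel) - (4 * s\<^sup>2) * \<phi> x"
    using Bochner_Integration.integral_diff[OF P Q] m by simp
  finally have d0: "(\<integral>z. ?I z * (?I z * (\<phi> (x + z) - \<phi> x)) \<partial>lborel) = (\<integral>z. ?I z * \<phi> (x + z) \<partial>lborel) - (4 * s\<^sup>2) * \<phi> x" .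
  have d: "(box_avg s \<phi> x - \<phi> x) * (4 * s\<^sup>2) = (\<integral>z. ?I z * (?I z * (\<phi> (x + z) - \<phi> x)) \<partial>lborel)"
  proof -
    have "(A / p - b) * p = A - p * b" if "p \<noteq> 0" for A p b :: real using that by (simp add: field_simps)
    from this[of "4 * s\<^sup>2"] show ?thesis using s unfolding box_avg_def e d0 by simp
  qed
  have "((box_avg s \<phi> x - \<phi> x) * (4 * s\<^sup>2))\<^sup>2 \<le> (n2 lborel ?I * n2 lborel (\<lambda>z. ?I z * (\<phi> (x + z) - \<phi> x)))\<^sup>2"
    unfolding d using L2_mult_bound[OF I2 D2] by (rule abs_le_square_iff[THEN iffD1, OF order_trans]) simp
  also have "\<dots> = (4 * s\<^sup>2) * (n2 lborel (\<lambda>z. ?I z * (\<phi> (x + z) - \<phi> x)))\<^sup>2"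
  proof -
    have "(n2 lborel ?I)\<^sup>2 = (\<integral>z. ?I z \<partial>lborel)" unfolding n2_sq by (intro Bochner_Integration.integral_cong) (auto simp: indicator_def)
    then show ?thesis using m by (simp add: power_mult_distrib)
  qed
  also have "(n2 lborel (\<lambda>z. ?I z * (\<phi> (x + z) - \<phi> x)))\<^sup>2 = (\<integral>z. ?I z * (\<phi> (x + z) - \<phi> x)\<^sup>2 \<partial>lborel)"
    unfolding n2_sq by (intro Bochner_Integration.integral_cong) (auto simp: indicator_def)
  finally have le: "((box_avg s \<phi> x - \<phi> x) * (4 * s\<^sup>2))\<^sup>2 \<le> (4 * s\<^sup>2) * (\<integral>z. ?I z * (\<phi> (x + z) - \<phi> x)\<^sup>2 \<partial>lborel)" .
  have gen: "d\<^sup>2 * p \<le> I" if le: "(d * p)\<^sup>2 \<le> p * I" and p: "p > 0" for d p I :: real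
  proof -
    have "p * (d\<^sup>2 * p) \<le> p * I" using le by (simp add: power2_eq_square mult_ac)
    then show ?thesis using p by simp
  qed
  have "(box_avg s \<phi> x - \<phi> x)\<^sup>2 * (4 * s\<^sup>2) \<le> (\<integral>z. ?I z * (\<phi> (x + z) - \<phi> x)\<^sup>2 \<partial>lborel)"
    by (rule gen[OF le]) (use s in simp)
  then show ?thesis using s by (simp add: pos_le_divide_eq power2_commute)
qed

text \<open>The pointwise bound is integrated in \<open>x\<close> and the order of integration
  exchanged, in nonnegative extended integrals. For a fixed shift \<open>z\<close> the translation
  estimate applies, with \<open>norm z \<le> 2 * s\<close> from the sum of the coordinates.\<close>

lemma box_avg_L2:
  assumes t: "test_fun \<Omega> \<phi>" and s: "s > 0"
  shows "sqint M (\<lambda>x. \<phi> x - box_avg s \<phi> x)" "n2 M (\<lambda>x. \<phi> x - box_avg s \<phi> x) \<le> 2 * s * n2 M (cgrad \<phi>)"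
proof -
  note [measurable] = test_borel[OF t]
  obtain C where C: "C \<ge> 0" "\<And>x. \<bar>\<phi> x\<bar> \<le> C" using test_fun_bounded[OF t] by metis
  have am [measurable]: "box_avg s \<phi> \<in> borel_measurable borel" by (rule box_avg_measurable) measurable
  let ?J = "indicat_real (square s 0)"
  let ?G = "(n2 M (cgrad \<phi>))\<^sup>2"
  have Im: "integrable lborel (\<lambda>z. ?J z * (\<phi> (x + z) - \<phi> x)\<^sup>2)" for x
  proof (rule Bochner_Integration.integrable_bound)
    show "integrable lborel (\<lambda>z. ?J z * (2 * C)\<^sup>2)" using emeasure_square_finite[of s 0] by (simp add: integrable_real_indicator)
    have "(\<phi> (x + z) - \<phi> x)\<^sup>2 \<le> (2 * C)\<^sup>2" for z
      unfolding abs_le_square_iff[symmetric] using C(2)[of x] C(2)[of "x + z"] C(1) by linarith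
    then show "AE z in lborel. norm (?J z * (\<phi> (x + z) - \<phi> x)\<^sup>2) \<le> norm (?J z * (2 * C)\<^sup>2)" by (auto simp: indicator_def)
  qed measurable
  have norm_z: "norm z \<le> 2 * s" if "z \<in> square s 0" for z :: R2
    using that norm_le_l1_cart[of z] by (simp add: mem_square sum_2)
  have inner: "(\<integral>\<^sup>+x. ennreal (?J z * (\<phi> (x + z) - \<phi> x)\<^sup>2) \<partial>lborel) \<le> ennreal ((2 * s)\<^sup>2 * ?G) * indicator (square s 0) z" for z
  proof (cases "z \<in> square s 0")
    case True
    have "(\<integral>\<^sup>+x. ennreal (?J z * (\<phi> (x + z) - \<phi> x)\<^sup>2) \<partial>lborel) = ennreal (\<integral>x. (\<phi> (x + z) - \<phi> x)\<^sup>2 \<partial>lborel)"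
      using True nn_integral_eq_integral[OF translation_estimate(1)[OF t, of z]] by simp
    also have "\<dots> \<le> ennreal ((2 * s)\<^sup>2 * ?G)"
    proof (rule ennreal_leI)
      have "(norm z)\<^sup>2 \<le> (2 * s)\<^sup>2" by (intro power_mono norm_z True) simp
      then show "(\<integral>x. (\<phi> (x + z) - \<phi> x)\<^sup>2 \<partial>lborel) \<le> (2 * s)\<^sup>2 * ?G"
        by (intro order_trans[OF translation_estimate_n2[OF t]] mult_right_mono) auto
    qed
    finally show ?thesis using True by simp
  qed simp
  have "(\<integral>\<^sup>+x. ennreal ((\<phi> x - box_avg s \<phi> x)\<^sup>2) \<partial>lborel) \<le> (\<integral>\<^sup>+x. (\<integral>\<^sup>+z. ennreal (?J z * (\<phi> (x + z) - \<phi> x)\<^sup>2) \<partial>lborel) * ennreal (1 / (4 * s\<^sup>2)) \<partial>lborel)"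
  proof (rule nn_integral_mono)
    fix x
    have "ennreal ((\<phi> x - box_avg s \<phi> x)\<^sup>2) \<le> ennreal ((\<integral>z. ?J z * (\<phi> (x + z) - \<phi> x)\<^sup>2 \<partial>lborel) * (1 / (4 * s\<^sup>2)))"
      using box_avg_pointwise[OF t s, of x] by (intro ennreal_leI) simp
    also have "\<dots> = ennreal (\<integral>z. ?J z * (\<phi> (x + z) - \<phi> x)\<^sup>2 \<partial>lborel) * ennreal (1 / (4 * s\<^sup>2))"
      by (rule ennreal_mult) (auto intro!: integral_nonneg_AE)
    also have "ennreal (\<integral>z. ?J z * (\<phi> (x + z) - \<phi> x)\<^sup>2 \<partial>lborel) = (\<integral>\<^sup>+z. ennreal (?J z * (\<phi> (x + z) - \<phi> x)\<^sup>2) \<partial>lborel)"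
      by (rule nn_integral_eq_integral[OF Im, symmetric]) auto
    finally show "ennreal ((\<phi> x - box_avg s \<phi> x)\<^sup>2) \<le> (\<integral>\<^sup>+z. ennreal (?J z * (\<phi> (x + z) - \<phi> x)\<^sup>2) \<partial>lborel) * ennreal (1 / (4 * s\<^sup>2))" .
  qed
  also have "\<dots> = (\<integral>\<^sup>+x. (\<integral>\<^sup>+z. ennreal (?J z * (\<phi> (x + z) - \<phi> x)\<^sup>2) \<partial>lborel) \<partial>lborel) * ennreal (1 / (4 * s\<^sup>2))"
    by (rule nn_integral_multc) measurable
  also have "(\<integral>\<^sup>+x. (\<integral>\<^sup>+z. ennreal (?J z * (\<phi> (x + z) - \<phi> x)\<^sup>2) \<partial>lborel) \<partial>lborel)
     = (\<integral>\<^sup>+z. (\<integral>\<^sup>+x. ennreal (?J z * (\<phi> (x + z) - \<phi> x)\<^sup>2) \<partial>lborel) \<partial>lborel)"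
    by (rule lborel_pair.Fubini') measurable
  also have "\<dots> \<le> (\<integral>\<^sup>+z. ennreal ((2 * s)\<^sup>2 * ?G) * indicator (square s 0) z \<partial>lborel)"
    by (rule nn_integral_mono) (rule inner)
  also have "\<dots> = ennreal ((2 * s)\<^sup>2 * ?G) * emeasure lborel (square s 0)" by (rule nn_integral_cmult_indicator) simp
  also have "emeasure lborel (square s 0) = ennreal (4 * s\<^sup>2)"
    using measure_square[OF s, of 0] emeasure_eq_ennreal_measure[of lborel "square s 0"] emeasure_square_finite[of s 0] by simp
  also have "ennreal ((2 * s)\<^sup>2 * ?G) * ennreal (4 * s\<^sup>2) * ennreal (1 / (4 * s\<^sup>2)) = ennreal ((2 * s)\<^sup>2 * ?G)"
    using s by (simp add: ennreal_mult[symmetric])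
  finally have nn: "(\<integral>\<^sup>+x. ennreal ((\<phi> x - box_avg s \<phi> x)\<^sup>2) \<partial>lborel) \<le> ennreal ((2 * s)\<^sup>2 * ?G)"
    by (simp add: mult_right_mono)
  have nnM: "(\<integral>\<^sup>+x. ennreal ((norm (\<phi> x - box_avg s \<phi> x))\<^sup>2) \<partial>M) \<le> ennreal ((2 * s)\<^sup>2 * ?G)"
  proof -
    have "(\<integral>\<^sup>+x. ennreal ((norm (\<phi> x - box_avg s \<phi> x))\<^sup>2) \<partial>M) = (\<integral>\<^sup>+x. ennreal ((\<phi> x - box_avg s \<phi> x)\<^sup>2) * indicator \<Omega> x \<partial>lebesgue)"
      by (subst nn_integral_restrict_space) auto
    also have "\<dots> \<le> (\<integral>\<^sup>+x. ennreal ((\<phi> x - box_avg s \<phi> x)\<^sup>2) \<partial>lebesgue)"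
      by (rule nn_integral_mono) (auto simp: indicator_def)
    also have "\<dots> = (\<integral>\<^sup>+x. ennreal ((\<phi> x - box_avg s \<phi> x)\<^sup>2) \<partial>lborel)" by (rule nn_integral_completion)
    finally show ?thesis using nn by (rule order_trans)
  qed
  have mM: "(\<lambda>x. \<phi> x - box_avg s \<phi> x) \<in> borel_measurable M" by (rule borel_imp_M) measurable
  have int: "integrable M (\<lambda>x. (norm (\<phi> x - box_avg s \<phi> x))\<^sup>2)"
  proof (rule integrableI_bounded)
    show "(\<lambda>x. (norm (\<phi> x - box_avg s \<phi> x))\<^sup>2) \<in> borel_measurable M" using mM by measurable
    show "(\<integral>\<^sup>+x. ennreal (norm ((norm (\<phi> x - box_avg s \<phi> x))\<^sup>2)) \<partial>M) < \<infinity>"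
      using le_less_trans[OF nnM ennreal_less_top] by simp
  qed
  then show "sqint M (\<lambda>x. \<phi> x - box_avg s \<phi> x)" using mM by (simp add: sqint_def)
  have "(n2 M (\<lambda>x. \<phi> x - box_avg s \<phi> x))\<^sup>2 \<le> (2 * s)\<^sup>2 * ?G"
    using nnM unfolding nn_integral_eq_integral[OF int AE_I2[OF zero_le_power2]] n2_sq
    by (subst (asm) ennreal_le_iff) auto
  then have "(n2 M (\<lambda>x. \<phi> x - box_avg s \<phi> x))\<^sup>2 \<le> (2 * s * n2 M (cgrad \<phi>))\<^sup>2" by (simp add: power_mult_distrib)
  then show "n2 M (\<lambda>x. \<phi> x - box_avg s \<phi> x) \<le> 2 * s * n2 M (cgrad \<phi>)"
    by (rule power2_le_imp_le) (use s in simp)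
qed

text \<open>Box averages of the sequence converge pointwise by weak convergence.\<close>

lemma rellich_test:
  assumes t: "\<And>n. test_fun \<Omega> (\<phi> n)" and C: "\<And>n. n2 M (cgrad (\<phi> n)) \<le> C"
    and w: "\<And>k. sqint M k \<Longrightarrow> (\<lambda>n. \<integral>x. \<phi> n x * k x \<partial>M) \<longlonglongrightarrow> 0"
  shows "(\<lambda>n. n2 M (\<phi> n)) \<longlonglongrightarrow> 0"
proof (rule LIMSEQ_I)
  fix r :: real assume r: "r > 0"
  have C0: "C \<ge> 0" using C[of 0] n2_nonneg[of M "cgrad (\<phi> 0)"] by linarith
  \<comment> \<open>Makes the averaging error \<open>2 * s * C\<close> at most \<open>r / 2\<close>;
    the summand 1 admits \<open>C = 0\<close>.\<close>
  define s where "s = r / (4 * (C + 1))"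
  have s: "s > 0" using r C0 by (simp add: s_def)
  have sC: "2 * s * C \<le> r / 2"
  proof -
    have "2 * s * C \<le> 2 * s * (C + 1)" using s by simp
    also have "\<dots> = r / 2" using C0 by (simp add: s_def field_simps)
    finally show ?thesis .
  qed
  have P: "n2 M (\<phi> n) \<le> poincare_const * C" for n
    by (rule order_trans[OF poincare_const(2)[OF t]]) (intro mult_left_mono C less_imp_le[OF poincare_const(1)])
  have km: "(\<lambda>t. indicat_real (square s x) t) \<in> borel_measurable M" for x by (rule borel_imp_M) measurable
  have k: "sqint M (indicat_real (square s x))" for x
    by (rule sqint_bounded_finite[OF finite_M km, where C=1]) (auto simp: indicator_def)
  have kn: "n2 M (indicat_real (square s x)) \<le> sqrt (measure M \<Omega>)" for x
  proof -
    have "n2 M (indicat_real (square s x)) \<le> 1 * n2 M (\<lambda>x. 1::real)"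
      by (rule n2_mono[OF sqint_const_finite[OF finite_M] km]) (auto simp: indicator_def)
    then show ?thesis by (simp add: n2_def)
  qed
  have av: "box_avg s (\<phi> n) x = (\<integral>t. \<phi> n t * indicat_real (square s x) t \<partial>M) / (4 * s\<^sup>2)" for n x
  proof -
    have [measurable]: "\<phi> n \<in> borel_measurable borel" by (rule test_borel[OF t])
    have "(\<integral>t. \<phi> n t * indicat_real (square s x) t \<partial>M) = (\<integral>t. \<phi> n t * indicat_real (square s x) t \<partial>lborel)"
      by (rule integral_M_lborel) (auto simp: test_fun_vanish_outside(1)[OF t])
    then show ?thesis by (simp add: box_avg_def mult.commute)
  qed
  have lim: "(\<lambda>n. box_avg s (\<phi> n) x) \<longlonglongrightarrow> 0" for x
    unfolding av using tendsto_divide[OF w[OF k[of x]] tendsto_const, of "4 * s\<^sup>2"] s by simp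
  define D where "D = poincare_const * C * sqrt (measure M \<Omega>) / (4 * s\<^sup>2)"
  have bd: "\<bar>box_avg s (\<phi> n) x\<bar> \<le> D" for n x
  proof -
    have "\<bar>\<integral>t. \<phi> n t * indicat_real (square s x) t \<partial>M\<bar> \<le> n2 M (\<phi> n) * n2 M (indicat_real (square s x))"
      by (rule L2_mult_bound[OF test_sqint(1)[OF t] k])
    also have "\<dots> \<le> (poincare_const * C) * sqrt (measure M \<Omega>)"
      by (intro mult_mono P kn) (use C0 poincare_const(1) in auto)
    finally show ?thesis unfolding av D_def abs_divide using s by (simp add: divide_right_mono)
  qed
  have am: "box_avg s (\<phi> n) \<in> borel_measurable M" for n
    by (rule borel_imp_M[OF box_avg_measurable[OF test_borel(1)[OF t]]])
  have "(\<lambda>n. \<integral>x. (norm (box_avg s (\<phi> n) x))\<^sup>2 \<partial>M) \<longlonglongrightarrow> (\<integral>x. 0 \<partial>M)"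
  proof (rule integral_dominated_convergence)
    show "integrable M (\<lambda>x. D\<^sup>2)" by (rule finite_measure.integrable_const[OF finite_M])
    note am [measurable]
    show "(\<lambda>x. (norm (box_avg s (\<phi> n) x))\<^sup>2) \<in> borel_measurable M" for n by measurable
    show "AE x in M. (\<lambda>n. (norm (box_avg s (\<phi> n) x))\<^sup>2) \<longlonglongrightarrow> 0"
      by (rule AE_I2, rule tendsto_eq_rhs[OF tendsto_power[OF tendsto_norm[OF lim]]]) simp
    show "AE x in M. norm ((norm (box_avg s (\<phi> n) x))\<^sup>2) \<le> D\<^sup>2" for n
      by (rule AE_I2) (use power_mono[OF bd, where n=2] in simp)
  qed auto
  then have "(\<lambda>n. sqrt (\<integral>x. (norm (box_avg s (\<phi> n) x))\<^sup>2 \<partial>M)) \<longlonglongrightarrow> sqrt 0"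
    by (intro tendsto_real_sqrt) simp
  then have "(\<lambda>n. n2 M (box_avg s (\<phi> n))) \<longlonglongrightarrow> 0" by (simp add: n2_def)
  from LIMSEQ_D[OF this half_gt_zero[OF r]] obtain N where N: "\<And>n. n \<ge> N \<Longrightarrow> n2 M (box_avg s (\<phi> n)) < r / 2" by auto
  have "n2 M (\<phi> n) < r" if n: "n \<ge> N" for n
  proof -
    have sa: "sqint M (box_avg s (\<phi> n))"
      by (rule sqint_bounded_finite[OF finite_M am, where C=D]) (use bd in simp)
    have "n2 M (\<phi> n) \<le> n2 M (box_avg s (\<phi> n)) + n2 M (\<lambda>x. \<phi> n x - box_avg s (\<phi> n) x)"
      by (rule n2_le_add_diff[OF test_sqint(1)[OF t] sa])
    also have "n2 M (\<lambda>x. \<phi> n x - box_avg s (\<phi> n) x) \<le> 2 * s * n2 M (cgrad (\<phi> n))" by (rule box_avg_L2(2)[OF t s])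
    also have "\<dots> \<le> 2 * s * C" by (intro mult_left_mono C) (use s in simp)
    finally show ?thesis using N[OF n] sC by linarith
  qed
  then show "\<exists>no. \<forall>n\<ge>no. norm (n2 M (\<phi> n) - 0) < r" by auto
qed

text \<open>Each \<open>u n\<close> is replaced by a test function at distance below
  \<open>1 / (n + 1)\<close> in function and gradient; this raises the gradient bound by at most 1
  and preserves weak convergence to zero.\<close>

lemma rellich:
  assumes h: "\<And>n. H1pair (u n) (g n)" and C: "\<And>n. n2 M (g n) \<le> C"
    and w: "\<And>k. sqint M k \<Longrightarrow> (\<lambda>n. \<integral>x. u n x * k x \<partial>M) \<longlonglongrightarrow> 0"
  shows "(\<lambda>n. n2 M (u n)) \<longlonglongrightarrow> 0"
proof -
  define \<epsilon> where "\<epsilon> n = inverse (real (Suc n))" for n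
  have e0: "\<epsilon> n > 0" "\<epsilon> n \<le> 1" for n by (auto simp: \<epsilon>_def inverse_le_1_iff)
  have e_lim: "\<epsilon> \<longlonglongrightarrow> 0" unfolding \<epsilon>_def by (rule LIMSEQ_inverse_real_of_nat)
  have "\<exists>f. test_fun \<Omega> f \<and> n2 M (\<lambda>x. u n x - f x) < \<epsilon> n \<and> n2 M (\<lambda>x. g n x - cgrad f x) < \<epsilon> n" for n
  proof -
    obtain \<phi> where phi: "\<And>j. test_fun \<Omega> (\<phi> j)" "(\<lambda>j. n2 M (\<lambda>x. u n x - \<phi> j x)) \<longlonglongrightarrow> 0"
      "(\<lambda>j. n2 M (\<lambda>x. g n x - cgrad (\<phi> j) x)) \<longlonglongrightarrow> 0" using H1pair_approx[OF h[of n]] by blast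
    obtain N1 where N1: "\<And>j. j \<ge> N1 \<Longrightarrow> n2 M (\<lambda>x. u n x - \<phi> j x) < \<epsilon> n" using LIMSEQ_D[OF phi(2) e0(1)[of n]] by auto
    obtain N2 where N2: "\<And>j. j \<ge> N2 \<Longrightarrow> n2 M (\<lambda>x. g n x - cgrad (\<phi> j) x) < \<epsilon> n" using LIMSEQ_D[OF phi(3) e0(1)[of n]] by auto
    show ?thesis using phi(1) N1[of "max N1 N2"] N2[of "max N1 N2"] by (intro exI[of _ "\<phi> (max N1 N2)"]) simp
  qed
  then have "\<exists>\<phi>. \<forall>n. test_fun \<Omega> (\<phi> n) \<and> n2 M (\<lambda>x. u n x - \<phi> n x) < \<epsilon> n \<and> n2 M (\<lambda>x. g n x - cgrad (\<phi> n) x) < \<epsilon> n"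
    by (intro choice allI)
  then obtain \<phi> where phi: "\<And>n. test_fun \<Omega> (\<phi> n)" "\<And>n. n2 M (\<lambda>x. u n x - \<phi> n x) < \<epsilon> n" "\<And>n. n2 M (\<lambda>x. g n x - cgrad (\<phi> n) x) < \<epsilon> n"
    by blast
  note sq = H1pair_sqint[OF h]
  have "(\<lambda>n. n2 M (\<phi> n)) \<longlonglongrightarrow> 0"
  proof (rule rellich_test[OF phi(1)])
    fix n
    have "n2 M (cgrad (\<phi> n)) \<le> n2 M (g n) + n2 M (\<lambda>x. cgrad (\<phi> n) x - g n x)" by (rule n2_le_add_diff[OF test_sqint(2)[OF phi(1)] sq(2)])
    also have "n2 M (\<lambda>x. cgrad (\<phi> n) x - g n x) = n2 M (\<lambda>x. g n x - cgrad (\<phi> n) x)" by (rule n2_minus)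
    finally show "n2 M (cgrad (\<phi> n)) \<le> C + 1" using C[of n] phi(3)[of n] e0(2)[of n] by linarith
  next
    fix k :: "R2 \<Rightarrow> real" assume k: "sqint M k"
    have "\<bar>(\<integral>x. (u n x - \<phi> n x) * k x \<partial>M)\<bar> \<le> \<epsilon> n * n2 M k" for n
      by (rule order_trans[OF L2_mult_bound[OF sqint_diff[OF sq(1) test_sqint(1)[OF phi(1)]] k]])
         (intro mult_right_mono less_imp_le[OF phi(2)] n2_nonneg)
    moreover have "(\<lambda>n. \<epsilon> n * n2 M k) \<longlonglongrightarrow> 0" using tendsto_mult_right[OF e_lim, of "n2 M k"] by simp
    ultimately have "(\<lambda>n. \<integral>x. (u n x - \<phi> n x) * k x \<partial>M) \<longlonglongrightarrow> 0" by (rule LIMSEQ_null_le)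
    from tendsto_diff[OF w[OF k] this]
    have "(\<lambda>n. (\<integral>x. u n x * k x \<partial>M) - (\<integral>x. (u n x - \<phi> n x) * k x \<partial>M)) \<longlonglongrightarrow> 0" by simp
    moreover have "(\<integral>x. u n x * k x \<partial>M) - (\<integral>x. (u n x - \<phi> n x) * k x \<partial>M) = (\<integral>x. \<phi> n x * k x \<partial>M)" for n
      using sqint_mult[OF sq(1)[of n] k] sqint_mult[OF test_sqint(1)[OF phi(1)[of n]] k] by (simp add: left_diff_distrib)
    ultimately show "(\<lambda>n. \<integral>x. \<phi> n x * k x \<partial>M) \<longlonglongrightarrow> 0" by simp
  qed
  from tendsto_add[OF this e_lim] have l: "(\<lambda>n. n2 M (\<phi> n) + \<epsilon> n) \<longlonglongrightarrow> 0" by simp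
  have "\<bar>n2 M (u n)\<bar> \<le> n2 M (\<phi> n) + \<epsilon> n" for n
    using n2_le_add_diff[OF sq(1) test_sqint(1)[OF phi(1)], of n n] phi(2)[of n] by simp
  then show ?thesis using l by (rule LIMSEQ_null_le)
qed

end

section \<open>The plane as the complex line, and weakly divergence free fields\<close>

definition cz :: "R2 \<Rightarrow> complex" where "cz x = Complex (x $ 1) (x $ 2)"
definition vc :: "complex \<Rightarrow> R2" where "vc w = (\<chi> i. if i = 1 then Re w else Im w)"
definition rot :: "R2 \<Rightarrow> R2" where "rot v = (\<chi> i. if i = 1 then - v $ 2 else v $ 1)"

lemma cz_simps [simp]: "Re (cz x) = x $ 1" "Im (cz x) = x $ 2" by (simp_all add: cz_def)
lemma vc_nth [simp]: "vc w $ 1 = Re w" "vc w $ 2 = Im w" by (simp_all add: vc_def)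
lemma rot_nth [simp]: "rot v $ 1 = - v $ 2" "rot v $ 2 = v $ 1" by (simp_all add: rot_def)

lemma inner_2: "(x :: R2) \<bullet> y = x $ 1 * y $ 1 + x $ 2 * y $ 2" by (simp add: inner_vec_def sum_2)

lemma norm_2: "(norm (x :: R2))\<^sup>2 = (x $ 1)\<^sup>2 + (x $ 2)\<^sup>2"
  by (simp only: power2_norm_eq_inner) (simp add: inner_2 power2_eq_square)

lemma norm_cz [simp]: "cmod (cz x) = norm x"
  by (rule power2_eq_imp_eq) (simp_all add: cmod_power2 norm_2)

lemma norm_vc [simp]: "norm (vc w) = cmod w"
  by (rule power2_eq_imp_eq) (simp_all add: cmod_power2 norm_2)

lemma cz_linear: "bounded_linear cz"
  by (rule bounded_linear_intro[where K=1]) (simp_all add: complex_eq_iff)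

lemma vc_linear: "bounded_linear vc"
  by (rule bounded_linear_intro[where K=1]) (simp_all add: vec_eq_iff forall_2)

lemma rot_linear: "bounded_linear rot"
proof (rule bounded_linear_intro[where K=1])
  show "norm (rot x) \<le> norm x * 1" for x
  proof -
    have "(norm (rot x))\<^sup>2 = (norm x)\<^sup>2" by (simp add: norm_2)
    then show ?thesis by simp
  qed
qed (simp_all add: vec_eq_iff forall_2)

text \<open>The Cauchy-Riemann equations in real form: for multiplication by \<open>w\<close> the
  gradient of the imaginary part is the rotated gradient of the real part, while conjugating the
  variable reverses the sign of the rotation. That sign change is the source of the jump
  \<open>c\<close> inside the ellipse.\<close>

lemma Re_mult_cz: "Re (w * cz d) = vc (cnj w) \<bullet> d" and Im_mult_cz: "Im (w * cz d) = rot (vc (cnj w)) \<bullet> d"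
  and Re_mult_cnj_cz: "Re (w * cnj (cz d)) = vc w \<bullet> d" and Im_mult_cnj_cz: "Im (w * cnj (cz d)) = - (rot (vc w) \<bullet> d)"
  by (simp_all add: inner_2 algebra_simps)

text \<open>Formally \<open>m\<close> is a rotated gradient, and its divergence vanishes because
  mixed second derivatives commute. As \<open>\<psi>\<close> is only Lipschitz this is carried out
  for difference quotients: translation invariance turns a difference of \<open>\<psi>\<close> times
  a difference of \<open>v\<close> into a mixed second difference of \<open>\<psi>\<close> against
  \<open>v\<close>, symmetric in the two directions.\<close>

lemma lipschitz_curl:
  assumes lip: "\<And>x y. norm (\<psi> x - \<psi> y) \<le> L * norm (x - y)"
    and der: "AE x in lborel. (\<psi> has_derivative (\<lambda>h. rot (m x) \<bullet> h)) (at x)"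
    and m: "m \<in> borel_measurable borel" and v: "test_fun A v"
  shows "(\<integral>x. m x \<bullet> cgrad v x \<partial>lborel) = 0"
proof -
  have pc: "continuous_on UNIV \<psi>" by (rule lipschitz_continuous[OF lip])
  note vc = test_fun_grad[OF v]
  obtain R where R: "R > 0" "\<And>x. x \<notin> cball 0 R \<Longrightarrow> v x = 0" using test_fun_bounded_support[OF v] by metis
  obtain C where C: "C \<ge> 0" "\<And>x. norm (cgrad v x) \<le> C" using test_fun_bounded[OF v] by metis
  note [measurable] = m borel_measurable_continuous_UNIV[OF pc] borel_measurable_continuous_UNIV[OF vc(2)]
    borel_measurable_continuous_UNIV[OF vc(3)]
  define e :: "2 \<Rightarrow> R2" where "e i = axis i 1" for i
  define s where "s n = inverse (real (Suc n))" for n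
  have s01: "s n > 0" "s n \<le> 1" for n by (auto simp: s_def inverse_le_1_iff)
  have ne: "norm (s n *\<^sub>R e i) \<le> 1" for n i using s01[of n] by (simp add: e_def norm_axis_1)
  define P where "P n i x = (\<psi> (x + s n *\<^sub>R e i) - \<psi> x)" for n i x
  \<comment> \<open>Backward shifts, so that moving them off \<open>v\<close> leaves forward shifts
    in both directions on \<open>\<psi>\<close>.\<close>
  define V where "V n i x = (v (x + s n *\<^sub>R (- e i)) - v x)" for n i x
  have cont: "continuous_on UNIV (\<lambda>x. \<psi> (x + a))" "continuous_on UNIV (\<lambda>x. v (x + a))" for a
    by (rule continuous_on_compose2[OF pc] continuous_on_compose2[OF vc(2)]; auto intro!: continuous_intros)+
  have vz: "v (x + a) = 0" if "norm a \<le> 1" "x \<notin> cball 0 (R + 1)" for x a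
    using that norm_triangle_ineq2[of x "-a"] by (intro R(2)) auto
  have i: "integrable lborel (\<lambda>x. \<psi> (x + a) * v (x + b))" if "norm b \<le> 1" for a b
    by (rule integrable_compact_support[where R="R + 1"]) (use vz[OF that] in \<open>auto intro!: continuous_intros cont\<close>)
  have shift: "(\<integral>x. \<psi> (x + a) * v (x + b) \<partial>lborel) = (\<integral>x. \<psi> (x + (a - b)) * v x \<partial>lborel)" for a b
  proof -
    have "(\<integral>x. \<psi> (x + (a - b)) * v x \<partial>lborel) = (\<integral>x. \<psi> ((b + x) + (a - b)) * v (b + x) \<partial>lborel)"
      by (rule lborel_integral_translate[symmetric]) measurable
    then show ?thesis by (simp add: algebra_simps)
  qed
  have PV: "(\<integral>x. P n j x * V n k x \<partial>lborel) = (\<integral>x. \<psi> (x + (s n *\<^sub>R e j + s n *\<^sub>R e k)) * v x \<partial>lborel)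
     - (\<integral>x. \<psi> (x + s n *\<^sub>R e j) * v x \<partial>lborel) - (\<integral>x. \<psi> (x + s n *\<^sub>R e k) * v x \<partial>lborel) + (\<integral>x. \<psi> x * v x \<partial>lborel)"
    and PVi: "integrable lborel (\<lambda>x. P n j x * V n k x)" for n j k
  proof -
    have nk: "norm (- s n *\<^sub>R e k) \<le> 1" using ne[of n k] by simp
    have ex: "P n j x * V n k x = (\<psi> (x + s n *\<^sub>R e j) * v (x + - s n *\<^sub>R e k) - \<psi> (x + s n *\<^sub>R e j) * v (x + 0))
      - (\<psi> (x + 0) * v (x + - s n *\<^sub>R e k) - \<psi> (x + 0) * v (x + 0))" for x
      by (simp add: P_def V_def algebra_simps)
    note ii = i[OF nk, of "s n *\<^sub>R e j"] i[of 0 "s n *\<^sub>R e j"] i[OF nk, of 0] i[of 0 0]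
    show "integrable lborel (\<lambda>x. P n j x * V n k x)" unfolding ex
      by (intro Bochner_Integration.integrable_diff ii) simp_all
    have "(\<integral>x. P n j x * V n k x \<partial>lborel) = ((\<integral>x. \<psi> (x + s n *\<^sub>R e j) * v (x + - s n *\<^sub>R e k) \<partial>lborel) - (\<integral>x. \<psi> (x + s n *\<^sub>R e j) * v (x + 0) \<partial>lborel))
      - ((\<integral>x. \<psi> (x + 0) * v (x + - s n *\<^sub>R e k) \<partial>lborel) - (\<integral>x. \<psi> (x + 0) * v (x + 0) \<partial>lborel))"
      unfolding ex using ii by simp
    then show "(\<integral>x. P n j x * V n k x \<partial>lborel) = (\<integral>x. \<psi> (x + (s n *\<^sub>R e j + s n *\<^sub>R e k)) * v x \<partial>lborel)
     - (\<integral>x. \<psi> (x + s n *\<^sub>R e j) * v x \<partial>lborel) - (\<integral>x. \<psi> (x + s n *\<^sub>R e k) * v x \<partial>lborel) + (\<integral>x. \<psi> x * v x \<partial>lborel)"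
      unfolding shift by simp
  qed
  define q where "q n x = (P n 2 x * real (Suc n)) * (V n 1 x * real (Suc n)) - (P n 1 x * real (Suc n)) * (V n 2 x * real (Suc n))" for n x
  have q0: "(\<integral>x. q n x \<partial>lborel) = 0" for n
  proof -
    have "q n x = (real (Suc n))\<^sup>2 * (P n 2 x * V n 1 x - P n 1 x * V n 2 x)" for x
      by (simp add: q_def power2_eq_square algebra_simps del: of_nat_Suc)
    moreover have "(\<integral>x. P n 2 x * V n 1 x - P n 1 x * V n 2 x \<partial>lborel) = 0"
      using PVi[of n 2 1] PVi[of n 1 2] by (simp add: PV add.commute)
    ultimately show ?thesis by simp
  qed
  have lim: "AE x in lborel. (\<lambda>n. q n x) \<longlonglongrightarrow> - (m x \<bullet> cgrad v x)"
    using der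
  proof eventually_elim
    case (elim x)
    have p: "(\<lambda>n. P n i x * real (Suc n)) \<longlonglongrightarrow> rot (m x) \<bullet> e i" for i
      unfolding P_def s_def by (rule directional_difference_quotient[OF elim])
    have vv: "(\<lambda>n. V n i x * real (Suc n)) \<longlonglongrightarrow> cgrad v x \<bullet> (- e i)" for i
      unfolding V_def s_def by (rule directional_difference_quotient[OF vc(1)])
    have "(\<lambda>n. q n x) \<longlonglongrightarrow> (rot (m x) \<bullet> e 2) * (cgrad v x \<bullet> (- e 1)) - (rot (m x) \<bullet> e 1) * (cgrad v x \<bullet> (- e 2))"
      unfolding q_def by (intro tendsto_intros p vv)
    moreover have "w \<bullet> e i = w $ i" for w i by (simp add: e_def inner_axis)
    ultimately show ?case by (simp add: inner_2[of "m x"])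
  qed
  define w where "w x = 2 * (\<bar>L\<bar> * C) * indicator (cball 0 (R + 1)) x" for x :: R2
  have w_i: "integrable lborel w"
    unfolding w_def by (intro integrable_mult_right integrable_real_indicator) (use emeasure_bounded_finite[OF bounded_cball] in auto)
  have Pb: "\<bar>P n i x * real (Suc n)\<bar> \<le> \<bar>L\<bar>" for n i x
  proof -
    have "\<bar>P n i x\<bar> \<le> \<bar>L\<bar> * norm (s n *\<^sub>R e i)"
      unfolding P_def using order_trans[OF lip[of "x + s n *\<^sub>R e i" x] mult_right_mono[OF abs_ge_self norm_ge_zero]] by simp
    also have "\<dots> = \<bar>L\<bar> * s n" using s01[of n] by (simp add: e_def norm_axis_1)
    finally have "\<bar>P n i x\<bar> * real (Suc n) \<le> \<bar>L\<bar> * s n * real (Suc n)" by (rule mult_right_mono) simp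
    also have "\<dots> = \<bar>L\<bar>" by (simp add: s_def del: of_nat_Suc)
    finally show ?thesis by (simp add: abs_mult del: of_nat_Suc)
  qed
  have Vb: "\<bar>V n i x * real (Suc n)\<bar> \<le> C" for n i x
  proof -
    have "\<bar>V n i x\<bar> \<le> C * norm (s n *\<^sub>R (- e i))"
      unfolding V_def using test_fun_lipschitz[OF v C(2), of "x + s n *\<^sub>R (- e i)" x] by simp
    also have "\<dots> = C * s n" using s01[of n] by (simp add: e_def norm_axis_1)
    finally have "\<bar>V n i x\<bar> * real (Suc n) \<le> C * s n * real (Suc n)" by (rule mult_right_mono) simp
    also have "\<dots> = C" by (simp add: s_def del: of_nat_Suc)
    finally show ?thesis by (simp add: abs_mult del: of_nat_Suc)
  qed
  have bd: "norm (q n x) \<le> w x" for n x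
  proof (cases "x \<in> cball 0 (R + 1)")
    case True
    have "\<bar>q n x\<bar> \<le> \<bar>P n 2 x * real (Suc n)\<bar> * \<bar>V n 1 x * real (Suc n)\<bar> + \<bar>P n 1 x * real (Suc n)\<bar> * \<bar>V n 2 x * real (Suc n)\<bar>"
      unfolding q_def by (rule order_trans[OF abs_triangle_ineq4]) (simp add: abs_mult)
    also have "\<dots> \<le> \<bar>L\<bar> * C + \<bar>L\<bar> * C" by (intro add_mono mult_mono Pb Vb) (use C in auto)
    finally show ?thesis using True by (simp add: w_def mult_ac)
  next
    case False
    have "V n i x = 0" for i
      unfolding V_def using vz[OF _ False, of "s n *\<^sub>R (- e i)"] vz[OF _ False, of 0] ne[of n i] by simp
    then show ?thesis using False by (simp add: q_def w_def)
  qed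
  have q_m: "q n \<in> borel_measurable lborel" for n unfolding q_def P_def V_def by measurable
  have "(\<lambda>n. \<integral>x. q n x \<partial>lborel) \<longlonglongrightarrow> (\<integral>x. - (m x \<bullet> cgrad v x) \<partial>lborel)"
    by (rule integral_dominated_convergence[OF _ q_m w_i lim]) (use bd in auto)
  then show ?thesis by (simp add: q0 LIMSEQ_const_iff)
qed

section \<open>The real potential and its stream function\<close>

context ellipse_field
begin

abbreviation inside :: "R2 \<Rightarrow> bool" where "inside x \<equiv> Q (cz x) \<le> 1"

definition pot :: "R2 \<Rightarrow> R2 \<Rightarrow> real" where "pot c x = Re (cz c * field (cz x))"
definition stream :: "R2 \<Rightarrow> R2 \<Rightarrow> real" where "stream c x = Im (cz c * field (cz x))"
definition grad_in :: "R2 \<Rightarrow> R2" where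
  "grad_in c = (1/2) *\<^sub>R c - (1 / (2 * (\<tau> + 2))) *\<^sub>R vc (\<kappa> * cnj (cz c))"
definition grad :: "R2 \<Rightarrow> R2 \<Rightarrow> R2" where
  "grad c x = (if inside x then grad_in c else vc (cnj (cz c * dfield (cz x))))"

lemma Qcz_continuous: "continuous_on UNIV (\<lambda>x. Q (cz x))"
  by (rule continuous_on_compose2[OF Q_continuous linear_continuous_on[OF cz_linear]]) auto

lemma fieldcz_continuous: "continuous_on UNIV (\<lambda>x. field (cz x))"
  by (rule continuous_on_compose2[OF field_continuous linear_continuous_on[OF cz_linear]]) auto

lemma fieldcz_lipschitz: "cmod (cz c * field (cz x) - cz c * field (cz y)) \<le> (norm c * lip) * norm (x - y)"
proof -
  have "cmod (cz c * field (cz x) - cz c * field (cz y)) = norm c * cmod (field (cz x) - field (cz y))"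
    unfolding right_diff_distrib[symmetric] norm_mult by simp
  also have "\<dots> \<le> norm c * (lip * cmod (cz x - cz y))" by (intro mult_left_mono field_lipschitz) simp
  also have "cz x - cz y = cz (x - y)" by (simp add: complex_eq_iff)
  finally show ?thesis by (simp add: mult.assoc)
qed

lemma pot_lipschitz: "norm (pot c x - pot c y) \<le> (norm c * lip) * norm (x - y)"
  unfolding pot_def using order_trans[OF abs_Re_le_cmod fieldcz_lipschitz[of c x y]] by simp

lemma stream_lipschitz: "norm (stream c x - stream c y) \<le> (norm c * lip) * norm (x - y)"
  unfolding stream_def using order_trans[OF abs_Im_le_cmod fieldcz_lipschitz[of c x y]] by simp

text \<open>In \<open>h_in\<close> the part with \<open>z\<close> is holomorphic and obeys the
  Cauchy-Riemann rule, whereas the part with \<open>cnj z\<close> enters the imaginary part with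
  opposite sign: \<open>- c / 2\<close> instead of \<open>c / 2\<close>. The difference is the
  summand \<open>- c\<close>.\<close>

lemma grad_in_h_in: "Re (cz c * h_in (cz d)) = grad_in c \<bullet> d" "Im (cz c * h_in (cz d)) = rot (grad_in c - c) \<bullet> d"
proof -
  have T: "\<tau> + 2 \<noteq> 0" using tau by simp
  have e: "cz c * h_in (cz d) = (1/2) *\<^sub>R (cz c * cnj (cz d)) - (1 / (2 * (\<tau> + 2))) *\<^sub>R (cz c * cnj \<kappa> * cz d)"
    unfolding h_in_def scaleR_conv_of_real by (simp add: algebra_simps)
  have "vc (cz c) = c" by (simp add: vec_eq_iff forall_2)
  moreover have "cnj (cz c * cnj \<kappa>) = \<kappa> * cnj (cz c)" by simp
  ultimately have r: "Re (cz c * cnj (cz d)) = c \<bullet> d" "Im (cz c * cnj (cz d)) = - (rot c \<bullet> d)"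
    "Re (cz c * cnj \<kappa> * cz d) = vc (\<kappa> * cnj (cz c)) \<bullet> d" "Im (cz c * cnj \<kappa> * cz d) = rot (vc (\<kappa> * cnj (cz c))) \<bullet> d"
    unfolding Re_mult_cnj_cz Im_mult_cnj_cz Re_mult_cz Im_mult_cz by (simp_all add: mult.commute)
  show "Re (cz c * h_in (cz d)) = grad_in c \<bullet> d"
    unfolding e grad_in_def minus_complex.sel scaleR_complex.sel r by (simp add: inner_diff_left)
  have "rot (grad_in c - c) = (-1/2) *\<^sub>R rot c - (1 / (2 * (\<tau> + 2))) *\<^sub>R rot (vc (\<kappa> * cnj (cz c)))"
  proof -
    have "grad_in c - c = (-1/2) *\<^sub>R c - (1 / (2 * (\<tau> + 2))) *\<^sub>R vc (\<kappa> * cnj (cz c))"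
      by (simp add: grad_in_def vec_eq_iff)
    moreover have "rot (a - b) = rot a - rot b" "rot (s *\<^sub>R a) = s *\<^sub>R rot a" for a b s
      using rot_linear by (auto simp: linear_diff linear_scale bounded_linear.linear)
    ultimately show ?thesis by (simp only:)
  qed
  then show "Im (cz c * h_in (cz d)) = rot (grad_in c - c) \<bullet> d"
    unfolding e minus_complex.sel scaleR_complex.sel r by (simp add: inner_diff_left)
qed

text \<open>The form in which the field enters \<open>lipschitz_curl\<close>: the stream function is
  continuous across the ellipse because \<open>field\<close> is, although its gradient is the
  rotation of \<open>grad c - c\<close> inside and of \<open>grad c\<close> outside.\<close>

lemma derivative_off_boundary:
  assumes q: "Q (cz x) \<noteq> 1"
  shows "(pot c has_derivative (\<lambda>h. grad c x \<bullet> h)) (at x)"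
    "(stream c has_derivative (\<lambda>h. rot (grad c x - (if inside x then c else 0)) \<bullet> h)) (at x)"
proof -
  have czd: "(cz has_derivative cz) (at x)" by (rule bounded_linear_imp_has_derivative[OF cz_linear])
  obtain F where F: "(field has_derivative F) (at (cz x))"
    and Fr: "\<And>h. Re (cz c * F (cz h)) = grad c x \<bullet> h" "\<And>h. Im (cz c * F (cz h)) = rot (grad c x - (if inside x then c else 0)) \<bullet> h"
  proof (cases "inside x")
    case True
    then have q1: "Q (cz x) < 1" using q by simp
    show ?thesis by (rule that[OF field_deriv_inside[OF q1]]) (use True grad_in_h_in in \<open>auto simp: grad_def\<close>)
  next
    case False
    then have q1: "Q (cz x) > 1" by simp
    have "(field has_derivative (\<lambda>h. dfield (cz x) * h)) (at (cz x))"
      using field_deriv_outside[OF q1] by (simp add: has_field_derivative_def)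
    then show ?thesis
      by (rule that) (use False Re_mult_cz[of "cz c * dfield (cz x)"] Im_mult_cz[of "cz c * dfield (cz x)"] in \<open>simp_all add: grad_def mult.assoc\<close>)
  qed
  have d: "((\<lambda>x. cz c * field (cz x)) has_derivative (\<lambda>h. cz c * F (cz h))) (at x)"
    by (intro has_derivative_mult_right has_derivative_compose[OF czd F])
  show "(pot c has_derivative (\<lambda>h. grad c x \<bullet> h)) (at x)"
    using has_derivative_Re[OF d] unfolding Fr(1) pot_def[abs_def] .
  show "(stream c has_derivative (\<lambda>h. rot (grad c x - (if inside x then c else 0)) \<bullet> h)) (at x)"
    using has_derivative_Im[OF d] unfolding Fr(2) stream_def[abs_def] .
qed

lemma grad_measurable: "grad c \<in> borel_measurable borel"
proof -
  note [measurable] = borel_measurable_continuous_UNIV[OF Qcz_continuous] borel_measurable_continuous_UNIV[OF fieldcz_continuous]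
  have [measurable]: "vc \<in> borel_measurable borel" "cnj \<in> borel_measurable borel"
    by (intro borel_measurable_continuous_UNIV linear_continuous_on vc_linear bounded_linear_cnj)+
  show ?thesis unfolding grad_def[abs_def] dfield_def by measurable
qed

lemma grad_continuous:
  assumes q: "Q (cz x) \<noteq> 1" shows "isCont (grad c) x"
proof (cases "inside x")
  case True
  have o: "open {x. Q (cz x) < 1}" by (rule open_Collect_less[OF Qcz_continuous continuous_on_const])
  have "\<forall>\<^sub>F y in nhds x. grad c y = grad_in c"
    using eventually_nhds_in_open[OF o, of x] True q by (auto simp: grad_def elim!: eventually_mono)
  then show ?thesis by (subst isCont_cong) auto
next
  case False
  have o: "open {x. Q (cz x) > 1}" by (rule open_Collect_less[OF continuous_on_const Qcz_continuous])
  have e: "\<forall>\<^sub>F y in nhds x. grad c y = vc (cnj (cz c * dfield (cz y)))"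
    using eventually_nhds_in_open[OF o, of x] False by (auto simp: grad_def elim!: eventually_mono)
  have fc: "isCont (\<lambda>x. field (cz x)) x" using fieldcz_continuous by (simp add: continuous_on_eq_continuous_at)
  have n: "\<kappa> * (field (cz x))\<^sup>2 - 1 \<noteq> 0" using outside_denom[of "cz x"] theta False by auto
  have "isCont (\<lambda>y. vc (cnj (cz c * dfield (cz y)))) x"
    unfolding dfield_def
    by (intro bounded_linear.isCont[OF vc_linear] bounded_linear.isCont[OF bounded_linear_cnj] continuous_intros fc n)
  then show ?thesis by (subst isCont_cong[OF e])
qed

lemma inside_norm: assumes "inside x" shows "(norm x)\<^sup>2 * (\<tau> - cmod \<kappa>) \<le> 2"
proof -
  have "Re (\<kappa> * (cnj (cz x))\<^sup>2) \<le> cmod \<kappa> * (norm x)\<^sup>2"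
    using complex_Re_le_cmod[of "\<kappa> * (cnj (cz x))\<^sup>2"] by (simp add: norm_mult norm_power)
  then show ?thesis using assms by (simp add: Q_def algebra_simps)
qed

lemma potential_bounds:
  obtains C where "C \<ge> 0" "\<And>x. \<bar>pot c x\<bar> \<le> C" "\<And>x. \<bar>pot c x\<bar> * norm x \<le> C"
    "\<And>x. norm (grad c x) \<le> C" "\<And>x. norm (grad c x) * (norm x)\<^sup>2 \<le> C"
proof -
  have d0: "\<tau> - cmod \<kappa> > 0" using kappa_less by simp
  define r where "r = 1 + 2 / (\<tau> - cmod \<kappa>)"
  have r1: "r \<ge> 1" using d0 by (simp add: r_def)
  have rin: "(norm x)\<^sup>2 \<le> r" "norm x \<le> r" if "inside x" for x
  proof -
    show s: "(norm x)\<^sup>2 \<le> r" using inside_norm[OF that] d0 by (simp add: r_def field_simps)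
    show "norm x \<le> r"
    proof (rule power2_le_imp_le)
      have "r * 1 \<le> r * r" using r1 by (intro mult_left_mono) auto
      then show "(norm x)\<^sup>2 \<le> r\<^sup>2" using s by (simp add: power2_eq_square)
    qed (use r1 in simp)
  qed
  define D where "D = 2 / (1 - \<theta>)"
  have D0: "D \<ge> 0" using theta by (simp add: D_def)
  have pf: "\<bar>pot c x\<bar> \<le> norm c * cmod (field (cz x))" for x
    unfolding pot_def using abs_Re_le_cmod[of "cz c * field (cz x)"] by (simp add: norm_mult)
  have f1: "cmod (field (cz x)) \<le> r" "cmod (field (cz x)) * norm x \<le> r" for x
  proof -
    show "cmod (field (cz x)) \<le> r"
    proof (cases "inside x")
      case True
      then show ?thesis using h_in_bound[of "cz x"] rin(2)[OF True] by (simp add: field_inside)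
    next
      case False
      then have s: "small_root (cz x) (field (cz x))" by (intro field_small_root) simp
      have "(cmod (field (cz x)))\<^sup>2 * 1 \<le> (cmod (field (cz x)))\<^sup>2 * (\<tau> + 2)" using tau by (intro mult_left_mono) auto
      then have "(cmod (field (cz x)))\<^sup>2 \<le> 1\<^sup>2" using s by (simp add: small_root_def)
      then have "cmod (field (cz x)) \<le> 1" by (rule power2_le_imp_le) simp
      then show ?thesis using r1 by simp
    qed
    show "cmod (field (cz x)) * norm x \<le> r"
    proof (cases "inside x")
      case True
      have "cmod (field (cz x)) * norm x \<le> norm x * norm x" 
        using h_in_bound[of "cz x"] True by (intro mult_right_mono) (auto simp: field_inside)
      then show ?thesis using rin(1)[OF True] by (simp add: power2_eq_square)
    next
      case False
      then show ?thesis using field_decay[of "cz x"] r1 by simp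
    qed
  qed
  have g: "norm (grad c x) \<le> norm (grad_in c) + norm c * D" for x
  proof (cases "inside x")
    case True then show ?thesis using D0 by (simp add: grad_def)
  next
    case False
    then have "cmod (dfield (cz x)) \<le> D" using dfield_bound(1)[of "cz x"] by (simp add: D_def)
    then have "norm c * cmod (dfield (cz x)) \<le> norm c * D" by (intro mult_left_mono) auto
    then have "norm (grad c x) \<le> norm c * D" using False by (simp add: grad_def norm_mult)
    then show ?thesis using norm_ge_zero[of "grad_in c"] by linarith
  qed
  have g2: "norm (grad c x) * (norm x)\<^sup>2 \<le> norm (grad_in c) * r + norm c * D" for x
  proof (cases "inside x")
    case True
    have "norm (grad c x) * (norm x)\<^sup>2 \<le> norm (grad_in c) * r"
      using True rin(1)[OF True] by (simp add: grad_def mult_left_mono)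
    then show ?thesis using mult_nonneg_nonneg[OF norm_ge_zero[of c] D0] by linarith
  next
    case False
    have "norm (grad c x) * (norm x)\<^sup>2 = norm c * (cmod (dfield (cz x)) * (norm x)\<^sup>2)"
      using False by (simp add: grad_def norm_mult)
    also have "\<dots> \<le> norm c * D" using dfield_bound(2)[of "cz x"] False by (intro mult_left_mono) (auto simp: D_def)
    finally show ?thesis using r1 mult_nonneg_nonneg[OF norm_ge_zero[of "grad_in c"], of r] by linarith
  qed
  have pp: "norm c * cmod (field (cz x)) \<le> norm c * r" "norm c * (cmod (field (cz x)) * norm x) \<le> norm c * r" for x
    by (intro mult_left_mono f1 norm_ge_zero)+
  define C where "C = norm c * r + norm (grad_in c) * r + norm (grad_in c) + norm c * D"
  have nn: "norm c * r \<ge> 0" "norm (grad_in c) * r \<ge> 0" "norm (grad_in c) \<ge> 0" "norm c * D \<ge> 0" using r1 D0 by auto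
  show ?thesis
  proof (rule that[of C])
    show "C \<ge> 0" unfolding C_def using nn by linarith
    show "\<bar>pot c x\<bar> \<le> C" for x unfolding C_def using pf[of x] pp(1)[of x] nn by linarith
    show "\<bar>pot c x\<bar> * norm x \<le> C" for x
      unfolding C_def using mult_right_mono[OF pf norm_ge_zero, of x x] pp(2)[of x, folded mult.assoc] nn by linarith
    show "norm (grad c x) \<le> C" for x unfolding C_def using g[of x] nn by linarith
    show "norm (grad c x) * (norm x)\<^sup>2 \<le> C" for x unfolding C_def using g2[of x] nn by linarith
  qed
qed

end

section \<open>Ellipses of unit determinant and their depolarisation matrix\<close>

definition mtr :: "real^2^2 \<Rightarrow> real" where "mtr H = H $ 1 $ 1 + H $ 2 $ 2"

text \<open>For \<open>det H = 1\<close> the eigenvalue of this map on the i-th principal axis is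
  \<open>(1 + \<lambda>) / (mtr H + 2)\<close>, with \<open>\<lambda>\<close> the eigenvalue of
  \<open>H\<close>; this is the classical depolarisation factor, the other semi-axis divided by the
  sum of both.\<close>

definition depol :: "real^2^2 \<Rightarrow> R2 \<Rightarrow> R2" where
  "depol H c = (1 / (mtr H + 2)) *\<^sub>R (c + H *v c)"

lemma matvec_2: "(H *v x) $ i = H $ i $ 1 * x $ 1 + H $ i $ 2 * x $ 2" for H :: "real^2^2"
  by (simp add: matrix_vector_mult_def sum_2)

lemma HsetD:
  assumes "H \<in> Hset"
  shows "H $ 2 $ 1 = H $ 1 $ 2" "H $ 1 $ 1 * H $ 2 $ 2 - (H $ 1 $ 2)\<^sup>2 = 1" "H $ 1 $ 1 > 0" "H $ 2 $ 2 > 0"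
proof -
  have "transpose H $ 1 $ 2 = H $ 1 $ 2" using assms by (simp add: Hset_def)
  then show s: "H $ 2 $ 1 = H $ 1 $ 2" by (simp add: transpose_def)
  show "H $ 1 $ 1 * H $ 2 $ 2 - (H $ 1 $ 2)\<^sup>2 = 1" using assms s by (simp add: Hset_def det_2 power2_eq_square)
  have pd: "\<xi> \<noteq> 0 \<Longrightarrow> \<xi> \<bullet> (H *v \<xi>) > 0" for \<xi> using assms by (simp add: Hset_def)
  have "(axis 1 1 :: R2) \<noteq> 0" "(axis 2 1 :: R2) \<noteq> 0" by (simp_all add: axis_eq_0_iff)
  from pd[OF this(1)] pd[OF this(2)] show "H $ 1 $ 1 > 0" "H $ 2 $ 2 > 0"
    by (simp_all add: inner_2 matvec_2 axis_def)
qed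

lemma Hset_mtr: assumes "H \<in> Hset" shows "mtr H \<ge> 2"
proof -
  note h = HsetD[OF assms]
  have "(mtr H)\<^sup>2 = (H $ 1 $ 1 - H $ 2 $ 2)\<^sup>2 + 4 * (H $ 1 $ 2)\<^sup>2 + 4 * (H $ 1 $ 1 * H $ 2 $ 2 - (H $ 1 $ 2)\<^sup>2)"
    by (simp add: mtr_def power2_eq_square algebra_simps)
  then have "2\<^sup>2 \<le> (mtr H)\<^sup>2" unfolding h(2) by simp
  then show ?thesis by (rule power2_le_imp_le) (use h in \<open>simp add: mtr_def\<close>)
qed

text \<open>Minus twice the traceless part of \<open>H\<close>, read as a complex number. The
  relation \<open>(cmod (kap H))^2 = (mtr H)^2 - 4\<close> is then the condition
  \<open>det H = 1\<close>.\<close>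

definition kap :: "real^2^2 \<Rightarrow> complex" where "kap H = Complex (H $ 2 $ 2 - H $ 1 $ 1) (- 2 * H $ 1 $ 2)"

lemma ellipse_field_kap: assumes "H \<in> Hset" shows "ellipse_field (kap H) (mtr H)"
proof
  show "(cmod (kap H))\<^sup>2 = (mtr H)\<^sup>2 - 4"
    unfolding cmod_power2 using HsetD(2)[OF assms] by (simp add: kap_def mtr_def power2_eq_square algebra_simps)
qed (rule Hset_mtr[OF assms])

lemma quadratic_form_Q:
  assumes "H \<in> Hset" shows "x \<bullet> (H *v x) = ellipse_field.Q (kap H) (mtr H) (cz x)"
proof -
  interpret ellipse_field "kap H" "mtr H" by (rule ellipse_field_kap[OF assms])
  show ?thesis
    unfolding Q_def norm_cz norm_2 using HsetD(1)[OF assms]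
    by (simp add: inner_2 matvec_2 kap_def mtr_def power2_eq_square field_simps)
qed

lemma ellipse_Q: assumes "H \<in> Hset" shows "x \<in> ellipse H \<longleftrightarrow> ellipse_field.Q (kap H) (mtr H) (cz x) \<le> 1"
  by (simp add: ellipse_def quadratic_form_Q[OF assms])

lemma grad_in_depol:
  assumes "H \<in> Hset" shows "ellipse_field.grad_in (kap H) (mtr H) c = depol H c"
proof -
  interpret ellipse_field "kap H" "mtr H" by (rule ellipse_field_kap[OF assms])
  have T: "mtr H + 2 \<noteq> 0" using Hset_mtr[OF assms] by simp
  have "(2 * (mtr H + 2)) *\<^sub>R grad_in c = (mtr H + 2) *\<^sub>R c - vc (kap H * cnj (cz c))"
    using T by (simp add: grad_in_def scaleR_diff_right)
  also have "\<dots> = 2 *\<^sub>R (c + H *v c)"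
    using HsetD(1)[OF assms] by (simp add: vec_eq_iff forall_2 matvec_2 kap_def mtr_def algebra_simps)
  also have "\<dots> = (2 * (mtr H + 2)) *\<^sub>R depol H c"
  proof -
    have "2 *\<^sub>R x = (2 * t) *\<^sub>R ((1 / t) *\<^sub>R x)" if "t \<noteq> 0" for t and x :: R2 using that by simp
    from this[OF T] show ?thesis unfolding depol_def .
  qed
  finally have "(2 * (mtr H + 2)) *\<^sub>R grad_in c = (2 * (mtr H + 2)) *\<^sub>R depol H c" .
  then show ?thesis using T by simp
qed

lemma ellipse_convex:
  assumes "H \<in> Hset" shows "convex (ellipse H)"
proof (rule convexI)
  fix x y :: R2 and u v :: real assume xy: "x \<in> ellipse H" "y \<in> ellipse H" and uv: "0 \<le> u" "0 \<le> v" "u + v = 1"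
  have pos: "(x - y) \<bullet> (H *v (x - y)) \<ge> 0"
  proof (cases "x - y = 0")
    case False then show ?thesis using assms by (simp add: Hset_def less_imp_le)
  qed simp
  have v: "v = 1 - u" using uv by simp
  have "(u *\<^sub>R x + v *\<^sub>R y) \<bullet> (H *v (u *\<^sub>R x + v *\<^sub>R y)) =
    u * (x \<bullet> (H *v x)) + v * (y \<bullet> (H *v y)) - (u * v) * ((x - y) \<bullet> (H *v (x - y)))"
    unfolding v using HsetD(1)[OF assms] by (simp add: inner_2 matvec_2 algebra_simps)
  also have "\<dots> \<le> u * 1 + v * 1 - 0"
    using xy uv pos by (intro diff_mono add_mono mult_left_mono mult_nonneg_nonneg) (auto simp: ellipse_def)
  finally show "u *\<^sub>R x + v *\<^sub>R y \<in> ellipse H" using uv by (simp add: ellipse_def)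
qed

lemma ellipse_continuous: "continuous_on UNIV (\<lambda>x :: R2. x \<bullet> (H *v x))" for H :: "real^2^2"
  by (intro continuous_intros linear_continuous_on matrix_vector_mul_bounded_linear)

lemma ellipse_closed: "closed (ellipse H)"
  unfolding ellipse_def by (rule closed_Collect_le[OF ellipse_continuous continuous_on_const])

lemma ellipse_bounded:
  assumes "H \<in> Hset" obtains r where "r > 0" "ellipse H \<subseteq> cball 0 r"
proof -
  interpret ellipse_field "kap H" "mtr H" by (rule ellipse_field_kap[OF assms])
  have d: "mtr H - cmod (kap H) > 0" using kappa_less by simp
  define r where "r = 1 + 2 / (mtr H - cmod (kap H))"
  have r1: "r \<ge> 1" using d by (simp add: r_def)
  have "norm x \<le> r" if "x \<in> ellipse H" for x
  proof (rule power2_le_imp_le)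
    have "(norm x)\<^sup>2 \<le> r" using inside_norm[of x] that d by (simp add: ellipse_Q[OF assms] r_def field_simps)
    moreover have "r * 1 \<le> r * r" using r1 by (intro mult_left_mono) auto
    ultimately show "(norm x)\<^sup>2 \<le> r\<^sup>2" by (simp add: power2_eq_square)
  qed (use r1 in simp)
  then have "ellipse H \<subseteq> cball 0 r" by auto
  then show ?thesis using that[of r] r1 by simp
qed

lemma ellipse_lmeasurable: assumes "H \<in> Hset" shows "ellipse H \<in> lmeasurable"
proof -
  obtain r where "ellipse H \<subseteq> cball 0 r" using ellipse_bounded[OF assms] by metis
  then have "bounded (ellipse H)" by (rule bounded_subset[OF bounded_cball])
  then show ?thesis using ellipse_closed by (intro lmeasurable_compact) (simp add: compact_eq_bounded_closed)
qed

text \<open>Frontiers of convex sets are null, and a point where the form equals 1 lies on the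
  frontier because moving it outward along its ray increases the form.\<close>

lemma ellipse_boundary_negligible:
  assumes "H \<in> Hset" shows "negligible {x. x \<bullet> (H *v x) = 1}"
proof (rule negligible_subset[OF negligible_convex_frontier[OF ellipse_convex[OF assms]]])
  show "{x. x \<bullet> (H *v x) = 1} \<subseteq> frontier (ellipse H)"
  proof
    fix x assume "x \<in> {x. x \<bullet> (H *v x) = 1}"
    then have x: "x \<bullet> (H *v x) = 1" by simp
    have "x \<notin> interior (ellipse H)"
    proof
      assume "x \<in> interior (ellipse H)"
      then obtain e where e: "e > 0" "cball x e \<subseteq> ellipse H" unfolding mem_interior_cball by blast
      define t where "t = e / (norm x + 1)"
      have t: "t > 0" using e(1) by (simp add: t_def add_nonneg_pos)
      have "x + t *\<^sub>R x \<in> cball x e"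
      proof -
        have "t * norm x \<le> t * (norm x + 1)" using t by simp
        also have "\<dots> = e" using norm_ge_zero[of x] by (simp add: t_def add_nonneg_eq_0_iff)
        finally show ?thesis using t by (simp add: dist_norm)
      qed
      then have "x + t *\<^sub>R x \<in> ellipse H" using e(2) by blast
      moreover have "(x + t *\<^sub>R x) \<bullet> (H *v (x + t *\<^sub>R x)) = (1 + t)\<^sup>2 * (x \<bullet> (H *v x))"
        by (simp add: inner_2 matvec_2 power2_eq_square algebra_simps)
      ultimately have "(1 + t)\<^sup>2 \<le> 1" using x by (simp add: ellipse_def)
      then have "t * t + t * 2 \<le> 0" by (simp add: power2_eq_square algebra_simps)
      then show False using t mult_pos_pos[OF t t] by linarith
    qed
    moreover have "x \<in> ellipse H" using x by (simp add: ellipse_def)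
    ultimately show "x \<in> frontier (ellipse H)" unfolding frontier_def using closure_subset[of "ellipse H"] by blast
  qed
qed

lemma ellipse_measure_pos: assumes "H \<in> Hset" shows "measure lebesgue (ellipse H) > 0"
proof -
  have "open {x :: R2. x \<bullet> (H *v x) < 1}" by (rule open_Collect_less[OF ellipse_continuous continuous_on_const])
  moreover have "0 \<in> {x :: R2. x \<bullet> (H *v x) < 1}" by simp
  ultimately have "\<not> negligible {x :: R2. x \<bullet> (H *v x) < 1}" using open_not_negligible by blast
  moreover have "{x :: R2. x \<bullet> (H *v x) < 1} \<subseteq> ellipse H" by (auto simp: ellipse_def)
  ultimately have "\<not> negligible (ellipse H)" using negligible_subset by blast
  then have "measure lebesgue (ellipse H) \<noteq> 0" using ellipse_lmeasurable[OF assms] by (simp add: negligible_iff_measure)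
  then show ?thesis using measure_nonneg[of lebesgue "ellipse H"] by linarith
qed

section \<open>The potential of the rescaled ellipse\<close>

lemma AE_lborel_affine:
  fixes P :: "'a::euclidean_space \<Rightarrow> bool"
  assumes "AE z in lborel. P z" "c \<noteq> 0"
  shows "AE x in lborel. P (c *\<^sub>R (x - x0))"
proof -
  obtain N where N: "N \<in> null_sets lborel" "{z. \<not> P z} \<subseteq> N"
    using assms(1) unfolding eventually_ae_filter by auto
  let ?T = "\<lambda>x. - (c *\<^sub>R x0) + c *\<^sub>R x"
  have "AE z in density (distr lborel borel ?T) (\<lambda>_. ennreal (\<bar>c\<bar> ^ DIM('a))). z \<notin> N"
    by (subst lborel_affine[OF assms(2), of "- (c *\<^sub>R x0)", symmetric]) (rule AE_not_in[OF N(1)])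
  then have "AE z in distr lborel borel ?T. z \<notin> N"
    using assms(2) by (subst (asm) AE_density) auto
  then have "AE x in lborel. ?T x \<notin> N" by (intro AE_distrD[of ?T lborel borel]) auto
  then show ?thesis
  proof eventually_elim
    case (elim x)
    moreover have "?T x = c *\<^sub>R (x - x0)" by (simp add: algebra_simps)
    ultimately show ?case using N(2) by auto
  qed
qed

text \<open>The field \<open>k - \<chi> c\<close> is the rotated gradient of a Lipschitz stream function (the conjugate
  harmonic function outside the ellipse), hence weakly divergence free.\<close>

lemma scaled_ellipse_potential:
  assumes H: "H \<in> Hset"
  obtains K k C L where "C \<ge> 0" "\<And>r x y. r > 0 \<Longrightarrow> norm (K r x - K r y) \<le> L * norm (x - y)"
    "\<And>r. r > 0 \<Longrightarrow> AE x in lborel. (K r has_derivative (\<lambda>h. k r x \<bullet> h)) (at x)"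
    "\<And>r. r > 0 \<Longrightarrow> AE x in lborel. isCont (k r) x"
    "\<And>r. k r \<in> borel_measurable borel"
    "\<And>r x. (1 / r) *\<^sub>R (x - x0) \<in> ellipse H \<Longrightarrow> k r x = depol H c"
    "\<And>r x. r > 0 \<Longrightarrow> \<bar>K r x\<bar> \<le> C * r" "\<And>r x. r > 0 \<Longrightarrow> \<bar>K r x\<bar> * norm (x - x0) \<le> C * r\<^sup>2"
    "\<And>r x. norm (k r x) \<le> C" "\<And>r x. r > 0 \<Longrightarrow> norm (k r x) * (norm (x - x0))\<^sup>2 \<le> C * r\<^sup>2"
    "\<And>r v A. r > 0 \<Longrightarrow> test_fun A v \<Longrightarrow>
       (\<integral>x. (k r x - (if (1 / r) *\<^sub>R (x - x0) \<in> ellipse H then c else 0)) \<bullet> cgrad v x \<partial>lborel) = 0"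
proof -
  interpret ellipse_field "kap H" "mtr H" by (rule ellipse_field_kap[OF H])
  obtain C where C: "C \<ge> 0" "\<And>x. \<bar>pot c x\<bar> \<le> C" "\<And>x. \<bar>pot c x\<bar> * norm x \<le> C"
    "\<And>x. norm (grad c x) \<le> C" "\<And>x. norm (grad c x) * (norm x)\<^sup>2 \<le> C" using potential_bounds by metis
  have AE: "AE x in lborel. Q (cz x) \<noteq> 1"
  proof -
    have "{x. x \<bullet> (H *v x) = 1} \<in> null_sets lborel"
      using ellipse_boundary_negligible[OF H] closed_Collect_eq[OF ellipse_continuous[of H] continuous_on_const[of UNIV 1]]
      by (simp add: negligible_iff_null_sets null_sets_completion_iff)
    from AE_not_in[OF this] show ?thesis by eventually_elim (simp add: quadratic_form_Q[OF H])
  qed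
  define T where "T r x = (1 / r) *\<^sub>R (x - x0)" for r x
  have T_diff: "T r x - T r y = (1 / r) *\<^sub>R (x - y)" for r x y by (simp add: T_def algebra_simps)
  have T_der: "(T r has_derivative (\<lambda>h. (1 / r) *\<^sub>R h)) (at x)" for r x
    unfolding T_def by (auto intro!: derivative_eq_intros)
  have T_cont: "continuous_on UNIV (T r)" for r unfolding T_def by (intro continuous_intros)
  have AEr: "AE x in lborel. Q (cz (T r x)) \<noteq> 1" if "r > 0" for r
    unfolding T_def by (rule AE_lborel_affine[OF AE]) (use that in simp)
  \<comment> \<open>The factor \<open>r\<close> cancels the inner derivative \<open>1 / r\<close>:
    the gradient keeps its size while the potential is of order \<open>r\<close>.\<close>
  define K where "K r x = r * pot c (T r x)" for r x
  define S where "S r x = r * stream c (T r x)" for r x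
  define k where "k r x = grad c (T r x)" for r x
  let ?m = "\<lambda>r x. k r x - (if T r x \<in> ellipse H then c else 0)"
  have lip: "norm (r * F (T r x) - r * F (T r y)) \<le> (norm c * lip) * norm (x - y)"
    if r: "r > 0" and F: "\<And>x y. norm (F x - F y) \<le> (norm c * lip) * norm (x - y)" for F :: "R2 \<Rightarrow> real" and r x y
  proof -
    have "norm (r * F (T r x) - r * F (T r y)) = r * norm (F (T r x) - F (T r y))"
      unfolding right_diff_distrib[symmetric] norm_mult using r by simp
    also have "\<dots> \<le> r * ((norm c * lip) * norm (T r x - T r y))" by (intro mult_left_mono F) (use r in simp)
    also have "\<dots> = (norm c * lip) * norm (x - y)" unfolding T_diff using r by simp
    finally show ?thesis .
  qed
  have der: "((\<lambda>x. r * F (T r x)) has_derivative (\<lambda>h. g \<bullet> h)) (at x)"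
    if r: "r > 0" and F: "(F has_derivative (\<lambda>h. g \<bullet> h)) (at (T r x))" for F :: "R2 \<Rightarrow> real" and r x g
  proof -
    have "((\<lambda>x. r * F (T r x)) has_derivative (\<lambda>h. r * (g \<bullet> ((1 / r) *\<^sub>R h)))) (at x)"
      by (intro has_derivative_mult_right has_derivative_compose[OF T_der F])
    then show ?thesis using r by simp
  qed
  have norm_T: "norm (T r x) = norm (x - x0) / r" if "r > 0" for r x using that by (simp add: T_def)
  show ?thesis
  proof (rule that[of C K "norm c * lip" k])
    show "0 \<le> C" by (rule C)
    fix r :: real
    have [measurable]: "T r \<in> borel_measurable borel" by (rule borel_measurable_continuous_UNIV[OF T_cont])
    note grad_measurable[measurable]
    show km: "k r \<in> borel_measurable borel" unfolding k_def[abs_def] by measurable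
    show "k r x = depol H c" if "(1 / r) *\<^sub>R (x - x0) \<in> ellipse H" for x
      using that by (simp add: k_def T_def grad_def ellipse_Q[OF H] grad_in_depol[OF H])
    show "norm (k r x) \<le> C" for x unfolding k_def by (rule C)
    assume r: "r > 0"
    show "norm (K r x - K r y) \<le> norm c * lip * norm (x - y)" for x y
      unfolding K_def by (rule lip[OF r pot_lipschitz])
    show "AE x in lborel. (K r has_derivative (\<lambda>h. k r x \<bullet> h)) (at x)"
      using AEr[OF r] unfolding K_def[abs_def] k_def
      by eventually_elim (rule der[OF r derivative_off_boundary(1)])
    show "AE x in lborel. isCont (k r) x"
      using AEr[OF r]
    proof eventually_elim
      case (elim x)
      have "isCont (T r) x" using T_cont by (simp add: continuous_on_eq_continuous_at)
      then show ?case unfolding k_def[abs_def] by (rule isCont_o2) (rule grad_continuous[OF elim])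
    qed
    show "\<bar>K r x\<bar> \<le> C * r" for x
      unfolding K_def abs_mult using r C(2)[of "T r x"] by (simp add: mult.commute)
    show "\<bar>K r x\<bar> * norm (x - x0) \<le> C * r\<^sup>2" for x
    proof -
      have "\<bar>K r x\<bar> * norm (x - x0) = r\<^sup>2 * (\<bar>pot c (T r x)\<bar> * norm (T r x))"
        unfolding K_def abs_mult norm_T[OF r] using r by (simp add: power2_eq_square)
      also have "\<dots> \<le> r\<^sup>2 * C" by (intro mult_left_mono C) simp
      finally show ?thesis by (simp add: mult.commute)
    qed
    show "norm (k r x) * (norm (x - x0))\<^sup>2 \<le> C * r\<^sup>2" for x
    proof -
      have "norm (k r x) * (norm (x - x0))\<^sup>2 = r\<^sup>2 * (norm (grad c (T r x)) * (norm (T r x))\<^sup>2)"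
        unfolding k_def norm_T[OF r] using r by (simp add: power_divide)
      also have "\<dots> \<le> r\<^sup>2 * C" by (intro mult_left_mono C) simp
      finally show ?thesis by (simp add: mult.commute)
    qed
    show "(\<integral>x. (k r x - (if (1 / r) *\<^sub>R (x - x0) \<in> ellipse H then c else 0)) \<bullet> cgrad v x \<partial>lborel) = 0"
      if v: "test_fun A v" for v A
    proof (rule lipschitz_curl[OF _ _ _ v])
      show "norm (S r x - S r y) \<le> norm c * lip * norm (x - y)" for x y
        unfolding S_def by (rule lip[OF r stream_lipschitz])
      have "AE x in lborel. (S r has_derivative (\<lambda>h. rot (?m r x) \<bullet> h)) (at x)"
        using AEr[OF r] unfolding S_def[abs_def] k_def
      proof eventually_elim
        case (elim x)
        have "((\<lambda>x. r * stream c (T r x)) has_derivative (\<lambda>h. rot (grad c (T r x) - (if inside (T r x) then c else 0)) \<bullet> h)) (at x)"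
          by (rule der[OF r derivative_off_boundary(2)[OF elim]])
        then show ?case by (simp add: ellipse_Q[OF H])
      qed
      then show "AE x in lborel. (S r has_derivative (\<lambda>h. rot (k r x - (if (1 / r) *\<^sub>R (x - x0) \<in> ellipse H then c else 0)) \<bullet> h)) (at x)"
        unfolding T_def .
      have "T r -` ellipse H \<inter> space borel \<in> sets borel"
        by (rule measurable_sets[of "T r" borel borel]) (use ellipse_closed in auto)
      then have [measurable]: "Measurable.pred borel (\<lambda>x. T r x \<in> ellipse H)" by (simp add: pred_def vimage_def)
      note km[measurable]
      have "(\<lambda>x. ?m r x) \<in> borel_measurable borel" by measurable
      then show "(\<lambda>x. k r x - (if (1 / r) *\<^sub>R (x - x0) \<in> ellipse H then c else 0)) \<in> borel_measurable borel"
        unfolding T_def .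
    qed
  qed
qed

section \<open>The expansion of the cost\<close>

lemma LIMSEQ_bounded_by:
  fixes s :: "nat \<Rightarrow> real"
  assumes "s \<longlonglongrightarrow> l" obtains C where "C \<ge> 0" "\<And>n. \<bar>s n\<bar> \<le> C"
proof -
  have "Bseq s" by (rule convergent_imp_Bseq) (use assms in \<open>auto simp: convergent_def\<close>)
  then obtain C where "C > 0" "\<And>n. norm (s n) \<le> C" unfolding Bseq_def by blast
  then show ?thesis by (intro that[of C]) auto
qed

text \<open>With the depolarisation matrix \<open>N\<close> in the role of \<open>depol H\<close>,
  the denominator is \<open>mtr H + 2\<close> times the determinant of
  \<open>a0 + (b - a0) * N\<close>; the numerator comes from solving for \<open>c\<close>
  explicitly.\<close>

definition dlim :: "real^2^2 \<Rightarrow> real \<Rightarrow> real \<Rightarrow> R2 \<Rightarrow> R2 \<Rightarrow> real" where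
  "dlim H a0 b u v = - (b - a0) * (u \<bullet> v)
     + (b - a0)\<^sup>2 * (b * (u \<bullet> v) + a0 * (u \<bullet> (H *v v))) / ((mtr H + 2) * a0 * b + (b - a0)\<^sup>2)"

text \<open>\<open>N = depol H\<close> has trace 1 and determinant \<open>1 / (\<tau> + 2)\<close>, so \<open>(a0 + (b - a0) N) c = - (b - a0) v\<close>
  is solved by Cayley--Hamilton.\<close>

lemma polarization_solve:
  assumes H: "H \<in> Hset" and a0: "a0 > 0" and b: "b > 0"
  obtains c where "a0 *\<^sub>R c + (b - a0) *\<^sub>R depol H c = - (b - a0) *\<^sub>R v"
    "\<And>u. - (b - a0) * (u \<bullet> v) - (b - a0) * (u \<bullet> depol H c) = dlim H a0 b u v"
proof -
  define T where "T = mtr H + 2"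
  define \<beta> where "\<beta> = b - a0"
  define D where "D = T * a0 * b + \<beta>\<^sup>2"
  have T: "T > 0" using Hset_mtr[OF H] by (simp add: T_def)
  have D: "D > 0" unfolding D_def using T a0 b by (simp add: add_pos_nonneg)
  have bb: "b = a0 + \<beta>" by (simp add: \<beta>_def)
  note h = HsetD[OF H]
  have det: "H $ 1 $ 1 * H $ 2 $ 2 = 1 + H $ 1 $ 2 * H $ 1 $ 2" using h(2) by (simp add: power2_eq_square)
  have CH: "H *v (H *v x) = (T - 2) *\<^sub>R (H *v x) - x" for x
    using det by (simp add: vec_eq_iff forall_2 matvec_2 T_def mtr_def h(1) algebra_simps)
  have Hlin: "H *v (x + y) = H *v x + H *v y" "H *v (x - y) = H *v x - H *v y" "H *v (s *\<^sub>R x) = s *\<^sub>R (H *v x)" for x y s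
    by (simp_all add: vec_eq_iff matvec_2 algebra_simps)
  \<comment> \<open>Since \<open>N\<close> has trace 1, the adjugate of
    \<open>a0 + \<beta> * N\<close> is \<open>b - \<beta> * N\<close>. Numerator and determinant are
    both multiplied by \<open>T\<close>, which clears the denominator of \<open>N\<close>.\<close>
  define c where "c = (- \<beta> / D) *\<^sub>R ((b * T) *\<^sub>R v - \<beta> *\<^sub>R (v + H *v v))"
  have Tdep: "T *\<^sub>R depol H x = x + H *v x" for x using T by (simp add: depol_def T_def)
  have "D *\<^sub>R (T *\<^sub>R (a0 *\<^sub>R c + \<beta> *\<^sub>R depol H c)) = D *\<^sub>R (T *\<^sub>R (- \<beta> *\<^sub>R v))"
  proof -
    have Dc: "D *\<^sub>R c = (- \<beta>) *\<^sub>R ((b * T) *\<^sub>R v - \<beta> *\<^sub>R (v + H *v v))" using D by (simp add: c_def)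
    have "D *\<^sub>R (T *\<^sub>R (a0 *\<^sub>R c + \<beta> *\<^sub>R depol H c)) = (T * a0) *\<^sub>R (D *\<^sub>R c) + \<beta> *\<^sub>R (D *\<^sub>R (T *\<^sub>R depol H c))"
      by (simp add: algebra_simps)
    also have "\<dots> = (T * a0) *\<^sub>R (D *\<^sub>R c) + \<beta> *\<^sub>R (D *\<^sub>R c + H *v (D *\<^sub>R c))"
      unfolding Tdep by (simp add: scaleR_add_right Hlin)
    also have "\<dots> = D *\<^sub>R (T *\<^sub>R (- \<beta> *\<^sub>R v))"
      unfolding Dc Hlin CH unfolding D_def bb vec_eq_iff
      by (simp add: algebra_simps power2_eq_square)
    finally show ?thesis .
  qed
  then have 1: "a0 *\<^sub>R c + \<beta> *\<^sub>R depol H c = - \<beta> *\<^sub>R v" unfolding scaleR_cancel_left using D T by simp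
  have 2: "- \<beta> * (u \<bullet> v) - \<beta> * (u \<bullet> depol H c) = dlim H a0 b u v" for u
  proof -
    have Tc: "T *\<^sub>R depol H c = (- \<beta> / D) *\<^sub>R ((b * T) *\<^sub>R (v + H *v v) - \<beta> *\<^sub>R ((v + H *v v) + (H *v v + H *v (H *v v))))"
      unfolding Tdep unfolding c_def Hlin by (simp add: algebra_simps)
    also have "(v + H *v v) + (H *v v + H *v (H *v v)) = T *\<^sub>R (H *v v)" unfolding CH by (simp add: vec_eq_iff algebra_simps)
    also have "(b * T) *\<^sub>R (v + H *v v) - \<beta> *\<^sub>R (T *\<^sub>R (H *v v)) = T *\<^sub>R (b *\<^sub>R v + a0 *\<^sub>R (H *v v))"
      unfolding bb by (simp add: algebra_simps)
    finally have "T *\<^sub>R depol H c = T *\<^sub>R ((- \<beta> / D) *\<^sub>R (b *\<^sub>R v + a0 *\<^sub>R (H *v v)))" by (simp add: mult.commute)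
    then have dc: "depol H c = (- \<beta> / D) *\<^sub>R (b *\<^sub>R v + a0 *\<^sub>R (H *v v))" unfolding scaleR_cancel_left using T by simp
    have "dlim H a0 b u v = - \<beta> * (u \<bullet> v) + \<beta>\<^sup>2 * (b * (u \<bullet> v) + a0 * (u \<bullet> (H *v v))) / D"
      by (simp add: dlim_def D_def T_def \<beta>_def)
    then show ?thesis unfolding dc by (simp add: inner_add_right power2_eq_square algebra_simps add_divide_distrib)
  qed
  show ?thesis using that[of c] 1 2 by (simp add: \<beta>_def)
qed

text \<open>The radii form a sequence because dominated convergence and the compactness argument are
  sequential; the one-sided limit is recovered at the end from arbitrary sequences. A single
  \<open>K\<close> bounds \<open>a\<close>, \<open>b\<close> and \<open>a x0\<close>, so the
  perturbed coefficients are admissible with the same constants.\<close>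

locale inclusion = bounded_open +
  fixes a f yd y p :: "R2 \<Rightarrow> real" and gy gp :: "R2 \<Rightarrow> R2" and \<alpha> K b :: real
    and x0 :: R2 and H :: "real^2^2" and r :: "nat \<Rightarrow> real"
  assumes adm: "admissible \<alpha> K a" and b_lower: "\<alpha> \<le> b" and b_upper: "b \<le> K"
    and f: "sqint M f" and yd: "sqint M yd"
    and y: "weak_sol a f y gy" and p: "weak_sol a (\<lambda>x. y x - yd x) p gp"
    and H: "H \<in> Hset" and r_pos: "\<And>n. r n > 0" and r_lim: "r \<longlonglongrightarrow> 0"
    and x0: "x0 \<in> \<Omega>" and a0: "\<alpha> \<le> a x0" "a x0 \<le> K"
begin

lemma alpha: "\<alpha> > 0" using adm by (simp add: admissible_def)
lemma K0: "K \<ge> 0" using adm by (simp add: admissible_def)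

definition B :: "nat \<Rightarrow> R2 set" where "B n = (\<lambda>z. x0 + r n *\<^sub>R z) ` ellipse H"

lemma B_iff: "x \<in> B n \<longleftrightarrow> (1 / r n) *\<^sub>R (x - x0) \<in> ellipse H"
proof
  assume "x \<in> B n"
  then show "(1 / r n) *\<^sub>R (x - x0) \<in> ellipse H" using r_pos[of n] by (auto simp: B_def)
next
  assume "(1 / r n) *\<^sub>R (x - x0) \<in> ellipse H"
  moreover have "x = x0 + r n *\<^sub>R ((1 / r n) *\<^sub>R (x - x0))" using r_pos[of n] by simp
  ultimately show "x \<in> B n" unfolding B_def by blast
qed

lemma B_sets [measurable, simp]: "B n \<in> sets borel"
proof -
  have "closed (B n)" unfolding B_def
    by (intro closed_translation[where S="(\<lambda>z. r n *\<^sub>R z) ` ellipse H", unfolded image_image] closed_scaling ellipse_closed)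
  then show ?thesis by simp
qed

definition \<rho> :: real where "\<rho> = (SOME s. s > 0 \<and> ellipse H \<subseteq> cball 0 s)"

lemma rho: "\<rho> > 0" "ellipse H \<subseteq> cball 0 \<rho>"
proof -
  obtain s where "s > 0" "ellipse H \<subseteq> cball 0 s" using ellipse_bounded[OF H] by metis
  then have "\<exists>s. s > 0 \<and> ellipse H \<subseteq> cball 0 s" by blast
  from someI_ex[OF this] show "\<rho> > 0" "ellipse H \<subseteq> cball 0 \<rho>" unfolding \<rho>_def by blast+
qed

lemma B_norm: assumes "x \<in> B n" shows "norm (x - x0) \<le> \<rho> * r n"
proof -
  have "norm ((1 / r n) *\<^sub>R (x - x0)) \<le> \<rho>" using assms rho(2) unfolding B_iff by auto
  then show ?thesis unfolding norm_scaleR using r_pos[of n] by (simp add: field_simps)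
qed

definition cube :: "real \<Rightarrow> nat \<Rightarrow> R2 set" where "cube s n = square (s * r n) x0"

lemma cube_sets [measurable, simp]: "cube s n \<in> sets borel" by (simp add: cube_def)

lemma norm_imp_cube: assumes "norm (x - x0) \<le> s * r n" shows "x \<in> cube s n"
  using component_le_norm_cart[of "x - x0" 1] component_le_norm_cart[of "x - x0" 2] assms
  by (simp add: cube_def mem_square)

lemma B_cube: "B n \<subseteq> cube \<rho> n" using B_norm norm_imp_cube by blast

abbreviation vol :: real where "vol \<equiv> measure lebesgue (ellipse H)"

lemma measure_B: "measure lebesgue (B n) = (r n)\<^sup>2 * vol" and B_lmeasurable: "B n \<in> lmeasurable"
proof -
  have e: "B n = (\<lambda>z. r n *\<^sub>R z + x0) ` ellipse H" unfolding B_def by (simp add: add.commute)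
  show "measure lebesgue (B n) = (r n)\<^sup>2 * vol" unfolding e by (subst measure_lebesgue_affine) simp
  have "bounded (B n)"
  proof (rule bounded_subset[OF bounded_cball])
    show "B n \<subseteq> cball x0 (\<rho> * r n)" using B_norm by (auto simp: dist_norm norm_minus_commute)
  qed
  then show "B n \<in> lmeasurable" by (rule bounded_set_imp_lmeasurable) simp
qed

abbreviation ext :: "(R2 \<Rightarrow> real) \<Rightarrow> R2 \<Rightarrow> real" where "ext F \<equiv> (\<lambda>x. indicat_real \<Omega> x * F x)"

text \<open>Lebesgue points are defined on the whole plane, hence the extension by zero; as
  \<open>x0\<close> is an interior point of the domain, small cubes around it do not see the
  extension.\<close>

definition good :: "(R2 \<Rightarrow> real) \<Rightarrow> bool" where
  "good F \<longleftrightarrow> integrable M F \<and> lebesgue_point (ext F) x0"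

lemma ext_integrable: "integrable M F \<Longrightarrow> integrable lebesgue (ext F)"
  by (subst (asm) integrable_restrict_space[OF Omega_sets(3)]) simp

lemma cube_cbox: "cube s n = cbox (x0 - (s * r n) *\<^sub>R One) (x0 + (s * r n) *\<^sub>R One)"
proof -
  have "(One :: R2) $ i = 1" for i
  proof -
    have g: "One \<bullet> b = 1" if "b \<in> Basis" for b :: R2 using that by simp
    have "(axis i (1::real) :: R2) \<in> Basis" by simp
    from g[OF this] show ?thesis by (simp only: inner_axis inner_real_def mult_1_right)
  qed
  then have "vec q = q *\<^sub>R (One :: R2)" for q by (simp add: vec_eq_iff)
  then show ?thesis by (simp only: cube_def square_def)
qed

lemma good_cube_lebesgue:
  assumes F: "good F" and s: "s > 0"
  shows "(\<lambda>n. (LINT x:cube s n|lebesgue. \<bar>ext F x - ext F x0\<bar>) / (r n)\<^sup>2) \<longlonglongrightarrow> 0"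
proof (rule LIMSEQ_I)
  fix e :: real assume e: "e > 0"
  define e' where "e' = e / (2 * s\<^sup>2)"
  have e': "e' > 0" using e s by (simp add: e'_def)
  obtain d where d: "d > 0" "\<And>h. 0 < h \<Longrightarrow> h < d \<Longrightarrow>
     (LINT t:cbox (x0 - h *\<^sub>R One) (x0 + h *\<^sub>R One)|lebesgue. \<bar>ext F t - ext F x0\<bar>) \<le> e' * h ^ DIM(R2)"
    using F e' unfolding good_def lebesgue_point_def by blast
  obtain N where N: "\<And>n. n \<ge> N \<Longrightarrow> r n < d / s"
    using order_tendstoD(2)[OF r_lim, of "d / s"] d(1) s unfolding eventually_sequentially by auto
  have "norm ((LINT x:cube s n|lebesgue. \<bar>ext F x - ext F x0\<bar>) / (r n)\<^sup>2 - 0) < e" if n: "n \<ge> N" for n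
  proof -
    have h: "0 < s * r n" "s * r n < d" using N[OF n] s r_pos[of n] by (auto simp: field_simps)
    have "(LINT x:cube s n|lebesgue. \<bar>ext F x - ext F x0\<bar>) \<le> e' * (s * r n)\<^sup>2"
      unfolding cube_cbox using d(2)[OF h] by simp
    also have "\<dots> = (e / 2) * (r n)\<^sup>2" using s by (simp add: e'_def power_mult_distrib)
    finally have "(LINT x:cube s n|lebesgue. \<bar>ext F x - ext F x0\<bar>) / (r n)\<^sup>2 \<le> e / 2"
      using r_pos[of n] by (simp add: pos_divide_le_eq)
    moreover have "(LINT x:cube s n|lebesgue. \<bar>ext F x - ext F x0\<bar>) / (r n)\<^sup>2 \<ge> 0"
      unfolding set_lebesgue_integral_def by (intro divide_nonneg_nonneg integral_nonneg_AE) auto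
    ultimately have "norm ((LINT x:cube s n|lebesgue. \<bar>ext F x - ext F x0\<bar>) / (r n)\<^sup>2 - 0) \<le> e / 2"
      by (simp only: real_norm_def diff_zero abs_of_nonneg)
    then show ?thesis using e by linarith
  qed
  then show "\<exists>no. \<forall>n\<ge>no. norm ((LINT x:cube s n|lebesgue. \<bar>ext F x - ext F x0\<bar>) / (r n)\<^sup>2 - 0) < e" by blast
qed

lemma cube_integrable:
  assumes "integrable M F" shows "set_integrable lebesgue (cube s n) (\<lambda>x. \<bar>ext F x - c\<bar>)"
proof (intro set_integrable_abs set_integral_diff)
  show "set_integrable lebesgue (cube s n) (ext F)"
    unfolding set_integrable_def by (rule integrable_mult_indicator[OF _ ext_integrable[OF assms]]) simp
  show "set_integrable lebesgue (cube s n) (\<lambda>t. c)"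
    using lmeasurable_cbox[of "x0 - (s * r n) *\<^sub>R One" "x0 + (s * r n) *\<^sub>R One"]
    by (simp add: set_integrable_def lmeasurable_iff_integrable cube_cbox)
qed

lemma good_cube:
  assumes F: "good F" and s: "s > 0"
  shows "(\<lambda>n. (\<integral>x. indicator (cube s n) x * \<bar>F x - F x0\<bar> \<partial>M) / (r n)\<^sup>2) \<longlonglongrightarrow> 0"
proof (rule LIMSEQ_null_le[OF _ good_cube_lebesgue[OF F s]])
  fix n
  have "(\<integral>x. indicator (cube s n) x * \<bar>F x - F x0\<bar> \<partial>M) = (\<integral>x. indicator \<Omega> x * (indicator (cube s n) x * \<bar>F x - F x0\<bar>) \<partial>lebesgue)"
    by (simp add: integral_restrict_space[OF Omega_sets(3)])
  also have "\<dots> = (\<integral>x. indicator \<Omega> x *\<^sub>R (indicator (cube s n) x * \<bar>ext F x - ext F x0\<bar>) \<partial>lebesgue)"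
    by (intro Bochner_Integration.integral_cong) (use x0 in \<open>auto simp: indicator_def\<close>)
  also have "\<dots> \<le> (LINT x:cube s n|lebesgue. \<bar>ext F x - ext F x0\<bar>)"
    unfolding set_lebesgue_integral_def
  proof (rule integral_mono)
    have i: "integrable lebesgue (\<lambda>x. indicat_real (cube s n) x * \<bar>ext F x - ext F x0\<bar>)"
      using cube_integrable[of F s n "ext F x0"] F by (simp add: set_integrable_def good_def)
    then show "integrable lebesgue (\<lambda>x. indicat_real (cube s n) x *\<^sub>R \<bar>ext F x - ext F x0\<bar>)" by simp
    show "integrable lebesgue (\<lambda>x. indicat_real \<Omega> x *\<^sub>R (indicat_real (cube s n) x * \<bar>ext F x - ext F x0\<bar>))"
      by (rule integrable_mult_indicator[OF _ i]) simp
  qed (auto simp: indicator_def)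
  finally have le: "(\<integral>x. indicator (cube s n) x * \<bar>F x - F x0\<bar> \<partial>M) \<le> (LINT x:cube s n|lebesgue. \<bar>ext F x - ext F x0\<bar>)" .
  have "(\<integral>x. indicator (cube s n) x * \<bar>F x - F x0\<bar> \<partial>M) \<ge> 0" by (intro integral_nonneg_AE) auto
  then show "\<bar>(\<integral>x. indicator (cube s n) x * \<bar>F x - F x0\<bar> \<partial>M) / (r n)\<^sup>2\<bar> \<le> (LINT x:cube s n|lebesgue. \<bar>ext F x - ext F x0\<bar>) / (r n)\<^sup>2"
    using le by (simp add: divide_right_mono)
qed

text \<open>The inclusion at scale \<open>r n\<close> lies in the cube of half-side
  \<open>\<rho> * r n\<close>, so its mean deviation is dominated by that of the cube.\<close>

lemma good_average:
  assumes F: "good F"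
  shows "(\<lambda>n. (\<integral>x. indicator (B n) x * F x \<partial>M) / (r n)\<^sup>2) \<longlonglongrightarrow> F x0 * vol"
proof (rule LIM_zero_cancel, rule LIMSEQ_null_le[OF _ good_cube_lebesgue[OF F rho(1)]])
  fix n
  have iF: "integrable lebesgue (ext F)" using F by (auto simp: good_def intro: ext_integrable)
  have i1: "integrable lebesgue (\<lambda>x. indicat_real (B n) x * ext F x)"
    using integrable_mult_indicator[OF _ iF, of "B n"] by simp
  have i2: "integrable lebesgue (\<lambda>x. indicat_real (B n) x * ext F x0)"
    using B_lmeasurable[of n] by (simp add: lmeasurable_iff_integrable)
  have i3: "integrable lebesgue (\<lambda>x. indicat_real (cube \<rho> n) x * \<bar>ext F x - ext F x0\<bar>)"
    using cube_integrable[of F \<rho> n "ext F x0"] F by (simp add: set_integrable_def good_def)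
  have "(\<integral>x. indicator (B n) x * F x \<partial>M) = (\<integral>x. indicator (B n) x * ext F x \<partial>lebesgue)"
    by (simp add: integral_restrict_space[OF Omega_sets(3)] mult.left_commute)
  moreover have "(\<integral>x. indicator (B n) x * ext F x0 \<partial>lebesgue) = F x0 * vol * (r n)\<^sup>2"
    using measure_B[of n] x0 by simp
  ultimately have "(\<integral>x. indicator (B n) x * F x \<partial>M) - F x0 * vol * (r n)\<^sup>2 =
     (\<integral>x. indicator (B n) x * ext F x - indicator (B n) x * ext F x0 \<partial>lebesgue)"
    by (simp only: Bochner_Integration.integral_diff[OF i1 i2])
  moreover have "norm (\<integral>x. indicator (B n) x * ext F x - indicator (B n) x * ext F x0 \<partial>lebesgue)
    \<le> (\<integral>x. indicator (cube \<rho> n) x * \<bar>ext F x - ext F x0\<bar> \<partial>lebesgue)"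
    by (rule norm_lebesgue_integral_le[OF Bochner_Integration.integrable_diff[OF i1 i2] i3])
       (use B_cube[of n] in \<open>auto simp: indicator_def\<close>)
  ultimately have "\<bar>(\<integral>x. indicator (B n) x * F x \<partial>M) - F x0 * vol * (r n)\<^sup>2\<bar> \<le> (LINT x:cube \<rho> n|lebesgue. \<bar>ext F x - ext F x0\<bar>)"
    by (simp add: set_lebesgue_integral_def)
  then have "\<bar>(\<integral>x. indicator (B n) x * F x \<partial>M) - F x0 * vol * (r n)\<^sup>2\<bar> / (r n)\<^sup>2 \<le> (LINT x:cube \<rho> n|lebesgue. \<bar>ext F x - ext F x0\<bar>) / (r n)\<^sup>2"
    by (rule divide_right_mono) simp
  moreover have "(\<integral>x. indicator (B n) x * F x \<partial>M) / (r n)\<^sup>2 - F x0 * vol = ((\<integral>x. indicator (B n) x * F x \<partial>M) - F x0 * vol * (r n)\<^sup>2) / (r n)\<^sup>2"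
    using r_pos[of n] by (simp add: field_simps)
  ultimately show "\<bar>(\<integral>x. indicator (B n) x * F x \<partial>M) / (r n)\<^sup>2 - F x0 * vol\<bar> \<le> (LINT x:cube \<rho> n|lebesgue. \<bar>ext F x - ext F x0\<bar>) / (r n)\<^sup>2"
    by (simp add: abs_divide)
qed

end

text \<open>The shape shared by the error estimates: an O(r) factor times an o(r) factor is
  o(r^2).\<close>

lemma small_product:
  fixes E S A r :: "nat \<Rightarrow> real"
  assumes E: "\<And>n. \<bar>E n\<bar> \<le> A n * S n" and A: "\<And>n. A n \<le> C * r n" and S: "\<And>n. S n \<ge> 0"
    and r: "\<And>n. r n > 0" and l: "(\<lambda>n. S n / r n) \<longlonglongrightarrow> 0"
  shows "(\<lambda>n. E n / (r n)\<^sup>2) \<longlonglongrightarrow> 0"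
proof (rule LIMSEQ_null_le)
  show "(\<lambda>n. C * (S n / r n)) \<longlonglongrightarrow> 0" using tendsto_mult_left[OF l, of C] by simp
  fix n
  have "\<bar>E n\<bar> \<le> (C * r n) * S n" by (rule order_trans[OF E mult_right_mono[OF A S]])
  then have "\<bar>E n\<bar> / (r n)\<^sup>2 \<le> ((C * r n) * S n) / (r n)\<^sup>2" by (rule divide_right_mono) simp
  also have "\<dots> = C * (S n / r n)" using r[of n] by (simp add: power2_eq_square)
  finally show "\<bar>E n / (r n)\<^sup>2\<bar> \<le> C * (S n / r n)" by (simp add: abs_divide)
qed

lemma tendsto_zero_from_squares:
  fixes S r :: "nat \<Rightarrow> real"
  assumes "\<And>n. S n \<ge> 0" "\<And>n. r n > 0" "(\<lambda>n. (S n)\<^sup>2 / (r n)\<^sup>2) \<longlonglongrightarrow> 0"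
  shows "(\<lambda>n. S n / r n) \<longlonglongrightarrow> 0"
proof -
  have "(\<lambda>n. sqrt ((S n)\<^sup>2 / (r n)\<^sup>2)) \<longlonglongrightarrow> sqrt 0" by (rule tendsto_real_sqrt[OF assms(3)])
  moreover have "sqrt ((S n)\<^sup>2 / (r n)\<^sup>2) = S n / r n" for n
    using assms(1)[of n] assms(2)[of n] by (simp add: real_sqrt_divide)
  ultimately show ?thesis by simp
qed

section \<open>The far field of the potential\<close>

context bounded_open
begin

text \<open>The exterior is cut into dyadic shells: on the j-th one the integrand is at most
  \<open>c j\<close>, and the enclosing square has area \<open>4 * (2 ^ Suc j * s)^2\<close>. The
  geometric series sums to \<open>64 / (3 * s^2)\<close>, rounded up to
  \<open>22 / s^2\<close>.\<close>

lemma quartic_tail: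
  assumes s: "s > 0"
  shows "(\<integral>\<^sup>+x. ennreal (indicator (- square s x0) x * (1 / norm (x - x0) ^ 4)) \<partial>lborel) \<le> ennreal (22 / s\<^sup>2)"
proof -
  define c where "c j = 1 / (2 ^ j * s) ^ 4" for j :: nat
  define Q where "Q j = square (2 ^ Suc j * s) x0" for j
  have c0: "c j \<ge> 0" for j using s by (simp add: c_def)
  have pt: "ennreal (indicator (- square s x0) x * (1 / norm (x - x0) ^ 4)) \<le> (\<Sum>j. ennreal (c j) * indicator (Q j) x)" for x
  proof (cases "x \<in> square s x0")
    case False
    define t where "t = max \<bar>x $ 1 - x0 $ 1\<bar> \<bar>x $ 2 - x0 $ 2\<bar>"
    have t: "t > s" using False by (auto simp: mem_square t_def)
    obtain n where n: "t / s < 2 ^ n" using real_arch_pow[of 2 "t / s"] by auto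
    \<comment> \<open>The least dyadic level whose square contains \<open>x\<close>; it is not 0,
      and the failure of its predecessor bounds the distance from below.\<close>
    define N where "N = (LEAST n. t \<le> 2 ^ n * s)"
    have ex: "t \<le> 2 ^ n * s" using n s by (simp add: pos_divide_less_eq less_imp_le)
    have N: "t \<le> 2 ^ N * s" unfolding N_def by (rule LeastI[of "\<lambda>n. t \<le> 2 ^ n * s", OF ex])
    have "N \<noteq> 0" using N t by (cases "N = 0") auto
    then obtain j where j: "N = Suc j" using not0_implies_Suc by blast
    have "\<not> t \<le> 2 ^ j * s" using not_less_Least[of j "\<lambda>n. t \<le> 2 ^ n * s"] j unfolding N_def by simp
    then have tj: "2 ^ j * s \<le> t" by simp
    have "t \<le> norm (x - x0)"
      using component_le_norm_cart[of "x - x0" 1] component_le_norm_cart[of "x - x0" 2] by (simp add: t_def)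
    then have "2 ^ j * s \<le> norm (x - x0)" using tj by simp
    then have "(2 ^ j * s) ^ 4 \<le> norm (x - x0) ^ 4" using s by (intro power_mono) auto
    moreover have "(2 ^ j * s) ^ 4 > 0" using s by simp
    ultimately have le: "1 / norm (x - x0) ^ 4 \<le> c j" unfolding c_def by (intro frac_le) auto
    have xQ: "x \<in> Q j" using N unfolding j Q_def mem_square t_def by simp
    have "ennreal (indicator (- square s x0) x * (1 / norm (x - x0) ^ 4)) \<le> ennreal (c j) * indicator (Q j) x"
      using le xQ False by (simp add: ennreal_leI)
    also have "\<dots> \<le> (\<Sum>i. ennreal (c i) * indicator (Q i) x)"
      using sum_le_suminf[OF summableI, of "{j}" "\<lambda>i. ennreal (c i) * indicator (Q i) x"]
      by (simp only: sum.insert finite.emptyI empty_iff not_False_eq_True sum.empty add_0_right finite_insert zero_le)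
    finally show ?thesis .
  qed simp
  have "(\<integral>\<^sup>+x. ennreal (indicator (- square s x0) x * (1 / norm (x - x0) ^ 4)) \<partial>lborel)
     \<le> (\<integral>\<^sup>+x. (\<Sum>j. ennreal (c j) * indicator (Q j) x) \<partial>lborel)" by (rule nn_integral_mono) (rule pt)
  also have "\<dots> = (\<Sum>j. \<integral>\<^sup>+x. ennreal (c j) * indicator (Q j) x \<partial>lborel)"
    by (rule nn_integral_suminf) (simp add: Q_def)
  also have "\<dots> = (\<Sum>j. ennreal (16 / s\<^sup>2 * (1/4) ^ j))"
  proof (rule arg_cong[where f=suminf], rule ext)
    fix j
    have sj: "2 ^ Suc j * s > 0" using s by simp
    have "(\<integral>\<^sup>+x. ennreal (c j) * indicator (Q j) x \<partial>lborel) = ennreal (c j) * emeasure lborel (Q j)"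
      by (rule nn_integral_cmult_indicator) (simp add: Q_def)
    also have "emeasure lborel (Q j) = ennreal (4 * (2 ^ Suc j * s)\<^sup>2)"
      using measure_square[OF sj, of x0] emeasure_eq_ennreal_measure[of lborel "Q j"] emeasure_square_finite[of "2 ^ Suc j * s" x0]
      by (simp add: Q_def)
    also have "ennreal (c j) * ennreal (4 * (2 ^ Suc j * s)\<^sup>2) = ennreal (c j * (4 * (2 ^ Suc j * s)\<^sup>2))"
      by (rule ennreal_mult[symmetric]) (use c0 in auto)
    also have "c j * (4 * (2 ^ Suc j * s)\<^sup>2) = 16 / s\<^sup>2 * (1/4) ^ j"
    proof -
      have "(1/4 :: real) ^ j = 1 / (2 ^ j)\<^sup>2" using power_mult_distrib[of "2::real" 2 j] by (simp add: power_divide power2_eq_square)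
      moreover have "1 / (q * s) ^ 4 * (4 * (2 * q * s)\<^sup>2) = 16 / s\<^sup>2 * (1 / q\<^sup>2)" if "q > 0" for q :: real
        using s that by (simp add: field_simps power2_eq_square power4_eq_xxxx)
      ultimately show ?thesis by (simp add: c_def)
    qed
    finally show "(\<integral>\<^sup>+x. ennreal (c j) * indicator (Q j) x \<partial>lborel) = ennreal (16 / s\<^sup>2 * (1/4) ^ j)" .
  qed
  also have "\<dots> = ennreal (16 / s\<^sup>2 * (1 / (1 - 1/4)))"
    using sums_mult[OF geometric_sums[of "1/4 :: real"], of "16 / s\<^sup>2"] by (intro suminf_ennreal_eq) auto
  also have "\<dots> \<le> ennreal (22 / s\<^sup>2)" using s by (intro ennreal_leI) (simp add: field_simps)
  finally show ?thesis .
qed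

lemma quartic_tail_M:
  fixes x0 :: R2
  assumes s: "s > 0"
  defines "q \<equiv> \<lambda>x. indicat_real (- square s x0) x * (1 / norm (x - x0) ^ 4)"
  shows "integrable M q" "(\<integral>x. q x \<partial>M) \<le> 22 / s\<^sup>2"
proof -
  have qm: "q \<in> borel_measurable borel" unfolding q_def by measurable
  have q0: "q x \<ge> 0" for x by (simp add: q_def)
  have "(\<integral>\<^sup>+x. ennreal (q x) \<partial>M) = (\<integral>\<^sup>+x. ennreal (q x) * indicator \<Omega> x \<partial>lebesgue)"
    by (subst nn_integral_restrict_space) auto
  also have "\<dots> \<le> (\<integral>\<^sup>+x. ennreal (q x) \<partial>lebesgue)" by (rule nn_integral_mono) (auto simp: indicator_def)
  also have "\<dots> = (\<integral>\<^sup>+x. ennreal (q x) \<partial>lborel)" by (rule nn_integral_completion)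
  also have "\<dots> \<le> ennreal (22 / s\<^sup>2)" unfolding q_def by (rule quartic_tail[OF s])
  finally have nn: "(\<integral>\<^sup>+x. ennreal (q x) \<partial>M) \<le> ennreal (22 / s\<^sup>2)" .
  show int: "integrable M q"
  proof (rule integrableI_bounded)
    show "q \<in> borel_measurable M" by (rule borel_imp_M[OF qm])
    show "(\<integral>\<^sup>+x. ennreal (norm (q x)) \<partial>M) < \<infinity>" using le_less_trans[OF nn ennreal_less_top] q0 by simp
  qed
  show "(\<integral>x. q x \<partial>M) \<le> 22 / s\<^sup>2"
    using nn unfolding nn_integral_eq_integral[OF int AE_I2[OF q0]] by (subst (asm) ennreal_le_iff) auto
qed

end

section \<open>The difference equation and the exact increment of the cost\<close>

context inclusion
begin

definition ar :: "nat \<Rightarrow> R2 \<Rightarrow> real" where "ar n = pert a b x0 (ellipse H) (r n)"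
definition dab :: "R2 \<Rightarrow> real" where "dab x = b - a x"
definition X :: "nat \<Rightarrow> (R2 \<Rightarrow> R2) \<Rightarrow> R2 \<Rightarrow> R2" where "X n u = (\<lambda>x. indicat_real (B n) x *\<^sub>R u x)"

lemma ar_eq: "ar n x = a x + indicat_real (B n) x * dab x"
  by (simp add: ar_def pert_def dab_def B_def indicator_def)

lemma a_meas: "a \<in> borel_measurable M" by (rule admissible_bound(1)[OF adm])

lemma ind_meas: "indicat_real (B n) \<in> borel_measurable M" by (rule borel_imp_M) simp

lemma dab_meas: "dab \<in> borel_measurable M"
  unfolding dab_def[abs_def] by (intro borel_measurable_diff borel_measurable_const a_meas)

lemma b_pos: "b > 0" using alpha b_lower by simp

lemma dab_bound: "AE x in M. \<bar>dab x\<bar> \<le> 2 * K"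
  using admissible_bound(2)[OF adm]
proof eventually_elim
  case (elim x)
  then show ?case using b_pos b_upper unfolding dab_def by linarith
qed

lemma a_a0_bound: "AE x in M. \<bar>a x - a x0\<bar> \<le> 2 * K"
  using admissible_bound(2)[OF adm]
proof eventually_elim
  case (elim x)
  then show ?case using a0 alpha by linarith
qed

lemma ar_adm: "admissible \<alpha> K (ar n)"
  unfolding admissible_def
proof (intro conjI alpha K0)
  note a_meas [measurable] dab_meas [measurable] ind_meas [measurable]
  show "ar n \<in> borel_measurable M" unfolding ar_eq[abs_def] by measurable
  show "AE x in M. \<alpha> \<le> ar n x \<and> \<bar>ar n x\<bar> \<le> K"
    using admissible_bound(2,5)[OF adm]
    by eventually_elim (use b_lower b_upper b_pos in \<open>auto simp: ar_eq dab_def indicator_def\<close>)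
qed

lemma X_sqint: assumes "sqint M u" shows "sqint M (X n u)" "n2 M (X n u) \<le> n2 M u"
proof -
  note sqint_meas[OF assms, measurable] ind_meas[measurable]
  have m: "X n u \<in> borel_measurable M" unfolding X_def by measurable
  have b: "AE x in M. norm (X n u x) \<le> 1 * norm (u x)" by (rule AE_I2) (auto simp: X_def indicator_def)
  show "sqint M (X n u)" by (rule sqint_bound[OF assms m b])
  show "n2 M (X n u) \<le> n2 M u" using n2_mono[OF assms m b] by simp
qed

lemma n2_X: "(n2 M (X n u))\<^sup>2 = (\<integral>x. indicat_real (B n) x * (norm (u x))\<^sup>2 \<partial>M)"
  unfolding n2_sq X_def by (intro Bochner_Integration.integral_cong) (auto simp: indicator_def)

lemma X_idem: "X n u x \<bullet> v x = X n u x \<bullet> X n v x"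
  by (simp add: X_def indicator_def)

text \<open>Every point other than \<open>x0\<close> eventually leaves the inclusions, so dominated
  convergence applies. This covers arbitrary fixed fields, in particular gradients of dual
  solutions, for which \<open>x0\<close> may fail to be a Lebesgue point.\<close>

lemma n2_X_tendsto: assumes u: "sqint M u" shows "(\<lambda>n. n2 M (X n u)) \<longlonglongrightarrow> 0"
proof -
  have "(\<lambda>n. \<integral>x. indicat_real (B n) x * (norm (u x))\<^sup>2 \<partial>M) \<longlonglongrightarrow> (\<integral>x. 0 \<partial>M)"
  proof (rule integral_dominated_convergence)
    show "integrable M (\<lambda>x. (norm (u x))\<^sup>2)" by (rule sqint_integrable[OF u])
    note sqint_meas[OF u, measurable] ind_meas[measurable]
    show "(\<lambda>x. indicat_real (B n) x * (norm (u x))\<^sup>2) \<in> borel_measurable M" for n by measurable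
    have "{x0} \<in> null_sets lebesgue" by (simp add: null_sets_completionI)
    from AE_not_in[OF this] have "AE x in lebesgue. x \<in> \<Omega> \<longrightarrow> x \<noteq> x0" by eventually_elim simp
    then have "AE x in M. x \<noteq> x0" by (simp add: AE_M)
    then show "AE x in M. (\<lambda>n. indicat_real (B n) x * (norm (u x))\<^sup>2) \<longlonglongrightarrow> 0"
    proof eventually_elim
      case (elim x)
      have "norm (x - x0) / \<rho> > 0" using elim rho(1) by simp
      from order_tendstoD(2)[OF r_lim this] have "\<forall>\<^sub>F n in sequentially. indicat_real (B n) x * (norm (u x))\<^sup>2 = 0"
      proof eventually_elim
        case (elim n)
        then have "\<rho> * r n < norm (x - x0)" using rho(1) by (simp add: pos_less_divide_eq mult.commute)
        then have "x \<notin> B n" using B_norm[of x n] by auto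
        then show ?case by simp
      qed
      then show ?case by (rule tendsto_eventually)
    qed
    show "AE x in M. norm (indicat_real (B n) x * (norm (u x))\<^sup>2) \<le> (norm (u x))\<^sup>2" for n
      by (rule AE_I2) (auto simp: indicator_def)
  qed auto
  then have "(\<lambda>n. sqrt ((n2 M (X n u))\<^sup>2)) \<longlonglongrightarrow> sqrt 0" unfolding n2_X by (intro tendsto_real_sqrt) simp
  then show ?thesis by simp
qed

lemma dab_int:
  assumes "sqint M u" "sqint M v"
  shows "integrable M (\<lambda>x. dab x * (u x \<bullet> v x))" "\<bar>\<integral>x. dab x * (u x \<bullet> v x) \<partial>M\<bar> \<le> 2 * K * n2 M u * n2 M v"
  using L2_weighted_bound[OF assms dab_meas dab_bound] K0 by auto

lemma ar_int:
  assumes "sqint M u" "sqint M v"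
  shows "integrable M (\<lambda>x. ar n x * (u x \<bullet> v x))" "\<bar>\<integral>x. ar n x * (u x \<bullet> v x) \<partial>M\<bar> \<le> K * n2 M u * n2 M v"
  using L2_weighted_bound[OF assms admissible_bound(1,2,3)[OF ar_adm]] by auto

definition sol :: "nat \<Rightarrow> (R2 \<Rightarrow> real) \<times> (R2 \<Rightarrow> R2)" where
  "sol n = (SOME q. weak_sol (ar n) f (fst q) (snd q))"

lemma sol: "weak_sol (ar n) f (fst (sol n)) (snd (sol n))"
proof -
  obtain u g where "weak_sol (ar n) f u g" by (rule weak_sol_exists[OF ar_adm f])
  then have "\<exists>q. weak_sol (ar n) f (fst q) (snd q)" by (intro exI[of _ "(u, g)"]) simp
  then show ?thesis unfolding sol_def by (rule someI_ex)
qed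

definition w :: "nat \<Rightarrow> R2 \<Rightarrow> real" where "w n x = fst (sol n) x - y x"
definition h :: "nat \<Rightarrow> R2 \<Rightarrow> R2" where "h n x = snd (sol n) x - gy x"

lemma wh: "H1pair (w n) (h n)"
  using H1pair_lincomb[OF weak_sol_H1pair[OF sol[of n]] weak_sol_H1pair[OF y], of 1 "-1"]
  by (simp add: w_def[abs_def] h_def[abs_def])

lemmas hs = H1pair_sqint(2)[OF wh] and ws = H1pair_sqint(1)[OF wh]
lemmas gys = H1pair_sqint(2)[OF weak_sol_H1pair[OF y]] and gps = H1pair_sqint(2)[OF weak_sol_H1pair[OF p]]
lemmas ys = H1pair_sqint(1)[OF weak_sol_H1pair[OF y]]

lemma difference_equation:
  assumes v: "H1pair v k"
  shows "(\<integral>x. ar n x * (h n x \<bullet> k x) \<partial>M) = - (\<integral>x. dab x * (X n gy x \<bullet> k x) \<partial>M)"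
proof -
  note ks = H1pair_sqint(2)[OF v] and gs = H1pair_sqint(2)[OF weak_sol_H1pair[OF sol[of n]]]
  have ia: "integrable M (\<lambda>x. a x * (gy x \<bullet> k x))" by (rule L2_weighted_bound(1)[OF gys ks admissible_bound(1,2,3)[OF adm]])
  have "(\<integral>x. ar n x * (h n x \<bullet> k x) \<partial>M) = (\<integral>x. ar n x * (snd (sol n) x \<bullet> k x) - (a x * (gy x \<bullet> k x) + dab x * (X n gy x \<bullet> k x)) \<partial>M)"
    by (intro Bochner_Integration.integral_cong) (auto simp: h_def ar_eq X_def inner_diff_left algebra_simps)
  also have "\<dots> = (\<integral>x. ar n x * (snd (sol n) x \<bullet> k x) \<partial>M) - ((\<integral>x. a x * (gy x \<bullet> k x) \<partial>M) + (\<integral>x. dab x * (X n gy x \<bullet> k x) \<partial>M))"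
    using ar_int(1)[OF gs ks] ia dab_int(1)[OF X_sqint(1)[OF gys] ks] by simp
  finally show ?thesis using weak_sol_eq[OF sol v, of n] weak_sol_eq[OF y v] by simp
qed

lemma energy_estimate: "\<alpha> * n2 M (h n) \<le> 2 * K * n2 M (X n gy)"
proof -
  have "\<alpha> * (n2 M (h n))\<^sup>2 \<le> (\<integral>x. ar n x * (h n x \<bullet> h n x) \<partial>M)" by (rule coercive[OF ar_adm hs])
  also have "\<dots> = - (\<integral>x. dab x * (X n gy x \<bullet> h n x) \<partial>M)" by (rule difference_equation[OF wh])
  also have "\<dots> \<le> 2 * K * n2 M (X n gy) * n2 M (h n)" using dab_int(2)[OF X_sqint(1)[OF gys] hs, of n n] by linarith
  finally have le: "(\<alpha> * n2 M (h n)) * n2 M (h n) \<le> (2 * K * n2 M (X n gy)) * n2 M (h n)" by (simp add: power2_eq_square)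
  show ?thesis
  proof (cases "n2 M (h n) = 0")
    case True then show ?thesis using K0 by simp
  next
    case False
    then have "n2 M (h n) > 0" using n2_nonneg[of M "h n"] by linarith
    then show ?thesis using le by simp
  qed
qed

text \<open>Testing the adjoint equation with \<open>w n\<close> expresses the first variation
  through \<open>h n\<close>; passing there from \<open>a\<close> to \<open>ar n\<close> allows the
  difference equation to be tested with \<open>p\<close>. The identity is exact, and smallness
  enters only afterwards.\<close>

lemma cost_difference:
  "Jcost \<Omega> f yd (ar n) - Jcost \<Omega> f yd a
    = - (\<integral>x. dab x * (X n gy x \<bullet> gp x) \<partial>M) - (\<integral>x. dab x * (X n (h n) x \<bullet> gp x) \<partial>M) + (n2 M (w n))\<^sup>2 / 2"
proof -
  have s: "sqint M (\<lambda>x. y x - yd x)" by (rule sqint_diff[OF ys yd])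
  have yr: "fst (sol n) x = y x + w n x" for x by (simp add: w_def)
  have "(\<integral>x. (fst (sol n) x - yd x)\<^sup>2 \<partial>M) = (\<integral>x. (norm (y x - yd x))\<^sup>2 + (2 * ((y x - yd x) * w n x) + (norm (w n x))\<^sup>2) \<partial>M)"
    unfolding yr by (intro Bochner_Integration.integral_cong) (auto simp: power2_eq_square algebra_simps)
  also have "\<dots> = (\<integral>x. (y x - yd x)\<^sup>2 \<partial>M) + (2 * (\<integral>x. (y x - yd x) * w n x \<partial>M) + (n2 M (w n))\<^sup>2)"
    using sqint_integrable[OF s] sqint_mult[OF s ws[of n]] sqint_integrable[OF ws[of n]] by (simp add: n2_sq)
  finally have 1: "Jcost \<Omega> f yd (ar n) - Jcost \<Omega> f yd a = (\<integral>x. (y x - yd x) * w n x \<partial>M) + (n2 M (w n))\<^sup>2 / 2"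
    unfolding Jcost_eq[OF ar_adm f yd sol] Jcost_eq[OF adm f yd y] by (simp add: add_divide_distrib)
  have "(\<integral>x. (y x - yd x) * w n x \<partial>M) = (\<integral>x. a x * (gp x \<bullet> h n x) \<partial>M)" by (rule weak_sol_eq[OF p wh, symmetric])
  also have "\<dots> = (\<integral>x. ar n x * (h n x \<bullet> gp x) - dab x * (X n (h n) x \<bullet> gp x) \<partial>M)"
    by (intro Bochner_Integration.integral_cong) (auto simp: ar_eq X_def inner_commute algebra_simps)
  also have "\<dots> = (\<integral>x. ar n x * (h n x \<bullet> gp x) \<partial>M) - (\<integral>x. dab x * (X n (h n) x \<bullet> gp x) \<partial>M)"
    using ar_int(1)[OF hs gps] dab_int(1)[OF X_sqint(1)[OF hs] gps] by simp
  also have "(\<integral>x. ar n x * (h n x \<bullet> gp x) \<partial>M) = - (\<integral>x. dab x * (X n gy x \<bullet> gp x) \<partial>M)"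
    by (rule difference_equation[OF weak_sol_H1pair[OF p]])
  finally show ?thesis using 1 by linarith
qed

lemma difference_equation_limit:
  assumes t: "\<And>j. test_fun \<Omega> (\<phi> j)" and C: "\<And>j x. norm (cgrad (\<phi> j) x) \<le> C"
    and l: "AE x in M. (\<lambda>j. cgrad (\<phi> j) x) \<longlonglongrightarrow> G x" and G: "sqint M G"
  shows "(\<integral>x. ar n x * (h n x \<bullet> G x) \<partial>M) = - (\<integral>x. dab x * (X n gy x \<bullet> G x) \<partial>M)"
proof -
  have gb: "AE x in M. norm (G x) \<le> C"
    using l by eventually_elim (rule LIMSEQ_le_const2[OF tendsto_norm], use C in auto)
  have C0: "C \<ge> 0" using C[of 0 0] norm_ge_zero[of "cgrad (\<phi> 0) 0"] by linarith
  have "(\<lambda>j. \<integral>x. (norm (G x - cgrad (\<phi> j) x))\<^sup>2 \<partial>M) \<longlonglongrightarrow> (\<integral>x. 0 \<partial>M)"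
  proof (rule integral_dominated_convergence)
    show "integrable M (\<lambda>x. (2 * C)\<^sup>2)" by (rule finite_measure.integrable_const[OF finite_M])
    note sqint_meas[OF G, measurable] test_meas(2)[OF t, measurable]
    show "(\<lambda>x. (norm (G x - cgrad (\<phi> j) x))\<^sup>2) \<in> borel_measurable M" for j by measurable
    show "AE x in M. (\<lambda>j. (norm (G x - cgrad (\<phi> j) x))\<^sup>2) \<longlonglongrightarrow> 0"
      using l
    proof eventually_elim
      case (elim x)
      have "(\<lambda>j. (norm (G x - cgrad (\<phi> j) x))\<^sup>2) \<longlonglongrightarrow> (norm (G x - G x))\<^sup>2" by (intro tendsto_intros elim)
      then show ?case by simp
    qed
    show "AE x in M. norm ((norm (G x - cgrad (\<phi> j) x))\<^sup>2) \<le> (2 * C)\<^sup>2" for j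
      using gb
    proof eventually_elim
      case (elim x)
      have "norm (G x - cgrad (\<phi> j) x) \<le> 2 * C" using norm_triangle_ineq4[of "G x" "cgrad (\<phi> j) x"] elim C[of j x] by linarith
      then show ?case using power_mono[of "norm (G x - cgrad (\<phi> j) x)" "2 * C" 2] by simp
    qed
  qed auto
  then have "(\<lambda>j. sqrt (\<integral>x. (norm (G x - cgrad (\<phi> j) x))\<^sup>2 \<partial>M)) \<longlonglongrightarrow> sqrt 0" by (intro tendsto_real_sqrt) simp
  then have n: "(\<lambda>j. n2 M (\<lambda>x. G x - cgrad (\<phi> j) x)) \<longlonglongrightarrow> 0" by (simp add: n2_def)
  have 1: "(\<lambda>j. \<integral>x. ar n x * (cgrad (\<phi> j) x \<bullet> h n x) \<partial>M) \<longlonglongrightarrow> (\<integral>x. ar n x * (G x \<bullet> h n x) \<partial>M)"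
    by (rule tendsto_L2_weighted[OF test_sqint(2)[OF t] G n hs admissible_bound(1,2,3)[OF ar_adm]])
  have 2: "(\<lambda>j. \<integral>x. dab x * (cgrad (\<phi> j) x \<bullet> X n gy x) \<partial>M) \<longlonglongrightarrow> (\<integral>x. dab x * (G x \<bullet> X n gy x) \<partial>M)"
    by (rule tendsto_L2_weighted[OF test_sqint(2)[OF t] G n X_sqint(1)[OF gys] dab_meas dab_bound]) (use K0 in simp)
  have "(\<integral>x. ar n x * (cgrad (\<phi> j) x \<bullet> h n x) \<partial>M) = - (\<integral>x. dab x * (cgrad (\<phi> j) x \<bullet> X n gy x) \<partial>M)" for j
    using difference_equation[OF H1pair_test[OF t], of n j] by (simp add: inner_commute)
  then have "(\<lambda>j. - (\<integral>x. dab x * (cgrad (\<phi> j) x \<bullet> X n gy x) \<partial>M)) \<longlonglongrightarrow> (\<integral>x. ar n x * (G x \<bullet> h n x) \<partial>M)" using 1 by simp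
  from LIMSEQ_unique[OF this tendsto_minus[OF 2]] show ?thesis by (simp add: inner_commute)
qed

lemma divergence_free_extend:
  assumes F: "F \<in> borel_measurable borel" and C: "\<And>x. norm (F x) \<le> C"
    and z: "\<And>v. test_fun \<Omega> v \<Longrightarrow> (\<integral>x. F x \<bullet> cgrad v x \<partial>lborel) = 0" and u: "H1pair u g"
  shows "(\<integral>x. F x \<bullet> g x \<partial>M) = 0"
proof -
  have Fs: "sqint M F" by (rule sqint_bounded_finite[OF finite_M borel_imp_M[OF F]]) (use C in auto)
  obtain \<phi> where phi: "\<And>n. test_fun \<Omega> (\<phi> n)" "(\<lambda>n. n2 M (\<lambda>x. u x - \<phi> n x)) \<longlonglongrightarrow> 0"
    "(\<lambda>n. n2 M (\<lambda>x. g x - cgrad (\<phi> n) x)) \<longlonglongrightarrow> 0" using H1pair_approx[OF u] by blast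
  have l: "(\<lambda>n. \<integral>x. 1 * (cgrad (\<phi> n) x \<bullet> F x) \<partial>M) \<longlonglongrightarrow> (\<integral>x. 1 * (g x \<bullet> F x) \<partial>M)"
    by (rule tendsto_L2_weighted[OF test_sqint(2)[OF phi(1)] H1pair_sqint(2)[OF u] phi(3) Fs, where C=1]) auto
  have "(\<integral>x. 1 * (cgrad (\<phi> n) x \<bullet> F x) \<partial>M) = 0" for n
  proof -
    note F[measurable] test_borel(2)[OF phi(1), measurable]
    have "(\<integral>x. F x \<bullet> cgrad (\<phi> n) x \<partial>M) = (\<integral>x. F x \<bullet> cgrad (\<phi> n) x \<partial>lborel)"
      by (rule integral_M_lborel) (auto simp: test_fun_vanish_outside(2)[OF phi(1)])
    then show ?thesis using z[OF phi(1)] by (simp add: inner_commute)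
  qed
  then show ?thesis using l by (simp add: LIMSEQ_const_iff inner_commute)
qed

end

text \<open>A differentiable cutoff that equals 1 only at the centre; since \<open>1 - \<eta>\<close> vanishes quadratically
  there, the quadratic decay of the potential's gradient compensates.\<close>

lemma pos_part_square_deriv: "((\<lambda>t::real. (max 0 t)\<^sup>2) has_real_derivative 2 * max 0 t) (at t)"
proof -
  consider "t > 0" | "t < 0" | "t = 0" by linarith
  then show ?thesis
  proof cases
    case 1
    have "((\<lambda>t. t\<^sup>2) has_real_derivative 2 * max 0 t) (at t)" using 1 by (auto intro!: derivative_eq_intros)
    moreover have "eventually (\<lambda>u. u\<^sup>2 = (max 0 u)\<^sup>2) (nhds t)"
      using eventually_nhds_in_open[of "{0<..}" t] 1 by (auto elim!: eventually_mono)
    ultimately show ?thesis by (subst (asm) DERIV_cong_ev[OF refl _ refl])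
  next
    case 2
    have "((\<lambda>t. 0) has_real_derivative 2 * max 0 t) (at t)" using 2 by simp
    moreover have "eventually (\<lambda>u. 0 = (max 0 u)\<^sup>2) (nhds t)"
      using eventually_nhds_in_open[of "{..<0}" t] 2 by (auto elim!: eventually_mono)
    ultimately show ?thesis by (subst (asm) DERIV_cong_ev[OF refl _ refl])
  next
    case 3
    have "((\<lambda>k. (max 0 k)\<^sup>2 / k) \<longlongrightarrow> 0) (at (0::real))"
    proof (rule Lim_null_comparison)
      show "\<forall>\<^sub>F k in at (0::real). norm ((max 0 k)\<^sup>2 / k) \<le> \<bar>k\<bar>"
        by (rule eventuallyI) (auto simp: max_def power2_eq_square)
      show "((\<lambda>k. \<bar>k\<bar>) \<longlongrightarrow> 0) (at (0::real))" by (auto intro!: tendsto_eq_intros)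
    qed
    then show ?thesis using 3 by (simp add: DERIV_def)
  qed
qed

definition cutoff :: "real \<Rightarrow> R2 \<Rightarrow> R2 \<Rightarrow> real" where
  "cutoff d x0 x = (max 0 (1 - (norm (x - x0))\<^sup>2 / d\<^sup>2))\<^sup>2"

definition cutoff_grad :: "real \<Rightarrow> R2 \<Rightarrow> R2 \<Rightarrow> R2" where
  "cutoff_grad d x0 x = (- (4 / d\<^sup>2) * max 0 (1 - (norm (x - x0))\<^sup>2 / d\<^sup>2)) *\<^sub>R (x - x0)"

lemma cutoff_has_derivative: "(cutoff d x0 has_derivative (\<lambda>h. cutoff_grad d x0 x \<bullet> h)) (at x)"
proof -
  have q0: "((\<lambda>x. 1 - (1 / d\<^sup>2) * ((x - x0) \<bullet> (x - x0))) has_derivative (\<lambda>h. - (2 / d\<^sup>2) * ((x - x0) \<bullet> h))) (at x)"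
    by (rule derivative_eq_intros refl ext | simp add: inner_commute[of _ "x - x0"])+
  then have q: "((\<lambda>x. 1 - ((x - x0) \<bullet> (x - x0)) / d\<^sup>2) has_derivative (\<lambda>h. - (2 / d\<^sup>2) * ((x - x0) \<bullet> h))) (at x)" by simp
  have m: "((\<lambda>t. (max 0 t)\<^sup>2) has_derivative (\<lambda>t'. 2 * max 0 t * t')) (at t)" for t :: real
    using pos_part_square_deriv[of t] by (simp add: has_field_derivative_def)
  have "((\<lambda>x. (max 0 (1 - ((x - x0) \<bullet> (x - x0)) / d\<^sup>2))\<^sup>2) has_derivative
    (\<lambda>h. 2 * max 0 (1 - ((x - x0) \<bullet> (x - x0)) / d\<^sup>2) * (- (2 / d\<^sup>2) * ((x - x0) \<bullet> h)))) (at x)"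
    by (rule has_derivative_compose[OF q m])
  moreover have "2 * max 0 (1 - ((x - x0) \<bullet> (x - x0)) / d\<^sup>2) * (- (2 / d\<^sup>2) * ((x - x0) \<bullet> h)) = cutoff_grad d x0 x \<bullet> h" for h
    by (simp add: cutoff_grad_def power2_norm_eq_inner)
  ultimately show ?thesis unfolding cutoff_def[abs_def] power2_norm_eq_inner by simp
qed

lemma cutoff_bounds:
  assumes d: "d > 0"
  shows "0 \<le> cutoff d x0 x" "cutoff d x0 x \<le> 1" "\<bar>cutoff d x0 x - 1\<bar> \<le> 2 * (norm (x - x0))\<^sup>2 / d\<^sup>2"
    "norm (cutoff_grad d x0 x) \<le> 4 / d\<^sup>2 * norm (x - x0)" "norm (cutoff_grad d x0 x) \<le> 4 / d"
    "x \<notin> cball x0 d \<Longrightarrow> cutoff d x0 x = 0"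
proof -
  define u where "u = (norm (x - x0))\<^sup>2 / d\<^sup>2"
  have u0: "u \<ge> 0" by (simp add: u_def)
  have c: "cutoff d x0 x = (max 0 (1 - u))\<^sup>2" by (simp add: cutoff_def u_def)
  have m: "0 \<le> max 0 (1 - u)" "max 0 (1 - u) \<le> 1" using u0 by auto
  show "0 \<le> cutoff d x0 x" "cutoff d x0 x \<le> 1" unfolding c using m by (auto simp: power_le_one)
  show "\<bar>cutoff d x0 x - 1\<bar> \<le> 2 * (norm (x - x0))\<^sup>2 / d\<^sup>2"
  proof (cases "u \<le> 1")
    case True
    then have "\<bar>cutoff d x0 x - 1\<bar> \<le> 2 * u"
      unfolding c using u0 mult_left_mono[OF True u0] by (simp add: max_def power2_eq_square algebra_simps abs_le_iff)
    then show ?thesis by (simp add: u_def)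
  next
    case False
    then have "\<bar>cutoff d x0 x - 1\<bar> \<le> 2 * u" unfolding c by (simp add: max_def)
    then show ?thesis by (simp add: u_def)
  qed
  have g: "norm (cutoff_grad d x0 x) = 4 / d\<^sup>2 * max 0 (1 - u) * norm (x - x0)"
    unfolding cutoff_grad_def u_def[symmetric] norm_scaleR abs_mult using m by simp
  have "4 / d\<^sup>2 * max 0 (1 - u) * norm (x - x0) \<le> 4 / d\<^sup>2 * 1 * norm (x - x0)"
    by (intro mult_right_mono mult_left_mono m) auto
  then show g1: "norm (cutoff_grad d x0 x) \<le> 4 / d\<^sup>2 * norm (x - x0)" unfolding g by simp
  show "norm (cutoff_grad d x0 x) \<le> 4 / d"
  proof (cases "norm (x - x0) \<le> d")
    case True
    have "4 / d\<^sup>2 * norm (x - x0) \<le> 4 / d\<^sup>2 * d" by (intro mult_left_mono True) simp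
    also have "\<dots> = 4 / d" using d by (simp add: power2_eq_square)
    finally show ?thesis using g1 by linarith
  next
    case False
    then have "d\<^sup>2 \<le> (norm (x - x0))\<^sup>2" using d by (intro power_mono) auto
    then have "u \<ge> 1" using d by (simp add: u_def)
    then have "max 0 (1 - u) = 0" by simp
    then show ?thesis unfolding g using d by simp
  qed
  show "cutoff d x0 x = 0" if "x \<notin> cball x0 d"
  proof -
    have "d \<le> norm (x - x0)" using that by (simp add: dist_norm norm_minus_commute)
    then have "d\<^sup>2 \<le> (norm (x - x0))\<^sup>2" using d by (intro power_mono) auto
    then have "u \<ge> 1" using d by (simp add: u_def)
    then show ?thesis unfolding c by simp
  qed
qed

lemma cutoff_lipschitz:
  assumes d: "d > 0" shows "norm (cutoff d x0 x - cutoff d x0 y) \<le> 4 / d * norm (x - y)"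
proof (rule differentiable_bound[where S=UNIV and f'="\<lambda>x h. cutoff_grad d x0 x \<bullet> h"])
  show "(cutoff d x0 has_derivative (\<lambda>h. cutoff_grad d x0 x \<bullet> h)) (at x within UNIV)" for x
    using cutoff_has_derivative by simp
  show "onorm (\<lambda>h. cutoff_grad d x0 x \<bullet> h) \<le> 4 / d" for x
  proof (rule onorm_bound)
    fix h show "norm (cutoff_grad d x0 x \<bullet> h) \<le> 4 / d * norm h"
      using Cauchy_Schwarz_ineq2[of "cutoff_grad d x0 x" h] mult_right_mono[OF cutoff_bounds(5)[OF d, of x0 x] norm_ge_zero[of h]] by simp
  qed (use d in simp)
qed auto

lemma cutoff_continuous: "continuous_on UNIV (cutoff d x0)" "continuous_on UNIV (cutoff_grad d x0)"
  unfolding cutoff_def[abs_def] cutoff_grad_def[abs_def] divide_inverse by (intro continuous_intros)+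

section \<open>The truncated potential as a test function\<close>

context inclusion
begin

text \<open>\<open>G\<close> is the gradient of the potential times the cutoff, a Lipschitz function
  supported in \<open>cball x0 d\<close>. The room between \<open>d\<close> and \<open>2 * d\<close>
  is the margin for mollification, and continuity of \<open>k\<close> off a null set turns
  convergence at continuity points into convergence almost everywhere.\<close>

lemma cutoff_potential:
  assumes d: "d > 0" and dO: "cball x0 (2 * d) \<subseteq> \<Omega>"
    and lip: "\<And>x y. norm (P x - P y) \<le> L * norm (x - y)"
    and der: "AE x in lborel. (P has_derivative (\<lambda>h. k x \<bullet> h)) (at x)"
    and cont: "AE x in lborel. isCont k x" and km: "k \<in> borel_measurable borel"
    and PC: "\<And>x. \<bar>P x\<bar> \<le> C" and kC: "\<And>x. norm (k x) \<le> C'"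
  defines "G \<equiv> \<lambda>x. cutoff d x0 x *\<^sub>R k x + P x *\<^sub>R cutoff_grad d x0 x"
  shows "sqint M G" "(\<integral>x. ar n x * (h n x \<bullet> G x) \<partial>M) = - (\<integral>x. dab x * (X n gy x \<bullet> G x) \<partial>M)"
proof -
  note cb = cutoff_bounds[OF d]
  have C0: "C \<ge> 0" using PC[of 0] abs_ge_zero[of "P 0"] by linarith
  have C0': "C' \<ge> 0" using kC[of 0] norm_ge_zero[of "k 0"] by linarith
  have Pc: "continuous_on UNIV P" by (rule lipschitz_continuous[OF lip])
  note km[measurable] borel_measurable_continuous_UNIV[OF Pc, measurable]
    borel_measurable_continuous_UNIV[OF cutoff_continuous(1), measurable] borel_measurable_continuous_UNIV[OF cutoff_continuous(2), measurable]
  define v where "v x = P x * cutoff d x0 x" for x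
  have vl: "norm (v x - v y) \<le> (\<bar>L\<bar> + C * (4 / d)) * norm (x - y)" for x y
  proof -
    have "v x - v y = (P x - P y) * cutoff d x0 x + P y * (cutoff d x0 x - cutoff d x0 y)" by (simp add: v_def algebra_simps)
    then have "norm (v x - v y) \<le> norm (P x - P y) * \<bar>cutoff d x0 x\<bar> + \<bar>P y\<bar> * norm (cutoff d x0 x - cutoff d x0 y)"
      by (metis abs_mult norm_triangle_ineq real_norm_def)
    also have "\<dots> \<le> (\<bar>L\<bar> * norm (x - y)) * 1 + C * (4 / d * norm (x - y))"
    proof (intro add_mono mult_mono PC cutoff_lipschitz[OF d])
      show "norm (P x - P y) \<le> \<bar>L\<bar> * norm (x - y)" by (rule order_trans[OF lip]) (auto intro: mult_right_mono)
    qed (use cb(1,2)[of x0 x] C0 in auto)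
    finally show ?thesis by (simp add: algebra_simps)
  qed
  have vM: "\<bar>v x\<bar> \<le> C" for x
    using mult_mono[OF PC cb(2) C0 cb(1), of x x0 x] cb(1)[of x0 x] by (simp add: v_def abs_mult)
  have vd: "AE x in lborel. (v has_derivative (\<lambda>h. G x \<bullet> h)) (at x)"
    using der
  proof eventually_elim
    case (elim x)
    have "((\<lambda>x. P x * cutoff d x0 x) has_derivative (\<lambda>h. P x * (cutoff_grad d x0 x \<bullet> h) + (k x \<bullet> h) * cutoff d x0 x)) (at x)"
      by (rule has_derivative_mult[OF elim cutoff_has_derivative])
    moreover have "P x * (cutoff_grad d x0 x \<bullet> h) + (k x \<bullet> h) * cutoff d x0 x = G x \<bullet> h" for h
      by (simp add: G_def inner_add_left)
    ultimately show ?case unfolding v_def[abs_def] by simp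
  qed
  have Gm: "G \<in> borel_measurable borel" unfolding G_def by measurable
  have Gb: "norm (G x) \<le> C' + C * (4 / d)" for x
  proof -
    have "norm (G x) \<le> \<bar>cutoff d x0 x\<bar> * norm (k x) + \<bar>P x\<bar> * norm (cutoff_grad d x0 x)"
      unfolding G_def by (rule order_trans[OF norm_triangle_ineq]) simp
    also have "\<dots> \<le> 1 * C' + C * (4 / d)" by (intro add_mono mult_mono PC kC cb(5)) (use cb(1,2)[of x0 x] C0 in auto)
    finally show ?thesis by simp
  qed
  have vz: "v x = 0" if "x \<notin> cball x0 d" for x unfolding v_def cb(6)[OF that] by simp
  have dO': "cball x0 (d + d) \<subseteq> \<Omega>" using dO by (simp only: mult_2)
  obtain \<phi> where phi: "\<And>n. test_fun \<Omega> (\<phi> n)" "\<And>n x. norm (cgrad (\<phi> n) x) \<le> C' + C * (4 / d)"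
     "\<And>x. isCont G x \<Longrightarrow> (\<lambda>n. cgrad (\<phi> n) x) \<longlonglongrightarrow> G x"
    by (rule mollification[OF vl vM vd Gm Gb vz d dO'], assumption) (rule that)
  have Gc: "AE x in lborel. isCont G x"
    using cont
  proof eventually_elim
    case (elim x)
    have "isCont P x" "isCont (cutoff d x0) x" "isCont (cutoff_grad d x0) x"
      using Pc cutoff_continuous by (simp_all add: continuous_on_eq_continuous_at)
    then show ?case unfolding G_def using elim by (intro continuous_intros)
  qed
  have l: "AE x in M. (\<lambda>j. cgrad (\<phi> j) x) \<longlonglongrightarrow> G x"
    unfolding AE_M using AE_completion[OF Gc] by eventually_elim (use phi(3) in blast)
  show Gs: "sqint M G" by (rule sqint_bounded_finite[OF finite_M borel_imp_M[OF Gm]]) (use Gb in auto)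
  show "(\<integral>x. ar n x * (h n x \<bullet> G x) \<partial>M) = - (\<integral>x. dab x * (X n gy x \<bullet> G x) \<partial>M)"
    by (rule difference_equation_limit[OF phi(1,2) l Gs])
qed

end

text \<open>The squared norms upgrade averages of the gradients to L2 statements on the inclusion.
  The factor \<open>b - a x\<close> stays inside the functions of \<open>Gyp\<close> and
  \<open>Gby\<close> because Lebesgue points of the factors need not be Lebesgue points of a
  product.\<close>

locale good_inclusion = inclusion +
  assumes Ga: "good a" and Gp: "\<And>i. good (\<lambda>x. gp x $ i)"
    and Gy_sq: "good (\<lambda>x. (norm (gy x))\<^sup>2)" and Gp_sq: "good (\<lambda>x. (norm (gp x))\<^sup>2)"
    and Gyp: "good (\<lambda>x. (b - a x) * (gy x \<bullet> gp x))" and Gby: "\<And>i. good (\<lambda>x. (b - a x) * gy x $ i)"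
begin

abbreviation \<beta> :: real where "\<beta> \<equiv> b - a x0"

text \<open>The squared gradient has a finite average limit over inclusions of area proportional to
  \<open>(r n)^2\<close>. A convergent sequence is bounded, so the rate holds for every
  \<open>n\<close> and not only eventually.\<close>

lemma gy_small: obtains C where "C \<ge> 0" "\<And>n. n2 M (X n gy) \<le> C * r n"
proof -
  have "(\<lambda>n. (n2 M (X n gy))\<^sup>2 / (r n)\<^sup>2) \<longlonglongrightarrow> (norm (gy x0))\<^sup>2 * vol"
    unfolding n2_X by (rule good_average[OF Gy_sq])
  then obtain C where C: "C \<ge> 0" "\<And>n. \<bar>(n2 M (X n gy))\<^sup>2 / (r n)\<^sup>2\<bar> \<le> C" by (rule LIMSEQ_bounded_by) blast
  have "n2 M (X n gy) \<le> sqrt C * r n" for n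
  proof (rule power2_le_imp_le)
    have "(n2 M (X n gy))\<^sup>2 / (r n)\<^sup>2 \<le> C" using C(2)[of n] by simp
    then show "(n2 M (X n gy))\<^sup>2 \<le> (sqrt C * r n)\<^sup>2"
      using C(1) r_pos[of n] by (simp add: pos_divide_le_eq power_mult_distrib)
    show "0 \<le> sqrt C * r n" using C(1) r_pos[of n] by simp
  qed
  then show ?thesis using that[of "sqrt C"] C(1) by simp
qed

lemma h_small: obtains C where "C \<ge> 0" "\<And>n. n2 M (h n) \<le> C * r n"
proof -
  obtain C where C: "C \<ge> 0" "\<And>n. n2 M (X n gy) \<le> C * r n" using gy_small by metis
  have "n2 M (h n) \<le> (2 * K * C / \<alpha>) * r n" for n
  proof -
    have "\<alpha> * n2 M (h n) \<le> 2 * K * (C * r n)"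
      by (rule order_trans[OF energy_estimate]) (intro mult_left_mono C, use K0 in simp)
    then show ?thesis using alpha by (simp add: field_simps)
  qed
  then show ?thesis using that[of "2 * K * C / \<alpha>"] C(1) K0 alpha by simp
qed

lemma lim_yp: "(\<lambda>n. (\<integral>x. dab x * (X n gy x \<bullet> gp x) \<partial>M) / (r n)\<^sup>2) \<longlonglongrightarrow> \<beta> * (gy x0 \<bullet> gp x0) * vol"
proof -
  have "dab x * (X n gy x \<bullet> gp x) = indicat_real (B n) x * ((b - a x) * (gy x \<bullet> gp x))" for n x
    by (simp add: dab_def X_def)
  then show ?thesis using good_average[OF Gyp] by simp
qed

lemma good_ind_integrable: assumes "good F" shows "integrable M (\<lambda>x. indicat_real (B n) x * F x)"
proof (rule Bochner_Integration.integrable_bound)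
  show F: "integrable M F" using assms by (simp add: good_def)
  show "(\<lambda>x. indicat_real (B n) x * F x) \<in> borel_measurable M"
    by (intro borel_measurable_times ind_meas borel_measurable_integrable[OF F])
qed (auto simp: indicator_def)

lemma lim_y: "(\<lambda>n. (\<integral>x. dab x * (X n gy x \<bullet> m) \<partial>M) / (r n)\<^sup>2) \<longlonglongrightarrow> \<beta> * (gy x0 \<bullet> m) * vol"
proof -
  let ?F = "\<lambda>x. (b - a x) *\<^sub>R gy x"
  have g: "good (\<lambda>x. ?F x $ i)" for i using Gby[of i] by simp
  have "dab x * (X n gy x \<bullet> m) = (indicat_real (B n) x * ?F x $ 1) * m $ 1 + (indicat_real (B n) x * ?F x $ 2) * m $ 2" for n x
    by (simp add: dab_def X_def inner_2 algebra_simps)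
  then have "(\<integral>x. dab x * (X n gy x \<bullet> m) \<partial>M) = (\<integral>x. indicat_real (B n) x * ?F x $ 1 \<partial>M) * m $ 1 + (\<integral>x. indicat_real (B n) x * ?F x $ 2 \<partial>M) * m $ 2" for n
    using good_ind_integrable[OF g[of 1], of n] good_ind_integrable[OF g[of 2], of n] by simp
  then have e: "(\<integral>x. dab x * (X n gy x \<bullet> m) \<partial>M) / (r n)\<^sup>2 = (\<integral>x. indicat_real (B n) x * ?F x $ 1 \<partial>M) / (r n)\<^sup>2 * m $ 1 + (\<integral>x. indicat_real (B n) x * ?F x $ 2 \<partial>M) / (r n)\<^sup>2 * m $ 2" for n
    by (simp add: add_divide_distrib)
  have "(\<lambda>n. (\<integral>x. indicat_real (B n) x * ?F x $ 1 \<partial>M) / (r n)\<^sup>2 * m $ 1 + (\<integral>x. indicat_real (B n) x * ?F x $ 2 \<partial>M) / (r n)\<^sup>2 * m $ 2)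
     \<longlonglongrightarrow> (?F x0 $ 1 * vol) * m $ 1 + (?F x0 $ 2 * vol) * m $ 2"
    by (intro tendsto_intros good_average g)
  moreover have "(?F x0 $ 1 * vol) * m $ 1 + (?F x0 $ 2 * vol) * m $ 2 = \<beta> * (gy x0 \<bullet> m) * vol"
    by (simp add: inner_2 algebra_simps)
  ultimately show ?thesis unfolding e by simp
qed

text \<open>Small cubes lie in the open domain, where the extension is constant. The constant arises
  when the square in the next lemma is expanded.\<close>

lemma const_good: "good (\<lambda>x. c)"
proof -
  obtain d where d: "d > 0" "ball x0 d \<subseteq> \<Omega>" using open_Omega x0 by (meson openE)
  have "lebesgue_point (ext (\<lambda>x. c)) x0"
    unfolding lebesgue_point_def
  proof (intro allI impI)
    fix e :: real assume e: "e > 0"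
    have "(LINT t:cbox (x0 - h *\<^sub>R One) (x0 + h *\<^sub>R One)|lebesgue. \<bar>ext (\<lambda>x. c) t - ext (\<lambda>x. c) x0\<bar>) \<le> e * h ^ DIM(R2)"
      if h: "0 < h" "h < d / 2" for h
    proof -
      have sub: "t \<in> \<Omega>" if t: "t \<in> cbox (x0 - h *\<^sub>R One) (x0 + h *\<^sub>R One)" for t
      proof -
        have "\<bar>(t - x0) \<bullet> i\<bar> \<le> h" if i: "i \<in> Basis" for i
          using t i by (simp add: mem_box inner_simps) (smt (verit))
        then have "norm (t - x0) \<le> (\<Sum>i\<in>(Basis::R2 set). h)" using norm_le_l1[of "t - x0"] sum_mono[of Basis "\<lambda>i. \<bar>(t - x0) \<bullet> i\<bar>" "\<lambda>_. h"] by fastforce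
        then have "norm (t - x0) \<le> 2 * h" by simp
        then show ?thesis using h d by (auto simp: dist_norm norm_minus_commute subset_eq)
      qed
      have "(LINT t:cbox (x0 - h *\<^sub>R One) (x0 + h *\<^sub>R One)|lebesgue. \<bar>ext (\<lambda>x. c) t - ext (\<lambda>x. c) x0\<bar>)
        = (\<integral>t. 0 \<partial>(lebesgue :: R2 measure))"
        unfolding set_lebesgue_integral_def
        by (rule Bochner_Integration.integral_cong) (use sub x0 in \<open>auto simp: indicator_def\<close>)
      then show ?thesis using e h by simp
    qed
    then show "\<exists>d>0. \<forall>h. 0 < h \<and> h < d \<longrightarrow> (LINT t:cbox (x0 - h *\<^sub>R One) (x0 + h *\<^sub>R One)|lebesgue. \<bar>ext (\<lambda>x. c) t - ext (\<lambda>x. c) x0\<bar>) \<le> e * h ^ DIM(R2)"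
      using d by (intro exI[of _ "d / 2"]) auto
  qed
  then show ?thesis using finite_measure.integrable_const[OF finite_M, of c] by (simp add: good_def)
qed

text \<open>Expanding the square reduces the L2 deviation to averages of the squared norm, of the
  components and of a constant, and their limits cancel.\<close>

lemma lim_p: "(\<lambda>n. n2 M (X n (\<lambda>x. gp x - gp x0)) / r n) \<longlonglongrightarrow> 0"
proof (rule tendsto_zero_from_squares[OF n2_nonneg r_pos])
  let ?v = "gp x0"
  let ?I = "\<lambda>n F. \<integral>x. indicat_real (B n) x * F x \<partial>M"
  let ?q = "(norm ?v)\<^sup>2"
  have sq: "(norm (x - v))\<^sup>2 = (norm x)\<^sup>2 - 2 * (x $ 1 * v $ 1 + x $ 2 * v $ 2) + (norm v)\<^sup>2" for x v :: R2
    unfolding power2_norm_eq_inner by (simp add: inner_2 algebra_simps power2_eq_square)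
  have e: "(n2 M (X n (\<lambda>x. gp x - ?v)))\<^sup>2 = ?I n (\<lambda>x. (norm (gp x))\<^sup>2) - 2 * (?I n (\<lambda>x. gp x $ 1) * ?v $ 1 + ?I n (\<lambda>x. gp x $ 2) * ?v $ 2) + ?I n (\<lambda>x. ?q)" for n
  proof -
    have "(n2 M (X n (\<lambda>x. gp x - ?v)))\<^sup>2 = (\<integral>x. indicat_real (B n) x * (norm (gp x))\<^sup>2 - 2 * ((indicat_real (B n) x * gp x $ 1) * ?v $ 1 + (indicat_real (B n) x * gp x $ 2) * ?v $ 2) + indicat_real (B n) x * ?q \<partial>M)"
      unfolding n2_X by (intro Bochner_Integration.integral_cong refl) (auto simp: sq algebra_simps)
    then show ?thesis
      using good_ind_integrable[OF Gp_sq, of n] good_ind_integrable[OF Gp[of 1], of n] good_ind_integrable[OF Gp[of 2], of n] good_ind_integrable[OF const_good[of ?q], of n] by simp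
  qed
  have e': "(n2 M (X n (\<lambda>x. gp x - ?v)))\<^sup>2 / (r n)\<^sup>2 = ?I n (\<lambda>x. (norm (gp x))\<^sup>2) / (r n)\<^sup>2 - 2 * (?I n (\<lambda>x. gp x $ 1) / (r n)\<^sup>2 * ?v $ 1 + ?I n (\<lambda>x. gp x $ 2) / (r n)\<^sup>2 * ?v $ 2) + ?I n (\<lambda>x. ?q) / (r n)\<^sup>2" for n
    unfolding e by (simp add: add_divide_distrib diff_divide_distrib)
  have "(\<lambda>n. (n2 M (X n (\<lambda>x. gp x - ?v)))\<^sup>2 / (r n)\<^sup>2) \<longlonglongrightarrow> ?q * vol - 2 * ((?v $ 1 * vol) * ?v $ 1 + (?v $ 2 * vol) * ?v $ 2) + ?q * vol"
    unfolding e' by (intro tendsto_intros good_average Gp_sq Gp const_good)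
  moreover have "?q * vol - 2 * ((?v $ 1 * vol) * ?v $ 1 + (?v $ 2 * vol) * ?v $ 2) + ?q * vol = 0"
    unfolding power2_norm_eq_inner by (simp add: inner_2 algebra_simps)
  ultimately show "(\<lambda>n. (n2 M (X n (\<lambda>x. gp x - gp x0)))\<^sup>2 / (r n)\<^sup>2) \<longlonglongrightarrow> 0" by simp
qed

end

section \<open>The error terms and the limit of the difference quotients\<close>

context good_inclusion
begin

text \<open>The squared integral is split at the cube of half-side \<open>s * r n\<close>. Inside,
  the bounds on \<open>k\<close> and on one factor \<open>a - a x0\<close> leave an average
  controlled by the Lebesgue point property; outside, the decay of \<open>k\<close> leads to the
  quartic tail, which is at most \<open>Z / s^2\<close> after division by \<open>(r n)^2\<close>.
  First \<open>s\<close> is chosen, then \<open>n\<close>.\<close>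

lemma lim_k:
  assumes km: "\<And>n. k n \<in> borel_measurable borel" and kC: "\<And>n x. norm (k n x) \<le> C"
    and kd: "\<And>n x. norm (k n x) * (norm (x - x0))\<^sup>2 \<le> C * (r n)\<^sup>2"
  shows "sqint M (\<lambda>x. (a x - a x0) *\<^sub>R k n x)" "(\<lambda>n. n2 M (\<lambda>x. (a x - a x0) *\<^sub>R k n x) / r n) \<longlonglongrightarrow> 0"
proof -
  note a_meas[measurable] borel_imp_M[OF km, measurable]
  have C0: "C \<ge> 0" by (rule order_trans[OF norm_ge_zero kC])
  show s: "sqint M (\<lambda>x. (a x - a x0) *\<^sub>R k n x)" for n
  proof (rule sqint_bounded_finite[OF finite_M])
    show "(\<lambda>x. (a x - a x0) *\<^sub>R k n x) \<in> borel_measurable M" by measurable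
    show "AE x in M. norm ((a x - a x0) *\<^sub>R k n x) \<le> 2 * K * C"
      using a_a0_bound
    proof eventually_elim
      case (elim x)
      then show ?case unfolding norm_scaleR by (intro mult_mono kC) (use K0 in auto)
    qed
  qed
  show "(\<lambda>n. n2 M (\<lambda>x. (a x - a x0) *\<^sub>R k n x) / r n) \<longlonglongrightarrow> 0"
  proof (rule tendsto_zero_from_squares[OF n2_nonneg r_pos], rule LIMSEQ_I)
    fix e :: real assume e: "e > 0"
    \<comment> \<open>\<open>88 = 4 * 22\<close>: the square of the bound \<open>2 * K\<close> times
      the constant of the quartic tail. The summand 1 in \<open>s\<close> ensures
      \<open>s \<le> s^2\<close>.\<close>
    define Z where "Z = 88 * K\<^sup>2 * C\<^sup>2"
    define s where "s = 1 + 2 * Z / e"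
    have Z0: "Z \<ge> 0" by (simp add: Z_def)
    have s1: "s \<ge> 1" using Z0 e by (simp add: s_def)
    have sZ: "Z / s\<^sup>2 \<le> e / 2"
    proof -
      have "2 * Z / e \<le> s" by (simp add: s_def)
      also have "s \<le> s\<^sup>2" using s1 by (simp add: power2_eq_square)
      finally show ?thesis using s1 e by (simp add: field_simps)
    qed
    define I where "I n = (\<integral>x. indicat_real (cube s n) x * \<bar>a x - a x0\<bar> \<partial>M)" for n
    have "(\<lambda>n. 2 * K * C\<^sup>2 * (I n / (r n)\<^sup>2)) \<longlonglongrightarrow> 2 * K * C\<^sup>2 * 0"
      unfolding I_def by (intro tendsto_mult_left good_cube[OF Ga]) (use s1 in simp)
    then obtain N where N: "\<And>n. n \<ge> N \<Longrightarrow> \<bar>2 * K * C\<^sup>2 * (I n / (r n)\<^sup>2)\<bar> < e / 2"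
      using LIMSEQ_D[of _ 0 "e / 2"] e by force
    have bound: "(n2 M (\<lambda>x. (a x - a x0) *\<^sub>R k n x))\<^sup>2 / (r n)\<^sup>2 \<le> 2 * K * C\<^sup>2 * (I n / (r n)\<^sup>2) + Z / s\<^sup>2" for n
    proof -
      define q where "q x = indicat_real (- square (s * r n) x0) x * (1 / norm (x - x0) ^ 4)" for x
      have sr: "s * r n > 0" using s1 r_pos[of n] by simp
      have qi: "integrable M q" "(\<integral>x. q x \<partial>M) \<le> 22 / (s * r n)\<^sup>2" unfolding q_def by (rule quartic_tail_M[OF sr])+
      have ai: "integrable M (\<lambda>x. indicat_real (cube s n) x * \<bar>a x - a x0\<bar>)"
      proof (rule sqint_imp_integrable(1)[OF finite_M sqint_bounded_finite[OF finite_M]])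
        have [measurable]: "indicat_real (cube s n) \<in> borel_measurable M" by (rule borel_imp_M) simp
        show "(\<lambda>x. indicat_real (cube s n) x * \<bar>a x - a x0\<bar>) \<in> borel_measurable M" by measurable
        show "AE x in M. norm (indicat_real (cube s n) x * \<bar>a x - a x0\<bar>) \<le> 2 * K"
          using a_a0_bound by eventually_elim (use K0 in \<open>auto simp: indicator_def\<close>)
      qed
      have "(n2 M (\<lambda>x. (a x - a x0) *\<^sub>R k n x))\<^sup>2
         \<le> (\<integral>x. 2 * K * C\<^sup>2 * (indicat_real (cube s n) x * \<bar>a x - a x0\<bar>) + 4 * K\<^sup>2 * C\<^sup>2 * (r n) ^ 4 * q x \<partial>M)"
        unfolding n2_sq
      proof (rule integral_mono_AE[OF sqint_integrable[OF s]])
        show "integrable M (\<lambda>x. 2 * K * C\<^sup>2 * (indicat_real (cube s n) x * \<bar>a x - a x0\<bar>) + 4 * K\<^sup>2 * C\<^sup>2 * (r n) ^ 4 * q x)"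
          using ai qi(1) by simp
        show "AE x in M. (norm ((a x - a x0) *\<^sub>R k n x))\<^sup>2 \<le> 2 * K * C\<^sup>2 * (indicat_real (cube s n) x * \<bar>a x - a x0\<bar>) + 4 * K\<^sup>2 * C\<^sup>2 * (r n) ^ 4 * q x"
          using a_a0_bound
        proof eventually_elim
          case (elim x)
          have eq: "(norm ((a x - a x0) *\<^sub>R k n x))\<^sup>2 = \<bar>a x - a x0\<bar>\<^sup>2 * (norm (k n x))\<^sup>2"
            by (simp add: power_mult_distrib)
          show ?case
          proof (cases "x \<in> cube s n")
            case True
            have "\<bar>a x - a x0\<bar>\<^sup>2 * (norm (k n x))\<^sup>2 \<le> (2 * K * \<bar>a x - a x0\<bar>) * C\<^sup>2"
            proof (rule mult_mono)
              show "\<bar>a x - a x0\<bar>\<^sup>2 \<le> 2 * K * \<bar>a x - a x0\<bar>"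
                using mult_right_mono[OF elim abs_ge_zero[of "a x - a x0"]] by (simp add: power2_eq_square)
            qed (use K0 kC in \<open>auto intro: power_mono\<close>)
            moreover have "q x = 0" using True by (simp add: q_def cube_def)
            ultimately show ?thesis unfolding eq using True by (simp add: mult_ac)
          next
            case False
            define t where "t = norm (x - x0)"
            have "\<not> t \<le> s * r n" using norm_imp_cube[of x s n] False by (auto simp: t_def)
            moreover have "x \<noteq> x0" using False sr by (auto simp: cube_def mem_square)
            then have t: "t > 0" by (simp add: t_def)
            have qx: "q x = 1 / t ^ 4" using False by (simp add: q_def cube_def t_def)
            have "norm (k n x) \<le> C * (r n)\<^sup>2 / t\<^sup>2" using kd[of n x] t by (simp add: t_def[symmetric] pos_le_divide_eq)
            then have "(norm (k n x))\<^sup>2 \<le> (C * (r n)\<^sup>2 / t\<^sup>2)\<^sup>2" by (intro power_mono) auto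
            moreover have "\<bar>a x - a x0\<bar>\<^sup>2 \<le> (2 * K)\<^sup>2" using elim by (intro power_mono) auto
            ultimately have "\<bar>a x - a x0\<bar>\<^sup>2 * (norm (k n x))\<^sup>2 \<le> (2 * K)\<^sup>2 * (C * (r n)\<^sup>2 / t\<^sup>2)\<^sup>2" by (intro mult_mono) auto
            also have "\<dots> = 4 * K\<^sup>2 * C\<^sup>2 * (r n) ^ 4 * q x"
              unfolding qx by (simp add: power_mult_distrib power_divide flip: power_mult)
            finally show ?thesis unfolding eq using False by simp
          qed
        qed
      qed
      also have "\<dots> = 2 * K * C\<^sup>2 * I n + 4 * K\<^sup>2 * C\<^sup>2 * (r n) ^ 4 * (\<integral>x. q x \<partial>M)" using ai qi(1) by (simp add: I_def)
      also have "\<dots> \<le> 2 * K * C\<^sup>2 * I n + 4 * K\<^sup>2 * C\<^sup>2 * (r n) ^ 4 * (22 / (s * r n)\<^sup>2)"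
        by (intro add_left_mono mult_left_mono qi(2)) simp
      also have "4 * K\<^sup>2 * C\<^sup>2 * (r n) ^ 4 * (22 / (s * r n)\<^sup>2) = Z / s\<^sup>2 * (r n)\<^sup>2"
        using r_pos[of n] s1 by (simp add: Z_def power_mult_distrib power4_eq_xxxx power2_eq_square)
      finally have "(n2 M (\<lambda>x. (a x - a x0) *\<^sub>R k n x))\<^sup>2 / (r n)\<^sup>2 \<le> (2 * K * C\<^sup>2 * I n + Z / s\<^sup>2 * (r n)\<^sup>2) / (r n)\<^sup>2"
        by (rule divide_right_mono) simp
      then show ?thesis using r_pos[of n] by (simp add: add_divide_distrib)
    qed
    have "norm ((n2 M (\<lambda>x. (a x - a x0) *\<^sub>R k n x))\<^sup>2 / (r n)\<^sup>2 - 0) < e" if n: "n \<ge> N" for n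
    proof -
      have "(n2 M (\<lambda>x. (a x - a x0) *\<^sub>R k n x))\<^sup>2 / (r n)\<^sup>2 \<ge> 0" by simp
      then show ?thesis unfolding real_norm_def diff_zero using bound[of n] N[OF n] sZ by linarith
    qed
    then show "\<exists>no. \<forall>n\<ge>no. norm ((n2 M (\<lambda>x. (a x - a x0) *\<^sub>R k n x))\<^sup>2 / (r n)\<^sup>2 - 0) < e" by blast
  qed
qed

lemma lim_hk:
  assumes km: "\<And>n. k n \<in> borel_measurable borel" and kC: "\<And>n x. norm (k n x) \<le> C"
    and kd: "\<And>n x. norm (k n x) * (norm (x - x0))\<^sup>2 \<le> C * (r n)\<^sup>2"
  shows "integrable M (\<lambda>x. h n x \<bullet> ((a x - a x0) *\<^sub>R k n x))"
    "(\<lambda>n. (\<integral>x. h n x \<bullet> ((a x - a x0) *\<^sub>R k n x) \<partial>M) / (r n)\<^sup>2) \<longlonglongrightarrow> 0"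
proof -
  note l = lim_k[of k C, OF km kC kd]
  show "integrable M (\<lambda>x. h n x \<bullet> ((a x - a x0) *\<^sub>R k n x))" by (rule sqint_inner[OF hs l(1)])
  obtain C' where C': "C' \<ge> 0" "\<And>n. n2 M (h n) \<le> C' * r n" by (rule h_small) blast
  show "(\<lambda>n. (\<integral>x. h n x \<bullet> ((a x - a x0) *\<^sub>R k n x) \<partial>M) / (r n)\<^sup>2) \<longlonglongrightarrow> 0"
    by (rule small_product[OF L2_inner_bound[OF hs l(1)] C'(2) n2_nonneg r_pos l(2)])
qed

text \<open>By duality \<open>w n / r n\<close> tends weakly to 0, because the energy of any fixed weak solution on the
  shrinking inclusions vanishes; compactness makes the convergence strong.\<close>

lemma lim_w: "(\<lambda>n. n2 M (w n) / r n) \<longlonglongrightarrow> 0"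
proof -
  obtain C where C: "C \<ge> 0" "\<And>n. n2 M (h n) \<le> C * r n" by (rule h_small) blast
  obtain D where D: "D \<ge> 0" "\<And>n. n2 M (X n gy) \<le> D * r n" by (rule gy_small) blast
  have H1: "H1pair (\<lambda>x. (1 / r n) * w n x) (\<lambda>x. (1 / r n) *\<^sub>R h n x)" for n
    using H1pair_lincomb[OF wh wh, of "1 / r n" n 0 n] by simp
  have hC: "n2 M (\<lambda>x. (1 / r n) *\<^sub>R h n x) \<le> C" for n
    unfolding n2_scaleR using C(2)[of n] r_pos[of n] by (simp add: field_simps)
  have weak: "(\<lambda>n. \<integral>x. (1 / r n) * w n x * k x \<partial>M) \<longlonglongrightarrow> 0" if k: "sqint M k" for k
  proof -
    \<comment> \<open>The dual problem: its solution converts the pairing of \<open>w n\<close> with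
      \<open>k\<close> into integrals over the inclusion, where \<open>X n g\<close> tends to
      0.\<close>
    obtain q g where q: "weak_sol a k q g" by (rule weak_sol_exists[OF adm k])
    note gs = H1pair_sqint(2)[OF weak_sol_H1pair[OF q]]
    have b: "\<bar>\<integral>x. (1 / r n) * w n x * k x \<partial>M\<bar> \<le> (2 * K * (D + C)) * n2 M (X n g)" for n
    proof -
      have ia: "integrable M (\<lambda>x. a x * (g x \<bullet> h n x))" by (rule L2_weighted_bound(1)[OF gs hs admissible_bound(1,2,3)[OF adm]])
      note ib = dab_int[OF hs[of n] X_sqint(1)[OF gs, of n]] and ic = dab_int[OF X_sqint(1)[OF gys, of n] X_sqint(1)[OF gs, of n]]
      have "(\<integral>x. ar n x * (h n x \<bullet> g x) \<partial>M) = (\<integral>x. a x * (g x \<bullet> h n x) + dab x * (h n x \<bullet> X n g x) \<partial>M)"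
        by (intro Bochner_Integration.integral_cong refl) (auto simp: ar_eq X_def inner_commute algebra_simps)
      also have "\<dots> = (\<integral>x. a x * (g x \<bullet> h n x) \<partial>M) + (\<integral>x. dab x * (h n x \<bullet> X n g x) \<partial>M)" using ia ib(1) by simp
      finally have "(\<integral>x. k x * w n x \<partial>M) = - (\<integral>x. dab x * (X n gy x \<bullet> X n g x) \<partial>M) - (\<integral>x. dab x * (h n x \<bullet> X n g x) \<partial>M)"
        using weak_sol_eq[OF q wh, of n] difference_equation[OF weak_sol_H1pair[OF q], of n] X_idem[of n gy _ g] by simp
      then have "\<bar>\<integral>x. k x * w n x \<partial>M\<bar> \<le> 2 * K * n2 M (X n gy) * n2 M (X n g) + 2 * K * n2 M (h n) * n2 M (X n g)"
        using ib(2) ic(2) by linarith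
      also have "\<dots> = (2 * K * (n2 M (X n gy) + n2 M (h n))) * n2 M (X n g)" by (simp add: algebra_simps)
      also have "\<dots> \<le> (2 * K * (D * r n + C * r n)) * n2 M (X n g)"
        by (intro mult_right_mono mult_left_mono add_mono C D n2_nonneg) (use K0 in simp)
      also have "\<dots> = r n * ((2 * K * (D + C)) * n2 M (X n g))" by (simp add: algebra_simps)
      finally have "\<bar>\<integral>x. k x * w n x \<partial>M\<bar> / r n \<le> (2 * K * (D + C)) * n2 M (X n g)"
        using r_pos[of n] by (simp add: pos_divide_le_eq mult.commute)
      moreover have "(\<integral>x. (1 / r n) * w n x * k x \<partial>M) = (1 / r n) * (\<integral>x. k x * w n x \<partial>M)"
        by (subst integral_mult_right_zero[symmetric]) (simp add: mult_ac)
      ultimately show ?thesis using r_pos[of n] by (simp add: abs_mult)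
    qed
    show ?thesis
    proof (rule LIMSEQ_null_le[OF b])
      show "(\<lambda>n. (2 * K * (D + C)) * n2 M (X n g)) \<longlonglongrightarrow> 0"
        using tendsto_mult_left[OF n2_X_tendsto[OF gs], of "2 * K * (D + C)"] by simp
    qed
  qed
  have "(\<lambda>n. n2 M (\<lambda>x. (1 / r n) * w n x)) \<longlonglongrightarrow> 0" by (rule rellich[OF H1 hC weak])
  moreover have "n2 M (\<lambda>x. (1 / r n) * w n x) = n2 M (w n) / r n" for n
    unfolding n2_cmult using r_pos[of n] by simp
  ultimately show ?thesis by simp
qed

text \<open>On the inclusion the potential's gradient is the constant \<open>depol H c\<close>, and \<open>c\<close> is chosen so that
  testing with it replaces \<open>(b - a x0) * (h n \<bullet> gp x0)\<close> by known terms; no limit profile of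
  \<open>h n\<close> is needed.\<close>

lemma main_limit: "(\<lambda>n. (Jcost \<Omega> f yd (ar n) - Jcost \<Omega> f yd a) / ((r n)\<^sup>2 * vol)) \<longlonglongrightarrow> dlim H (a x0) b (gy x0) (gp x0)"
proof -
  have a0': "a x0 > 0" using a0 alpha by linarith
  obtain c where c: "a x0 *\<^sub>R c + \<beta> *\<^sub>R depol H c = - \<beta> *\<^sub>R gp x0"
    "\<And>u. - \<beta> * (u \<bullet> gp x0) - \<beta> * (u \<bullet> depol H c) = dlim H (a x0) b u (gp x0)"
    by (rule polarization_solve[OF H a0' b_pos, of "gp x0"]) blast
  define m where "m = depol H c"
  obtain P k C L where C0: "C \<ge> 0" and lip: "\<And>r x y. r > 0 \<Longrightarrow> norm (P r x - P r y) \<le> L * norm (x - y)"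
    and der: "\<And>r. r > 0 \<Longrightarrow> AE x in lborel. (P r has_derivative (\<lambda>h. k r x \<bullet> h)) (at x)"
    and cont: "\<And>r. r > 0 \<Longrightarrow> AE x in lborel. isCont (k r) x"
    and km: "\<And>r. k r \<in> borel_measurable borel"
    and kin: "\<And>r x. (1 / r) *\<^sub>R (x - x0) \<in> ellipse H \<Longrightarrow> k r x = depol H c"
    and PC: "\<And>r x. r > 0 \<Longrightarrow> \<bar>P r x\<bar> \<le> C * r" and Pd: "\<And>r x. r > 0 \<Longrightarrow> \<bar>P r x\<bar> * norm (x - x0) \<le> C * r\<^sup>2"
    and kC: "\<And>r x. norm (k r x) \<le> C" and kd: "\<And>r x. r > 0 \<Longrightarrow> norm (k r x) * (norm (x - x0))\<^sup>2 \<le> C * r\<^sup>2"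
    and div: "\<And>r v A. r > 0 \<Longrightarrow> test_fun A v \<Longrightarrow>
       (\<integral>x. (k r x - (if (1 / r) *\<^sub>R (x - x0) \<in> ellipse H then c else 0)) \<bullet> cgrad v x \<partial>lborel) = 0"
    by (rule scaled_ellipse_potential[OF H, of x0 c]) (rule that)
  have kB: "k (r n) x = m" if "x \<in> B n" for n x using kin[of "r n" x] that unfolding B_iff m_def by simp
  obtain e0 where e0: "e0 > 0" "cball x0 e0 \<subseteq> \<Omega>" using open_Omega x0 by (meson open_contains_cball)
  define d where "d = e0 / 2"
  have d: "d > 0" "cball x0 (2 * d) \<subseteq> \<Omega>" using e0 by (auto simp: d_def)
  define G where "G n x = cutoff d x0 x *\<^sub>R k (r n) x + P (r n) x *\<^sub>R cutoff_grad d x0 x" for n x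
  define e where "e n x = G n x - k (r n) x" for n x
  have Gs: "sqint M (G n)" and Geq: "(\<integral>x. ar n x * (h n x \<bullet> G n x) \<partial>M) = - (\<integral>x. dab x * (X n gy x \<bullet> G n x) \<partial>M)" for n
    unfolding G_def[abs_def]
    by (rule cutoff_potential[OF d lip[OF r_pos] der[OF r_pos] cont[OF r_pos] km PC[OF r_pos] kC])+
  have ks: "sqint M (k (r n))" for n
    by (rule sqint_bounded_finite[OF finite_M borel_imp_M[OF km], where C=C]) (use kC in auto)
  have es: "sqint M (e n)" for n unfolding e_def[abs_def] by (rule sqint_diff[OF Gs ks])
  \<comment> \<open>\<open>6 = 2 + 4\<close>: the defect \<open>1 - cutoff\<close> contributes 2
    against the decay of \<open>k\<close>, the gradient of the cutoff contributes 4 against the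
    decay of the potential.\<close>
  define D where "D = 6 * C / d\<^sup>2"
  have eD: "norm (e n x) \<le> D * (r n)\<^sup>2" for n x
  proof -
    have "e n x = (cutoff d x0 x - 1) *\<^sub>R k (r n) x + P (r n) x *\<^sub>R cutoff_grad d x0 x"
      by (simp add: e_def G_def algebra_simps)
    then have "norm (e n x) \<le> \<bar>cutoff d x0 x - 1\<bar> * norm (k (r n) x) + \<bar>P (r n) x\<bar> * norm (cutoff_grad d x0 x)"
      by (simp add: norm_triangle_le)
    also have "\<dots> \<le> 2 * (norm (x - x0))\<^sup>2 / d\<^sup>2 * norm (k (r n) x) + \<bar>P (r n) x\<bar> * (4 / d\<^sup>2 * norm (x - x0))"
      by (intro add_mono mult_right_mono mult_left_mono cutoff_bounds(3,4)[OF d(1)]) auto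
    also have "\<dots> = 2 / d\<^sup>2 * (norm (k (r n) x) * (norm (x - x0))\<^sup>2) + 4 / d\<^sup>2 * (\<bar>P (r n) x\<bar> * norm (x - x0))"
      by (simp add: mult_ac)
    also have "\<dots> \<le> 2 / d\<^sup>2 * (C * (r n)\<^sup>2) + 4 / d\<^sup>2 * (C * (r n)\<^sup>2)"
      by (intro add_mono mult_left_mono kd[OF r_pos] Pd[OF r_pos]) auto
    also have "\<dots> = D * (r n)\<^sup>2" by (simp add: D_def field_simps)
    finally show ?thesis .
  qed
  have e_lim: "(\<lambda>n. n2 M (e n) / r n) \<longlonglongrightarrow> 0"
  proof (rule LIMSEQ_null_le)
    have one: "sqint M (\<lambda>x. 1 :: real)" by (rule sqint_const_finite[OF finite_M])
    fix n
    have "n2 M (e n) \<le> (D * (r n)\<^sup>2) * n2 M (\<lambda>x. 1 :: real)"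
      by (rule n2_mono[OF one sqint_meas[OF es]]) (use eD C0 in \<open>auto simp: D_def\<close>)
    then have "n2 M (e n) / r n \<le> (D * (r n)\<^sup>2) * n2 M (\<lambda>x. 1 :: real) / r n" by (rule divide_right_mono) (use r_pos[of n] in simp)
    also have "\<dots> = (D * n2 M (\<lambda>x. 1 :: real)) * r n" using r_pos[of n] by (simp add: power2_eq_square)
    finally show "\<bar>n2 M (e n) / r n\<bar> \<le> (D * n2 M (\<lambda>x. 1 :: real)) * r n" using r_pos[of n] by (simp add: abs_of_nonneg)
    show "(\<lambda>n. (D * n2 M (\<lambda>x. 1 :: real)) * r n) \<longlonglongrightarrow> 0" using tendsto_mult_left[OF r_lim] by force
  qed
  \<comment> \<open>\<open>k1\<close> and \<open>k2\<close> mark the two places where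
    \<open>a\<close> is frozen at \<open>x0\<close>: off the inclusion when testing with
    \<open>k\<close> (on it the perturbed coefficient is exactly \<open>b\<close>), and on the
    inclusion when \<open>b - a\<close> is replaced by \<open>\<beta>\<close> against
    \<open>gp x0\<close>. Both fields have the decay required by \<open>lim_hk\<close>.\<close>
  define k1 where "k1 n x = (if x \<in> B n then 0 else k (r n) x)" for n x
  define k2 where "k2 n x = (if x \<in> B n then gp x0 else 0)" for n x
  have k1: "k1 n \<in> borel_measurable borel" "norm (k1 n x) \<le> C" "norm (k1 n x) * (norm (x - x0))\<^sup>2 \<le> C * (r n)\<^sup>2" for n x
  proof -
    note km[measurable]
    show "k1 n \<in> borel_measurable borel" unfolding k1_def[abs_def] by measurable
  qed (use kC kd[OF r_pos] C0 in \<open>auto simp: k1_def\<close>)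
  define C2 where "C2 = norm (gp x0) * (1 + \<rho>\<^sup>2)"
  have C2: "norm (gp x0) \<le> C2" "norm (gp x0) * \<rho>\<^sup>2 \<le> C2" "C2 \<ge> 0" by (auto simp: C2_def algebra_simps)
  have k2: "k2 n \<in> borel_measurable borel" "norm (k2 n x) \<le> C2" "norm (k2 n x) * (norm (x - x0))\<^sup>2 \<le> C2 * (r n)\<^sup>2" for n x
  proof -
    show "k2 n \<in> borel_measurable borel" unfolding k2_def[abs_def] by measurable
    show "norm (k2 n x) \<le> C2" using C2 by (simp add: k2_def)
    show "norm (k2 n x) * (norm (x - x0))\<^sup>2 \<le> C2 * (r n)\<^sup>2"
    proof (cases "x \<in> B n")
      case True
      have "(norm (x - x0))\<^sup>2 \<le> (\<rho> * r n)\<^sup>2" by (intro power_mono B_norm[OF True]) auto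
      then have "norm (gp x0) * (norm (x - x0))\<^sup>2 \<le> norm (gp x0) * (\<rho> * r n)\<^sup>2" by (rule mult_left_mono) simp
      also have "\<dots> = (norm (gp x0) * \<rho>\<^sup>2) * (r n)\<^sup>2" by (simp add: power_mult_distrib)
      also have "\<dots> \<le> C2 * (r n)\<^sup>2" by (rule mult_right_mono[OF C2(2)]) simp
      finally show ?thesis using True by (simp add: k2_def)
    next
      case False then show ?thesis using C2(3) by (simp add: k2_def)
    qed
  qed
  note lim1 = lim_hk[of k1 C, OF k1] and lim2 = lim_hk[of k2 C2, OF k2]
  define E1 where "E1 n = (\<integral>x. h n x \<bullet> ((a x - a x0) *\<^sub>R k1 n x) \<partial>M)" for n
  define E2 where "E2 n = (\<integral>x. ar n x * (h n x \<bullet> e n x) \<partial>M)" for n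
  define E3 where "E3 n = (\<integral>x. dab x * (X n gy x \<bullet> e n x) \<partial>M)" for n
  define E4 where "E4 n = (\<integral>x. h n x \<bullet> ((a x - a x0) *\<^sub>R k2 n x) \<partial>M)" for n
  define E5 where "E5 n = (\<integral>x. dab x * (h n x \<bullet> X n (\<lambda>x. gp x - gp x0) x) \<partial>M)" for n
  define Y where "Y n = (\<integral>x. X n (h n) x \<bullet> gp x0 \<partial>M)" for n
  have cs: "sqint M (\<lambda>x. v)" for v :: R2 by (rule sqint_const_finite[OF finite_M])
  have gd: "sqint M (\<lambda>x. gp x - gp x0)" by (rule sqint_diff[OF gps cs])
  note Xh = X_sqint(1)[OF hs]
  have Yi: "integrable M (\<lambda>x. X n (h n) x \<bullet> gp x0)" for n by (rule sqint_inner[OF Xh cs])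
  have free: "integrable M (\<lambda>x. (k (r n) x - indicat_real (B n) x *\<^sub>R c) \<bullet> h n x)"
      "(\<integral>x. (k (r n) x - indicat_real (B n) x *\<^sub>R c) \<bullet> h n x \<partial>M) = 0" for n
  proof -
    let ?F = "\<lambda>x. k (r n) x - indicat_real (B n) x *\<^sub>R c"
    note km[measurable]
    have Fm: "?F \<in> borel_measurable borel" by measurable
    have Fb: "norm (?F x) \<le> C + norm c" for x
      by (rule order_trans[OF norm_triangle_ineq4]) (use kC[of "r n" x] in \<open>auto simp: indicator_def intro: add_mono add_increasing2\<close>)
    have "sqint M ?F" by (rule sqint_bounded_finite[OF finite_M borel_imp_M[OF Fm]]) (use Fb in auto)
    then show "integrable M (\<lambda>x. ?F x \<bullet> h n x)" by (rule sqint_inner[OF _ hs])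
    have F_if: "?F x = k (r n) x - (if (1 / r n) *\<^sub>R (x - x0) \<in> ellipse H then c else 0)" for x
      using B_iff[of x n] by (simp add: indicator_def)
    show "(\<integral>x. ?F x \<bullet> h n x \<partial>M) = 0"
      by (rule divergence_free_extend[OF Fm Fb _ wh]) (unfold F_if, rule div[OF r_pos])
  qed
  have key: "\<beta> * Y n = (\<integral>x. dab x * (X n gy x \<bullet> m) \<partial>M) + (E1 n + E2 n + E3 n)" for n
  proof -
    \<comment> \<open>On the inclusion the equation for \<open>c\<close> turns \<open>b * m\<close>
      into \<open>a x0 * (m - c) - \<beta> * gp x0\<close>. The first part completes the divergence
      free field, which integrates to zero against \<open>h n\<close>; the second produces
      \<open>Y n\<close>.\<close>
    have pt: "ar n x * (h n x \<bullet> G n x) = a x0 * ((k (r n) x - indicat_real (B n) x *\<^sub>R c) \<bullet> h n x)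
       - \<beta> * (X n (h n) x \<bullet> gp x0) + h n x \<bullet> ((a x - a x0) *\<^sub>R k1 n x) + ar n x * (h n x \<bullet> e n x)" for x
    proof -
      have s: "ar n x * (h n x \<bullet> G n x) = ar n x * (h n x \<bullet> k (r n) x) + ar n x * (h n x \<bullet> e n x)"
        by (simp add: e_def inner_diff_right algebra_simps)
      have "ar n x * (h n x \<bullet> k (r n) x) = a x0 * ((k (r n) x - indicat_real (B n) x *\<^sub>R c) \<bullet> h n x)
         - \<beta> * (X n (h n) x \<bullet> gp x0) + h n x \<bullet> ((a x - a x0) *\<^sub>R k1 n x)"
      proof (cases "x \<in> B n")
        case True
        have "h n x \<bullet> (a x0 *\<^sub>R c + \<beta> *\<^sub>R m) = h n x \<bullet> (- \<beta> *\<^sub>R gp x0)" unfolding m_def c(1) ..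
        then have "a x0 * (h n x \<bullet> c) + \<beta> * (h n x \<bullet> m) = - \<beta> * (h n x \<bullet> gp x0)" by (simp add: inner_add_right)
        then show ?thesis using True kB[OF True]
          by (simp add: ar_eq dab_def X_def k1_def inner_diff_left inner_commute[of _ "h n x"] algebra_simps)
      next
        case False
        then show ?thesis by (simp add: ar_eq X_def k1_def inner_commute algebra_simps)
      qed
      then show ?thesis using s by simp
    qed
    have "(\<integral>x. ar n x * (h n x \<bullet> G n x) \<partial>M) = a x0 * 0 - \<beta> * Y n + E1 n + E2 n"
      unfolding pt using free[of n] Yi[of n] lim1(1)[of n] ar_int(1)[OF hs es, of n n n]
      by (simp add: Y_def E1_def E2_def)
    moreover have "(\<integral>x. dab x * (X n gy x \<bullet> G n x) \<partial>M) = (\<integral>x. dab x * (X n gy x \<bullet> m) \<partial>M) + E3 n"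
    proof -
      have "dab x * (X n gy x \<bullet> G n x) = dab x * (X n gy x \<bullet> m) + dab x * (X n gy x \<bullet> e n x)" for x
        using kB[of x n] by (cases "x \<in> B n") (auto simp: X_def e_def inner_diff_right algebra_simps)
      then show ?thesis using dab_int(1)[OF X_sqint(1)[OF gys] cs, of n m] dab_int(1)[OF X_sqint(1)[OF gys] es, of n n]
        by (simp add: E3_def)
    qed
    ultimately show ?thesis using Geq[of n] by simp
  qed
  \<comment> \<open>The second integral of the cost formula is split into
    \<open>\<beta> * Y n\<close>, which \<open>key\<close> expresses through \<open>gy\<close>, the
    freezing error \<open>E4\<close> and the oscillation \<open>E5\<close> of
    \<open>gp\<close>.\<close>
  have hp: "(\<integral>x. dab x * (X n (h n) x \<bullet> gp x) \<partial>M) = \<beta> * Y n - E4 n + E5 n" for n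
  proof -
    have "dab x * (X n (h n) x \<bullet> gp x) = \<beta> * (X n (h n) x \<bullet> gp x0) - h n x \<bullet> ((a x - a x0) *\<^sub>R k2 n x)
       + dab x * (h n x \<bullet> X n (\<lambda>x. gp x - gp x0) x)" for x
      by (simp add: X_def k2_def dab_def inner_diff_right algebra_simps)
    then show ?thesis using Yi[of n] lim2(1)[of n] dab_int(1)[OF hs X_sqint(1)[OF gd], of n n]
      by (simp add: Y_def E4_def E5_def)
  qed
  obtain C3 where C3: "C3 \<ge> 0" "\<And>n. n2 M (h n) \<le> C3 * r n" by (rule h_small) blast
  obtain C4 where C4: "C4 \<ge> 0" "\<And>n. n2 M (X n gy) \<le> C4 * r n" by (rule gy_small) blast
  have l1: "(\<lambda>n. E1 n / (r n)\<^sup>2) \<longlonglongrightarrow> 0" and l4: "(\<lambda>n. E4 n / (r n)\<^sup>2) \<longlonglongrightarrow> 0"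
    unfolding E1_def E4_def by (rule lim1(2), rule lim2(2))
  have l2: "(\<lambda>n. E2 n / (r n)\<^sup>2) \<longlonglongrightarrow> 0"
  proof (rule small_product[OF _ _ n2_nonneg r_pos e_lim])
    show "\<bar>E2 n\<bar> \<le> (K * n2 M (h n)) * n2 M (e n)" for n unfolding E2_def by (rule ar_int(2)[OF hs es])
    show "K * n2 M (h n) \<le> (K * C3) * r n" for n using mult_left_mono[OF C3(2)[of n] K0] by simp
  qed
  have l3: "(\<lambda>n. E3 n / (r n)\<^sup>2) \<longlonglongrightarrow> 0"
  proof (rule small_product[OF _ _ n2_nonneg r_pos e_lim])
    show "\<bar>E3 n\<bar> \<le> (2 * K * n2 M (X n gy)) * n2 M (e n)" for n unfolding E3_def by (rule dab_int(2)[OF X_sqint(1)[OF gys] es])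
    show "2 * K * n2 M (X n gy) \<le> (2 * K * C4) * r n" for n using mult_left_mono[OF C4(2)[of n], of "2 * K"] K0 by simp
  qed
  have l5: "(\<lambda>n. E5 n / (r n)\<^sup>2) \<longlonglongrightarrow> 0"
  proof (rule small_product[OF _ _ n2_nonneg r_pos lim_p])
    show "\<bar>E5 n\<bar> \<le> (2 * K * n2 M (h n)) * n2 M (X n (\<lambda>x. gp x - gp x0))" for n unfolding E5_def by (rule dab_int(2)[OF hs X_sqint(1)[OF gd]])
    show "2 * K * n2 M (h n) \<le> (2 * K * C3) * r n" for n using mult_left_mono[OF C3(2)[of n], of "2 * K"] K0 by simp
  qed
  have l6: "(\<lambda>n. (n2 M (w n) / r n)\<^sup>2 / 2) \<longlonglongrightarrow> 0" using tendsto_power[OF lim_w, of 2] by (auto intro: tendsto_eq_intros)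
  let ?Q = "\<lambda>n. (- ((\<integral>x. dab x * (X n gy x \<bullet> gp x) \<partial>M) / (r n)\<^sup>2) - (\<integral>x. dab x * (X n gy x \<bullet> m) \<partial>M) / (r n)\<^sup>2
     - (E1 n / (r n)\<^sup>2 + E2 n / (r n)\<^sup>2 + E3 n / (r n)\<^sup>2) + E4 n / (r n)\<^sup>2 - E5 n / (r n)\<^sup>2 + (n2 M (w n) / r n)\<^sup>2 / 2) / vol"
  have vol: "vol > 0" by (rule ellipse_measure_pos[OF H])
  have "?Q \<longlonglongrightarrow> (- (\<beta> * (gy x0 \<bullet> gp x0) * vol) - \<beta> * (gy x0 \<bullet> m) * vol - (0 + 0 + 0) + 0 - 0 + 0) / vol"
    by (intro tendsto_intros lim_yp lim_y l1 l2 l3 l4 l5 l6) (use vol in simp)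
  moreover have "(- (\<beta> * (gy x0 \<bullet> gp x0) * vol) - \<beta> * (gy x0 \<bullet> m) * vol - (0 + 0 + 0) + 0 - 0 + 0) / vol = dlim H (a x0) b (gy x0) (gp x0)"
    using c(2)[of "gy x0"] vol by (simp add: m_def[symmetric] diff_divide_distrib left_diff_distrib)
  moreover have "(Jcost \<Omega> f yd (ar n) - Jcost \<Omega> f yd a) / ((r n)\<^sup>2 * vol) = ?Q n" for n
  proof -
    have "Jcost \<Omega> f yd (ar n) - Jcost \<Omega> f yd a = - (\<integral>x. dab x * (X n gy x \<bullet> gp x) \<partial>M) - (\<integral>x. dab x * (X n gy x \<bullet> m) \<partial>M)
       - (E1 n + E2 n + E3 n) + E4 n - E5 n + (n2 M (w n))\<^sup>2 / 2"
      unfolding cost_difference hp key by simp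
    then show ?thesis by (simp add: power_divide add_divide_distrib diff_divide_distrib)
  qed
  ultimately show ?thesis by simp
qed

end

section \<open>The range over all ellipses\<close>

text \<open>The two terms on the left are the squared real and imaginary parts of the product of
  \<open>u\<close> and \<open>v\<close> as complex numbers.\<close>

lemma quadratic_product_identity:
  "(u $ 1 * v $ 1 - u $ 2 * v $ 2)\<^sup>2 + (u $ 1 * v $ 2 + u $ 2 * v $ 1)\<^sup>2 = (norm u * norm v)\<^sup>2" for u v :: R2
  unfolding power_mult_distrib norm_2 by (simp add: power2_eq_square algebra_simps)

text \<open>Split \<open>H\<close> into half its trace times the identity and its traceless part.
  Subtracting the centre of the interval cancels the trace in the numerator, so the trace survives
  only in the denominator.\<close>

lemma dlim_center:
  assumes H: "H \<in> Hset" and a0: "a0 > 0" and b: "b > 0"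
  shows "dlim H a0 b u v - (- (b - a0) * (u \<bullet> v) + 1/2 * (b - a0)\<^sup>2 / b * (u \<bullet> v))
    = (b - a0)\<^sup>2 / (2 * b) * (((b\<^sup>2 - a0\<^sup>2) * (u \<bullet> v) + 2 * b * a0 * ((H $ 1 $ 1 - H $ 2 $ 2) / 2 * (u $ 1 * v $ 1 - u $ 2 * v $ 2)
        + H $ 1 $ 2 * (u $ 1 * v $ 2 + u $ 2 * v $ 1))) / (mtr H * a0 * b + a0\<^sup>2 + b\<^sup>2))"
proof -
  define D where "D = mtr H * a0 * b + a0\<^sup>2 + b\<^sup>2"
  have "mtr H * a0 * b > 0" using Hset_mtr[OF H] a0 b by simp
  then have D: "D > 0" unfolding D_def by (simp add: add_pos_nonneg)
  define s where "s = u \<bullet> v"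
  define q where "q = u \<bullet> (H *v v)"
  define \<delta> where "\<delta> = (H $ 1 $ 1 - H $ 2 $ 2) / 2 * (u $ 1 * v $ 1 - u $ 2 * v $ 2) + H $ 1 $ 2 * (u $ 1 * v $ 2 + u $ 2 * v $ 1)"
  have q: "q = mtr H * s / 2 + \<delta>"
    unfolding q_def s_def \<delta>_def mtr_def by (simp add: inner_2 matvec_2 HsetD(1)[OF H] field_simps)
  have De: "(mtr H + 2) * a0 * b + (b - a0)\<^sup>2 = D" by (simp add: D_def power2_eq_square algebra_simps)
  have "(b - a0)\<^sup>2 * (b * s + a0 * q) / D - 1/2 * (b - a0)\<^sup>2 / b * s = (b - a0)\<^sup>2 / (2 * b) * ((2 * b * (b * s + a0 * q) - D * s) / D)"
    using b D by (simp add: field_simps)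
  also have "2 * b * (b * s + a0 * q) - D * s = (b\<^sup>2 - a0\<^sup>2) * s + 2 * b * a0 * \<delta>"
    unfolding q D_def by (simp add: power2_eq_square algebra_simps)
  finally show ?thesis unfolding dlim_def De s_def[symmetric] q_def[symmetric] \<delta>_def[symmetric] D_def[symmetric] by simp
qed

text \<open>For \<open>det H = 1\<close> the traceless part of \<open>H\<close>, read as a plane
  vector, is shorter than \<open>mtr H / 2\<close>; Cauchy-Schwarz pairs it with the complex product
  of \<open>u\<close> and \<open>v\<close>, of length \<open>T\<close>. Since
  \<open>b^2 - a0^2\<close> is at most \<open>a0^2 + b^2\<close> in modulus, the numerator is at
  most \<open>D * T\<close>.\<close>

lemma dlim_bound:
  fixes u v :: R2 and a0 b :: real
  assumes H: "H \<in> Hset" and a0: "a0 > 0" and b: "b > 0"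
  defines "c \<equiv> - (b - a0) * (u \<bullet> v) + 1/2 * (b - a0)\<^sup>2 / b * (u \<bullet> v)"
    and "t \<equiv> 1/2 * (b - a0)\<^sup>2 / b * (norm u * norm v)"
  shows "dlim H a0 b u v \<in> {c - t .. c + t}"
proof -
  define T where "T = norm u * norm v"
  define A where "A = u $ 1 * v $ 1 - u $ 2 * v $ 2"
  define B where "B = u $ 1 * v $ 2 + u $ 2 * v $ 1"
  define g where "g = (H $ 1 $ 1 - H $ 2 $ 2) / 2"
  define D where "D = mtr H * a0 * b + a0\<^sup>2 + b\<^sup>2"
  have T0: "T \<ge> 0" by (simp add: T_def)
  have tau: "mtr H > 0" using Hset_mtr[OF H] by simp
  then have "mtr H * a0 * b > 0" using a0 b by simp
  then have D: "D > 0" unfolding D_def by (simp add: add_pos_nonneg)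
  have AB: "A\<^sup>2 + B\<^sup>2 = T\<^sup>2" unfolding A_def B_def T_def by (rule quadratic_product_identity)
  have gh: "g\<^sup>2 + (H $ 1 $ 2)\<^sup>2 \<le> (mtr H / 2)\<^sup>2"
    using HsetD(2)[OF H] by (simp add: g_def mtr_def power2_eq_square field_simps)
  have "(g * A + H $ 1 $ 2 * B)\<^sup>2 \<le> (g\<^sup>2 + (H $ 1 $ 2)\<^sup>2) * (A\<^sup>2 + B\<^sup>2)"
    using zero_le_power2[of "g * B - H $ 1 $ 2 * A"] by (simp add: power2_eq_square algebra_simps)
  also have "\<dots> \<le> (mtr H / 2)\<^sup>2 * T\<^sup>2" unfolding AB by (rule mult_right_mono[OF gh]) simp
  finally have "\<bar>g * A + H $ 1 $ 2 * B\<bar> \<le> mtr H / 2 * T"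
    unfolding power_mult_distrib[symmetric] using T0 tau by (intro power2_le_imp_le[of "\<bar>g * A + H $ 1 $ 2 * B\<bar>"]) simp_all
  then have 1: "\<bar>2 * b * a0 * (g * A + H $ 1 $ 2 * B)\<bar> \<le> mtr H * a0 * b * T"
  proof -
    assume le: "\<bar>g * A + H $ 1 $ 2 * B\<bar> \<le> mtr H / 2 * T"
    have "\<bar>2 * b * a0 * (g * A + H $ 1 $ 2 * B)\<bar> = (2 * b * a0) * \<bar>g * A + H $ 1 $ 2 * B\<bar>"
      unfolding abs_mult[of "2 * b * a0"] using a0 b by simp
    also have "\<dots> \<le> (2 * b * a0) * (mtr H / 2 * T)" by (rule mult_left_mono[OF le]) (use a0 b in simp)
    finally show ?thesis by (simp add: mult_ac)
  qed
  have "\<bar>(b\<^sup>2 - a0\<^sup>2) * (u \<bullet> v)\<bar> \<le> (a0\<^sup>2 + b\<^sup>2) * T"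
    unfolding abs_mult T_def by (intro mult_mono Cauchy_Schwarz_ineq2) (auto simp: abs_le_iff)
  then have "\<bar>(b\<^sup>2 - a0\<^sup>2) * (u \<bullet> v) + 2 * b * a0 * (g * A + H $ 1 $ 2 * B)\<bar> \<le> D * T"
    using 1 unfolding D_def distrib_right by linarith
  then have "\<bar>((b\<^sup>2 - a0\<^sup>2) * (u \<bullet> v) + 2 * b * a0 * (g * A + H $ 1 $ 2 * B)) / D\<bar> \<le> T"
    using D by (simp add: pos_divide_le_eq mult.commute)
  then have "(b - a0)\<^sup>2 / (2 * b) * \<bar>((b\<^sup>2 - a0\<^sup>2) * (u \<bullet> v) + 2 * b * a0 * (g * A + H $ 1 $ 2 * B)) / D\<bar> \<le> (b - a0)\<^sup>2 / (2 * b) * T"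
    using b by (intro mult_left_mono) auto
  moreover have "(b - a0)\<^sup>2 / (2 * b) * \<bar>((b\<^sup>2 - a0\<^sup>2) * (u \<bullet> v) + 2 * b * a0 * (g * A + H $ 1 $ 2 * B)) / D\<bar> = \<bar>dlim H a0 b u v - c\<bar>"
    unfolding c_def dlim_center[OF H a0 b] g_def A_def B_def D_def using b by (simp add: abs_mult)
  moreover have "(b - a0)\<^sup>2 / (2 * b) * T = t" by (simp add: t_def T_def)
  ultimately have "\<bar>dlim H a0 b u v - c\<bar> \<le> t" by simp
  then show ?thesis by (auto simp: abs_le_iff)
qed

text \<open>\<open>H n\<close> has eigenvalues \<open>1 / x n\<close> and \<open>x n\<close> with
  \<open>x n\<close> tending to 0. Its traceless part grows like half the trace in the fixed
  direction \<open>(C, S)\<close>, so the terms without trace die out and only the cosine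
  \<open>\<theta>\<close> of the angle between \<open>(C, S)\<close> and \<open>(A, B)\<close>
  survives.\<close>

lemma dlim_approximation:
  fixes u v :: R2 and a0 b :: real
  assumes a0: "a0 > 0" and b: "b > 0" and l: "\<bar>\<theta>\<bar> \<le> 1"
  defines "c \<equiv> - (b - a0) * (u \<bullet> v) + 1/2 * (b - a0)\<^sup>2 / b * (u \<bullet> v)"
    and "t \<equiv> 1/2 * (b - a0)\<^sup>2 / b * (norm u * norm v)"
  obtains H :: "nat \<Rightarrow> real^2^2" where "\<And>n. H n \<in> Hset" "(\<lambda>n. dlim (H n) a0 b u v) \<longlonglongrightarrow> c + \<theta> * t"
proof -
  define T where "T = norm u * norm v"
  define A where "A = u $ 1 * v $ 1 - u $ 2 * v $ 2"
  define B where "B = u $ 1 * v $ 2 + u $ 2 * v $ 1"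
  have AB: "A\<^sup>2 + B\<^sup>2 = T\<^sup>2" unfolding A_def B_def T_def by (rule quadratic_product_identity)
  obtain C S where CS: "C\<^sup>2 + S\<^sup>2 = 1" "C * A + S * B = \<theta> * T"
  proof (cases "T = 0")
    case True
    then have "A = 0" "B = 0" using AB by (auto simp: sum_power2_eq_zero_iff)
    then show ?thesis using that[of 1 0] True by simp
  next
    case False
    \<comment> \<open>The sine to the cosine \<open>\<theta>\<close>: \<open>(C, S)\<close> is the
      normalised vector \<open>(A, B)\<close> turned by that angle.\<close>
    define \<mu> where "\<mu> = sqrt (1 - \<theta>\<^sup>2)"
    have "\<theta>\<^sup>2 \<le> 1" using l by (simp add: abs_square_le_1)
    then have mu: "\<mu>\<^sup>2 = 1 - \<theta>\<^sup>2" by (simp add: \<mu>_def)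
    have 1: "(\<theta> * A - \<mu> * B)\<^sup>2 + (\<theta> * B + \<mu> * A)\<^sup>2 = (\<theta>\<^sup>2 + \<mu>\<^sup>2) * (A\<^sup>2 + B\<^sup>2)" by (simp add: power2_eq_square algebra_simps)
    have 2: "(\<theta> * A - \<mu> * B) * A + (\<theta> * B + \<mu> * A) * B = \<theta> * (A\<^sup>2 + B\<^sup>2)" by (simp add: power2_eq_square algebra_simps)
    show ?thesis
    proof (rule that[of "(\<theta> * A - \<mu> * B) / T" "(\<theta> * B + \<mu> * A) / T"])
      show "((\<theta> * A - \<mu> * B) / T)\<^sup>2 + ((\<theta> * B + \<mu> * A) / T)\<^sup>2 = 1"
        unfolding power_divide add_divide_distrib[symmetric] 1 mu AB using False by simp
      have "(\<theta> * A - \<mu> * B) / T * A + (\<theta> * B + \<mu> * A) / T * B = \<theta> * (A\<^sup>2 + B\<^sup>2) / T"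
        unfolding 2[symmetric] by (simp add: add_divide_distrib distrib_right left_diff_distrib diff_divide_distrib)
      then show "(\<theta> * A - \<mu> * B) / T * A + (\<theta> * B + \<mu> * A) / T * B = \<theta> * T"
        unfolding AB using False by (simp add: power2_eq_square)
    qed
  qed
  define x where "x n = inverse (real (Suc n))" for n
  have x: "x n > 0" "x n \<le> 1" for n by (auto simp: x_def inverse_le_1_iff)
  have x_lim: "x \<longlonglongrightarrow> 0" unfolding x_def by (rule LIMSEQ_inverse_real_of_nat)
  define \<tau> where "\<tau> n = 1 / x n + x n" for n
  define \<sigma> where "\<sigma> n = 1 / x n - x n" for n
  define H :: "nat \<Rightarrow> real^2^2" where
    "H n = vector [vector [(\<tau> n + \<sigma> n * C) / 2, \<sigma> n * S / 2], vector [\<sigma> n * S / 2, (\<tau> n - \<sigma> n * C) / 2]]" for n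
  have Hc: "H n $ 1 $ 1 = (\<tau> n + \<sigma> n * C) / 2" "H n $ 1 $ 2 = \<sigma> n * S / 2" "H n $ 2 $ 1 = \<sigma> n * S / 2"
    "H n $ 2 $ 2 = (\<tau> n - \<sigma> n * C) / 2" for n by (simp_all add: H_def)
  have det: "H n $ 1 $ 1 * H n $ 2 $ 2 - H n $ 1 $ 2 * H n $ 1 $ 2 = 1" for n
  proof -
    have "H n $ 1 $ 1 * H n $ 2 $ 2 - H n $ 1 $ 2 * H n $ 1 $ 2 = ((\<tau> n)\<^sup>2 - (\<sigma> n)\<^sup>2 * (C\<^sup>2 + S\<^sup>2)) / 4"
      unfolding Hc by (simp add: power2_eq_square field_simps)
    also have "\<dots> = 1" unfolding CS \<tau>_def \<sigma>_def using x(1)[of n] by (simp add: power2_eq_square algebra_simps)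
    finally show ?thesis .
  qed
  have h11: "H n $ 1 $ 1 > 0" for n
  proof -
    have "C\<^sup>2 \<le> 1" using CS(1) zero_le_power2[of S] by linarith
    then have "\<bar>C\<bar> \<le> 1" by (simp add: abs_square_le_1)
    moreover have s0: "\<sigma> n \<ge> 0"
    proof -
      have "1 / x n \<ge> 1" using x[of n] by simp
      then show ?thesis unfolding \<sigma>_def using x(2)[of n] by linarith
    qed
    ultimately have "\<bar>\<sigma> n * C\<bar> \<le> \<sigma> n * 1" unfolding abs_mult by (intro mult_mono) auto
    moreover have "\<sigma> n < \<tau> n" using x(1)[of n] by (simp add: \<sigma>_def \<tau>_def)
    ultimately show ?thesis unfolding Hc abs_le_iff by simp
  qed
  have Hset: "H n \<in> Hset" for n
    unfolding Hset_def
  proof (intro CollectI conjI allI impI)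
    show "transpose (H n) = H n" by (simp add: vec_eq_iff forall_2 transpose_def Hc)
    show "det (H n) = 1" using det[of n] by (simp add: det_2 Hc)
    fix \<xi> :: R2 assume xi: "\<xi> \<noteq> 0"
    let ?h = "H n $ 1 $ 1" and ?k = "H n $ 1 $ 2"
    have "?h * (\<xi> \<bullet> (H n *v \<xi>)) = (?h * \<xi> $ 1 + ?k * \<xi> $ 2)\<^sup>2 + (H n $ 1 $ 1 * H n $ 2 $ 2 - H n $ 1 $ 2 * H n $ 1 $ 2) * (\<xi> $ 2)\<^sup>2"
      using Hc(2,3)[of n] by (simp add: inner_2 matvec_2 power2_eq_square algebra_simps)
    also have "\<dots> = (?h * \<xi> $ 1 + ?k * \<xi> $ 2)\<^sup>2 + (\<xi> $ 2)\<^sup>2" unfolding det by simp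
    also have "\<dots> > 0"
    proof (cases "\<xi> $ 2 = 0")
      case True
      then have "\<xi> $ 1 \<noteq> 0" using xi by (auto simp: vec_eq_iff forall_2)
      then show ?thesis using True h11[of n] by simp
    next
      case False then show ?thesis by (simp add: add_nonneg_pos)
    qed
    finally show "\<xi> \<bullet> (H n *v \<xi>) > 0" using h11[of n] by (simp add: zero_less_mult_iff)
  qed
  \<comment> \<open>Numerator and denominator are multiplied by \<open>x n\<close>, which removes
    the poles of the trace before the limit is taken.\<close>
  have eq: "dlim (H n) a0 b u v - c = (b - a0)\<^sup>2 / (2 * b) *
    (((b\<^sup>2 - a0\<^sup>2) * (u \<bullet> v) * x n + b * a0 * ((1 - (x n)\<^sup>2) * (\<theta> * T))) / ((1 + (x n)\<^sup>2) * a0 * b + (a0\<^sup>2 + b\<^sup>2) * x n))" for n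
  proof -
    have d: "(H n $ 1 $ 1 - H n $ 2 $ 2) / 2 * A + H n $ 1 $ 2 * B = \<sigma> n * (\<theta> * T) / 2"
      unfolding CS(2)[symmetric] Hc by (simp add: field_simps)
    have m: "mtr (H n) = \<tau> n" unfolding mtr_def Hc by (simp add: field_simps)
    have "dlim (H n) a0 b u v - c = (b - a0)\<^sup>2 / (2 * b) * (((b\<^sup>2 - a0\<^sup>2) * (u \<bullet> v) + 2 * b * a0 * (\<sigma> n * (\<theta> * T) / 2)) / (\<tau> n * a0 * b + a0\<^sup>2 + b\<^sup>2))"
      unfolding c_def dlim_center[OF Hset a0 b] m A_def[symmetric] B_def[symmetric] d ..
    also have "((b\<^sup>2 - a0\<^sup>2) * (u \<bullet> v) + 2 * b * a0 * (\<sigma> n * (\<theta> * T) / 2)) / (\<tau> n * a0 * b + a0\<^sup>2 + b\<^sup>2)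
      = (((b\<^sup>2 - a0\<^sup>2) * (u \<bullet> v) + 2 * b * a0 * (\<sigma> n * (\<theta> * T) / 2)) * x n) / ((\<tau> n * a0 * b + a0\<^sup>2 + b\<^sup>2) * x n)"
      using x(1)[of n] by simp
    also have "((b\<^sup>2 - a0\<^sup>2) * (u \<bullet> v) + 2 * b * a0 * (\<sigma> n * (\<theta> * T) / 2)) * x n = (b\<^sup>2 - a0\<^sup>2) * (u \<bullet> v) * x n + b * a0 * ((1 - (x n)\<^sup>2) * (\<theta> * T))"
    proof -
      have "\<sigma> n * x n = 1 - (x n)\<^sup>2" using x(1)[of n] by (simp add: \<sigma>_def power2_eq_square left_diff_distrib)
      then show ?thesis unfolding \<open>\<sigma> n * x n = 1 - (x n)\<^sup>2\<close>[symmetric] by (simp add: algebra_simps)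
    qed
    also have "(\<tau> n * a0 * b + a0\<^sup>2 + b\<^sup>2) * x n = (1 + (x n)\<^sup>2) * a0 * b + (a0\<^sup>2 + b\<^sup>2) * x n"
    proof -
      have "\<tau> n * x n = 1 + (x n)\<^sup>2" using x(1)[of n] by (simp add: \<tau>_def power2_eq_square distrib_right)
      then show ?thesis unfolding \<open>\<tau> n * x n = 1 + (x n)\<^sup>2\<close>[symmetric] by (simp add: algebra_simps)
    qed
    finally show ?thesis .
  qed
  have "(\<lambda>n. dlim (H n) a0 b u v - c) \<longlonglongrightarrow> (b - a0)\<^sup>2 / (2 * b) *
    (((b\<^sup>2 - a0\<^sup>2) * (u \<bullet> v) * 0 + b * a0 * ((1 - 0\<^sup>2) * (\<theta> * T))) / ((1 + 0\<^sup>2) * a0 * b + (a0\<^sup>2 + b\<^sup>2) * 0))"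
    unfolding eq by (intro tendsto_intros x_lim) (use a0 b in auto)
  also have "(b - a0)\<^sup>2 / (2 * b) *
    (((b\<^sup>2 - a0\<^sup>2) * (u \<bullet> v) * 0 + b * a0 * ((1 - 0\<^sup>2) * (\<theta> * T))) / ((1 + 0\<^sup>2) * a0 * b + (a0\<^sup>2 + b\<^sup>2) * 0)) = \<theta> * t"
    using a0 b by (simp add: t_def T_def)
  finally have "(\<lambda>n. dlim (H n) a0 b u v) \<longlonglongrightarrow> c + \<theta> * t"
    using tendsto_add[OF tendsto_const[of c]] by fastforce
  then show ?thesis using that[of H] Hset by blast
qed

lemma dlim_closure:
  fixes u v :: R2 and a0 b :: real
  assumes a0: "a0 > 0" and b: "b > 0"
  defines "c \<equiv> - (b - a0) * (u \<bullet> v) + 1/2 * (b - a0)\<^sup>2 / b * (u \<bullet> v)"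
    and "t \<equiv> 1/2 * (b - a0)\<^sup>2 / b * (norm u * norm v)"
  shows "closure {dlim H a0 b u v | H. H \<in> Hset} = {c - t .. c + t}"
    "(INF H\<in>Hset. dlim H a0 b u v) = c - t"
proof -
  have t0: "t \<ge> 0" using b by (simp add: t_def)
  have bd: "dlim H a0 b u v \<in> {c - t .. c + t}" if "H \<in> Hset" for H
    unfolding c_def t_def by (rule dlim_bound[OF that a0 b])
  show "closure {dlim H a0 b u v | H. H \<in> Hset} = {c - t .. c + t}"
  proof (intro equalityI subsetI)
    fix z assume "z \<in> closure {dlim H a0 b u v | H. H \<in> Hset}"
    moreover have "closure {dlim H a0 b u v | H. H \<in> Hset} \<subseteq> {c - t .. c + t}"
      by (rule closure_minimal) (use bd in auto)
    ultimately show "z \<in> {c - t .. c + t}" by blast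
  next
    fix z assume z: "z \<in> {c - t .. c + t}"
    \<comment> \<open>For \<open>t = 0\<close> the quotient is 0 by convention, which is consistent
      because then \<open>z = c\<close>.\<close>
    define l where "l = (z - c) / t"
    have l: "\<bar>l\<bar> \<le> 1" "c + l * t = z" using z t0 by (cases "t = 0"; auto simp: l_def abs_le_iff field_simps)+
    obtain H where H: "\<And>n. H n \<in> Hset" "(\<lambda>n. dlim (H n) a0 b u v) \<longlonglongrightarrow> z"
      using dlim_approximation[OF a0 b l(1), of u v] l(2) unfolding c_def t_def by metis
    show "z \<in> closure {dlim H a0 b u v | H. H \<in> Hset}"
      unfolding closure_sequential using H by (intro exI[of _ "\<lambda>n. dlim (H n) a0 b u v"]) blast
  qed
  have "\<bar>- 1 :: real\<bar> \<le> 1" by simp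
  then obtain H where H: "\<And>n. H n \<in> Hset" "(\<lambda>n. dlim (H n) a0 b u v) \<longlonglongrightarrow> c + (-1) * t"
    using dlim_approximation[OF a0 b, of "-1" u v] unfolding c_def t_def by metis
  have bb: "bdd_below ((\<lambda>H. dlim H a0 b u v) ` Hset)" by (rule bdd_belowI2[of _ "c - t"]) (use bd in auto)
  show "(INF H\<in>Hset. dlim H a0 b u v) = c - t"
  proof (rule antisym)
    have "(INF H\<in>Hset. dlim H a0 b u v) \<le> dlim (H n) a0 b u v" for n by (rule cINF_lower[OF bb H(1)])
    then have "(INF H\<in>Hset. dlim H a0 b u v) \<le> c + (-1) * t" by (intro LIMSEQ_le_const[OF H(2)]) auto
    then show "(INF H\<in>Hset. dlim H a0 b u v) \<le> c - t" by simp
    show "c - t \<le> (INF H\<in>Hset. dlim H a0 b u v)" by (rule cINF_greatest) (use H(1) bd in auto)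
  qed
qed

section \<open>Assembly at almost every point\<close>

theorem mainTheorem15:
  fixes \<Omega> :: "R2 set" and \<alpha> b :: real and a f yd y p :: "R2 \<Rightarrow> real"
  assumes "open \<Omega>" and "connected \<Omega>" and "bounded \<Omega>" and "\<alpha> > 0"
    and "L2_on \<Omega> f" and "L2_on \<Omega> yd"
    and "set_borel_measurable lebesgue \<Omega> a"
    and "\<exists>M. AE x in lebesgue. x \<in> \<Omega> \<longrightarrow> \<bar>a x\<bar> \<le> M"
    and "AE x in lebesgue. x \<in> \<Omega> \<longrightarrow> a x \<ge> \<alpha>"
    and "b \<ge> \<alpha>"
    and "state_sol \<Omega> f a y"
    and "adj_sol \<Omega> a y yd p"
  shows "AE x0 in lebesgue. x0 \<in> \<Omega> \<longrightarrow>
    (let gy = wgrad \<Omega> y x0; gp = wgrad \<Omega> p x0;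
         c = - (b - a x0) * (gy \<bullet> gp) + 1/2 * (b - a x0)\<^sup>2 / b * (gy \<bullet> gp);
         t = 1/2 * (b - a x0)\<^sup>2 / b * (norm gy * norm gp)
     in (\<forall>H\<in>Hset. (dJ_quot \<Omega> f yd a b x0 (ellipse H) \<longlongrightarrow> dJ \<Omega> f yd a b x0 (ellipse H)) (at_right 0))
      \<and> closure {dJ \<Omega> f yd a b x0 (ellipse H) | H. H \<in> Hset} = {c - t .. c + t}
      \<and> (INF H\<in>Hset. dJ \<Omega> f yd a b x0 (ellipse H)) = c - t)"
proof -
  interpret bounded_open \<Omega> by unfold_locales fact+
  have am: "a \<in> borel_measurable M" using assms(7) by (simp add: set_measurable_M)
  have b: "b > 0" using assms(4,10) by linarith
  obtain K0 where K0: "AE x in lebesgue. x \<in> \<Omega> \<longrightarrow> \<bar>a x\<bar> \<le> K0" using assms(8) by blast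
  \<comment> \<open>The maximum with \<open>b\<close> makes the bound valid for the perturbed
    coefficients as well.\<close>
  define K where "K = max K0 b"
  have K: "b \<le> K" "K \<ge> 0" using b by (auto simp: K_def)
  have aK: "AE x in lebesgue. x \<in> \<Omega> \<longrightarrow> \<alpha> \<le> a x \<and> \<bar>a x\<bar> \<le> K"
    using K0 assms(9) by eventually_elim (auto simp: K_def)
  then have adm: "admissible \<alpha> K a" unfolding admissible_def AE_M using am assms(4) K by simp
  note ab = admissible_bound[OF adm]
  have f: "sqint M f" and yd: "sqint M yd" using assms(5,6) by (simp_all add: L2_on_iff)
  define gy where "gy = wgrad \<Omega> y"
  define gp where "gp = wgrad \<Omega> p"
  have y: "weak_sol a f y gy" using assms(11) state_sol_iff[OF am] by (simp add: gy_def)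
  have p: "weak_sol a (\<lambda>x. y x - yd x) p gp" using adj_sol_imp_weak_sol[OF assms(12) am] by (simp add: gp_def)
  note gys = H1pair_sqint(2)[OF weak_sol_H1pair[OF y]] and gps = H1pair_sqint(2)[OF weak_sol_H1pair[OF p]]
  note am[measurable] sqint_meas[OF gys, measurable] sqint_meas[OF gps, measurable]
  have bam: "(\<lambda>x. b - a x) \<in> borel_measurable M" by measurable
  have baK: "AE x in M. \<bar>b - a x\<bar> \<le> 2 * K"
    using ab(2) by eventually_elim (use K b in linarith)
  have ia: "integrable M a"
    by (rule sqint_imp_integrable(1)[OF finite_M sqint_bounded_finite[OF finite_M am]]) (use ab(2) in simp)
  have comp: "integrable M (\<lambda>x. g x $ i)" if "sqint M g" for g :: "R2 \<Rightarrow> R2" and i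
  proof (rule sqint_imp_integrable(1)[OF finite_M sqint_bound[OF that, where C=1]])
    show "(\<lambda>x. g x $ i) \<in> borel_measurable M"
      by (rule measurable_compose[OF sqint_meas[OF that] borel_measurable_continuous_onI]) (intro continuous_intros)
  qed (simp add: component_le_norm_cart)
  have bgy: "sqint M (\<lambda>x. (b - a x) *\<^sub>R gy x)"
  proof (rule sqint_bound[OF gys, where C="2 * K"])
    show "(\<lambda>x. (b - a x) *\<^sub>R gy x) \<in> borel_measurable M" by measurable
    show "AE x in M. norm ((b - a x) *\<^sub>R gy x) \<le> 2 * K * norm (gy x)"
      using baK by eventually_elim (auto intro: mult_right_mono)
  qed
  have iby: "integrable M (\<lambda>x. (b - a x) * gy x $ i)" for i using comp[OF bgy, of i] by simp
  have iyp: "integrable M (\<lambda>x. (b - a x) * (gy x \<bullet> gp x))"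
    by (rule L2_weighted_bound(1)[OF gys gps bam baK]) (use K in simp)
  define pt where "pt F x \<longleftrightarrow> lebesgue_point (\<lambda>x. indicat_real \<Omega> x * F x) x" for F x
  have AE_pt: "AE x in lebesgue. pt F x" if "integrable M F" for F
    unfolding pt_def by (rule AE_lebesgue_point) (use that integrable_restrict_space[OF Omega_sets(3), of F] in simp)
  \<comment> \<open>The exceptional null set is fixed here, before any \<open>H\<close> or sequence
    of radii is chosen.\<close>
  note aes = AE_pt[OF ia] AE_pt[OF comp[OF gps, of 1]] AE_pt[OF comp[OF gps, of 2]]
    AE_pt[OF sqint_integrable[OF gys]] AE_pt[OF sqint_integrable[OF gps]] AE_pt[OF iyp] AE_pt[OF iby[of 1]] AE_pt[OF iby[of 2]]
  show ?thesis
    using aK aes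
  proof eventually_elim
    case (elim x0)
    show ?case
    proof
      assume x0: "x0 \<in> \<Omega>"
      then have a0: "\<alpha> \<le> a x0" "a x0 \<le> K" using elim(1) by auto
      have a0': "a x0 > 0" using a0 assms(4) by linarith
      have seq: "(\<lambda>n. dJ_quot \<Omega> f yd a b x0 (ellipse H) (r n)) \<longlonglongrightarrow> dlim H (a x0) b (gy x0) (gp x0)"
        if H: "H \<in> Hset" and r: "\<And>n. r n > 0" "r \<longlonglongrightarrow> 0" for H r
      proof -
        interpret inclusion \<Omega> a f yd y p gy gp \<alpha> K b x0 H r
          by unfold_locales (fact adm assms(10) K(1) f yd y p H r x0 a0)+
        interpret good_inclusion \<Omega> a f yd y p gy gp \<alpha> K b x0 H r
        proof unfold_locales
          show "good a" using ia elim by (simp add: good_def pt_def)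
          show "good (\<lambda>x. gp x $ i)" "good (\<lambda>x. (b - a x) * gy x $ i)" for i
            using comp[OF gps, of i] iby[of i] elim exhaust_2[of i] by (auto simp: good_def pt_def)
          show "good (\<lambda>x. (norm (gy x))\<^sup>2)" "good (\<lambda>x. (norm (gp x))\<^sup>2)"
            using sqint_integrable[OF gys] sqint_integrable[OF gps] elim by (auto simp: good_def pt_def)
          show "good (\<lambda>x. (b - a x) * (gy x \<bullet> gp x))" using iyp elim by (simp add: good_def pt_def)
        qed
        show ?thesis using main_limit by (simp add: dJ_quot_def ar_def)
      qed
      \<comment> \<open>The limit from the right at 0 is equivalent to the limits along all positive
        null sequences; once it exists, the \<open>Lim\<close> in \<open>dJ\<close> denotes
        it.\<close>
      have lim: "(dJ_quot \<Omega> f yd a b x0 (ellipse H) \<longlongrightarrow> dlim H (a x0) b (gy x0) (gp x0)) (at_right 0)" if H: "H \<in> Hset" for H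
        unfolding tendsto_at_iff_sequentially comp_def using seq[OF H] by auto
      have dJ: "dJ \<Omega> f yd a b x0 (ellipse H) = dlim H (a x0) b (gy x0) (gp x0)" if "H \<in> Hset" for H
        unfolding dJ_def by (rule tendsto_Lim[OF trivial_limit_at_right_real lim[OF that]])
      have set: "{dJ \<Omega> f yd a b x0 (ellipse H) | H. H \<in> Hset} = {dlim H (a x0) b (gy x0) (gp x0) | H. H \<in> Hset}"
        using dJ by (intro Collect_cong) metis
      have inf: "(INF H\<in>Hset. dJ \<Omega> f yd a b x0 (ellipse H)) = (INF H\<in>Hset. dlim H (a x0) b (gy x0) (gp x0))"
        by (rule INF_cong[OF refl dJ])
      show "let gy = wgrad \<Omega> y x0; gp = wgrad \<Omega> p x0;
         c = - (b - a x0) * (gy \<bullet> gp) + 1/2 * (b - a x0)\<^sup>2 / b * (gy \<bullet> gp);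
         t = 1/2 * (b - a x0)\<^sup>2 / b * (norm gy * norm gp)
     in (\<forall>H\<in>Hset. (dJ_quot \<Omega> f yd a b x0 (ellipse H) \<longlongrightarrow> dJ \<Omega> f yd a b x0 (ellipse H)) (at_right 0))
      \<and> closure {dJ \<Omega> f yd a b x0 (ellipse H) | H. H \<in> Hset} = {c - t .. c + t}
      \<and> (INF H\<in>Hset. dJ \<Omega> f yd a b x0 (ellipse H)) = c - t"
        unfolding Let_def gy_def[symmetric] gp_def[symmetric]
      proof (intro conjI ballI)
        show "(dJ_quot \<Omega> f yd a b x0 (ellipse H) \<longlongrightarrow> dJ \<Omega> f yd a b x0 (ellipse H)) (at_right 0)" if "H \<in> Hset" for H
          unfolding dJ[OF that] by (rule lim[OF that])
      qed (unfold set inf, rule dlim_closure[OF a0' b], rule dlim_closure[OF a0' b])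
    qed
  qed
qed

end
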